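(* Let $p$ be an odd prime with $p\neq 5$ and $p\not\equiv 1 \pmod 8$. Then, as $n\to\infty$, $$\log^+ \mathfrak{p}(n,\chi_p) \sim \tfrac12 \kappa \sqrt{\left(1-\tfrac1p\right) n},$$ where $\kappa = \pi\sqrt{2/3}$.
   Context: For $f:\mathbb{N}\to\{0,\pm1\}$ and a partition $\pi=(a_1,\dots,a_k)$ of $n$ (i.e. positive integers $a_1\ge\dots\ge a_k$ with $a_1+\dots+a_k=n$), put $f(\pi)=f(a_1)\cdots f(a_k)$, and define the $f$-signed partition number $\mathfrak{p}(n,f)=\sum_{\pi}f(\pi)$, the sum over all partitions $\pi$ of $n$. For an odd prime $p$, $\chi_p(n)$ denotes the Legendre symbol $(\frac{n}{p})$ (equal to $+1$ if $n$ is a nonzero quadratic residue mod $p$, $-1$ if a quadratic nonresidue, $0$ if $p\mid n$). $\log^+ x := \max\{0,\log x\}$ (with $\log^+ x := 0$ for $x\le 0$). $a_n\sim b_n$ means $a_n/b_n\to1$. *)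

theory Defs
  imports "HOL-Number_Theory.Number_Theory" "HOL-Library.Landau_Symbols" Complex_Main
begin

definition partitions_of :: "nat \<Rightarrow> nat list set" where
  "partitions_of n = {as. sorted_wrt (\<ge>) as \<and> (\<forall>a\<in>set as. a > 0) \<and> sum_list as = n}"

lemma finite_partitions_of: "finite (partitions_of n)"
proof (rule finite_subset)
  have len: "length as \<le> sum_list as" if "\<forall>a\<in>set as. a > 0" for as :: "nat list"
    using that by (induction as) auto
  show "partitions_of n \<subseteq> {as. set as \<subseteq> {..n} \<and> length as \<le> n}"
    using len by (auto simp: partitions_of_def dest: member_le_sum_list)
  show "finite {as. set as \<subseteq> {..n} \<and> length as \<le> n}"
    by (rule finite_lists_length_le) simp
qed

text \<open>The \<open>f\<close>-signed partition number, for \<open>f\<close> with values in \<open>{-1, 0, 1}\<close>; the value of \<open>f\<close> at 0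
  is never used, since parts are positive.\<close>

definition signed_partition_number :: "nat \<Rightarrow> (nat \<Rightarrow> int) \<Rightarrow> int" where
  "signed_partition_number n f = (\<Sum>as\<in>partitions_of n. prod_list (map f as))"

definition legendre_char :: "nat \<Rightarrow> nat \<Rightarrow> int" where
  "legendre_char p n = Legendre (int n) (int p)"

text \<open>The case split is needed because the library's \<open>ln\<close> satisfies \<open>ln (-x) = ln x\<close>.\<close>

definition log_plus :: "real \<Rightarrow> real" where
  "log_plus x = (if x \<le> 0 then 0 else max 0 (ln x))"

definition kappa :: real where
  "kappa = pi * sqrt (2 / 3)"

end

theory Submission
  imports Defs "HOL-Complex_Analysis.Complex_Analysis" "HOL-Real_Asymp.Real_Asymp" "HOL-Probability.Distributions"
begin

text \<open>
  Circle method. Let \<open>F(z) = \<Prod> 1 / (1 - \<chi>(m) z ^ m)\<close> be the generating function and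
  \<open>A = (1 - 1/p) pi\<^sup>2 / 24\<close>. As \<open>t\<close> decreases to 0, \<open>t ln F(exp (-t))\<close> and \<open>t ln F(-exp (-t))\<close> both tend to
  \<open>A\<close>, so the singularities at 1 and -1 tie in leading order. In the ratio the even powers of \<open>\<chi>\<close> cancel:
  \<open>F(-exp (-t)) = F(exp (-t)) exp (-2 Q(t))\<close>, where \<open>Q(t)\<close> is the sum of \<open>\<chi>(m) artanh (exp (-m t))\<close> over odd
  \<open>m\<close>. The behaviour of \<open>Q\<close> at 0 is governed by \<open>\<Sum> r \<chi>(r)\<close> and \<open>\<Sum> \<chi>(r) ln \<Gamma>(r/p)\<close>, hence, by the sign of the
  quadratic Gauss sum, by \<open>L(1, \<chi>) > 0\<close>: \<open>Q\<close> tends to infinity if \<open>p mod 8 = 3\<close>, to a positive limit if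
  \<open>p mod 8\<close> is 5 or 7, and to 0 if \<open>p mod 8 = 1\<close>. So in the first three cases the arc at -1 contributes at most
  a fixed fraction \<open>< 1\<close> of the arc at 1. Near all other points of the unit circle \<open>F\<close> is exponentially
  smaller, except that for \<open>p = 5\<close> some fifth roots of unity tie as well. The saddle point \<open>t \<sim> sqrt (A/n)\<close>
  then gives the logarithm \<open>2 sqrt (A n)\<close>.
\<close>

section \<open>The quadratic character modulo an odd prime\<close>

text \<open>Logarithms ignore constant factors, so two-sided bounds by constant multiples of the
  saddle-point term are enough. Positivity is the delicate half: the main terms at 1 and -1 agree
  exactly, so it rests on the next term of the comparison, and there an eventual lower bound
  \<open>Q \<ge> \<delta> > 0\<close> suffices. If \<open>Q\<close> tended to 0, the arc at -1,
  which carries the sign \<open>(-1) ^ n\<close>, could cancel the arc at 1 for odd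
  \<open>n\<close>.

  On the rest of the circle one gap must hold uniformly. Compactness replaces a dissection into
  Farey arcs: a sequence of violating points \<open>\<zeta> * exp (- w)\<close> accumulates at some
  \<open>\<zeta>\<close> on the unit circle, and its direction of approach is recorded by the limit
  \<open>v\<close> of \<open>Re w / w\<close>, a point of the circle with diameter from 0 to 1. What
  remains is one strict inequality for each pair of \<open>\<zeta>\<close> and \<open>v\<close>.

  The generating function enters as the exponential of a power series, so its logarithm is
  single-valued on the disc; the coefficients are recognised by the recursion coming from the
  logarithmic derivative.\<close>

locale odd_prime =
  fixes p :: nat
  assumes prime_p: "prime p" and odd_p: "odd p"
begin

lemma p_ge_3: "p \<ge> 3"
  using prime_p odd_p prime_ge_2_nat[of p] by (cases "p = 2") auto

lemma p_pos [simp]: "p > 0"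
  using p_ge_3 by linarith

definition chi :: "nat \<Rightarrow> real" where
  "chi n = real_of_int (legendre_char p n)"

lemma legendre_char_values: "legendre_char p n \<in> {-1, 0, 1}"
  by (simp add: legendre_char_def Legendre_def)

lemma chi_values: "chi n = -1 \<or> chi n = 0 \<or> chi n = 1"
  using legendre_char_values[of n] by (auto simp: chi_def)

lemma abs_chi_le_1: "\<bar>chi n\<bar> \<le> 1"
  using chi_values[of n] by auto

lemma chi_eq_0_iff: "chi n = 0 \<longleftrightarrow> p dvd n"
  by (auto simp: chi_def legendre_char_def Legendre_def cong_0_iff)

lemma chi_0 [simp]: "chi 0 = 0"
  by (simp add: chi_eq_0_iff)

lemma chi_power2: "\<not> p dvd n \<Longrightarrow> chi n ^ 2 = 1"
  using chi_values[of n] chi_eq_0_iff[of n] by auto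

lemma legendre_cong:
  assumes "[a = b] (mod int p)" shows "Legendre a (int p) = Legendre b (int p)"
proof -
  have "[a = 0] (mod int p) \<longleftrightarrow> [b = 0] (mod int p)"
    using assms by (metis cong_sym cong_trans)
  moreover have "QuadRes (int p) a \<longleftrightarrow> QuadRes (int p) b"
    unfolding QuadRes_def using assms by (metis cong_sym cong_trans)
  ultimately show ?thesis by (simp add: Legendre_def)
qed

lemma chi_cong:
  assumes "[a = b] (mod p)" shows "chi a = chi b"
  unfolding chi_def legendre_char_def
  using legendre_cong[of "int a" "int b"] assms by (simp add: cong_int_iff)

lemma chi_mod [simp]: "chi (n mod p) = chi n"
  by (rule chi_cong) simp

lemma chi_add_p_mult [simp]: "chi (n + p * k) = chi n" "chi (p * k + n) = chi n"
  by (auto intro!: chi_cong simp: Cong.cong_def)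

lemma chi_add_p [simp]: "chi (n + p) = chi n" "chi (p + n) = chi n"
  by (auto intro!: chi_cong simp: Cong.cong_def)

text \<open>Euler's criterion gives the congruence modulo \<open>p\<close>. Both sides lie in {-1,
  0, 1}, so they differ by at most 2 < \<open>p\<close>, and congruent values are equal.\<close>

lemma legendre_mult: "Legendre (a * b) (int p) = Legendre a (int p) * Legendre b (int p)"
proof -
  have e: "[Legendre x (int p) = x ^ ((p - 1) div 2)] (mod int p)" for x
    using euler_criterion[of p x] prime_p p_ge_3 by simp
  have "[Legendre (a * b) (int p) = Legendre a (int p) * Legendre b (int p)] (mod int p)"
    using e[of "a * b"] cong_mult[OF e[of a] e[of b]]
    by (simp add: power_mult_distrib) (metis cong_sym cong_trans)
  then have d: "int p dvd Legendre (a * b) (int p) - Legendre a (int p) * Legendre b (int p)"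
    by (simp add: cong_iff_dvd_diff)
  have v: "Legendre x (int p) \<in> {-1, 0, 1}" for x
    by (simp add: Legendre_def)
  show ?thesis
  proof (rule ccontr)
    assume "\<not> ?thesis"
    then have "Legendre (a * b) (int p) - Legendre a (int p) * Legendre b (int p) \<noteq> 0" by simp
    from zdvd_imp_le[of "int p" "\<bar>Legendre (a * b) (int p) - Legendre a (int p) * Legendre b (int p)\<bar>"]
    have "int p \<le> \<bar>Legendre (a * b) (int p) - Legendre a (int p) * Legendre b (int p)\<bar>"
      using d \<open>_ \<noteq> 0\<close> by simp
    moreover have "\<bar>Legendre (a * b) (int p) - Legendre a (int p) * Legendre b (int p)\<bar> \<le> 2"
      using v[of "a * b"] v[of a] v[of b] by auto
    ultimately show False using p_ge_3 by linarith
  qed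
qed

lemma chi_mult: "chi (a * b) = chi a * chi b"
  by (simp add: chi_def legendre_char_def legendre_mult)

lemma chi_1 [simp]: "chi (Suc 0) = 1"
proof -
  have "chi 1 = chi 1 * chi 1" using chi_mult[of 1 1] by simp
  then show ?thesis using chi_eq_0_iff[of 1] p_ge_3 by auto
qed

text \<open>A nonzero square has exactly the roots \<open>m\<close> and \<open>p - m\<close>,
  because \<open>p\<close> divides \<open>(n - m) * (n + m)\<close>; they are distinct because
  \<open>p\<close> is odd.\<close>

lemma card_square_roots:
  assumes "a < p" shows "real (card {n\<in>{..<p}. n\<^sup>2 mod p = a}) = 1 + chi a"
proof -
  have qr: "n\<^sup>2 mod p = a \<longleftrightarrow> int p dvd (int n)\<^sup>2 - int a" for n
  proof -
    have "n\<^sup>2 mod p = a \<longleftrightarrow> [n\<^sup>2 = a] (mod p)" using assms by (simp add: Cong.cong_def)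
    also have "\<dots> \<longleftrightarrow> [(int n)\<^sup>2 = int a] (mod int p)" by (metis cong_int_iff of_nat_power)
    finally show ?thesis by (simp add: cong_iff_dvd_diff)
  qed
  have pi: "prime (int p)" using prime_p by simp
  consider "a = 0" | "a \<noteq> 0" "QuadRes (int p) (int a)" | "a \<noteq> 0" "\<not> QuadRes (int p) (int a)"
    by (cases "a = 0"; cases "QuadRes (int p) (int a)") simp_all
  then show ?thesis
  proof cases
    case 1
    have "{n\<in>{..<p}. n\<^sup>2 mod p = a} = {0}"
    proof -
      have n0: "n = 0" if n: "n < p" "n\<^sup>2 mod p = 0" for n
      proof -
        have "p dvd n\<^sup>2" using n(2) by (rule mod_0_imp_dvd)
        then have "p dvd n" using prime_dvd_power prime_p by blast
        then show ?thesis using n(1) nat_dvd_not_less by blast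
      qed
      have "{n\<in>{..<p}. n\<^sup>2 mod p = a} \<subseteq> {0}"
      proof
        fix x assume "x \<in> {n\<in>{..<p}. n\<^sup>2 mod p = a}"
        then have "x < p" "x\<^sup>2 mod p = 0" using 1 by simp_all
        then have "x = 0" by (rule n0)
        then show "x \<in> {0}" by simp
      qed
      moreover have "0 \<in> {n\<in>{..<p}. n\<^sup>2 mod p = a}" using 1 by simp
      ultimately show ?thesis by blast
    qed
    then show ?thesis using 1 by simp
  next
    case 2
    then obtain y where y: "[y\<^sup>2 = int a] (mod int p)" by (auto simp: QuadRes_def)
    define m where "m = nat (y mod int p)"
    have m: "m < p" "int m = y mod int p" by (auto simp: m_def nat_less_iff)
    have my: "[(int m)\<^sup>2 = int a] (mod int p)"
      using y unfolding m(2) by (simp add: Cong.cong_def power_mod)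
    then have mm: "int p dvd (int m)\<^sup>2 - int a" by (simp add: cong_iff_dvd_diff)
    have an: "\<not> int p dvd int a" using 2 assms zdvd_imp_le[of "int p" "int a"] by auto
    have m0: "m \<noteq> 0" 
    proof
      assume "m = 0"
      then have "int p dvd - int a" using mm by simp
      then show False using an by (simp only: dvd_minus_iff)
    qed
    have cls: "n = m \<or> n = p - m" if "n < p" "n\<^sup>2 mod p = a" for n
    proof -
      have "int p dvd (int n)\<^sup>2 - int a" using that(2) by (simp only: qr)
      then have "int p dvd ((int n)\<^sup>2 - int a) - ((int m)\<^sup>2 - int a)" using mm by (rule dvd_diff)
      also have "\<dots> = (int n - int m) * (int n + int m)" by (simp add: algebra_simps power2_eq_square)
      finally have "int p dvd (int n - int m) \<or> int p dvd int n + int m"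
        using pi by (simp add: prime_dvd_mult_iff)
      then show ?thesis
      proof
        assume d: "int p dvd int n - int m"
        have "\<bar>int n - int m\<bar> < int p" using that m by linarith
        then have "int n - int m = 0" using d dvd_imp_le_int[of "int n - int m" "int p"] by force
        then show ?thesis by simp
      next
        assume "int p dvd int n + int m"
        then obtain k where k: "int n + int m = int p * k" by (auto elim: dvdE)
        have "0 < int p * k" "int p * k < int p * 2" using k that m m0 by linarith+
        then have "k = 1" by (simp add: zero_less_mult_iff)
        then show ?thesis using k by auto
      qed
    qed
    have sq1: "(p - m)\<^sup>2 mod p = a"
    proof -
      have "(int (p - m))\<^sup>2 - int a = ((int m)\<^sup>2 - int a) + int p * (int p - 2 * int m)"
        using m by (simp add: of_nat_diff power2_eq_square algebra_simps)
      then have "int p dvd (int (p - m))\<^sup>2 - int a" using mm by (metis dvd_add dvd_triv_left)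
      then show ?thesis by (simp only: qr)
    qed
    have sq2: "m\<^sup>2 mod p = a" unfolding qr by (rule mm)
    have "{n\<in>{..<p}. n\<^sup>2 mod p = a} = {m, p - m}"
    proof (intro equalityI subsetI)
      fix x assume "x \<in> {n\<in>{..<p}. n\<^sup>2 mod p = a}"
      then have "x < p" "x\<^sup>2 mod p = a" by simp_all
      then have "x = m \<or> x = p - m" by (rule cls)
      then show "x \<in> {m, p - m}" by simp
    next
      fix x assume "x \<in> {m, p - m}"
      then have "x < p" "x\<^sup>2 mod p = a" using m(1) m0 sq1 sq2 by (elim insertE; simp)+
      then show "x \<in> {n\<in>{..<p}. n\<^sup>2 mod p = a}" by simp
    qed
    moreover have "m \<noteq> p - m"
    proof
      assume "m = p - m"
      then have "p = m + m" using m(1) by linarith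
      then show False using odd_p by (metis odd_add)
    qed
    ultimately have "card {n\<in>{..<p}. n\<^sup>2 mod p = a} = 2"
      by (simp only: card_2_iff) blast
    moreover have "chi a = 1" using 2(2) an by (simp add: chi_def legendre_char_def Legendre_def cong_0_iff)
    ultimately show ?thesis by simp
  next
    case 3
    have an: "\<not> int p dvd int a" using 3 assms zdvd_imp_le[of "int p" "int a"] by auto
    have "{n\<in>{..<p}. n\<^sup>2 mod p = a} = {}"
      using 3(2) unfolding qr QuadRes_def cong_iff_dvd_diff by blast
    moreover have "chi a = -1" using 3 an by (simp add: chi_def legendre_char_def Legendre_def cong_0_iff)
    ultimately show ?thesis by simp
  qed
qed

text \<open>Grouping \<open>n\<close> by its square. It has two uses: a constant \<open>f\<close>
  gives \<open>sum_chi\<close>, and powers of a root of unity identify the Gauss sum with a sum over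
  squares.\<close>

lemma sum_squares_mod:
  fixes f :: "nat \<Rightarrow> 'a :: {real_algebra_1, comm_ring_1}"
  shows "(\<Sum>n<p. f (n\<^sup>2 mod p)) = (\<Sum>a<p. of_real (1 + chi a) * f a)"
proof -
  have "(\<Sum>n<p. f (n\<^sup>2 mod p)) = (\<Sum>a<p. \<Sum>n\<in>{n\<in>{..<p}. n\<^sup>2 mod p = a}. f (n\<^sup>2 mod p))"
    by (rule sum.group[symmetric]) auto
  also have "\<dots> = (\<Sum>a<p. of_real (1 + chi a) * f a)"
  proof (rule sum.cong)
    fix a assume a: "a \<in> {..<p}"
    define S where "S = {n\<in>{..<p}. n\<^sup>2 mod p = a}"
    have "(\<Sum>n\<in>S. f (n\<^sup>2 mod p)) = (\<Sum>n\<in>S. f a)"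
      by (rule sum.cong) (auto simp: S_def)
    also have "\<dots> = of_real (real (card S)) * f a" by simp
    also have "real (card S) = 1 + chi a" using card_square_roots[of a] a by (simp add: S_def)
    finally show "(\<Sum>n\<in>{n\<in>{..<p}. n\<^sup>2 mod p = a}. f (n\<^sup>2 mod p)) = of_real (1 + chi a) * f a"
      unfolding S_def .
  qed simp
  finally show ?thesis .
qed

lemma sum_chi: "(\<Sum>a<p. chi a) = 0"
  using sum_squares_mod[of "\<lambda>_. 1 :: real"] by (simp add: sum.distrib)

text \<open>Euler's criterion at -1, where the exponent \<open>(p - 1) div 2\<close> is even exactly
  for \<open>p mod 4 = 1\<close>; as in \<open>legendre_mult\<close>, \<open>p > 2\<close> upgrades
  the congruence to an equality.\<close>

lemma chi_minus:
  assumes "r \<le> p" shows "chi (p - r) = (if p mod 4 = 1 then chi r else - chi r)"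
proof -
  have e: "[Legendre (-1) (int p) = (-1) ^ ((p - 1) div 2)] (mod int p)"
    using euler_criterion[of p "-1"] prime_p p_ge_3 by simp
  define s where "s = (-1 :: int) ^ ((p - 1) div 2)"
  have s: "s = (if p mod 4 = 1 then 1 else -1)"
  proof (cases "p mod 4 = 1")
    case True
    then have "even ((p - 1) div 2)" by presburger
    then show ?thesis using True by (simp add: s_def)
  next
    case False
    then have "odd ((p - 1) div 2)" using odd_p by presburger
    then show ?thesis using False by (simp add: s_def)
  qed
  have "Legendre (-1) (int p) = s"
  proof (rule ccontr)
    assume n: "Legendre (-1) (int p) \<noteq> s"
    have d: "int p dvd Legendre (-1) (int p) - s" using e by (simp add: cong_iff_dvd_diff s_def)
    have v: "Legendre (-1) (int p) \<in> {-1, 0, 1}" by (simp add: Legendre_def)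
    have "int p \<le> \<bar>Legendre (-1) (int p) - s\<bar>"
      using zdvd_imp_le[of "int p" "\<bar>Legendre (-1) (int p) - s\<bar>"] d n by simp
    moreover have "\<bar>Legendre (-1) (int p) - s\<bar> \<le> 2" using v s by auto
    ultimately show False using p_ge_3 by linarith
  qed
  moreover have "Legendre (int (p - r)) (int p) = Legendre (-1 * int r) (int p)"
    by (rule legendre_cong) (use assms in \<open>simp add: of_nat_diff cong_iff_dvd_diff\<close>)
  ultimately have "Legendre (int (p - r)) (int p) = s * Legendre (int r) (int p)"
    by (simp only: legendre_mult)
  then show ?thesis by (simp add: chi_def legendre_char_def s)
qed

text \<open>Gauss's lemma: the sign is the parity of the number of doubled residues above
  \<open>(p - 1) / 2\<close>. For \<open>p = 8 * k + 5\<close> these are the doubles of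
  \<open>2 * k + 2, ..., 4 * k + 2\<close>, which are \<open>2 * k + 1\<close> numbers.\<close>

lemma chi_2:
  assumes "p mod 8 = 5" shows "chi 2 = -1"
proof -
  define k where "k = int (p div 8)"
  have k: "int p = 8 * k + 5" "k \<ge> 0"
    using assms div_mult_mod_eq[of p 8] unfolding k_def by linarith+
  have n2: "\<not> [2 = 0] (mod int p)" using p_ge_3 zdvd_imp_le[of "int p" 2] by (auto simp: cong_0_iff)
  interpret GAUSS p 2
    by unfold_locales (use prime_p p_ge_3 n2 in simp_all)
  have A: "A = {0<..4 * k + 2}" unfolding A_def using k by (simp add: add.commute)
  \<comment> \<open>Doubles of elements of \<open>A\<close> stay below \<open>p\<close>, so
    reduction modulo \<open>p\<close> changes nothing.\<close>
  have "C = (\<lambda>x. x * 2) ` A"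
    unfolding C_def B_def image_image by (rule image_cong) (use k in \<open>auto simp: A\<close>)
  then have "E = (\<lambda>x. x * 2) ` {2 * k + 2..4 * k + 2}"
    unfolding E_def A using k by auto
  then have "card E = card {2 * k + 2..4 * k + 2}"
    by (simp add: card_image inj_on_def)
  also have "\<dots> = nat (2 * k + 1)" by simp
  finally have "odd (card E)" using k by (simp add: even_nat_iff)
  then show ?thesis using gauss_lemma by (simp add: chi_def legendre_char_def)
qed

end

section \<open>The sign of the quadratic Gauss sum\<close>

text \<open>At a primitive \<open>p\<close>-th root of unity the alternating sum of Gaussian binomials becomes the Gauss sum, while
  Gauss's product formula for it becomes a product of sines whose sign is visible.\<close>

fun qbinomial :: "'a::comm_ring_1 \<Rightarrow> nat \<Rightarrow> nat \<Rightarrow> 'a" where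
  "qbinomial q n 0 = 1"
| "qbinomial q 0 (Suc k) = 0"
| "qbinomial q (Suc n) (Suc k) = qbinomial q n k + q ^ Suc k * qbinomial q n (Suc k)"

lemma qbinomial_eq_0: "k > n \<Longrightarrow> qbinomial q n k = 0"
  by (induction q n k rule: qbinomial.induct) auto

text \<open>This and \<open>qbinomial_Suc_Suc_mult\<close> are the ratio formulas for neighbouring
  Gaussian binomials with denominators cleared, hence valid in any commutative ring, also where
  \<open>1 - q ^ Suc k\<close> is a zero divisor.\<close>

lemma qbinomial_Suc_right:
  "(1 - q ^ Suc k) * qbinomial q n (Suc k) = (1 - q ^ (n - k)) * qbinomial q n k"
proof (induction n arbitrary: k)
  case 0
  then show ?case by simp
next
  case (Suc n)
  show ?case
  proof (cases k)
    case 0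
    have IH: "(1 - q) * qbinomial q n (Suc 0) = 1 - q ^ n" using Suc.IH[of 0] by simp
    have "(1 - q) * (1 + q * qbinomial q n (Suc 0)) = (1 - q) + q * ((1 - q) * qbinomial q n (Suc 0))"
      by (simp add: algebra_simps)
    also have "\<dots> = 1 - q ^ Suc n" unfolding IH by (simp add: algebra_simps)
    finally show ?thesis using 0 by simp
  next
    case (Suc j)
    show ?thesis
    proof (cases "j < n")
      case True
      define B0 B1 B2 where B: "B0 = qbinomial q n j" "B1 = qbinomial q n (Suc j)" "B2 = qbinomial q n (Suc (Suc j))"
      have 1: "(1 - q ^ Suc j) * B1 = (1 - q ^ (n - j)) * B0" using Suc.IH[of j] B by simp
      have 2: "(1 - q ^ Suc (Suc j)) * B2 = (1 - q ^ (n - Suc j)) * B1" using Suc.IH[of "Suc j"] B by simp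
      have e1: "q ^ Suc (Suc j) * q ^ (n - Suc j) = q ^ Suc n" "q ^ Suc j * q ^ (n - j) = q ^ Suc n"
        using True by (simp_all flip: power_add power_Suc)
      have "(1 - q ^ Suc (Suc j)) * (B1 + q ^ Suc (Suc j) * B2)
          = (1 - q ^ Suc (Suc j)) * B1 + q ^ Suc (Suc j) * ((1 - q ^ Suc (Suc j)) * B2)"
        by (simp only: algebra_simps)
      also have "\<dots> = (1 - q ^ Suc (Suc j)) * B1 + q ^ Suc (Suc j) * ((1 - q ^ (n - Suc j)) * B1)"
        by (simp only: 2)
      also have "\<dots> = B1 - (q ^ Suc (Suc j) * q ^ (n - Suc j)) * B1"
        by (simp add: algebra_simps del: power_Suc qbinomial.simps)
      also have "\<dots> = (1 - q ^ Suc j) * B1 + (q ^ Suc j - q ^ Suc j * q ^ (n - j)) * B1"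
        unfolding e1 by (simp add: algebra_simps del: power_Suc qbinomial.simps)
      also have "\<dots> = (1 - q ^ (n - j)) * B0 + (q ^ Suc j - q ^ Suc j * q ^ (n - j)) * B1"
        by (simp only: 1)
      also have "\<dots> = (1 - q ^ (n - j)) * (B0 + q ^ Suc j * B1)"
        by (simp add: algebra_simps del: power_Suc)
      finally show ?thesis using Suc B by simp
    next
      case False
      then show ?thesis using Suc by (simp add: qbinomial_eq_0)
    qed
  qed
qed

lemma qbinomial_Suc_Suc_mult:
  "(1 - q ^ Suc k) * qbinomial q (Suc n) (Suc k) = (1 - q ^ Suc n) * qbinomial q n k"
proof (cases "k \<le> n")
  case True
  have e: "q ^ Suc k * q ^ (n - k) = q ^ Suc n" using True by (simp flip: power_add power_Suc)
  have "(1 - q ^ Suc k) * qbinomial q (Suc n) (Suc k)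
      = (1 - q ^ Suc k) * qbinomial q n k + q ^ Suc k * ((1 - q ^ Suc k) * qbinomial q n (Suc k))"
    by (simp add: algebra_simps del: power_Suc)
  also have "\<dots> = qbinomial q n k - (q ^ Suc k * q ^ (n - k)) * qbinomial q n k"
    unfolding qbinomial_Suc_right by (simp add: algebra_simps del: power_Suc qbinomial.simps)
  finally show ?thesis unfolding e by (simp add: algebra_simps del: power_Suc qbinomial.simps)
next
  case False
  then show ?thesis by (simp add: qbinomial_eq_0)
qed

text \<open>Pascal's rule expresses the sum through the row \<open>g\<close> of
  \<open>n + 1\<close>; reindexing collapses it to the terms
  \<open>(1 - q ^ Suc k) * g (Suc k)\<close>, and absorption lowers the row once more.\<close>

lemma alternating_qbinomial_sum_rec:
  "(\<Sum>k\<le>n + 2. (-1) ^ k * qbinomial q (n + 2) k) = (1 - q ^ Suc n) * (\<Sum>k\<le>n. (-1) ^ k * qbinomial q n k)"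
proof -
  define g where "g = qbinomial q (Suc n)"
  have "(\<Sum>k\<le>n + 2. (-1) ^ k * qbinomial q (n + 2) k)
      = 1 + (\<Sum>k\<le>Suc n. (-1) ^ Suc k * qbinomial q (Suc (Suc n)) (Suc k))"
    by (simp only: add_2_eq_Suc' sum.atMost_Suc_shift) simp
  also have "\<dots> = 1 - (\<Sum>k\<le>Suc n. (-1) ^ k * g k) + (\<Sum>k\<le>Suc n. (-1) ^ Suc k * q ^ Suc k * g (Suc k))"
    by (simp add: g_def sum_negf sum_subtractf sum.distrib algebra_simps del: sum.atMost_Suc)
  \<comment> \<open>The added term vanishes; with it, splitting off \<open>k = 0\<close> puts both
    sums over the same shifted index.\<close>
  also have "(\<Sum>k\<le>Suc n. (-1) ^ k * g k) = (\<Sum>k\<le>Suc (Suc n). (-1) ^ k * g k)"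
    by (subst (2) sum.atMost_Suc) (simp add: g_def qbinomial_eq_0)
  also have "\<dots> = 1 + (\<Sum>k\<le>Suc n. (-1) ^ Suc k * g (Suc k))"
    by (subst sum.atMost_Suc_shift) (simp add: g_def)
  also have "1 - (1 + (\<Sum>k\<le>Suc n. (-1) ^ Suc k * g (Suc k))) + (\<Sum>k\<le>Suc n. (-1) ^ Suc k * q ^ Suc k * g (Suc k))
      = (\<Sum>k\<le>Suc n. (-1) ^ k * ((1 - q ^ Suc k) * g (Suc k)))"
    by (simp add: sum_negf sum_subtractf sum.distrib algebra_simps del: sum.atMost_Suc)
  also have "\<dots> = (\<Sum>k\<le>Suc n. (-1) ^ k * ((1 - q ^ Suc n) * qbinomial q n k))"
    unfolding g_def qbinomial_Suc_Suc_mult ..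
  also have "\<dots> = (1 - q ^ Suc n) * (\<Sum>k\<le>n. (-1) ^ k * qbinomial q n k)"
    by (simp add: qbinomial_eq_0 sum_distrib_left algebra_simps)
  finally show ?thesis .
qed

lemma alternating_qbinomial_sum:
  "(\<Sum>k\<le>2 * m. (-1) ^ k * qbinomial q (2 * m) k) = (\<Prod>i<m. 1 - q ^ (2 * i + 1))"
proof (induction m)
  case (Suc m)
  have "(\<Sum>k\<le>2 * Suc m. (-1) ^ k * qbinomial q (2 * Suc m) k)
      = (1 - q ^ Suc (2 * m)) * (\<Sum>k\<le>2 * m. (-1) ^ k * qbinomial q (2 * m) k)"
    using alternating_qbinomial_sum_rec[of q "2 * m"] by (simp only: mult_Suc_right add.commute)
  then show ?case unfolding Suc.IH by (simp add: mult.commute)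
qed simp

text \<open>For a primitive root of order \<open>n + 1\<close>, \<open>q ^ (n - k)\<close> is the
  inverse of \<open>q ^ Suc k\<close>, so the ratio of neighbours
  \<open>(1 - q ^ (n - k)) / (1 - q ^ Suc k)\<close> is \<open>- (w ^ Suc k)\<close>. Multiplying
  these ratios gives the triangular exponent.\<close>

lemma qbinomial_root_of_unity:
  fixes q w :: "'a::field"
  assumes "q * w = 1" and "q ^ Suc n = 1" and "\<And>i. 0 < i \<Longrightarrow> i \<le> n \<Longrightarrow> q ^ i \<noteq> 1" and "k \<le> n"
  shows "qbinomial q n k = (-1) ^ k * w ^ (k * (k + 1) div 2)"
  using \<open>k \<le> n\<close>
proof (induction k)
  case 0
  show ?case by simp
next
  case (Suc k)
  have qw: "q ^ i * w ^ i = 1" for i using assms(1) by (metis power_mult_distrib power_one)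
  have "q ^ (n - k) * q ^ Suc k = 1" using assms(2) Suc.prems by (simp flip: power_add power_Suc)
  then have qi: "q ^ (n - k) = w ^ Suc k" using qw[of "Suc k"]
    by (metis mult.assoc mult.commute mult.right_neutral)
  have ne: "1 - q ^ Suc k \<noteq> 0" using assms(3)[of "Suc k"] Suc.prems by simp
  have "(1 - q ^ Suc k) * qbinomial q n (Suc k) = (1 - w ^ Suc k) * qbinomial q n k"
    unfolding qbinomial_Suc_right qi ..
  also have "1 - w ^ Suc k = (1 - q ^ Suc k) * (- (w ^ Suc k))"
    using qw[of "Suc k"] by (simp add: algebra_simps del: power_Suc)
  finally have "qbinomial q n (Suc k) = - (w ^ Suc k) * qbinomial q n k"
    using ne by (metis mult.assoc mult_left_cancel)
  also have "\<dots> = (-1) ^ Suc k * (w ^ Suc k * w ^ (k * (k + 1) div 2))"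
    using Suc by simp
  also have "w ^ Suc k * w ^ (k * (k + 1) div 2) = w ^ (Suc k * (Suc k + 1) div 2)"
  proof -
    have "Suc k * (Suc k + 1) div 2 = Suc k + k * (k + 1) div 2"
    proof -
      have "Suc k * (Suc k + 1) = k * (k + 1) + Suc k * 2" by (simp add: algebra_simps)
      then show ?thesis by (simp only: div_mult_self1[OF zero_neq_numeral[symmetric]])
    qed
    then show ?thesis by (simp only: power_add)
  qed
  finally show ?case .
qed

lemma sum_lessThan_periodic_shift:
  fixes f :: "nat \<Rightarrow> 'a::comm_monoid_add"
  assumes "\<And>n. f (n + p) = f n"
  shows "(\<Sum>n<p. f (n + d)) = (\<Sum>n<p. f n)"
proof (induction d)
  case (Suc d)
  have "(\<Sum>n<p. f (n + Suc d)) = (\<Sum>n<p. f (n + d))"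
  proof (cases p)
    case (Suc m)
    have "(\<Sum>n<p. f (n + Suc d)) = (\<Sum>n<m. f (n + Suc d)) + f (d + p)"
      using Suc by (simp add: add.commute)
    also have "\<dots> = f (0 + d) + (\<Sum>n<m. f (Suc n + d))" using assms by (simp add: add.commute)
    also have "\<dots> = (\<Sum>n<Suc m. f (n + d))" by (rule sum.lessThan_Suc_shift[symmetric])
    finally show ?thesis using Suc by simp
  qed simp
  then show ?case using Suc by simp
qed simp

section \<open>Gauss sums at a primitive \<open>p\<close>-th root of unity\<close>

context odd_prime
begin

lemma sum_lessThan_coprime_scale:
  fixes f :: "nat \<Rightarrow> 'a::comm_monoid_add"
  assumes f: "\<And>n. f (n mod p) = f n" and k: "\<not> p dvd k"
  shows "(\<Sum>n<p. f (k * n)) = (\<Sum>n<p. f n)"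
proof -
  have inj: "inj_on (\<lambda>n. k * n mod p) {..<p}"
  proof (rule inj_onI)
    fix x y assume "x \<in> {..<p}" "y \<in> {..<p}" and e: "k * x mod p = k * y mod p"
    have "coprime k p" using k prime_p by (metis coprime_commute prime_imp_coprime_nat)
    then have "[x = y] (mod p)" using e by (metis Cong.cong_def cong_mult_lcancel_nat)
    then show "x = y" using \<open>x \<in> _\<close> \<open>y \<in> _\<close> by (simp add: Cong.cong_def)
  qed
  have im: "(\<lambda>n. k * n mod p) ` {..<p} = {..<p}"
    by (rule card_subset_eq) (auto simp: card_image[OF inj])
  have "(\<Sum>n<p. f n) = (\<Sum>n\<in>(\<lambda>n. k * n mod p) ` {..<p}. f n)" by (simp only: im)
  also have "\<dots> = (\<Sum>n<p. f (k * n mod p))" by (subst sum.reindex[OF inj]) simp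
  finally show ?thesis by (simp add: f)
qed

definition om :: complex where "om = cis (2 * pi / real p)"

lemma om_power: "om ^ n = cis (2 * pi * real n / real p)"
  unfolding om_def Complex.DeMoivre by (simp add: mult_ac)

lemma om_power_p [simp]: "om ^ p = 1"
  by (simp add: om_power)

lemma om_power_mod [simp]: "om ^ (n mod p) = om ^ n"
proof -
  have "om ^ n = om ^ (p * (n div p) + n mod p)" by simp
  also have "\<dots> = om ^ (n mod p)" by (simp only: power_add power_mult om_power_p) simp
  finally show ?thesis by simp
qed

lemma om_power_eq_1_iff: "om ^ n = 1 \<longleftrightarrow> p dvd n"
proof
  assume "p dvd n"
  then show "om ^ n = 1" by (auto simp: power_mult elim!: dvdE)
next
  assume *: "om ^ n = 1"
  have "cis (2 * pi * real n / real p) = 1" using * by (simp add: om_power)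
  then have "cos (2 * pi * real n / real p) = 1" by (simp add: complex_eq_iff)
  then obtain k :: int where "2 * pi * real n / real p = real_of_int k * 2 * pi"
    by (auto simp: cos_one_2pi_int)
  then have "real n = real_of_int k * real p" by (simp add: field_simps)
  then have "int n = k * int p" by (metis of_int_eq_iff of_int_mult of_int_of_nat_eq)
  then show "p dvd n" by (metis dvd_triv_right int_dvd_int_iff)
qed

lemma om_nonzero [simp]: "om \<noteq> 0" and norm_om [simp]: "norm om = 1"
  by (simp_all add: om_def)

lemma sum_om_power: "(\<Sum>n<p. om ^ (k * n)) = (if p dvd k then of_nat p else 0)"
proof (cases "p dvd k")
  case True
  then have "om ^ (k * n) = 1" for n by (simp add: om_power_eq_1_iff)
  then show ?thesis using True by simp
next
  case False
  then have "om ^ k \<noteq> 1" by (simp add: om_power_eq_1_iff)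
  then have "(\<Sum>n<p. (om ^ k) ^ n) = ((om ^ k) ^ p - 1) / (om ^ k - 1)" by (rule geometric_sum)
  also have "(om ^ k) ^ p = (om ^ p) ^ k" by (simp only: flip: power_mult) (simp add: mult.commute)
  finally show ?thesis using False by (simp add: power_mult)
qed

definition gauss_sum :: "complex \<Rightarrow> complex" where
  "gauss_sum z = (\<Sum>a<p. of_real (chi a) * z ^ a)"

text \<open>Replacing \<open>a\<close> by \<open>k * a\<close> permutes the residues if
  \<open>p\<close> does not divide \<open>k\<close>; otherwise both sides vanish by
  \<open>sum_chi\<close>. This separability later turns logarithms at roots of unity into
  \<open>L1\<close>.\<close>

lemma gauss_sum_power: "gauss_sum (om ^ k) = of_real (chi k) * gauss_sum om"
proof (cases "p dvd k")
  case True
  have "om ^ k = 1" using True by (simp add: om_power_eq_1_iff)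
  then have "gauss_sum (om ^ k) = of_real (\<Sum>a<p. chi a)" by (simp add: gauss_sum_def)
  then show ?thesis using True by (simp add: sum_chi chi_eq_0_iff[THEN iffD2])
next
  case False
  have c2: "chi a = chi k * chi (k * a)" for a
  proof -
    have "chi k * chi (k * a) = (chi k)\<^sup>2 * chi a" by (simp add: chi_mult power2_eq_square)
    then show ?thesis using chi_power2[OF False] by simp
  qed
  have "gauss_sum (om ^ k) = (\<Sum>a<p. of_real (chi k) * (of_real (chi (k * a)) * om ^ (k * a)))"
    unfolding gauss_sum_def
  proof (rule sum.cong[OF refl])
    fix a
    show "of_real (chi a) * (om ^ k) ^ a = of_real (chi k) * (of_real (chi (k * a)) * om ^ (k * a))"
      by (subst c2) (simp add: power_mult)
  qed
  also have "\<dots> = of_real (chi k) * (\<Sum>a<p. of_real (chi (k * a)) * om ^ (k * a))"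
    by (simp add: sum_distrib_left)
  also have "(\<Sum>a<p. of_real (chi (k * a)) * om ^ (k * a)) = gauss_sum om"
    unfolding gauss_sum_def by (rule sum_lessThan_coprime_scale) (use False in auto)
  finally show ?thesis .
qed

lemma gauss_sum_eq_square_sum: "gauss_sum om = (\<Sum>n<p. om ^ (n\<^sup>2))"
proof -
  have "(\<Sum>n<p. om ^ (n\<^sup>2)) = (\<Sum>n<p. om ^ (n\<^sup>2 mod p))" by simp
  also have "\<dots> = (\<Sum>a<p. of_real (1 + chi a) * om ^ a)" by (rule sum_squares_mod)
  also have "\<dots> = (\<Sum>a<p. om ^ (1 * a)) + gauss_sum om"
    by (simp add: gauss_sum_def algebra_simps sum.distrib)
  also have "(\<Sum>a<p. om ^ (1 * a)) = 0" unfolding sum_om_power using p_ge_3 by simp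
  finally show ?thesis by simp
qed

text \<open>After one copy of the square sum is shifted by \<open>n\<close>, the product
  \<open>cnj S * S\<close> is a double sum of \<open>om ^ (d\<^sup>2) * om ^ (2 * d * n)\<close>,
  and summing over \<open>n\<close> first leaves only \<open>d = 0\<close>.\<close>

lemma norm_gauss_sum: "norm (gauss_sum om) = sqrt (real p)"
proof -
  define S where "S = gauss_sum om"
  have c: "cnj (om ^ i) * om ^ i = 1" for i
    by (metis complex_norm_square mult.commute norm_om norm_power of_real_1 power_one)
  have p2: "p dvd 2 * d \<longleftrightarrow> p dvd d" for d
    using prime_p odd_p p_ge_3 by (metis coprime_dvd_mult_right_iff coprime_right_2_iff_odd)
  have sh: "S = (\<Sum>d<p. om ^ ((d + n)\<^sup>2))" for n
  proof -
    have "om ^ ((m + p)\<^sup>2) = om ^ (m\<^sup>2)" for m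
    proof -
      have "(m + p)\<^sup>2 = m\<^sup>2 + p * (2 * m + p)" by (simp add: power2_eq_square algebra_simps)
      then show ?thesis by (simp only: power_add power_mult om_power_p) simp
    qed
    then show ?thesis unfolding S_def gauss_sum_eq_square_sum
      by (rule sum_lessThan_periodic_shift[symmetric])
  qed
  have "cnj S * S = (\<Sum>n<p. cnj (om ^ (n\<^sup>2)) * S)"
    by (subst S_def) (simp add: gauss_sum_eq_square_sum sum_distrib_right)
  also have "\<dots> = (\<Sum>n<p. \<Sum>d<p. cnj (om ^ (n\<^sup>2)) * om ^ ((d + n)\<^sup>2))"
    by (rule sum.cong[OF refl], subst sh) (simp add: sum_distrib_left)
  also have "\<dots> = (\<Sum>n<p. \<Sum>d<p. om ^ (d\<^sup>2) * om ^ (2 * d * n))"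
  proof (intro sum.cong refl)
    fix n d
    have "om ^ ((d + n)\<^sup>2) = om ^ (n\<^sup>2) * (om ^ (d\<^sup>2) * om ^ (2 * d * n))"
      by (simp add: power2_sum add_ac flip: power_add)
    then show "cnj (om ^ (n\<^sup>2)) * om ^ ((d + n)\<^sup>2) = om ^ (d\<^sup>2) * om ^ (2 * d * n)"
      using c[of "n\<^sup>2"] by (metis mult.assoc mult.left_neutral)
  qed
  also have "\<dots> = (\<Sum>d<p. om ^ (d\<^sup>2) * (\<Sum>n<p. om ^ (2 * d * n)))"
    by (subst sum.swap) (simp add: sum_distrib_left)
  also have "\<dots> = (\<Sum>d<p. if d = 0 then of_nat p else 0)"
    unfolding sum_om_power p2 by (rule sum.cong) (auto dest: nat_dvd_not_less)
  also have "\<dots> = of_nat p" by simp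
  finally have "complex_of_real ((norm S)\<^sup>2) = complex_of_real (real p)"
    by (simp only: complex_norm_square mult.commute of_real_of_nat_eq)
  then have "(norm S)\<^sup>2 = real p" using of_real_eq_iff by blast
  then show ?thesis unfolding S_def by (metis norm_ge_zero real_sqrt_unique)
qed

lemma gauss_sum_product:
  "gauss_sum om = (\<Prod>i<(p - 1) div 2. 2 * \<i> * of_real (sin (2 * pi * real (2 * i + 1) / real p)))"
proof -
  define m where "m = (p - 1) div 2"
  have pm: "p = Suc (2 * m)" using odd_p by (auto simp: m_def elim!: oddE)
  \<comment> \<open>Squaring \<open>om\<close> turns the triangular exponents
    \<open>k * (k + 1) div 2\<close> into \<open>k * (k + 1)\<close>, where the square can be
    completed modulo \<open>p\<close>.\<close>
  define w where "w = om\<^sup>2"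
  define q where "q = inverse w"
  have qw: "q * w = 1" by (simp add: q_def w_def)
  have wn: "w ^ i = 1 \<longleftrightarrow> p dvd i" for i
  proof -
    have "w ^ i = om ^ (2 * i)" by (simp add: w_def power_mult)
    then have "w ^ i = 1 \<longleftrightarrow> p dvd 2 * i" by (simp add: om_power_eq_1_iff)
    then show ?thesis using odd_p by (metis coprime_dvd_mult_right_iff coprime_right_2_iff_odd)
  qed
  have qn: "q ^ i = 1 \<longleftrightarrow> p dvd i" for i
    unfolding q_def power_inverse inverse_eq_1_iff by (rule wn)
  have q1: "q ^ Suc (2 * m) = 1" using qn[of p] unfolding pm[symmetric] by simp
  have q2: "q ^ i \<noteq> 1" if "0 < i" "i \<le> 2 * m" for i
  proof -
    have "i < p" using that pm by linarith
    then show ?thesis using qn nat_dvd_not_less that by blast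
  qed
  have "(\<Prod>i<m. 1 - q ^ (2 * i + 1)) = (\<Sum>k\<le>2 * m. (-1) ^ k * qbinomial q (2 * m) k)"
    by (rule alternating_qbinomial_sum[symmetric])
  also have "\<dots> = (\<Sum>k<p. w ^ (k * (k + 1) div 2))"
  proof (rule sum.cong)
    fix k assume "k \<in> {..<p}"
    then have "qbinomial q (2 * m) k = (-1) ^ k * w ^ (k * (k + 1) div 2)"
      by (intro qbinomial_root_of_unity[OF qw q1 q2]) (simp_all add: pm)
    then show "(-1) ^ k * qbinomial q (2 * m) k = w ^ (k * (k + 1) div 2)"
      by (simp flip: mult.assoc power_mult_distrib)
  qed (use pm in auto)
  also have "\<dots> = (\<Sum>k<p. om ^ (k * (k + 1)))"
  proof (rule sum.cong)
    fix k
    have "w ^ (k * (k + 1) div 2) = om ^ (2 * (k * (k + 1) div 2))" by (simp only: w_def power_mult)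
    also have "2 * (k * (k + 1) div 2) = k * (k + 1)" by simp
    finally show "w ^ (k * (k + 1) div 2) = om ^ (k * (k + 1))" .
  qed simp
  finally have P: "(\<Prod>i<m. 1 - q ^ (2 * i + 1)) = (\<Sum>k<p. om ^ (k * (k + 1)))" .
  \<comment> \<open>\<open>m + 1\<close> is the inverse of 2 modulo \<open>p\<close>, so this shift
    completes the square in \<open>k * (k + 1)\<close>.\<close>
  have "gauss_sum om = (\<Sum>k<p. om ^ ((k + (m + 1))\<^sup>2))"
  proof -
    have "om ^ ((n + p)\<^sup>2) = om ^ (n\<^sup>2)" for n
    proof -
      have "(n + p)\<^sup>2 = n\<^sup>2 + p * (2 * n + p)" by (simp add: power2_eq_square algebra_simps)
      then show ?thesis by (simp only: power_add power_mult om_power_p) simp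
    qed
    then show ?thesis unfolding gauss_sum_eq_square_sum
      by (rule sum_lessThan_periodic_shift[symmetric])
  qed
  also have "\<dots> = (\<Sum>k<p. om ^ ((m + 1)\<^sup>2) * om ^ (k * (k + 1)))"
  proof (rule sum.cong)
    fix k
    have "(k + (m + 1))\<^sup>2 = (m + 1)\<^sup>2 + k * (k + 1) + p * k"
      unfolding pm by (simp add: power2_eq_square algebra_simps)
    then show "om ^ ((k + (m + 1))\<^sup>2) = om ^ ((m + 1)\<^sup>2) * om ^ (k * (k + 1))"
      by (simp only: power_add power_mult om_power_p) simp
  qed simp
  also have "\<dots> = om ^ ((m + 1)\<^sup>2) * (\<Prod>i<m. 1 - q ^ (2 * i + 1))"
    unfolding P by (simp add: sum_distrib_left)
  also have "om ^ ((m + 1)\<^sup>2) = om ^ (m\<^sup>2)"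
  proof -
    have "(m + 1)\<^sup>2 = m\<^sup>2 + p" by (simp add: pm power2_eq_square)
    then show ?thesis by (simp only: power_add om_power_p) simp
  qed
  \<comment> \<open>The prefactor is spread over the \<open>m\<close> factors, as the first
    \<open>m\<close> odd numbers add up to \<open>m\<^sup>2\<close>; each factor then becomes a
    difference of conjugates, that is, a sine.\<close>
  also have "om ^ (m\<^sup>2) = (\<Prod>i<m. om ^ (2 * i + 1))"
  proof -
    have "(\<Sum>i<m. 2 * i + 1) = m\<^sup>2" by (induction m) (auto simp: power2_eq_square)
    then show ?thesis by (metis power_sum)
  qed
  also have "\<dots> * (\<Prod>i<m. 1 - q ^ (2 * i + 1)) = (\<Prod>i<m. om ^ (2 * i + 1) * (1 - q ^ (2 * i + 1)))"
    by (rule prod.distrib[symmetric])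
  also have "\<dots> = (\<Prod>i<m. 2 * \<i> * of_real (sin (2 * pi * real (2 * i + 1) / real p)))"
  proof (rule prod.cong)
    fix i
    define x where "x = 2 * pi * real (2 * i + 1) / real p"
    have x: "om ^ (2 * i + 1) = cis x" unfolding om_power x_def ..
    have "q ^ (2 * i + 1) = inverse ((om ^ (2 * i + 1))\<^sup>2)"
      by (simp only: q_def w_def power_inverse flip: power_mult) (simp add: mult.commute)
    then have "om ^ (2 * i + 1) * (1 - q ^ (2 * i + 1)) = cis x - cis (- x)"
      unfolding x by (simp add: power2_eq_square algebra_simps flip: cis_inverse)
    also have "\<dots> = 2 * \<i> * of_real (sin x)" by (simp add: complex_eq_iff)
    finally show "om ^ (2 * i + 1) * (1 - q ^ (2 * i + 1)) = 2 * \<i> * of_real (sin (2 * pi * real (2 * i + 1) / real p))"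
      unfolding x_def .
  qed simp
  finally show ?thesis by (simp only: m_def)
qed

lemma (in -) prod_sgn_lessThan:
  fixes f :: "nat \<Rightarrow> real"
  assumes "\<And>i. i < b \<Longrightarrow> f i > 0" "\<And>i. b \<le> i \<Longrightarrow> i < b + a \<Longrightarrow> f i < 0"
  shows "(-1) ^ a * (\<Prod>i<b + a. f i) > 0"
  using assms(2)
proof (induction a)
  case 0
  then show ?case using assms(1) by (auto intro!: prod_pos)
next
  case (Suc a)
  have 1: "(-1) ^ a * (\<Prod>i<b + a. f i) > 0" using Suc by auto
  have 2: "- f (b + a) > 0" using Suc.prems[of "b + a"] by simp
  have "(-1) ^ Suc a * (\<Prod>i<b + Suc a. f i) = ((-1) ^ a * (\<Prod>i<b + a. f i)) * (- f (b + a))"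
    by simp
  then show ?case using mult_pos_pos[OF 1 2] by simp
qed

text \<open>The modulus is known, so only the sign of the sine product is at stake. Exactly the last
  \<open>a = p div 4\<close> of its \<open>m\<close> factors are negative, and the resulting
  \<open>(-1) ^ a\<close> cancels against \<open>\<i> ^ m\<close>, which is \<open>(-1) ^ a\<close>
  or \<open>(-1) ^ a * \<i>\<close>.\<close>

theorem gauss_sum_value:
  "gauss_sum om = (if p mod 4 = 1 then of_real (sqrt (real p)) else \<i> * of_real (sqrt (real p)))"
proof -
  define s where "s i = 2 * sin (2 * pi * real (2 * i + 1) / real p)" for i :: nat
  define m where "m = (p - 1) div 2"
  have G: "gauss_sum om = \<i> ^ m * of_real (\<Prod>i<m. s i)"
    unfolding gauss_sum_product s_def m_def by (simp add: prod.distrib mult_ac power_mult_distrib)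
  define a where "a = p div 4"
  define b where "b = m - a"
  have par: "(p mod 4 = 1 \<and> p = 4 * a + 1 \<and> m = 2 * a \<and> b = a) \<or>
             (p mod 4 \<noteq> 1 \<and> p = 4 * a + 3 \<and> m = 2 * a + 1 \<and> b = a + 1)"
  proof -
    have "p mod 4 = 1 \<or> p mod 4 = 3" using odd_p by presburger
    moreover have "p = 4 * a + p mod 4" by (simp add: a_def)
    ultimately consider "p mod 4 = 1" "p = 4 * a + 1" | "p mod 4 = 3" "p = 4 * a + 3" by metis
    then show ?thesis
    proof cases
      case 1
      then have "m = 2 * a" by (simp add: m_def)
      then show ?thesis using 1 by (simp add: b_def)
    next
      case 2
      then have "m = 2 * a + 1" by (simp add: m_def)
      then show ?thesis using 2 by (simp add: b_def)
    qed
  qed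
  have pos: "s i > 0" if "i < b" for i
  proof -
    have "2 * (2 * i + 1) < p" using par that by auto
    then have "real (2 * (2 * i + 1)) < real p" by (simp only: of_nat_less_iff)
    then have "pi * (real (2 * (2 * i + 1)) / real p) < pi * 1" by (intro mult_strict_left_mono) simp_all
    then have "2 * pi * real (2 * i + 1) / real p < pi" by (simp add: mult_ac)
    then show ?thesis unfolding s_def by (intro mult_pos_pos sin_gt_zero) auto
  qed
  have neg: "s i < 0" if "b \<le> i" "i < b + a" for i
  proof -
    have 1: "p < 2 * (2 * i + 1)" "2 * i + 1 < p" using par that by auto
    then have "real p < real (2 * (2 * i + 1))" "real (2 * i + 1) < real p" by (simp_all only: of_nat_less_iff)
    then have "pi * 1 < pi * (real (2 * (2 * i + 1)) / real p)" "2 * pi * (real (2 * i + 1) / real p) < 2 * pi * 1"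
      by (intro mult_strict_left_mono; simp)+
    then have "pi < 2 * pi * real (2 * i + 1) / real p" "2 * pi * real (2 * i + 1) / real p < 2 * pi"
      by (simp_all add: mult_ac)
    then show ?thesis unfolding s_def using sin_lt_zero by simp
  qed
  have ba: "b + a = m" using par by auto
  define R where "R = (-1) ^ a * (\<Prod>i<m. s i)"
  have R: "R > 0" unfolding R_def ba[symmetric] by (rule prod_sgn_lessThan) (use pos neg in auto)
  have sR: "(\<Prod>i<m. s i) = (-1) ^ a * R" by (simp add: R_def flip: mult.assoc power_mult_distrib)
  have "gauss_sum om = (if p mod 4 = 1 then of_real R else \<i> * of_real R)"
  proof (cases "p mod 4 = 1")
    case True
    then have "m = 2 * a" using par by auto
    then have "\<i> ^ m = (-1) ^ a" by (simp add: power_mult)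
    then show ?thesis using True unfolding G sR by (simp flip: mult.assoc power_mult_distrib)
  next
    case False
    then have "m = 2 * a + 1" using par by auto
    then have "\<i> ^ m = (-1) ^ a * \<i>" by (simp add: power_mult)
    then show ?thesis using False unfolding G sR by (simp flip: mult.assoc power_mult_distrib)
  qed
  moreover from this have "norm (gauss_sum om) = R" using R by (auto simp: norm_mult split: if_splits)
  ultimately show ?thesis using norm_gauss_sum by simp
qed

end

section \<open>Summation by parts and sums over divisors\<close>

lemma sum_by_parts:
  fixes a c :: "nat \<Rightarrow> 'a::comm_ring_1"
  shows "(\<Sum>k<n. c k * a k) = (\<Sum>k<n. (\<Sum>i\<le>k. c i) * (a k - a (Suc k))) + (\<Sum>i<n. c i) * a n"
proof (induction n)
  case (Suc n)
  have e: "{..n} = {..<Suc n}" by auto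
  show ?case unfolding sum.lessThan_Suc Suc.IH by (simp add: e algebra_simps)
qed simp

text \<open>The decrements of \<open>a\<close> telescope to \<open>a 0 - a n\<close>, and the
  boundary term adds \<open>a n\<close> back.\<close>

lemma abel_bound:
  fixes a c :: "nat \<Rightarrow> real"
  assumes C: "\<And>n. \<bar>\<Sum>i<n. c i\<bar> \<le> C" and dec: "\<And>n. a (Suc n) \<le> a n" and pos: "\<And>n. a n \<ge> 0"
  shows "\<bar>\<Sum>k<n. c k * a k\<bar> \<le> C * a 0"
proof -
  have "\<bar>\<Sum>k<n. (\<Sum>i\<le>k. c i) * (a k - a (Suc k))\<bar> \<le> (\<Sum>k<n. C * (a k - a (Suc k)))"
  proof (rule order_trans[OF sum_abs sum_mono])
    fix k
    have "\<bar>\<Sum>i\<le>k. c i\<bar> \<le> C" using C[of "Suc k"] by (simp only: lessThan_Suc_atMost)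
    then show "\<bar>(\<Sum>i\<le>k. c i) * (a k - a (Suc k))\<bar> \<le> C * (a k - a (Suc k))"
      using dec[of k] by (simp add: abs_mult mult_right_mono)
  qed
  moreover have "\<bar>(\<Sum>i<n. c i) * a n\<bar> \<le> C * a n"
    using C[of n] pos[of n] by (simp add: abs_mult mult_right_mono)
  moreover have "(\<Sum>k<n. C * (a k - a (Suc k))) = C * (a 0 - a n)"
    by (simp flip: sum_distrib_left add: sum_lessThan_telescope')
  ultimately show ?thesis unfolding sum_by_parts[of c a n] by (simp add: algebra_simps abs_le_iff)
qed

lemma summable_abel:
  fixes a c :: "nat \<Rightarrow> real"
  assumes C: "\<And>n. \<bar>\<Sum>i<n. c i\<bar> \<le> C" and dec: "\<And>n. a (Suc n) \<le> a n" and lim: "a \<longlonglongrightarrow> 0"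
  shows "summable (\<lambda>k. c k * a k)"
proof -
  have tel: "(\<lambda>n. a n - a (Suc n)) sums (a 0 - 0)"
    using telescope_sums'[OF lim] by simp
  have "summable (\<lambda>k. (\<Sum>i\<le>k. c i) * (a k - a (Suc k)))"
  proof (rule summable_comparison_test')
    show "summable (\<lambda>k. C * (a k - a (Suc k)))" using tel by (intro summable_mult) (simp add: sums_iff)
    fix k
    have "\<bar>\<Sum>i\<le>k. c i\<bar> \<le> C" using C[of "Suc k"] by (simp only: lessThan_Suc_atMost)
    then show "norm ((\<Sum>i\<le>k. c i) * (a k - a (Suc k))) \<le> C * (a k - a (Suc k))"
      using dec[of k] by (simp add: abs_mult mult_right_mono)
  qed
  then have "convergent (\<lambda>n. \<Sum>k<n. (\<Sum>i\<le>k. c i) * (a k - a (Suc k)))"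
    by (simp add: summable_iff_convergent)
  moreover have "(\<lambda>n. (\<Sum>i<n. c i) * a n) \<longlonglongrightarrow> 0"
  proof (rule Lim_null_comparison)
    show "\<forall>\<^sub>F n in sequentially. norm ((\<Sum>i<n. c i) * a n) \<le> C * \<bar>a n\<bar>"
      using C by (auto simp: abs_mult mult_right_mono)
    show "(\<lambda>n. C * \<bar>a n\<bar>) \<longlonglongrightarrow> 0" using tendsto_mult_left[OF tendsto_rabs[OF lim], of C] by simp
  qed
  ultimately have "convergent (\<lambda>n. (\<Sum>k<n. (\<Sum>i\<le>k. c i) * (a k - a (Suc k))) + (\<Sum>i<n. c i) * a n)"
    by (intro convergent_add) (auto simp: convergent_def)
  then show ?thesis by (simp add: summable_iff_convergent sum_by_parts[of c a])
qed

lemma suminf_abel_bound: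
  fixes a c :: "nat \<Rightarrow> real"
  assumes C: "\<And>n. \<bar>\<Sum>i<n. c i\<bar> \<le> C" and dec: "\<And>n. a (Suc n) \<le> a n" and lim: "a \<longlonglongrightarrow> 0"
  shows "\<bar>\<Sum>k. c k * a k\<bar> \<le> C * a 0"
proof -
  have pos: "a n \<ge> 0" for n
    using decseq_ge[OF decseq_SucI lim] dec by blast
  have "(\<lambda>n. \<bar>\<Sum>k<n. c k * a k\<bar>) \<longlonglongrightarrow> \<bar>\<Sum>k. c k * a k\<bar>"
    by (intro tendsto_rabs summable_LIMSEQ summable_abel[where c = c and C = C and a = a, OF C dec lim])
  then show ?thesis
    by (rule Lim_bounded[where M=0]) (intro allI impI abel_bound[where c = c and C = C and a = a, OF C dec pos])
qed

section \<open>Double series rearranged by divisors\<close>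

lemma bij_betw_divisor_pairs:
  "bij_betw (\<lambda>(n, d). (n div d - 1, d - 1)) (SIGMA n:{0<..}. {d. d dvd n}) (UNIV \<times> (UNIV :: nat set))"
proof (rule bij_betwI[where g = "\<lambda>(k, m). (Suc k * Suc m, Suc m)"])
  show "(\<lambda>(k, m). (Suc k * Suc m, Suc m)) \<in> UNIV \<times> UNIV \<rightarrow> (SIGMA n:{0<..}. {d. d dvd n})"
    by (auto simp del: mult_Suc mult_Suc_right)
  show "(\<lambda>(n, d). (n div d - 1, d - 1)) \<in> (SIGMA n:{0<..}. {d. d dvd n}) \<rightarrow> UNIV \<times> (UNIV :: nat set)"
    by simp
  fix x :: "nat \<times> nat" assume x: "x \<in> (SIGMA n:{0<..}. {d. d dvd n})"
  then obtain n d where nd: "x = (n, d)" "n > 0" "d dvd n" by auto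
  then have "d > 0" "n div d > 0" by (auto simp: dvd_div_eq_0_iff intro!: Nat.gr0I)
  then show "(case case x of (n, d) \<Rightarrow> (n div d - 1, d - 1) of (k, m) \<Rightarrow> (Suc k * Suc m, Suc m)) = x"
    using nd by (simp del: mult_Suc mult_Suc_right)
next
  fix y :: "nat \<times> nat" assume "y \<in> UNIV \<times> UNIV"
  obtain k m where y: "y = (k, m)" by (cases y)
  have "Suc k * Suc m div Suc m = Suc k" by (rule nonzero_mult_div_cancel_right) simp
  then show "(\<lambda>(n, d). (n div d - 1, d - 1)) ((\<lambda>(k, m). (Suc k * Suc m, Suc m)) y) = y"
    unfolding y by (simp del: mult_Suc mult_Suc_right)
qed

text \<open>The shift by \<open>Suc\<close> avoids the index 0, which has infinitely many divisors.\<close>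

lemma sums_over_divisors:
  fixes g :: "nat \<Rightarrow> nat \<Rightarrow> 'a::banach"
  assumes abs: "(\<lambda>(k, m). norm (g (Suc k) (Suc m))) summable_on UNIV"
  shows "(\<lambda>n. \<Sum>d | d dvd Suc n. g (Suc n div d) d) sums (\<Sum>k. \<Sum>m. g (Suc k) (Suc m))"
    and "summable (\<lambda>k. \<Sum>m. g (Suc k) (Suc m))"
    and "summable (\<lambda>m. g (Suc k) (Suc m))"
proof -
  define G where "G = (\<lambda>(k, m). g (Suc k) (Suc m))"
  have absG: "G abs_summable_on UNIV \<times> UNIV"
    using abs by (simp add: G_def case_prod_unfold)
  then have G: "G summable_on UNIV \<times> UNIV" by (rule abs_summable_summable)
  define S where "S = infsum G (UNIV \<times> UNIV)"
  have hs: "(G has_sum S) (UNIV \<times> UNIV)" unfolding S_def by (rule has_sum_infsum[OF G])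
  have absr: "(\<lambda>m. norm (G (k, m))) summable_on UNIV" for k
    by (rule summable_on_SigmaD1[of "\<lambda>k m. norm (G (k, m))" UNIV "\<lambda>_. UNIV", OF _ UNIV_I])
       (use absG in \<open>simp add: case_prod_unfold\<close>)
  have row: "((\<lambda>m. G (k, m)) has_sum (\<Sum>\<^sub>\<infinity>m. G (k, m))) UNIV" for k
    using abs_summable_summable[of "\<lambda>m. G (k, m)" UNIV] absr[of k] by (simp add: has_sum_infsum)
  then have rs: "(\<lambda>m. G (k, m)) sums (\<Sum>\<^sub>\<infinity>m. G (k, m))" for k
    by (rule has_sum_imp_sums)
  then show "summable (\<lambda>m. g (Suc k) (Suc m))" by (simp add: G_def sums_iff)
  have inf_eq: "(\<Sum>\<^sub>\<infinity>m. G (k, m)) = (\<Sum>m. g (Suc k) (Suc m))" for k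
    using rs[of k] by (simp add: G_def sums_iff)
  have "((\<lambda>k. \<Sum>\<^sub>\<infinity>m. G (k, m)) has_sum S) UNIV"
    by (rule has_sum_SigmaD[OF hs]) (use row in auto)
  then have s1: "(\<lambda>k. \<Sum>m. g (Suc k) (Suc m)) sums S"
    unfolding inf_eq by (rule has_sum_imp_sums)
  then show "summable (\<lambda>k. \<Sum>m. g (Suc k) (Suc m))" by (simp add: sums_iff)
  have "((\<lambda>x. G ((\<lambda>(n, d). (n div d - 1, d - 1)) x)) has_sum S) (SIGMA n:{0<..}. {d. d dvd n})"
    using has_sum_reindex_bij_betw[OF bij_betw_divisor_pairs, of G S] hs by simp
  then have "((\<lambda>(n, d). g (n div d) d) has_sum S) (SIGMA n:{0<..}. {d. d dvd n})"
  proof (rule has_sum_cong[THEN iffD1, rotated])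
    fix x :: "nat \<times> nat" assume "x \<in> (SIGMA n:{0<..}. {d. d dvd n})"
    then obtain n d where nd: "x = (n, d)" "n > 0" "d dvd n" by auto
    then have "d > 0" "n div d > 0" by (auto simp: dvd_div_eq_0_iff intro!: Nat.gr0I)
    then show "G ((\<lambda>(n, d). (n div d - 1, d - 1)) x) = (\<lambda>(n, d). g (n div d) d) x"
      using nd by (simp add: G_def)
  qed
  then have "((\<lambda>n. \<Sum>d | d dvd n. g (n div d) d) has_sum S) {0<..}"
    by (rule has_sum_SigmaD) (auto intro!: has_sum_finite)
  then have "((\<lambda>n. \<Sum>d | d dvd Suc n. g (Suc n div d) d) has_sum S) UNIV"
    using has_sum_reindex_bij_betw[of Suc UNIV "{0<..}" "\<lambda>n. \<Sum>d | d dvd n. g (n div d) d" S]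
    by (simp add: bij_betw_def greaterThan_0)
  then have "(\<lambda>n. \<Sum>d | d dvd Suc n. g (Suc n div d) d) sums S" by (rule has_sum_imp_sums)
  then show "(\<lambda>n. \<Sum>d | d dvd Suc n. g (Suc n div d) d) sums (\<Sum>k. \<Sum>m. g (Suc k) (Suc m))"
    using sums_unique[OF s1] by simp
qed

lemma summable_Suc_power_mult:
  fixes r :: real
  assumes "0 \<le> r" "r < 1" shows "summable (\<lambda>k. real (Suc k) ^ j * r ^ k)"
proof (cases "r = 0")
  case False
  then have r: "0 < r" using assms by simp
  have "summable (\<lambda>k. (1 / (1::real)) * (real (Suc k) ^ j * r ^ k))"
  proof -
    \<comment> \<open>Half of the exponential decay, one factor \<open>s ^ k\<close>, keeps the
      polynomial bounded; the other half is summed geometrically.\<close>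
    define s where "s = sqrt r"
    have s: "0 < s" "s < 1" "s * s = r" using r assms by (auto simp: s_def)
    have "(\<lambda>k. real (Suc k) ^ j * s ^ k) \<longlonglongrightarrow> 0" using s by real_asymp
    then have "Bseq (\<lambda>k. real (Suc k) ^ j * s ^ k)" by (intro convergent_imp_Bseq) (auto simp: convergent_def)
    then obtain K where K: "\<And>k. norm (real (Suc k) ^ j * s ^ k) \<le> K" by (auto simp: Bseq_def)
    have "summable (\<lambda>k. real (Suc k) ^ j * r ^ k)"
    proof (rule summable_comparison_test')
      show "summable (\<lambda>k. K * s ^ k)" using s by (intro summable_mult summable_geometric) auto
      fix k
      have "norm (real (Suc k) ^ j * r ^ k) = norm (real (Suc k) ^ j * s ^ k) * s ^ k"
        using s by (simp add: abs_mult power_mult_distrib flip: s(3))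
      also have "\<dots> \<le> K * s ^ k" using K s by (intro mult_right_mono) auto
      finally show "norm (real (Suc k) ^ j * r ^ k) \<le> K * s ^ k" .
    qed
    then show ?thesis by simp
  qed
  then show ?thesis by simp
next
  case True
  then show ?thesis by (intro summable_finite[of "{0}"]) auto
qed

lemma summable_on_pairs:
  fixes g :: "nat \<Rightarrow> nat \<Rightarrow> 'a::real_normed_vector"
  assumes r: "0 \<le> r" "r < 1"
    and g: "\<And>k m. norm (g (Suc k) (Suc m)) \<le> C * real (Suc k * Suc m) ^ j * r ^ (Suc k * Suc m)"
  shows "(\<lambda>(k, m). norm (g (Suc k) (Suc m))) summable_on UNIV"
proof -
  \<comment> \<open>For \<open>r = 0\<close> the sign of \<open>C\<close> is undetermined; the
    product, bounded below through \<open>g\<close> at \<open>k = m = 0\<close>, is what the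
    majorant contains.\<close>
  have C: "0 \<le> C * r"
    using order_trans[OF norm_ge_zero g[of 0 0]] by simp
  define h where "h k = real (Suc k) ^ j * r ^ k" for k
  have h0: "h k \<ge> 0" for k using r by (simp add: h_def)
  have "summable h" unfolding h_def by (rule summable_Suc_power_mult[OF r])
  then have "(\<lambda>k. h k) summable_on UNIV"
    by (intro norm_summable_imp_summable_on) (simp add: h0)
  then have "(\<lambda>(k, m). h k * h m) summable_on UNIV \<times> UNIV"
    by (intro summable_on_SigmaI[where g = "\<lambda>k. h k * infsum h UNIV"])
       (auto intro!: has_sum_cmult_right summable_on_cmult_left simp: h0 has_sum_infsum)
  then have "(\<lambda>(k, m). (C * r) * (h k * h m)) summable_on UNIV"
    using summable_on_cmult_right[of "\<lambda>(k, m). h k * h m" UNIV "C * r"] by (simp add: case_prod_unfold)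
  then show ?thesis
  proof (rule summable_on_comparison_test)
    fix x :: "nat \<times> nat"
    obtain k m where x: "x = (k, m)" by (cases x)
    have "C * real (Suc k * Suc m) ^ j * r ^ (Suc k * Suc m)
        = (C * r) * (real (Suc k * Suc m) ^ j * r ^ (k + m + k * m))"
      by (simp add: add_ac mult_ac)
    \<comment> \<open>Dropping \<open>k * m\<close> from the exponent makes the majorant a function
      of \<open>k\<close> times a function of \<open>m\<close>.\<close>
    also have "r ^ (k + m + k * m) \<le> r ^ (k + m)" using r by (intro power_decreasing) auto
    then have "(C * r) * (real (Suc k * Suc m) ^ j * r ^ (k + m + k * m))
        \<le> (C * r) * (real (Suc k * Suc m) ^ j * r ^ (k + m))"
      using C by (intro mult_left_mono) auto
    also have "\<dots> = (C * r) * (h k * h m)"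
      unfolding h_def of_nat_mult power_mult_distrib power_add by (simp only: mult_ac)
    finally show "(case x of (k, m) \<Rightarrow> norm (g (Suc k) (Suc m))) \<le> (case x of (k, m) \<Rightarrow> (C * r) * (h k * h m))"
      using g[of k m] unfolding x by simp
  qed auto
qed

section \<open>Positivity of the L-value at 1\<close>

context odd_prime
begin

lemma sum_chi_periods: "(\<Sum>i<p * k. chi i) = 0"
proof (induction k)
  case (Suc k)
  have "(\<Sum>i<p * Suc k. chi i) = (\<Sum>i<p * k. chi i) + (\<Sum>i<p. chi (i + p * k))"
  proof -
    have "(\<Sum>i<p * Suc k. chi i) = (\<Sum>i=0..<p * k. chi i) + (\<Sum>i=0 + p * k..<p + p * k. chi i)"
      using sum.atLeastLessThan_concat[of 0 "p * k" "p + p * k" chi] by (simp add: lessThan_atLeast0)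
    also have "(\<Sum>i=0 + p * k..<p + p * k. chi i) = (\<Sum>i=0..<p. chi (i + p * k))"
      by (rule sum.shift_bounds_nat_ivl)
    finally show ?thesis by (simp add: lessThan_atLeast0)
  qed
  then show ?case using Suc sum_chi by simp
qed simp

lemma abs_sum_chi_le: "\<bar>\<Sum>i<n. chi i\<bar> \<le> real p"
proof -
  have "(\<Sum>i<n. chi i) = (\<Sum>i<p * (n div p). chi i) + (\<Sum>i=p * (n div p)..<n. chi i)"
    using sum.atLeastLessThan_concat[of 0 "p * (n div p)" n chi] times_div_less_eq_dividend[of p n]
    by (simp add: lessThan_atLeast0)
  then have "\<bar>\<Sum>i<n. chi i\<bar> \<le> (\<Sum>i=p * (n div p)..<n. \<bar>chi i\<bar>)"
    by (simp add: sum_chi_periods)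
  also have "\<dots> \<le> (\<Sum>i=p * (n div p)..<n. 1)" by (intro sum_mono abs_chi_le_1)
  also have "\<dots> = real (n - p * (n div p))" by simp
  also have "\<dots> = real (n mod p)" by (simp add: minus_mult_div_eq_mod)
  also have "\<dots> \<le> real p" by (simp add: mod_less_divisor less_imp_le)
  finally show ?thesis .
qed

lemma abs_sum_chi_Suc_le: "\<bar>\<Sum>i<n. chi (Suc i)\<bar> \<le> real p"
proof -
  have "(\<Sum>i<Suc n. chi i) = chi 0 + (\<Sum>i<n. chi (Suc i))" by (rule sum.lessThan_Suc_shift)
  then show ?thesis using abs_sum_chi_le[of "Suc n"] by simp
qed

definition chi_divisor_sum :: "nat \<Rightarrow> real" where
  "chi_divisor_sum n = (\<Sum>d | d dvd n. chi d)"

lemma (in -) divisors_prime_power_Suc: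
  fixes q :: nat
  assumes q: "prime q" and m: "\<not> q dvd m"
  shows "{d. d dvd q ^ Suc a * m} = {d. d dvd q ^ a * m} \<union> (\<lambda>e. q ^ Suc a * e) ` {e. e dvd m}"
    and "{d. d dvd q ^ a * m} \<inter> (\<lambda>e. q ^ Suc a * e) ` {e. e dvd m} = {}"
proof -
  show "{d. d dvd q ^ Suc a * m} = {d. d dvd q ^ a * m} \<union> (\<lambda>e. q ^ Suc a * e) ` {e. e dvd m}"
  proof (intro equalityI subsetI)
    fix d assume "d \<in> {d. d dvd q ^ Suc a * m}"
    then obtain x y where xy: "d = x * y" "x dvd q ^ Suc a" "y dvd m"
      using division_decomp by blast
    then obtain i where i: "i \<le> Suc a" "x = q ^ i" using divides_primepow_nat[OF q, of x "Suc a"] by blast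
    show "d \<in> {d. d dvd q ^ a * m} \<union> (\<lambda>e. q ^ Suc a * e) ` {e. e dvd m}"
    proof (cases "i = Suc a")
      case True
      then show ?thesis using xy i by blast
    next
      case False
      then have "q ^ i dvd q ^ a" using i by (intro le_imp_power_dvd) simp
      then have "d dvd q ^ a * m" unfolding xy(1) i(2) using xy(3) by (rule mult_dvd_mono)
      then show ?thesis by blast
    qed
  next
    fix d assume "d \<in> {d. d dvd q ^ a * m} \<union> (\<lambda>e. q ^ Suc a * e) ` {e. e dvd m}"
    then show "d \<in> {d. d dvd q ^ Suc a * m}"
    proof
      assume "d \<in> {d. d dvd q ^ a * m}"
      then show ?thesis by (simp add: mult.assoc)
    next
      assume "d \<in> (\<lambda>e. q ^ Suc a * e) ` {e. e dvd m}"
      then show ?thesis by (auto intro: mult_dvd_mono)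
    qed
  qed
  show "{d. d dvd q ^ a * m} \<inter> (\<lambda>e. q ^ Suc a * e) ` {e. e dvd m} = {}"
  proof (rule ccontr)
    assume "\<not> ?thesis"
    then obtain e where "q ^ Suc a * e dvd q ^ a * m" by blast
    then have "q ^ a * (q * e) dvd q ^ a * m" by (simp add: mult_ac)
    then have "q * e dvd m" using q by (simp add: prime_gt_0_nat)
    then show False using m by (auto dest: dvd_mult_left)
  qed
qed

lemma chi_power: "chi (q ^ a) = chi q ^ a"
  by (induction a) (simp_all add: chi_mult)

text \<open>Multiplicativity in the form that an induction over prime powers uses: passing from
  \<open>q ^ a\<close> to \<open>q ^ Suc a\<close> adds exactly the divisors that are multiples of
  \<open>q ^ Suc a\<close>.\<close>

lemma chi_divisor_sum_prime_power_mult: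
  assumes "prime q" "\<not> q dvd m" "m > 0"
  shows "chi_divisor_sum (q ^ a * m) = (\<Sum>i\<le>a. chi q ^ i) * chi_divisor_sum m"
proof (induction a)
  case (Suc a)
  note d = divisors_prime_power_Suc[OF assms(1,2), of a]
  have q0: "q > 0" using assms by (simp add: prime_gt_0_nat)
  have "chi_divisor_sum (q ^ Suc a * m) = chi_divisor_sum (q ^ a * m) + (\<Sum>d\<in>(\<lambda>e. q ^ Suc a * e) ` {e. e dvd m}. chi d)"
    unfolding chi_divisor_sum_def d(1) by (rule sum.union_disjoint[OF _ _ d(2)]) (use q0 assms in auto)
  also have "(\<Sum>d\<in>(\<lambda>e. q ^ Suc a * e) ` {e. e dvd m}. chi d) = (\<Sum>e | e dvd m. chi (q ^ Suc a * e))"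
    by (subst sum.reindex) (use q0 in \<open>auto simp: inj_on_def\<close>)
  also have "\<dots> = chi q ^ Suc a * chi_divisor_sum m"
    unfolding chi_mult chi_power chi_divisor_sum_def by (simp add: sum_distrib_left)
  finally show ?case using Suc by (simp add: algebra_simps)
qed (simp)

lemma sum_power_chi_nonneg: "(\<Sum>i\<le>a. chi q ^ i) \<ge> 0"
  and sum_power_chi_ge_1: "(\<Sum>i\<le>2 * a. chi q ^ i) \<ge> 1"
proof -
  have m: "(\<Sum>i\<le>a. (-1 :: real) ^ i) = (if even a then 1 else 0)" for a
    by (induction a) auto
  have z: "(\<Sum>i\<le>a. (0 :: real) ^ i) = 1" for a
    by (induction a) auto
  show "(\<Sum>i\<le>a. chi q ^ i) \<ge> 0" "(\<Sum>i\<le>2 * a. chi q ^ i) \<ge> 1"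
    using chi_values[of q] by (auto simp: m z)
qed

lemma (in -) prime_power_decomposition:
  fixes n :: nat
  assumes "n > 1"
  obtains q a m where "prime q" "a > 0" "\<not> q dvd m" "m > 0" "n = q ^ a * m" "m < n"
proof -
  obtain q where q: "prime q" "q dvd n" using assms prime_factor_nat[of n] by auto
  define a where "a = multiplicity q n"
  obtain m where m: "n = q ^ a * m" "\<not> q dvd m"
    using multiplicity_decompose'[of n q] q assms unfolding a_def by (metis not_prime_unit not_less0)
  have a: "a > 0" using m q by (cases a) auto
  have m0: "m > 0" using m assms by (cases m) auto
  have "1 < q ^ a" by (rule one_less_power[OF prime_gt_1_nat[OF q(1)] a])
  then have "m < n" unfolding m(1) using m0 by simp
  then show ?thesis using that q(1) a m m0 by blast
qed

lemma chi_divisor_sum_nonneg: "n > 0 \<Longrightarrow> chi_divisor_sum n \<ge> 0"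
proof (induction n rule: less_induct)
  case (less n)
  show ?case
  proof (cases "n > 1")
    case True
    then obtain q a m where *: "prime q" "\<not> q dvd m" "m > 0" "n = q ^ a * m" "m < n"
      using prime_power_decomposition by metis
    then show ?thesis
      unfolding *(4) chi_divisor_sum_prime_power_mult[OF *(1-3)]
      using less.IH[OF *(5,3)] sum_power_chi_nonneg by simp
  next
    case False
    then have "n = 1" using less by simp
    then show ?thesis by (simp add: chi_divisor_sum_def)
  qed
qed

lemma chi_divisor_sum_square: "n > 0 \<Longrightarrow> chi_divisor_sum (n\<^sup>2) \<ge> 1"
proof (induction n rule: less_induct)
  case (less n)
  show ?case
  proof (cases "n > 1")
    case True
    then obtain q a m where *: "prime q" "\<not> q dvd m" "m > 0" "n = q ^ a * m" "m < n"
      using prime_power_decomposition by metis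
    have n2: "n\<^sup>2 = q ^ (2 * a) * m\<^sup>2" by (simp add: *(4) power_mult_distrib power_mult mult.commute flip: power_mult)
    have "\<not> q dvd m\<^sup>2" "m\<^sup>2 > 0" using * prime_dvd_power by auto
    then have "chi_divisor_sum (n\<^sup>2) = (\<Sum>i\<le>2 * a. chi q ^ i) * chi_divisor_sum (m\<^sup>2)"
      unfolding n2 using chi_divisor_sum_prime_power_mult[OF *(1)] by blast
    also have "\<dots> \<ge> 1 * 1"
      using less.IH[OF *(5,3)] sum_power_chi_ge_1[where q=q and a=a] by (intro mult_mono) auto
    finally show ?thesis by simp
  next
    case False
    then have "n = 1" using less by simp
    then show ?thesis by (simp add: chi_divisor_sum_def)
  qed
qed

definition L1 :: real where
  "L1 = (\<Sum>m. chi (Suc m) * (1 / real (Suc m)))"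

lemma summable_L1: "summable (\<lambda>m. chi (Suc m) * (1 / real (Suc m)))"
proof (rule summable_abel[where C = "real p"])
  show "\<bar>\<Sum>i<n. chi (Suc i)\<bar> \<le> real p" for n by (rule abs_sum_chi_Suc_le)
  show "1 / real (Suc (Suc n)) \<le> 1 / real (Suc n)" for n by (simp add: field_simps)
  show "(\<lambda>n. 1 / real (Suc n)) \<longlonglongrightarrow> 0" by real_asymp
qed

text \<open>AM-GM for the terms \<open>i\<close> and \<open>m - i\<close>, whose geometric mean is
  \<open>s ^ m\<close> independently of \<open>i\<close>.\<close>

lemma (in -) geometric_sum_am_gm:
  fixes s :: real
  assumes "0 \<le> s"
  shows "real (Suc m) * s ^ m \<le> (\<Sum>i\<le>m. (s\<^sup>2) ^ i)"
proof -
  have "(\<Sum>i\<le>m. (s\<^sup>2) ^ i) = (\<Sum>i\<le>m. (s\<^sup>2) ^ (m - i))"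
    by (rule sum.nat_diff_reindex[of "\<lambda>i. (s\<^sup>2) ^ i" "Suc m", unfolded lessThan_Suc_atMost, simplified, symmetric])
  then have "2 * (\<Sum>i\<le>m. (s\<^sup>2) ^ i) = (\<Sum>i\<le>m. (s\<^sup>2) ^ i + (s\<^sup>2) ^ (m - i))"
    by (simp add: sum.distrib)
  also have "\<dots> \<ge> (\<Sum>i\<le>m. 2 * s ^ m)"
  proof (rule sum_mono)
    fix i assume "i \<in> {..m}"
    then have e: "s ^ i * s ^ (m - i) = s ^ m" by (simp flip: power_add)
    have "(s ^ i - s ^ (m - i))\<^sup>2 \<ge> 0" by simp
    then have "2 * (s ^ i * s ^ (m - i)) \<le> (s ^ i)\<^sup>2 + (s ^ (m - i))\<^sup>2"
      by (simp add: power2_diff)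
    then show "2 * s ^ m \<le> (s\<^sup>2) ^ i + (s\<^sup>2) ^ (m - i)"
      unfolding e by (simp add: power_mult[symmetric] mult.commute)
  qed
  finally show ?thesis by simp
qed

text \<open>\<open>b\<close> is the termwise difference between the series of
  \<open>L1 / (1 - r)\<close> and the Lambert series, with \<open>chi\<close> removed; monotonicity
  makes Abel's bound applicable. With \<open>S m = 1 + ... + r ^ m\<close> it amounts to
  \<open>(m + 1) * (m + 2) * r ^ (m + 1) \<le> S m * S (m + 1)\<close>, which follows from
  \<open>S m \<ge> (m + 1) * sqrt r ^ m\<close>.\<close>

lemma (in -) monsky_decreasing:
  fixes r :: real
  assumes r: "0 < r" "r < 1"
  defines "b \<equiv> \<lambda>m. 1 / (real m * (1 - r)) - r ^ m / (1 - r ^ m)"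
  shows "b (Suc (Suc m)) \<le> b (Suc m)"
proof -
  define s where "s = sqrt r"
  have s: "0 < s" "s < 1" "s\<^sup>2 = r" using r by (auto simp: s_def)
  define S where "S m = (\<Sum>i\<le>m. r ^ i)" for m
  have S: "1 - r ^ Suc m = (1 - r) * S m" for m
    by (simp only: S_def sum_gp_basic)
  have Sp: "S m > 0" for m
    unfolding S_def using r by (intro sum_pos) auto
  have lower: "S m \<ge> real (Suc m) * s ^ m" for m
    unfolding S_def using geometric_sum_am_gm[of s m] s by simp
  have S_Suc: "S (Suc m) = S m + r ^ Suc m" by (simp add: S_def)
  have "real (Suc m) * real (Suc (Suc m)) * r ^ Suc m \<le> real (Suc m) * real (Suc (Suc m)) * (s ^ m * s ^ Suc m)"
  proof (rule mult_left_mono)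
    have "m + Suc m + 1 = 2 * Suc m" by simp
    then have "r ^ Suc m = s ^ (m + Suc m + 1)" by (simp only: power_mult s(3))
    also have "\<dots> \<le> s ^ (m + Suc m)" using s by (intro power_decreasing) auto
    finally show "r ^ Suc m \<le> s ^ m * s ^ Suc m" by (simp only: power_add)
  qed simp
  also have "\<dots> = (real (Suc m) * s ^ m) * (real (Suc (Suc m)) * s ^ Suc m)" by (simp only: mult_ac)
  also have "\<dots> \<le> S m * S (Suc m)"
    using s less_imp_le[OF Sp[of m]] by (intro mult_mono lower) auto
  finally have key: "real (Suc m) * real (Suc (Suc m)) * r ^ Suc m \<le> S m * S (Suc m)" .
  have "r ^ Suc m / (1 - r ^ Suc m) - r ^ Suc (Suc m) / (1 - r ^ Suc (Suc m))
      = (r ^ Suc m * S (Suc m) - r ^ Suc (Suc m) * S m) / ((1 - r) * (S m * S (Suc m)))"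
    unfolding S using r Sp[of m] Sp[of "Suc m"] by (simp add: divide_simps)
  also have "r ^ Suc m * S (Suc m) - r ^ Suc (Suc m) * S m = r ^ Suc m * ((1 - r) * S m + r ^ Suc m)"
    unfolding S_Suc by (simp add: algebra_simps)
  also have "(1 - r) * S m + r ^ Suc m = 1" using S[of m] by simp
  finally have 1: "r ^ Suc m / (1 - r ^ Suc m) - r ^ Suc (Suc m) / (1 - r ^ Suc (Suc m))
      = r ^ Suc m / ((1 - r) * (S m * S (Suc m)))" by simp
  have 2: "1 / (real (Suc m) * (1 - r)) - 1 / (real (Suc (Suc m)) * (1 - r))
      = 1 / ((1 - r) * (real (Suc m) * real (Suc (Suc m))))"
    using r by (simp add: divide_simps)
  have "r ^ Suc m / (S m * S (Suc m)) \<le> 1 / (real (Suc m) * real (Suc (Suc m)))"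
    using key Sp[of m] Sp[of "Suc m"] by (simp add: pos_divide_le_eq pos_le_divide_eq mult_ac)
  then have "r ^ Suc m / (S m * S (Suc m)) / (1 - r) \<le> 1 / (real (Suc m) * real (Suc (Suc m))) / (1 - r)"
    using r by (intro divide_right_mono) auto
  then have "r ^ Suc m / ((1 - r) * (S m * S (Suc m))) \<le> 1 / ((1 - r) * (real (Suc m) * real (Suc (Suc m))))"
    by (simp add: mult.commute)
  then show ?thesis unfolding b_def using 1 2 by linarith
qed

text \<open>Expanding \<open>1 / (1 - r ^ m)\<close> geometrically gives a double series over the
  factorisations of \<open>n\<close>. The factor with \<open>chi\<close> sits in the first slot of
  \<open>g\<close>, so the divisor sum appears with cofactors until \<open>d\<close> is exchanged
  with \<open>n div d\<close>.\<close>

lemma lambert_chi: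
  assumes r: "0 < r" "r < 1"
  shows "(\<lambda>n. chi_divisor_sum (Suc n) * r ^ Suc n) sums (\<Sum>m. chi (Suc m) * (r ^ Suc m / (1 - r ^ Suc m)))"
    and "summable (\<lambda>m. chi (Suc m) * (r ^ Suc m / (1 - r ^ Suc m)))"
proof -
  define g where "g = (\<lambda>m k. chi m * r ^ (k * m))"
  have "(\<lambda>(k, m). norm (g (Suc k) (Suc m))) summable_on UNIV"
  proof (rule summable_on_pairs[where C = 1 and r = r and j = 0])
    fix k m
    have "\<bar>chi (Suc k)\<bar> * r ^ (Suc m * Suc k) \<le> 1 * r ^ (Suc m * Suc k)"
      using r by (intro mult_right_mono abs_chi_le_1) auto
    then show "norm (g (Suc k) (Suc m)) \<le> 1 * real (Suc k * Suc m) ^ 0 * r ^ (Suc k * Suc m)"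
      using r by (simp add: g_def abs_mult mult.commute del: mult_Suc mult_Suc_right power_Suc)
  qed (use r in auto)
  note sd = sums_over_divisors[OF this]
  have inner: "(\<Sum>k. g (Suc m) (Suc k)) = chi (Suc m) * (r ^ Suc m / (1 - r ^ Suc m))" for m
  proof -
    have x: "norm (r ^ Suc m) < 1" using r power_Suc_less_one[of r m] by (simp del: power_Suc)
    have "(\<lambda>k. chi (Suc m) * (r ^ Suc m * (r ^ Suc m) ^ k)) sums (chi (Suc m) * (r ^ Suc m * (1 / (1 - r ^ Suc m))))"
      by (intro sums_mult geometric_sums x)
    moreover have "g (Suc m) (Suc k) = chi (Suc m) * (r ^ Suc m * (r ^ Suc m) ^ k)" for k
    proof -
      have "r ^ (Suc k * Suc m) = (r ^ Suc m) ^ Suc k" by (metis mult.commute power_mult)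
      then show ?thesis by (simp add: g_def)
    qed
    ultimately show ?thesis by (simp add: sums_iff)
  qed
  show "summable (\<lambda>m. chi (Suc m) * (r ^ Suc m / (1 - r ^ Suc m)))"
    using sd(2) unfolding inner .
  have "(\<Sum>d | d dvd Suc n. g (Suc n div d) d) = chi_divisor_sum (Suc n) * r ^ Suc n" for n
  proof -
    have dd: "Suc n div (Suc n div d) = d" if "d dvd Suc n" for d
    proof -
      obtain c where c: "Suc n = d * c" using \<open>d dvd Suc n\<close> by (rule dvdE)
      then have "d > 0" "c > 0" by (auto intro!: Nat.gr0I)
      then show ?thesis unfolding c by simp
    qed
    have "(\<Sum>d | d dvd Suc n. g (Suc n div d) d) = (\<Sum>d | d dvd Suc n. chi (Suc n div d) * r ^ Suc n)"
      by (rule sum.cong) (auto simp: g_def simp del: power_Suc)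
    also have "\<dots> = (\<Sum>d | d dvd Suc n. chi d * r ^ Suc n)"
      by (rule sum.reindex_bij_witness[of _ "\<lambda>d. Suc n div d" "\<lambda>d. Suc n div d"]) (auto simp: dd simp del: power_Suc)
    finally show ?thesis by (simp only: chi_divisor_sum_def sum_distrib_right)
  qed
  then show "(\<lambda>n. chi_divisor_sum (Suc n) * r ^ Suc n) sums (\<Sum>m. chi (Suc m) * (r ^ Suc m / (1 - r ^ Suc m)))"
    using sd(1) unfolding inner by simp
qed

text \<open>Monsky's argument: by summation by parts, \<open>L1 \<le> 0\<close> would bound the Lambert series of \<open>\<chi>\<close> from above as
  \<open>r \<longlongrightarrow> 1\<close>, but its coefficients are nonnegative, and at least 1 at squares.\<close>

theorem L1_pos: "L1 > 0"
proof -
  \<comment> \<open>Abel's bound will give \<open>L1 / (1 - r) \<ge> T - p\<close>. With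
    \<open>r\<close> so close to 1 that each of the first \<open>K\<close> squares contributes more
    than \<open>(p + 1) / (p + 2)\<close>, the Lambert sum \<open>T\<close> is at least
    \<open>p + 1\<close>.\<close>
  define K where "K = p + 2"
  have "((\<lambda>r. r ^ (K\<^sup>2)) \<longlongrightarrow> (1 :: real) ^ (K\<^sup>2)) (at_left 1)"
    by (intro tendsto_intros)
  then have "\<forall>\<^sub>F r in at_left (1 :: real). r ^ (K\<^sup>2) > real (p + 1) / real (p + 2)"
    by (rule order_tendstoD(1)) (simp add: field_simps)
  moreover have "\<forall>\<^sub>F r in at_left (1 :: real). 0 < r \<and> r < 1"
    using eventually_at_left_real[of 0 1] by simp
  ultimately have "\<forall>\<^sub>F r in at_left (1 :: real). r ^ (K\<^sup>2) > real (p + 1) / real (p + 2) \<and> 0 < r \<and> r < 1"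
    by eventually_elim auto
  then obtain r :: real where rK: "r ^ (K\<^sup>2) > real (p + 1) / real (p + 2)" and r: "0 < r" "r < 1"
    using eventually_happens[of _ "at_left (1 :: real)"] by (auto simp: trivial_limit_at_left_real)
  define b where "b m = 1 / (real m * (1 - r)) - r ^ m / (1 - r ^ m)" for m :: nat
  have bound: "\<bar>\<Sum>m. chi (Suc m) * b (Suc m)\<bar> \<le> real p * b (Suc 0)"
  proof (rule suminf_abel_bound[of "\<lambda>m. chi (Suc m)" "real p" "\<lambda>m. b (Suc m)"])
    show "b (Suc (Suc n)) \<le> b (Suc n)" for n
      unfolding b_def by (rule monsky_decreasing[OF r])
    have "(\<lambda>n. 1 / (real n * (1 - r)) - r ^ n / (1 - r ^ n)) \<longlonglongrightarrow> 0"
    proof -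
      have "(\<lambda>n. r ^ n) \<longlonglongrightarrow> 0" using r by (intro LIMSEQ_realpow_zero) auto
      from tendsto_divide[OF this tendsto_diff[OF tendsto_const this], of 1]
      have "(\<lambda>n. r ^ n / (1 - r ^ n)) \<longlonglongrightarrow> 0 / (1 - 0)" by simp
      moreover have "(\<lambda>n. 1 / (real n * (1 - r))) \<longlonglongrightarrow> 0" using r by real_asymp
      ultimately show ?thesis using tendsto_diff by fastforce
    qed
    then show "(\<lambda>m. b (Suc m)) \<longlonglongrightarrow> 0" unfolding b_def by (rule LIMSEQ_Suc)
  qed (rule abs_sum_chi_Suc_le)
  have b1: "b (Suc 0) = 1" using r by (simp add: b_def field_simps)
  define T where "T = (\<Sum>n. chi_divisor_sum (Suc n) * r ^ Suc n)"
  have "(\<lambda>m. chi (Suc m) * (1 / real (Suc m)) * (1 / (1 - r)) - chi (Suc m) * (r ^ Suc m / (1 - r ^ Suc m)))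
      sums (L1 * (1 / (1 - r)) - T)"
    unfolding T_def L1_def
    using lambert_chi[OF r] summable_L1 by (intro sums_diff sums_mult2) (auto simp: sums_iff)
  moreover have "chi (Suc m) * (1 / real (Suc m)) * (1 / (1 - r)) - chi (Suc m) * (r ^ Suc m / (1 - r ^ Suc m))
      = chi (Suc m) * b (Suc m)" for m
    by (simp add: b_def right_diff_distrib)
  ultimately have "(\<Sum>m. chi (Suc m) * b (Suc m)) = L1 / (1 - r) - T" by (simp add: sums_iff)
  then have "L1 / (1 - r) \<ge> T - real p" using bound b1 by simp
  moreover have "T \<ge> real (p + 1)"
  proof -
    have sT: "summable (\<lambda>n. chi_divisor_sum (Suc n) * r ^ Suc n)" using lambert_chi(1)[OF r] by (simp add: sums_iff)
    define I where "I = (\<lambda>k. (Suc k)\<^sup>2 - 1) ` {..<K}"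
    have inj: "inj_on (\<lambda>k. (Suc k)\<^sup>2 - 1) {..<K}"
    proof (rule inj_onI)
      fix x y assume "(Suc x)\<^sup>2 - 1 = (Suc y)\<^sup>2 - 1"
      moreover have "(Suc x)\<^sup>2 > 0" "(Suc y)\<^sup>2 > 0" by simp_all
      ultimately have "(Suc x)\<^sup>2 = (Suc y)\<^sup>2" by linarith
      then show "x = y" using power2_eq_iff_nonneg[of "Suc x" "Suc y"] by simp
    qed
    have "real (p + 1) = real K * (real (p + 1) / real (p + 2))" by (simp add: K_def)
    also have "\<dots> \<le> (\<Sum>k<K. r ^ (K\<^sup>2))" using mult_left_mono[OF less_imp_le[OF rK], of "real K"] by simp
    also have "\<dots> \<le> (\<Sum>k<K. chi_divisor_sum ((Suc k)\<^sup>2) * r ^ ((Suc k)\<^sup>2))"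
    proof (rule sum_mono)
      fix k assume "k \<in> {..<K}"
      then have "(Suc k)\<^sup>2 \<le> K\<^sup>2" by (intro power_mono) auto
      then have "r ^ (K\<^sup>2) \<le> r ^ ((Suc k)\<^sup>2)" using r by (intro power_decreasing) auto
      moreover have "1 * r ^ ((Suc k)\<^sup>2) \<le> chi_divisor_sum ((Suc k)\<^sup>2) * r ^ ((Suc k)\<^sup>2)"
        using chi_divisor_sum_square[of "Suc k"] r by (intro mult_right_mono) auto
      ultimately show "r ^ (K\<^sup>2) \<le> chi_divisor_sum ((Suc k)\<^sup>2) * r ^ ((Suc k)\<^sup>2)" by simp
    qed
    also have "\<dots> = (\<Sum>n\<in>I. chi_divisor_sum (Suc n) * r ^ Suc n)"
      unfolding I_def by (subst sum.reindex[OF inj]) (simp del: power_Suc)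
    also have "\<dots> \<le> T" unfolding T_def
      by (rule sum_le_suminf[OF sT]) (use r chi_divisor_sum_nonneg in \<open>auto simp: I_def\<close>)
    finally show ?thesis .
  qed
  ultimately have "L1 / (1 - r) > 0" by simp
  then show ?thesis using r by (simp add: zero_less_divide_iff)
qed

end

section \<open>Finite formulas for the L-value\<close>

text \<open>This is \<open>1 - cis x = 2 * sin (x / 2) * cis ((x - pi) / 2)\<close>; the angle lies
  strictly between -pi/2 and pi/2, so the logarithm is the principal one.\<close>

lemma Ln_one_minus_cis:
  assumes "0 < x" "x < 2 * pi"
  shows "Ln (1 - cis x) = of_real (ln (2 * sin (x / 2))) + \<i> * of_real ((x - pi) / 2)"
proof -
  define w where "w = of_real (ln (2 * sin (x / 2))) + \<i> * of_real ((x - pi) / 2)"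
  have s: "sin (x / 2) > 0" using assms by (intro sin_gt_zero) auto
  have "exp w = of_real (2 * sin (x / 2)) * cis ((x - pi) / 2)"
    unfolding w_def exp_add using s by (simp add: exp_of_real cis_conv_exp)
  also have "(x - pi) / 2 = x / 2 - pi / 2" by (simp add: field_simps)
  also have "cis (x / 2 - pi / 2) = Complex (sin (x / 2)) (- cos (x / 2))"
    by (simp add: complex_eq_iff cos_diff sin_diff)
  also have "of_real (2 * sin (x / 2)) * Complex (sin (x / 2)) (- cos (x / 2)) = 1 - cis x"
    using cos_double_sin[of "x / 2"] sin_double[of "x / 2"]
    by (simp add: complex_eq_iff power2_eq_square)
  finally have "Ln (1 - cis x) = Ln (exp w)" by simp
  also have "\<dots> = w" by (rule Ln_exp) (use assms in \<open>auto simp: w_def\<close>)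
  finally show ?thesis by (simp only: w_def)
qed

text \<open>\<open>1 - r ^ Suc m\<close> is \<open>1 - r\<close> times a sum of \<open>Suc m\<close>
  powers, each at least \<open>r ^ Suc m\<close>. In \<open>abel_L1\<close> this makes
  \<open>(1 - r ^ m) / m\<close> decreasing in \<open>m\<close>.\<close>

lemma power_mult_le_one_minus_power:
  fixes r :: real
  assumes "0 \<le> r" "r \<le> 1"
  shows "real (Suc m) * ((1 - r) * r ^ Suc m) \<le> 1 - r ^ Suc m"
proof (induction m)
  case 0
  have "(1 - r) * r \<le> (1 - r) * 1" using assms by (intro mult_left_mono) auto
  then show ?case by simp
next
  case (Suc m)
  have "real (Suc (Suc m)) * ((1 - r) * r ^ Suc (Suc m))
      = r * (real (Suc m) * ((1 - r) * r ^ Suc m)) + (1 - r) * r ^ Suc (Suc m)"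
    by (simp add: algebra_simps)
  also have "\<dots> \<le> r * (1 - r ^ Suc m) + (1 - r) * 1"
    using assms by (intro add_mono mult_left_mono Suc power_le_one) auto
  finally show ?case by (simp add: algebra_simps)
qed

context odd_prime
begin

text \<open>Abel's limit theorem with a rate: the difference from \<open>L1\<close> has the
  coefficients \<open>(1 - r ^ m) / m\<close>, which decrease from \<open>1 - r\<close>, so
  summation by parts bounds it by \<open>p * (1 - r)\<close>.\<close>

lemma abel_L1: "((\<lambda>r. \<Sum>m. chi (Suc m) * (r ^ Suc m / real (Suc m))) \<longlongrightarrow> L1) (at_left 1)"
proof (rule LIM_zero_cancel, rule Lim_null_comparison)
  have ev: "\<forall>\<^sub>F r in at_left (1 :: real). 0 < r \<and> r < 1"
    using eventually_at_left_real[of 0 1] by simp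
  show "\<forall>\<^sub>F r in at_left 1. norm ((\<Sum>m. chi (Suc m) * (r ^ Suc m / real (Suc m))) - L1) \<le> real p * (1 - r)"
    using ev
  proof eventually_elim
    case (elim r)
    then have r: "0 < r" "r < 1" by auto
    define a where "a = (\<lambda>m. (1 - r ^ Suc m) / real (Suc m))"
    have lim: "a \<longlonglongrightarrow> 0"
    proof -
      have "(\<lambda>n. r ^ n) \<longlonglongrightarrow> 0" using r by (intro LIMSEQ_realpow_zero) auto
      then have "(\<lambda>n. 1 - r ^ Suc n) \<longlonglongrightarrow> 1 - 0" by (intro tendsto_diff tendsto_const LIMSEQ_Suc)
      moreover have "(\<lambda>n. 1 / real (Suc n)) \<longlonglongrightarrow> 0" by real_asymp
      ultimately have "(\<lambda>n. (1 - r ^ Suc n) * (1 / real (Suc n))) \<longlonglongrightarrow> (1 - 0) * 0"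
        by (rule tendsto_mult)
      then show ?thesis by (simp add: a_def)
    qed
    have dec: "a (Suc m) \<le> a m" for m
    proof -
      have "real (Suc m) * (1 - r ^ Suc (Suc m)) = real (Suc m) * (1 - r ^ Suc m) + real (Suc m) * ((1 - r) * r ^ Suc m)"
        by (simp add: algebra_simps)
      also have "\<dots> \<le> real (Suc (Suc m)) * (1 - r ^ Suc m)"
        using power_mult_le_one_minus_power[of r m] r by (simp add: algebra_simps)
      finally show ?thesis unfolding a_def
        by (simp add: divide_simps mult.commute del: of_nat_Suc power_Suc)
    qed
    note ab = abs_sum_chi_Suc_le dec lim
    have sa: "summable (\<lambda>m. chi (Suc m) * a m)"
      by (rule summable_abel[where c = "\<lambda>m. chi (Suc m)" and a = a, OF ab])
    have "norm (\<Sum>m. chi (Suc m) * a m) \<le> real p * a 0"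
      using suminf_abel_bound[where c = "\<lambda>m. chi (Suc m)" and a = a, OF ab] by simp
    moreover have "(\<Sum>m. chi (Suc m) * (r ^ Suc m / real (Suc m))) = L1 - (\<Sum>m. chi (Suc m) * a m)"
      unfolding L1_def suminf_diff[OF summable_L1 sa] 
      by (rule suminf_cong) (simp add: a_def diff_divide_distrib right_diff_distrib)
    ultimately show ?case by (simp add: a_def)
  qed
  have "((\<lambda>r. real p * (1 - r)) \<longlongrightarrow> real p * (1 - 1)) (at_left 1)" by (intro tendsto_intros)
  then show "((\<lambda>r. real p * (1 - r)) \<longlongrightarrow> 0) (at_left 1)" by simp
qed

text \<open>Inside the disc the logarithm series may be summed over \<open>a\<close> first; the
  inner sum is a multiple of \<open>gauss_sum (om ^ n)\<close>, that is, of \<open>chi n\<close>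
  times the Gauss sum.\<close>

lemma gauss_sum_L_series:
  assumes r: "0 < r" "r < 1"
  shows "gauss_sum om * of_real (\<Sum>m. chi (Suc m) * (r ^ Suc m / real (Suc m)))
    = - (\<Sum>a<p. of_real (chi a) * Ln (1 - of_real r * om ^ a))"
proof -
  have s1: "(\<lambda>n. of_real (chi a) * (- ((of_real r * om ^ a) ^ n) / of_nat n)) sums
      (of_real (chi a) * Ln (1 - of_real r * om ^ a))" for a
  proof -
    have "norm (- (of_real r * om ^ a)) < 1" using r by (simp add: norm_mult norm_power)
    from Ln_series'[OF this] show ?thesis by (intro sums_mult) simp
  qed
  have s2: "(\<lambda>n. \<Sum>a<p. of_real (chi a) * (- ((of_real r * om ^ a) ^ n) / of_nat n)) sums
      (\<Sum>a<p. of_real (chi a) * Ln (1 - of_real r * om ^ a))"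
    by (intro sums_sum s1)
  have t: "(\<Sum>a<p. of_real (chi a) * (- ((of_real r * om ^ a) ^ n) / of_nat n))
      = - (gauss_sum om * of_real (chi n * (r ^ n / real n)))" for n
  proof -
    have "(\<Sum>a<p. of_real (chi a) * (- ((of_real r * om ^ a) ^ n) / of_nat n))
        = (\<Sum>a<p. - of_real (r ^ n / real n) * (of_real (chi a) * (om ^ n) ^ a))"
      by (rule sum.cong) (auto simp: power_mult_distrib mult.commute simp flip: power_mult)
    also have "\<dots> = - of_real (r ^ n / real n) * gauss_sum (om ^ n)"
      by (simp add: gauss_sum_def sum_distrib_left)
    finally show ?thesis by (simp add: gauss_sum_power)
  qed
  have "(\<lambda>n. - (gauss_sum om * of_real (chi (Suc n) * (r ^ Suc n / real (Suc n))))) sums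
      (\<Sum>a<p. of_real (chi a) * Ln (1 - of_real r * om ^ a))"
    using s2 unfolding t by (subst sums_Suc_iff) simp
  then have s3: "(\<lambda>n. gauss_sum om * of_real (chi (Suc n) * (r ^ Suc n / real (Suc n)))) sums
      (- (\<Sum>a<p. of_real (chi a) * Ln (1 - of_real r * om ^ a)))"
    using sums_minus by fastforce
  \<comment> \<open>Convergence of the real series is read off from the multiplied one by dividing
    by the Gauss sum.\<close>
  have g0: "gauss_sum om \<noteq> 0" 
  proof
    assume "gauss_sum om = 0"
    then have "sqrt (real p) = 0" using norm_gauss_sum by simp
    then show False using p_pos by simp
  qed
  have "summable (\<lambda>n. complex_of_real (chi (Suc n) * (r ^ Suc n / real (Suc n))))"
    by (rule summable_mult_D[OF sums_summable[OF s3] g0])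
  then have "summable (\<lambda>n. chi (Suc n) * (r ^ Suc n / real (Suc n)))"
    by (simp only: summable_of_real_iff)
  then have "(\<lambda>n. gauss_sum om * of_real (chi (Suc n) * (r ^ Suc n / real (Suc n)))) sums
      (gauss_sum om * of_real (\<Sum>m. chi (Suc m) * (r ^ Suc m / real (Suc m))))"
    by (intro sums_mult sums_of_real summable_sums)
  with s3 show ?thesis by (rule sums_unique2[symmetric])
qed

lemma gauss_sum_L1:
  "gauss_sum om * of_real L1 = - (\<Sum>a<p. of_real (chi a) * 
     (of_real (ln (2 * sin (pi * real a / real p))) + \<i> * of_real (pi * real a / real p - pi / 2)))"
proof -
  have Lna: "Ln (1 - om ^ a) = of_real (ln (2 * sin (pi * real a / real p))) + \<i> * of_real (pi * real a / real p - pi / 2)"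
    if "0 < a" "a < p" for a
  proof -
    define x where "x = 2 * pi * real a / real p"
    have "0 < x" "x < 2 * pi" using that by (auto simp: x_def field_simps)
    from Ln_one_minus_cis[OF this] show ?thesis
      unfolding om_power x_def by (simp add: diff_divide_distrib)
  qed
  have "((\<lambda>r. - (\<Sum>a<p. of_real (chi a) * Ln (1 - of_real r * om ^ a))) \<longlongrightarrow>
      - (\<Sum>a<p. of_real (chi a) * Ln (1 - of_real 1 * om ^ a))) (at_left 1)"
  proof (intro tendsto_minus tendsto_sum)
    fix a assume a: "a \<in> {..<p}"
    show "((\<lambda>r. of_real (chi a) * Ln (1 - of_real r * om ^ a)) \<longlongrightarrow> of_real (chi a) * Ln (1 - of_real 1 * om ^ a)) (at_left 1)"
    \<comment> \<open>At \<open>a = 0\<close> the logarithm is singular as \<open>r\<close> tends to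
      1, but \<open>chi 0 = 0\<close> removes the term.\<close>
    proof (cases "a = 0")
      case False
      have "om ^ a \<noteq> 1" using False a nat_dvd_not_less by (auto simp: om_power_eq_1_iff)
      have nn: "1 - of_real 1 * om ^ a \<notin> \<real>\<^sub>\<le>\<^sub>0"
      proof
        assume "1 - of_real 1 * om ^ a \<in> \<real>\<^sub>\<le>\<^sub>0"
        then have *: "Re (om ^ a) \<ge> 1" "Im (om ^ a) = 0" by (auto simp: complex_nonpos_Reals_iff)
        moreover have "Re (om ^ a) \<le> 1" using complex_Re_le_cmod[of "om ^ a"] by (simp add: norm_power)
        ultimately have "om ^ a = 1" by (simp add: complex_eq_iff)
        then show False using \<open>om ^ a \<noteq> 1\<close> by simp
      qed
      show ?thesis by (intro tendsto_mult tendsto_const tendsto_Ln tendsto_diff tendsto_of_real tendsto_ident_at nn)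
    qed simp
  qed
  moreover have "\<forall>\<^sub>F r in at_left 1. - (\<Sum>a<p. of_real (chi a) * Ln (1 - of_real r * om ^ a))
      = gauss_sum om * of_real (\<Sum>m. chi (Suc m) * (r ^ Suc m / real (Suc m)))"
    using eventually_at_left_real[OF zero_less_one]
  proof (rule eventually_mono)
    fix r :: real assume "r \<in> {0<..<1}"
    then show "- (\<Sum>a<p. of_real (chi a) * Ln (1 - of_real r * om ^ a))
        = gauss_sum om * of_real (\<Sum>m. chi (Suc m) * (r ^ Suc m / real (Suc m)))"
      using gauss_sum_L_series[of r] by (simp del: power_Suc of_nat_Suc)
  qed
  ultimately have "((\<lambda>r. gauss_sum om * of_real (\<Sum>m. chi (Suc m) * (r ^ Suc m / real (Suc m)))) \<longlongrightarrow>
      - (\<Sum>a<p. of_real (chi a) * Ln (1 - of_real 1 * om ^ a))) (at_left 1)"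
    by (rule Lim_transform_eventually)
  moreover have "((\<lambda>r. gauss_sum om * of_real (\<Sum>m. chi (Suc m) * (r ^ Suc m / real (Suc m)))) \<longlongrightarrow>
      gauss_sum om * of_real L1) (at_left 1)"
    by (intro tendsto_mult tendsto_const tendsto_of_real abel_L1)
  ultimately have "gauss_sum om * of_real L1 = - (\<Sum>a<p. of_real (chi a) * Ln (1 - of_real 1 * om ^ a))"
    by (intro tendsto_unique[OF trivial_limit_at_left_real])
  also have "\<dots> = - (\<Sum>a<p. of_real (chi a) * 
     (of_real (ln (2 * sin (pi * real a / real p))) + \<i> * of_real (pi * real a / real p - pi / 2)))"
  proof (intro arg_cong[where f = uminus] sum.cong refl)
    fix a assume "a \<in> {..<p}"
    then show "of_real (chi a) * Ln (1 - of_real 1 * om ^ a) = of_real (chi a) * 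
     (of_real (ln (2 * sin (pi * real a / real p))) + \<i> * of_real (pi * real a / real p - pi / 2))"
      by (cases "a = 0") (auto simp: Lna)
  qed
  finally show ?thesis .
qed

text \<open>For \<open>p mod 4 = 1\<close> the Gauss sum is the positive root of \<open>p\<close>,
  so real parts keep the sign of \<open>L1\<close>; the constant \<open>ln 2\<close> drops out by
  \<open>sum_chi\<close>.\<close>

lemma L1_even:
  assumes "p mod 4 = 1"
  shows "sqrt (real p) * L1 = - (\<Sum>a<p. chi a * ln (sin (pi * real a / real p)))"
proof -
  have "sqrt (real p) * L1 = Re (gauss_sum om * of_real L1)"
    unfolding gauss_sum_value using assms by simp
  also have "\<dots> = - (\<Sum>a<p. chi a * ln (2 * sin (pi * real a / real p)))"
    unfolding gauss_sum_L1 by (simp add: Re_sum)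
  also have "(\<Sum>a<p. chi a * ln (2 * sin (pi * real a / real p)))
      = (\<Sum>a<p. chi a * ln 2 + chi a * ln (sin (pi * real a / real p)))"
  proof (rule sum.cong)
    fix a assume a: "a \<in> {..<p}"
    show "chi a * ln (2 * sin (pi * real a / real p)) = chi a * ln 2 + chi a * ln (sin (pi * real a / real p))"
    proof (cases "a = 0")
      case False
      have "sin (pi * real a / real p) > 0" using False a by (intro sin_gt_zero) (auto simp: field_simps)
      then show ?thesis by (simp add: ln_mult distrib_left)
    qed simp
  qed simp
  also have "\<dots> = (\<Sum>a<p. chi a * ln (sin (pi * real a / real p)))"
    by (simp add: sum.distrib sum_chi flip: sum_distrib_right)
  finally show ?thesis .
qed

text \<open>Here the Gauss sum is \<open>\<i>\<close> times the positive root, and the imaginary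
  parts of the logarithms, the sawtooth \<open>pi * a / p - pi / 2\<close>, survive. Positivity of
  \<open>L1\<close> thereby makes the sum of \<open>a * chi a\<close> negative.\<close>

lemma L1_odd:
  assumes "p mod 4 \<noteq> 1"
  shows "sqrt (real p) * L1 = - (pi / real p) * (\<Sum>a<p. real a * chi a)"
proof -
  have "sqrt (real p) * L1 = Im (gauss_sum om * of_real L1)"
    unfolding gauss_sum_value using assms by simp
  also have "\<dots> = - (\<Sum>a<p. chi a * (pi * real a / real p - pi / 2))"
    unfolding gauss_sum_L1 by (simp add: Im_sum)
  also have "(\<Sum>a<p. chi a * (pi * real a / real p - pi / 2))
      = (\<Sum>a<p. pi / real p * (real a * chi a) - chi a * (pi / 2))"
    by (rule sum.cong) (auto simp: algebra_simps)
  also have "\<dots> = pi / real p * (\<Sum>a<p. real a * chi a) - (\<Sum>a<p. chi a) * (pi / 2)"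
    by (simp only: sum_subtractf sum_distrib_left sum_distrib_right)
  finally show ?thesis by (simp add: sum_chi)
qed

end

section \<open>Comparison of the two dominant singularities\<close>

definition artanh_exp :: "real \<Rightarrow> real" where
  "artanh_exp x = (ln (1 + exp (- x)) - ln (1 - exp (- x))) / 2"

text \<open>In hyperbolic form this and \<open>artanh_exp''\<close> are
  \<open>- 1 / (2 * sinh x)\<close> and \<open>cosh x / (2 * (sinh x)\<^sup>2)\<close>.\<close>

definition artanh_exp' :: "real \<Rightarrow> real" where
  "artanh_exp' x = - exp (- x) / (1 - exp (- 2 * x))"

definition artanh_exp'' :: "real \<Rightarrow> real" where
  "artanh_exp'' x = exp (- x) * (1 + exp (- 2 * x)) / (1 - exp (- 2 * x))\<^sup>2"

lemma has_field_derivative_artanh_exp: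
  assumes "x > 0" shows "(artanh_exp has_field_derivative artanh_exp' x) (at x)"
proof -
  define u where "u = exp (- x)"
  have u: "0 < u" "u < 1" using assms by (auto simp: u_def)
  have u2: "exp (- 2 * x) = u\<^sup>2" by (simp add: u_def power2_eq_square flip: exp_add)
  have u3: "1 - u\<^sup>2 > 0" using u by (simp add: power_less_one_iff abs_square_less_1)
  have "((\<lambda>x. 1 + exp (- x)) has_field_derivative - u) (at x)" "((\<lambda>x. 1 - exp (- x)) has_field_derivative u) (at x)"
    by (auto intro!: derivative_eq_intros simp: u_def)
  note D = this
  have "1 + exp (- x) > 0" "1 - exp (- x) > 0" using u by (auto simp: u_def add_pos_pos)
  note D' = DERIV_chain2[OF DERIV_ln_divide[OF this(1)] D(1)] DERIV_chain2[OF DERIV_ln_divide[OF this(2)] D(2)]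
  from DERIV_cdivide[OF DERIV_diff[OF D'], of 2, folded u_def]
  have "((\<lambda>x. (ln (1 + exp (- x)) - ln (1 - exp (- x))) / 2) has_field_derivative
      (- u / (1 + u) - u / (1 - u)) / 2) (at x)" by (simp add: u_def)
  moreover have "(- u / (1 + u) - u / (1 - u)) / 2 = artanh_exp' x"
  proof -
    have "1 - u\<^sup>2 = (1 + u) * (1 - u)" by (simp add: power2_eq_square algebra_simps)
    then show ?thesis unfolding artanh_exp'_def u2 u_def[symmetric] using u
      by (simp add: divide_simps) (simp add: algebra_simps)
  qed
  ultimately show ?thesis unfolding artanh_exp_def[abs_def] by simp
qed

lemma has_field_derivative_artanh_exp':
  assumes "x > 0" shows "(artanh_exp' has_field_derivative artanh_exp'' x) (at x)"
proof -
  define v q where "v = exp (- x)" and "q = exp (- 2 * x)"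
  have ne: "1 - exp (- 2 * x) \<noteq> 0" using assms by simp
  have 1: "((\<lambda>x. - exp (- x)) has_field_derivative v) (at x)"
    by (auto intro!: derivative_eq_intros simp: v_def)
  have 2: "((\<lambda>x. 1 - exp (- 2 * x)) has_field_derivative 2 * q) (at x)"
    by (auto intro!: derivative_eq_intros simp: q_def)
  have "v * (1 - q) - (- v) * (2 * q) = v * (1 + q)" by (simp add: algebra_simps)
  then show ?thesis
    unfolding artanh_exp'_def[abs_def] artanh_exp''_def
    by (intro DERIV_cong[OF DERIV_divide[OF 1 2 ne]])
       (simp only: v_def[symmetric] q_def[symmetric] power2_eq_square)
qed

text \<open>With \<open>s = sinh x\<close>, the estimate \<open>2 * cosh x \<le> 2 * s + 2\<close>
  leaves multiples of \<open>1 / s\<close> and \<open>1 / s\<^sup>2\<close>, which are controlled by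
  \<open>s \<ge> x\<^sup>2 / 4\<close> and \<open>s \<ge> x\<close>. Only the order
  \<open>1 / x\<^sup>2\<close> matters later; 3 is a round constant.\<close>

lemma artanh_exp''_bounds:
  assumes "x > 0" shows "0 \<le> artanh_exp'' x" "artanh_exp'' x \<le> 3 / x\<^sup>2"
proof -
  define u where "u = exp (- x)"
  have u: "0 < u" "u < 1" using assms by (auto simp: u_def)
  have u2: "exp (- 2 * x) = u\<^sup>2" by (simp add: u_def power2_eq_square flip: exp_add)
  define s where "s = (exp x - exp (- x)) / 2"
  have ex: "exp x = 1 / u" by (simp add: u_def exp_minus divide_inverse)
  have s1: "s \<ge> x"
  proof -
    have e1: "exp x \<ge> 1 + x + x\<^sup>2 / 2" using assms exp_lower_Taylor_quadratic[of x] by simp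
    have d: "1 + x + x\<^sup>2 / 2 > 0" using assms by (intro add_pos_nonneg) auto
    \<comment> \<open>This product turns the lower bound for \<open>exp x\<close> into the upper
      bound \<open>1 - x + x\<^sup>2 / 2\<close> for \<open>exp (- x)\<close>; the two bounds differ
      by \<open>2 * x\<close>.\<close>
    have "(1 - x + x\<^sup>2 / 2) * (1 + x + x\<^sup>2 / 2) = 1 + (x\<^sup>2)\<^sup>2 / 4"
      by (simp add: power2_eq_square algebra_simps)
    then have "1 \<le> (1 - x + x\<^sup>2 / 2) * (1 + x + x\<^sup>2 / 2)" by simp
    then have "1 / (1 + x + x\<^sup>2 / 2) \<le> 1 - x + x\<^sup>2 / 2" using d by (simp only: pos_divide_le_eq)
    moreover have "exp (- x) \<le> 1 / (1 + x + x\<^sup>2 / 2)"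
      unfolding exp_minus inverse_eq_divide using e1 d by (intro divide_left_mono mult_pos_pos) auto
    ultimately show ?thesis using e1 by (simp add: s_def)
  qed
  have s2: "s \<ge> x\<^sup>2 / 4"
  proof -
    have "exp x \<ge> 1 + x + x\<^sup>2 / 2" using assms exp_lower_Taylor_quadratic[of x] by simp
    moreover have "exp (- x) \<le> 1" using assms by simp
    ultimately have "exp x - exp (- x) \<ge> x + x\<^sup>2 / 2" by linarith
    then have "s \<ge> (x + x\<^sup>2 / 2) / 2" unfolding s_def by (intro divide_right_mono) auto
    then show ?thesis using assms by simp
  qed
  have s: "s > 0" using s1 assms by simp
  have su: "1 - u\<^sup>2 = 2 * u * s" using u by (simp add: s_def ex u_def[symmetric] field_simps power2_eq_square)
  have e: "artanh_exp'' x = (1 + u\<^sup>2) / u / (4 * s\<^sup>2)"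
    unfolding artanh_exp''_def u2 su u_def[symmetric] using u s by (simp add: field_simps power2_eq_square)
  show "0 \<le> artanh_exp'' x" unfolding e using u s by simp
  have "(1 + u\<^sup>2) / u = 2 * s + 2 * u" using u by (simp add: s_def ex u_def[symmetric] field_simps power2_eq_square)
  also have "\<dots> \<le> 2 * s + 2" using u by simp
  finally have "artanh_exp'' x \<le> (2 * s + 2) / (4 * s\<^sup>2)"
    unfolding e using s by (intro divide_right_mono) auto
  also have "\<dots> = (1 / s) / 2 + (1 / s\<^sup>2) / 2" using s by (simp add: field_simps power2_eq_square)
  also have "\<dots> \<le> (1 / (x\<^sup>2 / 4)) / 2 + (1 / x\<^sup>2) / 2"
    using s1 s2 assms by (intro add_mono divide_right_mono frac_le power_mono) auto
  also have "\<dots> \<le> 3 / x\<^sup>2" using assms by (simp add: field_simps)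
  finally show "artanh_exp'' x \<le> 3 / x\<^sup>2" .
qed

lemma artanh_exp_taylor:
  assumes y: "y > 0" and h: "h \<ge> 0"
  shows "\<bar>artanh_exp (y + h) - artanh_exp y - h * artanh_exp' y\<bar> \<le> 3 * h\<^sup>2 / y\<^sup>2"
proof (cases "h = 0")
  case False
  then have h: "h > 0" using h by simp
  obtain z where z: "y < z" "z < y + h" "artanh_exp (y + h) - artanh_exp y = (y + h - y) * artanh_exp' z"
    using MVT2[of y "y + h" artanh_exp artanh_exp'] h y has_field_derivative_artanh_exp by force
  obtain v where v: "y < v" "v < z" "artanh_exp' z - artanh_exp' y = (z - y) * artanh_exp'' v"
    using MVT2[of y z artanh_exp' artanh_exp''] z y has_field_derivative_artanh_exp' by force
  have "artanh_exp (y + h) - artanh_exp y - h * artanh_exp' y = h * ((z - y) * artanh_exp'' v)"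
    unfolding v(3)[symmetric] using z(3) by (simp add: algebra_simps)
  moreover have "\<bar>h * ((z - y) * artanh_exp'' v)\<bar> \<le> h * (h * (3 / y\<^sup>2))"
  proof -
    have "artanh_exp'' v \<le> 3 / v\<^sup>2" using artanh_exp''_bounds[of v] v y by simp
    also have "\<dots> \<le> 3 / y\<^sup>2" using v y by (intro divide_left_mono power_mono mult_pos_pos) auto
    finally have "(z - y) * artanh_exp'' v \<le> h * (3 / y\<^sup>2)"
      using z v y artanh_exp''_bounds[of v] by (intro mult_mono) auto
    moreover have "(z - y) * artanh_exp'' v \<ge> 0" using artanh_exp''_bounds[of v] v y by simp
    ultimately show ?thesis using h by (simp only: abs_of_nonneg mult_nonneg_nonneg mult_left_mono less_imp_le)
  qed
  ultimately show ?thesis by (simp add: power2_eq_square mult_ac)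
qed simp

lemma artanh_exp_le:
  assumes "x > 0" shows "0 \<le> artanh_exp x" "artanh_exp x \<le> exp (- x) / (1 - exp (- x))"
proof -
  define u where "u = exp (- x)"
  have u: "0 < u" "u < 1" using assms by (auto simp: u_def)
  have 1: "ln (1 + u) \<le> u" using u ln_add_one_self_le_self[of u] by simp
  have "ln (1 / (1 - u)) \<le> 1 / (1 - u) - 1" using u by (intro ln_le_minus_one) auto
  also have "1 / (1 - u) - 1 = u / (1 - u)" using u by (simp add: field_simps)
  finally have 2: "- ln (1 - u) \<le> u / (1 - u)" using u by (simp add: ln_div)
  have 3: "u \<le> u / (1 - u)" using u by (simp add: field_simps)
  show "artanh_exp x \<le> exp (- x) / (1 - exp (- x))"
  proof -
    define q where "q = u / (1 - u)"
    have "ln (1 + u) - ln (1 - u) \<le> 2 * q" using 1 2 3 unfolding q_def[symmetric] by linarith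
    then have "(ln (1 + u) - ln (1 - u)) / 2 \<le> q" by simp
    then have "(ln (1 + u) - ln (1 - u)) / 2 \<le> u / (1 - u)" by (simp only: q_def)
    then show ?thesis unfolding artanh_exp_def u_def[symmetric] .
  qed
  have "ln (1 + u) \<ge> 0" "ln (1 - u) \<le> 0" using u by auto
  then show "0 \<le> artanh_exp x" unfolding artanh_exp_def u_def[symmetric] by simp
qed

lemma artanh_exp'_neg: "x > 0 \<Longrightarrow> artanh_exp' x < 0"
  by (simp add: artanh_exp'_def)

lemma tendsto_artanh_exp_plus_ln: "((\<lambda>x. artanh_exp x + ln x / 2) \<longlongrightarrow> ln 2 / 2) (at_right 0)"
  unfolding artanh_exp_def by real_asymp

lemma tendsto_mult_artanh_exp':
  assumes "c > 0" shows "((\<lambda>t. t * artanh_exp' (c * t)) \<longlongrightarrow> - 1 / (2 * c)) (at_right 0)"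
proof -
  have "((\<lambda>t. t * artanh_exp' (c * t)) \<longlongrightarrow> - (inverse c / 2)) (at_right 0)"
    unfolding artanh_exp'_def using assms by real_asymp
  then show ?thesis using assms by (simp add: field_simps)
qed

section \<open>Sums of \<open>artanh_exp (m * t)\<close> with periodic weights of mean zero, as
  \<open>t\<close> tends to 0\<close>

locale odd_period_weights =
  fixes w :: "nat \<Rightarrow> real" and P :: nat
  assumes P_pos: "P > 0" and w_0: "w 0 = 0" and w_periodic: "w (n + P) = w n"
    and w_le: "\<bar>w n\<bar> \<le> 1" and w_sum: "(\<Sum>r<P. w r) = 0"
begin

definition moment :: real where "moment = (\<Sum>r<P. real r * w r)"

definition Q :: "real \<Rightarrow> real" where "Q t = (\<Sum>m. w m * artanh_exp (real m * t))"

definition block :: "nat \<Rightarrow> real \<Rightarrow> real" where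
  "block j t = (\<Sum>r<P. w r * artanh_exp (real (P * j + r) * t))"

text \<open>The linear Taylor term at the start of a block is removed, except in block 0, which
  starts at the singularity of \<open>artanh_exp\<close> and stays whole.\<close>

definition err :: "nat \<Rightarrow> real \<Rightarrow> real" where
  "err j t = (if j = 0 then block 0 t else block j t - t * artanh_exp' (real (P * j) * t) * moment)"

lemma w_mult_period: "w (n + P * j) = w n"
proof (induction j)
  case (Suc j)
  then show ?case using w_periodic[of "n + P * j"] by (simp add: add_ac)
qed simp

lemma summable_Q:
  assumes t: "t > 0" shows "summable (\<lambda>m. w m * artanh_exp (real m * t))"
proof (rule summable_comparison_test')
  have "summable (\<lambda>m. (exp (- t)) ^ m)" using t by (intro summable_geometric) auto
  then show "summable (\<lambda>m. 1 / (1 - exp (- t)) * (exp (- t)) ^ m)" by (rule summable_mult)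
  fix m :: nat
  show "norm (w m * artanh_exp (real m * t)) \<le> 1 / (1 - exp (- t)) * (exp (- t)) ^ m"
  proof (cases "m = 0")
    case False
    then have mt: "real m * t \<ge> t" "real m * t > 0" using t by (simp_all add: mult_le_cancel_right1)
    have "norm (w m * artanh_exp (real m * t)) \<le> 1 * artanh_exp (real m * t)"
      using artanh_exp_le(1)[OF mt(2)] w_le[of m] by (simp add: abs_mult mult_right_mono mult_left_le_one_le)
    also have "\<dots> \<le> exp (- (real m * t)) / (1 - exp (- (real m * t)))"
      using artanh_exp_le(2)[OF mt(2)] by simp
    also have "\<dots> \<le> exp (- (real m * t)) / (1 - exp (- t))"
      using t mt by (intro divide_left_mono mult_pos_pos) auto
    also have "exp (- (real m * t)) = (exp (- t)) ^ m" by (simp flip: exp_of_nat_mult)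
    finally show ?thesis by simp
  qed (use t w_0 in simp)
qed

lemma block_sums: "t > 0 \<Longrightarrow> (\<lambda>j. block j t) sums Q t"
proof -
  assume t: "t > 0"
  have "(\<lambda>m. w m * artanh_exp (real m * t)) sums Q t"
    unfolding Q_def using summable_Q[OF t] by (rule summable_sums)
  then have "(\<lambda>j. \<Sum>m = j * P..<j * P + P. w m * artanh_exp (real m * t)) sums Q t"
    using P_pos by (rule sums_group)
  moreover have "(\<Sum>m = j * P..<j * P + P. w m * artanh_exp (real m * t)) = block j t" for j
  proof -
    have "(\<Sum>m = 0 + j * P..<P + j * P. w m * artanh_exp (real m * t))
        = (\<Sum>r=0..<P. w (r + j * P) * artanh_exp (real (r + j * P) * t))"
      by (rule sum.shift_bounds_nat_ivl)
    also have "\<dots> = block j t"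
      unfolding block_def lessThan_atLeast0
    proof (rule sum.cong)
      fix r
      have "r + j * P = P * j + r" by simp
      moreover have "w (r + j * P) = w r" using w_mult_period[of r j] by (simp only: mult.commute)
      ultimately show "w (r + j * P) * artanh_exp (real (r + j * P) * t) = w r * artanh_exp (real (P * j + r) * t)"
        by (simp only:)
    qed simp
    finally show ?thesis by (simp add: add.commute)
  qed
  ultimately show ?thesis by simp
qed

text \<open>Mean zero removes the constant Taylor term, and \<open>moment\<close> is the coefficient
  of the linear one. The quadratic remainder depends only on \<open>(r * t) / (P * j * t)\<close>,
  so the bound is free of \<open>t\<close>, as Tannery's theorem requires.\<close>

lemma block_error:
  assumes t: "t > 0" and j: "j > 0"
  shows "\<bar>err j t\<bar> \<le> 3 * real P / real j ^ 2"
proof -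
  define y where "y = real (P * j) * t"
  have y: "y > 0" using t j P_pos by (simp add: y_def)
  have "err j t = (\<Sum>r<P. w r * artanh_exp (y + real r * t)) - (\<Sum>r<P. w r) * artanh_exp y - t * artanh_exp' y * moment"
    using j by (simp add: err_def block_def w_sum y_def algebra_simps)
  also have "\<dots> = (\<Sum>r<P. w r * (artanh_exp (y + real r * t) - artanh_exp y - (real r * t) * artanh_exp' y))"
    unfolding moment_def sum_distrib_left sum_distrib_right sum_subtractf[symmetric]
    by (rule sum.cong) (auto simp: algebra_simps)
  also have "\<bar>\<dots>\<bar> \<le> (\<Sum>r<P. 3 / real j ^ 2)"
  proof (rule order_trans[OF sum_abs sum_mono])
    fix r assume r: "r \<in> {..<P}"
    have "\<bar>w r * (artanh_exp (y + real r * t) - artanh_exp y - (real r * t) * artanh_exp' y)\<bar>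
        \<le> 1 * (3 * (real r * t)\<^sup>2 / y\<^sup>2)"
      unfolding abs_mult using t by (intro mult_mono w_le artanh_exp_taylor y) auto
    also have "\<dots> \<le> 3 * (real P * t)\<^sup>2 / y\<^sup>2"
      using r t by (simp add: divide_right_mono mult_right_mono power_mono)
    also have "\<dots> = 3 / real j ^ 2"
      using t P_pos j by (simp add: y_def power_mult_distrib)
    finally show "\<bar>w r * (artanh_exp (y + real r * t) - artanh_exp y - (real r * t) * artanh_exp' y)\<bar> \<le> 3 / real j ^ 2" .
  qed
  also have "\<dots> = 3 * real P / real j ^ 2" by simp
  finally show ?thesis .
qed

definition block_lim :: "nat \<Rightarrow> real" where
  "block_lim j = - (\<Sum>r<P. w r * ln (real (P * j + r))) / 2"

definition err_lim :: "nat \<Rightarrow> real" where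
  "err_lim j = (if j = 0 then block_lim 0 else block_lim j + moment / (2 * real (P * j)))"

text \<open>Near 0, \<open>artanh_exp x\<close> is \<open>- ln x / 2 + ln 2 / 2\<close> up to a term
  that tends to 0; both \<open>ln t\<close> and \<open>ln 2\<close> are multiplied by the vanishing
  sum of the weights.\<close>

lemma tendsto_block: "((\<lambda>t. block j t) \<longlongrightarrow> block_lim j) (at_right 0)"
proof -
  have 1: "((\<lambda>t. \<Sum>r<P. w r * (artanh_exp (real (P * j + r) * t) + ln (real (P * j + r) * t) / 2)) \<longlongrightarrow>
      (\<Sum>r<P. w r * (ln 2 / 2))) (at_right 0)"
  proof (intro tendsto_sum)
    fix r
    show "((\<lambda>t. w r * (artanh_exp (real (P * j + r) * t) + ln (real (P * j + r) * t) / 2)) \<longlongrightarrow> w r * (ln 2 / 2)) (at_right 0)"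
    proof (cases "P * j + r = 0")
      case True
      then have "r = 0" by simp
      then show ?thesis using w_0 by simp
    next
      case False
      define c where "c = real (P * j + r)"
      have c: "c > 0" using False by (simp only: c_def of_nat_0_less_iff neq0_conv)
      have "filterlim (\<lambda>t. c * t) (at_right 0) (at_right 0)" using c by real_asymp
      from filterlim_compose[OF tendsto_artanh_exp_plus_ln this] show ?thesis
        unfolding c_def by (intro tendsto_mult tendsto_const)
    qed
  qed
  have ev: "\<forall>\<^sub>F t in at_right 0. (\<Sum>r<P. w r * (artanh_exp (real (P * j + r) * t) + ln (real (P * j + r) * t) / 2)) + block_lim j = block j t"
    using eventually_at_right_less[of "0::real"]
  proof eventually_elim
    case (elim t)
    have "(\<Sum>r<P. w r * (artanh_exp (real (P * j + r) * t) + ln (real (P * j + r) * t) / 2))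
        = (\<Sum>r<P. w r * artanh_exp (real (P * j + r) * t) + w r * ln (real (P * j + r)) / 2 + w r * (ln t / 2))"
    proof (rule sum.cong)
      fix r
      show "w r * (artanh_exp (real (P * j + r) * t) + ln (real (P * j + r) * t) / 2)
          = w r * artanh_exp (real (P * j + r) * t) + w r * ln (real (P * j + r)) / 2 + w r * (ln t / 2)"
      proof (cases "P * j + r = 0")
        case True
        then have "r = 0" by simp
        then show ?thesis using w_0 by simp
      next
        case False
        then have "real (P * j + r) > 0" by (simp only: of_nat_0_less_iff neq0_conv)
        then show ?thesis using elim by (simp add: ln_mult distrib_left add_divide_distrib del: of_nat_add of_nat_mult)
      qed
    qed simp
    also have "\<dots> = block j t - block_lim j + (\<Sum>r<P. w r) * (ln t / 2)"
      by (simp add: block_def block_lim_def sum.distrib sum_distrib_right sum_divide_distrib)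
    finally show ?case by (simp add: w_sum)
  qed
  have "((\<lambda>t. (\<Sum>r<P. w r * (artanh_exp (real (P * j + r) * t) + ln (real (P * j + r) * t) / 2)) + block_lim j) \<longlongrightarrow>
      (\<Sum>r<P. w r * (ln 2 / 2)) + block_lim j) (at_right 0)"
    by (intro tendsto_add 1 tendsto_const)
  moreover have "(\<Sum>r<P. w r * (ln 2 / 2)) = (\<Sum>r<P. w r) * (ln 2 / 2)" by (rule sum_distrib_right[symmetric])
  ultimately show ?thesis using Lim_transform_eventually[OF _ ev] by (simp add: w_sum)
qed

lemma tendsto_err: "((\<lambda>t. err j t) \<longlongrightarrow> err_lim j) (at_right 0)"
proof (cases "j = 0")
  case True
  then show ?thesis using tendsto_block[of 0] by (simp add: err_def err_lim_def)
next
  case False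
  then have "real (P * j) > 0" using P_pos by simp
  from tendsto_mult_artanh_exp'[OF this]
  have "((\<lambda>t. block j t - t * artanh_exp' (real (P * j) * t) * moment) \<longlongrightarrow> block_lim j - (- 1 / (2 * real (P * j))) * moment) (at_right 0)"
    by (intro tendsto_diff tendsto_block tendsto_mult tendsto_const)
  then show ?thesis using False by (simp add: err_def err_lim_def)
qed

lemma err_tannery:
  "\<forall>\<^sub>F t in at_right 0. summable (\<lambda>j. norm (err j t))" "summable (\<lambda>j. norm (err_lim j))"
  "((\<lambda>t. \<Sum>j. err j t) \<longlongrightarrow> (\<Sum>j. err_lim j)) (at_right 0)"
proof -
  have b: "\<forall>\<^sub>F (j, t) in at_top \<times>\<^sub>F at_right 0. norm (err j t) \<le> 3 * real P / real j ^ 2"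
    using eventually_prodI[OF eventually_gt_at_top[of "0::nat"] eventually_at_right_less[of "0::real"]]
    by eventually_elim (auto intro: block_error)
  have s: "summable (\<lambda>j. 3 * real P / real j ^ 2)"
    using summable_mult[OF inverse_power_summable[of 2, where 'a=real], of "3 * real P"]
    by (simp add: divide_inverse)
  note T = tannerys_theorem[where a = err and b = err_lim, OF tendsto_err b s trivial_limit_at_right_real]
  show "\<forall>\<^sub>F t in at_right 0. summable (\<lambda>j. norm (err j t))" "summable (\<lambda>j. norm (err_lim j))"
    "((\<lambda>t. \<Sum>j. err j t) \<longlongrightarrow> (\<Sum>j. err_lim j)) (at_right 0)"
    using T by blast+
qed

text \<open>With zero moment the limits of the blocks form a blockwise sum of
  \<open>- w m * ln m / 2\<close>. Sorted by residues, its partial sums contain Euler's limit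
  formula for \<open>ln_Gamma (r / P)\<close>; the other terms, with \<open>ln (fact n)\<close>,
  \<open>ln P\<close> and \<open>ln n\<close>, carry the factor \<open>\<Sum>r<P. w r\<close> or
  \<open>moment\<close>, both 0.\<close>

lemma tendsto_Q:
  assumes "moment = 0"
  shows "(Q \<longlongrightarrow> (\<Sum>r<P. w r * ln_Gamma (real r / real P)) / 2) (at_right 0)"
proof -
  have "\<forall>\<^sub>F t in at_right 0. (\<Sum>j. err j t) = Q t"
    using eventually_at_right_less[of "0::real"]
  proof eventually_elim
    case (elim t)
    have "err j t = block j t" for j using assms by (simp add: err_def)
    then show ?case using block_sums[OF elim] by (simp add: sums_iff)
  qed
  then have "(Q \<longlongrightarrow> (\<Sum>j. err_lim j)) (at_right 0)"
    by (rule Lim_transform_eventually[OF err_tannery(3)])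
  moreover have "(\<Sum>j. err_lim j) = (\<Sum>r<P. w r * ln_Gamma (real r / real P)) / 2"
  proof -
    have "summable err_lim" using err_tannery(2) by (rule summable_norm_cancel)
    then have 1: "(\<lambda>n. \<Sum>j\<le>n. err_lim j) \<longlonglongrightarrow> (\<Sum>j. err_lim j)"
      using summable_sums sums_def_le by blast
    have 2: "(\<lambda>n. (\<Sum>r<P. w r * ln_Gamma_series (real r / real P) n) / 2) \<longlonglongrightarrow> (\<Sum>r<P. w r * ln_Gamma (real r / real P)) / 2"
    proof (intro tendsto_divide tendsto_const tendsto_sum)
      fix r
      show "(\<lambda>n. w r * ln_Gamma_series (real r / real P) n) \<longlonglongrightarrow> w r * ln_Gamma (real r / real P)"
      proof (cases "r = 0")
        case False
        then show ?thesis using P_pos by (intro tendsto_mult tendsto_const ln_Gamma_real_LIMSEQ) simp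
      qed (use w_0 in simp)
    qed simp
    have "\<forall>\<^sub>F n in sequentially. (\<Sum>r<P. w r * ln_Gamma_series (real r / real P) n) / 2 = (\<Sum>j\<le>n. err_lim j)"
      using eventually_gt_at_top[of "0::nat"]
    proof eventually_elim
      case (elim n)
      have one: "w r * (\<Sum>j\<le>n. ln (real (P * j + r))) = 
          w r * (real (Suc n) * ln (real P) + ln (fact n)) + real r * w r * (ln (real n) / real P)
            - w r * ln_Gamma_series (real r / real P) n" for r
      proof (cases "r = 0")
        case False
        define z where "z = real r / real P"
        have z: "z > 0" using False P_pos by (simp add: z_def)
        have "(\<Sum>j\<le>n. ln (real (P * j + r))) = (\<Sum>j\<le>n. ln (real P) + ln (real j + z))"
        proof (rule sum.cong)
          fix j
          have "real (P * j + r) = real P * (real j + z)" using P_pos by (simp add: z_def field_simps)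
          moreover have "real j + z > 0" using z by (simp add: add_nonneg_pos)
          ultimately show "ln (real (P * j + r)) = ln (real P) + ln (real j + z)"
            using P_pos ln_mult_pos[of "real P" "real j + z"] by simp
        qed simp
        also have "\<dots> = real (Suc n) * ln (real P) + (\<Sum>j\<le>n. ln (real j + z))" by (simp add: sum.distrib)
        also have "(\<Sum>j\<le>n. ln (real j + z)) = ln z + (\<Sum>j=1..n. ln (real j + z))"
          by (simp add: atMost_atLeast0 sum.atLeast_Suc_atMost)
        also have "(\<Sum>j=1..n. ln (real j + z)) = (\<Sum>j=1..n. ln (real j) + ln (z / real j + 1))"
        proof (rule sum.cong)
          fix j assume "j \<in> {1..n}"
          then have j: "real j > 0" by simp
          then have "real j + z = real j * (z / real j + 1)" by (simp add: field_simps)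
          moreover have "z / real j + 1 > 0" using z j by (simp add: add_nonneg_pos)
          ultimately show "ln (real j + z) = ln (real j) + ln (z / real j + 1)" using j ln_mult_pos[of "real j" "z / real j + 1"] by simp
        qed simp
        also have "\<dots> = ln (fact n) + (\<Sum>j=1..n. ln (z / real j + 1))"
        proof -
          have "ln (fact n) = (\<Sum>j=1..n. ln (real j))"
            by (induction n) (auto simp: ln_mult_pos add.commute simp del: of_nat_Suc)
          then show ?thesis by (simp add: sum.distrib)
        qed
        finally have S: "(\<Sum>j\<le>n. ln (real (P * j + r))) = real (Suc n) * ln (real P) + ln (fact n)
            + z * ln (real n) - ln_Gamma_series z n"
          by (simp add: ln_Gamma_series_def)
        show ?thesis unfolding S by (simp add: z_def algebra_simps)
      qed (use w_0 in simp)
      have "(\<Sum>j\<le>n. err_lim j) = - (\<Sum>j\<le>n. \<Sum>r<P. w r * ln (real (P * j + r))) / 2"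
      proof -
        have "err_lim j = block_lim j" for j using assms by (simp add: err_lim_def)
        then show ?thesis by (simp add: block_lim_def sum_negf flip: sum_divide_distrib)
      qed
      also have "(\<Sum>j\<le>n. \<Sum>r<P. w r * ln (real (P * j + r))) = (\<Sum>r<P. w r * (\<Sum>j\<le>n. ln (real (P * j + r))))"
        by (subst sum.swap) (simp only: sum_distrib_left)
      also have "\<dots> = (\<Sum>r<P. w r) * (real (Suc n) * ln (real P) + ln (fact n)) + moment * (ln (real n) / real P)
          - (\<Sum>r<P. w r * ln_Gamma_series (real r / real P) n)"
        unfolding one moment_def by (simp only: sum_subtractf sum.distrib sum_distrib_right)
      finally show ?case using assms by (simp add: w_sum)
    qed
    then have "(\<lambda>n. \<Sum>j\<le>n. err_lim j) \<longlonglongrightarrow> (\<Sum>r<P. w r * ln_Gamma (real r / real P)) / 2"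
      by (rule Lim_transform_eventually[OF 2])
    then show ?thesis using 1 LIMSEQ_unique by blast
  qed
  ultimately show ?thesis by simp
qed

text \<open>All linear terms \<open>t * artanh_exp' (P * j * t) * moment\<close> are nonnegative
  here, and the one for \<open>j\<close> tends to \<open>- moment / (2 * P * j)\<close>; as the
  harmonic series diverges, finitely many of them outweigh the convergent error.\<close>

lemma Q_eventually_gt_1:
  assumes "moment < 0"
  shows "\<forall>\<^sub>F t in at_right 0. Q t > 1"
proof -
  define L where "L = (\<Sum>j. err_lim j)"
  have "filterlim (\<lambda>J. \<Sum>j=1..J. 1 / real j) at_top sequentially"
    using harm_at_top unfolding harm_def by (simp add: inverse_eq_divide)
  \<comment> \<open>The threshold makes the first \<open>J\<close> linear terms tend to at least
    \<open>3 - L\<close>; together with the errors, which tend to \<open>L\<close>, the limit is at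
    least 3.\<close>
  then have "\<forall>\<^sub>F J in sequentially. (\<Sum>j=1..J. 1 / real j) \<ge> (3 - L) * (2 * real P) / (- moment)"
    by (simp add: filterlim_at_top)
  then obtain J where J: "(\<Sum>j=1..J. 1 / real j) \<ge> (3 - L) * (2 * real P) / (- moment)"
    using eventually_happens by fastforce
  have "((\<lambda>t. (\<Sum>j. err j t) + (\<Sum>j=1..J. t * artanh_exp' (real (P * j) * t) * moment)) \<longlongrightarrow>
      L + (\<Sum>j=1..J. - 1 / (2 * real (P * j)) * moment)) (at_right 0)"
    unfolding L_def
    by (intro tendsto_add err_tannery(3) tendsto_sum tendsto_mult_artanh_exp'[THEN tendsto_mult[OF _ tendsto_const]])
       (use P_pos in auto)
  moreover have "(\<Sum>j=1..J. - 1 / (2 * real (P * j)) * moment) \<ge> 3 - L"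
  proof -
    have "(\<Sum>j=1..J. - 1 / (2 * real (P * j)) * moment) = (- moment / (2 * real P)) * (\<Sum>j=1..J. 1 / real j)"
      unfolding sum_distrib_left by (rule sum.cong) (auto simp: field_simps)
    also have "\<dots> \<ge> (- moment / (2 * real P)) * ((3 - L) * (2 * real P) / (- moment))"
      using assms by (intro mult_left_mono J) (auto intro: divide_nonpos_nonneg)
    also have "(- moment / (2 * real P)) * ((3 - L) * (2 * real P) / (- moment)) = 3 - L"
      using assms P_pos by (simp add: field_simps)
    finally show ?thesis .
  qed
  ultimately have "\<forall>\<^sub>F t in at_right 0. (\<Sum>j. err j t) + (\<Sum>j=1..J. t * artanh_exp' (real (P * j) * t) * moment) > 1"
    by (intro order_tendstoD(1)) auto
  then show ?thesis using err_tannery(1) eventually_at_right_less[of "0::real"]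
  proof eventually_elim
    case (elim t)
    define m where "m j = (if j = 0 then 0 else t * artanh_exp' (real (P * j) * t) * moment)" for j :: nat
    have se: "summable (\<lambda>j. err j t)" using elim(2) by (rule summable_norm_cancel)
    have bl: "block j t = err j t + m j" for j by (simp add: err_def m_def)
    have "(\<lambda>j. block j t - err j t) sums (Q t - (\<Sum>j. err j t))"
      using block_sums[OF elim(3)] se by (intro sums_diff summable_sums)
    then have ms: "m sums (Q t - (\<Sum>j. err j t))" by (simp add: bl)
    have m0: "m j \<ge> 0" for j
    proof (cases "j = 0")
      case False
      then have "artanh_exp' (real (P * j) * t) < 0" using P_pos elim(3) by (intro artanh_exp'_neg) simp
      then have "t * artanh_exp' (real (P * j) * t) < 0" using elim(3) by (simp add: mult_pos_neg)
      then show ?thesis using assms False by (simp add: m_def mult_nonpos_nonpos)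
    qed (simp add: m_def)
    have "sum m {1..J} \<le> suminf m"
      using ms m0 by (intro sum_le_suminf) (auto simp: sums_iff)
    then have "sum m {1..J} \<le> Q t - (\<Sum>j. err j t)" using ms by (simp add: sums_iff)
    moreover have "sum m {1..J} = (\<Sum>j=1..J. t * artanh_exp' (real (P * j) * t) * moment)"
      by (rule sum.cong) (auto simp: m_def)
    ultimately show ?case using elim(1) by linarith
  qed
qed

end

section \<open>Gamma function identities and the behaviour of \<open>Q\<close> for the quadratic
  character\<close>

lemma ln_Gamma_duplication:
  fixes x :: real
  assumes "x > 0"
  shows "ln_Gamma x + ln_Gamma (x + 1 / 2) = (1 - 2 * x) * ln 2 + ln (sqrt pi) + ln_Gamma (2 * x)"
proof -
  have nn: "complex_of_real y \<notin> \<int>\<^sub>\<le>\<^sub>0" if "y > 0" for y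
    using that by (auto elim!: nonpos_Ints_cases simp: complex_eq_iff)
  have "complex_of_real (Gamma x * Gamma (x + 1 / 2)) = complex_of_real (exp ((1 - 2 * x) * ln 2) * sqrt pi * Gamma (2 * x))"
    using Gamma_legendre_duplication[of "complex_of_real x"] nn[of x] nn[of "x + 1/2"] assms
    by (simp flip: Gamma_complex_of_real exp_of_real)
  then have "Gamma x * Gamma (x + 1 / 2) = exp ((1 - 2 * x) * ln 2) * sqrt pi * Gamma (2 * x)"
    by (simp only: of_real_eq_iff)
  moreover have "Gamma x > 0" "Gamma (x + 1 / 2) > 0" "Gamma (2 * x) > 0"
    using assms by (auto intro!: Gamma_real_pos)
  ultimately have "ln (Gamma x) + ln (Gamma (x + 1 / 2)) = (1 - 2 * x) * ln 2 + ln (sqrt pi) + ln (Gamma (2 * x))"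
    by (simp add: ln_mult_pos flip: ln_mult_pos[of "Gamma x" "Gamma (x + 1 / 2)"])
  then show ?thesis using assms by (simp add: ln_Gamma_real_pos)
qed

lemma ln_Gamma_reflection:
  fixes x :: real
  assumes "0 < x" "x < 1"
  shows "ln_Gamma x + ln_Gamma (1 - x) = ln pi - ln (sin (pi * x))"
proof -
  have s: "sin (pi * x) > 0" using assms by (intro sin_gt_zero) auto
  have "complex_of_real (Gamma x * Gamma (1 - x)) = complex_of_real (pi / sin (pi * x))"
    using Gamma_reflection_complex[of "complex_of_real x"]
    by (simp flip: Gamma_complex_of_real sin_of_real)
  then have "Gamma x * Gamma (1 - x) = pi / sin (pi * x)"
    by (simp only: of_real_eq_iff)
  moreover have "Gamma x > 0" "Gamma (1 - x) > 0"
    using assms by (auto intro!: Gamma_real_pos)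
  ultimately have "ln (Gamma x) + ln (Gamma (1 - x)) = ln pi - ln (sin (pi * x))"
    using s by (simp add: ln_div flip: ln_mult_pos[of "Gamma x" "Gamma (1 - x)"])
  then show ?thesis using assms by (simp add: ln_Gamma_real_pos)
qed

lemma sum_odd_lessThan_double:
  fixes g :: "nat \<Rightarrow> 'a::ab_group_add"
  shows "(\<Sum>r<2 * n. if odd r then g r else 0) = (\<Sum>r<2 * n. g r) - (\<Sum>s<n. g (2 * s))"
  by (induction n) (simp_all add: algebra_simps)

lemma sum_lessThan_double:
  fixes g :: "nat \<Rightarrow> 'a::comm_monoid_add"
  shows "(\<Sum>r<2 * n. g r) = (\<Sum>r<n. g r) + (\<Sum>r<n. g (r + n))"
proof -
  have "(\<Sum>r<2 * n. g r) = (\<Sum>r=0..<n. g r) + (\<Sum>r=0 + n..<n + n. g r)"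
    using sum.atLeastLessThan_concat[of 0 n "n + n" g] by (simp add: lessThan_atLeast0 mult_2)
  also have "(\<Sum>r=0 + n..<n + n. g r) = (\<Sum>r=0..<n. g (r + n))"
    by (rule sum.shift_bounds_nat_ivl)
  finally show ?thesis by (simp add: lessThan_atLeast0)
qed

context odd_prime
begin

definition odd_chi :: "nat \<Rightarrow> real" where
  "odd_chi r = (if odd r then chi r else 0)"

text \<open>Odd indices are all indices minus the even ones; the second half of the period
  \<open>2 * p\<close> is the shift by \<open>p\<close>, and an even index \<open>2 * s\<close>
  contributes \<open>chi 2 * chi s\<close>.\<close>

lemma sum_odd_chi: "(\<Sum>r<2 * p. odd_chi r * f r)
    = (\<Sum>s<p. chi s * (f s + f (s + p))) - chi 2 * (\<Sum>s<p. chi s * f (2 * s))"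
proof -
  have "(\<Sum>r<2 * p. odd_chi r * f r) = (\<Sum>r<2 * p. if odd r then chi r * f r else 0)"
    by (rule sum.cong) (auto simp: odd_chi_def)
  also have "\<dots> = (\<Sum>r<p. chi r * f r) + (\<Sum>r<p. chi (r + p) * f (r + p)) - (\<Sum>s<p. chi (2 * s) * f (2 * s))"
    unfolding sum_odd_lessThan_double sum_lessThan_double ..
  finally show ?thesis
    by (simp add: chi_mult sum.distrib sum_distrib_left algebra_simps)
qed

sublocale odd_period_weights odd_chi "2 * p"
proof
  show "odd_chi (n + 2 * p) = odd_chi n" for n
    using chi_add_p_mult(1)[of n 2] by (simp add: odd_chi_def mult.commute)
  show "\<bar>odd_chi n\<bar> \<le> 1" for n by (simp add: odd_chi_def abs_chi_le_1)
  show "(\<Sum>r<2 * p. odd_chi r) = 0"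
    using sum_odd_chi[of "\<lambda>_. 1"] by (simp add: sum_chi flip: sum_distrib_right)
qed (auto simp: odd_chi_def)

definition N1 :: real where "N1 = (\<Sum>s<p. real s * chi s)"

lemma moment_eq: "moment = 2 * (1 - chi 2) * N1"
proof -
  have "moment = (\<Sum>r<2 * p. odd_chi r * real r)"
    unfolding moment_def by (simp add: mult.commute)
  also have "\<dots> = (\<Sum>s<p. chi s * (real s + real (s + p))) - chi 2 * (\<Sum>s<p. chi s * real (2 * s))"
    by (rule sum_odd_chi)
  also have "(\<Sum>s<p. chi s * (real s + real (s + p))) = (\<Sum>s<p. 2 * (real s * chi s) + real p * chi s)"
    by (rule sum.cong) (auto simp: algebra_simps)
  also have "\<dots> = 2 * N1" by (simp add: sum.distrib N1_def sum_chi flip: sum_distrib_left)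
  also have "(\<Sum>s<p. chi s * real (2 * s)) = 2 * N1"
    by (simp add: N1_def sum_distrib_left mult_ac)
  finally show ?thesis by (simp add: algebra_simps)
qed

text \<open>Legendre duplication at \<open>s / (2 * p)\<close> merges the values at \<open>s\<close>
  and \<open>s + p\<close> into \<open>ln_Gamma (s / p)\<close>, giving the same sum that the even
  indices subtract with the factor \<open>chi 2\<close>. The term \<open>(1 - s / p) * ln 2\<close>
  leaves the multiple of \<open>N1\<close>.\<close>

lemma Q_limit_value:
  "(\<Sum>r<2 * p. odd_chi r * ln_Gamma (real r / real (2 * p)))
    = (1 - chi 2) * (\<Sum>s<p. chi s * ln_Gamma (real s / real p)) - N1 / real p * ln 2"
proof -
  define f where "f r = ln_Gamma (real r / real (2 * p))" for r
  have "(\<Sum>s<p. chi s * (f s + f (s + p)))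
      = (\<Sum>s<p. chi s * (ln 2 + ln (sqrt pi)) - ln 2 / real p * (real s * chi s) + chi s * ln_Gamma (real s / real p))"
  proof (rule sum.cong)
    fix s
    show "chi s * (f s + f (s + p)) = chi s * (ln 2 + ln (sqrt pi)) - ln 2 / real p * (real s * chi s) + chi s * ln_Gamma (real s / real p)"
    proof (cases "s = 0")
      case False
      define z where "z = real s / real (2 * p)"
      have z: "z > 0" using False p_pos by (simp add: z_def)
      have "real (s + p) / real (2 * p) = z + 1 / 2" "real s / real p = 2 * z"
        using p_pos by (simp_all add: z_def field_simps)
      then have e: "f s + f (s + p) = (1 - real s / real p) * ln 2 + ln (sqrt pi) + ln_Gamma (real s / real p)"
        using ln_Gamma_duplication[OF z] by (simp add: f_def z_def)
      show ?thesis unfolding e by (simp add: algebra_simps)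
    qed simp
  qed simp
  also have "\<dots> = (\<Sum>s<p. chi s) * (ln 2 + ln (sqrt pi)) - ln 2 / real p * N1 + (\<Sum>s<p. chi s * ln_Gamma (real s / real p))"
    by (simp only: sum.distrib sum_subtractf sum_distrib_left sum_distrib_right N1_def)
  finally have 1: "(\<Sum>s<p. chi s * (f s + f (s + p))) = (\<Sum>s<p. chi s * ln_Gamma (real s / real p)) - ln 2 / real p * N1"
    by (simp add: sum_chi)
  have 2: "f (2 * s) = ln_Gamma (real s / real p)" for s by (simp add: f_def)
  show ?thesis using sum_odd_chi[of f] unfolding 1 2 by (simp add: f_def algebra_simps)
qed

lemma Q_eventually_pos:
  assumes "p mod 8 \<noteq> 1"
  shows "\<exists>\<delta>>0. \<forall>\<^sub>F t in at_right 0. Q t \<ge> \<delta>"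
proof -
  have limit: ?thesis if "moment = 0" "(1 - chi 2) * (\<Sum>s<p. chi s * ln_Gamma (real s / real p)) - N1 / real p * ln 2 > 0"
  proof -
    define l where "l = ((1 - chi 2) * (\<Sum>s<p. chi s * ln_Gamma (real s / real p)) - N1 / real p * ln 2) / 2"
    have "(Q \<longlongrightarrow> l) (at_right 0)" using tendsto_Q[OF that(1)] unfolding l_def Q_limit_value .
    moreover have l: "l > 0" using that(2) by (simp add: l_def)
    ultimately have "\<forall>\<^sub>F t in at_right 0. Q t > l / 2" by (intro order_tendstoD(1)) auto
    then have "\<forall>\<^sub>F t in at_right 0. Q t \<ge> l / 2" by eventually_elim auto
    then show ?thesis using l by (intro exI[of _ "l / 2"]) auto
  qed
  have L: "sqrt (real p) * L1 > 0" using L1_pos p_pos by simp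
  show ?thesis
  proof (cases "p mod 4 = 1")
    case True
    then have "p mod 8 = 5" using assms by presburger
    \<comment> \<open>Hence \<open>1 - chi 2 = 2\<close>. Once the symmetry between \<open>s\<close>
      and \<open>p - s\<close> gives \<open>N1 = 0\<close>, the limit of \<open>Q\<close> is the
      Gamma sum \<open>W\<close>, and the same symmetry evaluates \<open>2 * W\<close> by the
      reflection formula.\<close>
    then have c2: "chi 2 = -1" by (rule chi_2)
    have refl: "(\<Sum>s<p. chi s * g s) = (\<Sum>s<p. chi s * g (p - s))" for g :: "nat \<Rightarrow> real"
    proof -
      have "(\<Sum>s\<in>{1..<p}. chi s * g s) = (\<Sum>s\<in>{1..<p}. chi s * g (p - s))"
        by (rule sum.reindex_bij_witness[of _ "\<lambda>s. p - s" "\<lambda>s. p - s"]) (auto simp: chi_minus True)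
      moreover have "(\<Sum>s<p. chi s * h s) = (\<Sum>s\<in>{1..<p}. chi s * h s)" for h :: "nat \<Rightarrow> real"
        by (rule sum.mono_neutral_right) (auto simp: Suc_le_eq)
      ultimately show ?thesis by simp
    qed
    have "N1 = (\<Sum>s<p. chi s * real s)" by (simp add: N1_def mult.commute)
    also have "\<dots> = (\<Sum>s<p. chi s * real (p - s))" by (rule refl)
    also have "\<dots> = (\<Sum>s<p. real p * chi s - real s * chi s)"
      by (rule sum.cong) (auto simp: of_nat_diff algebra_simps)
    also have "\<dots> = - N1" by (simp add: sum_subtractf N1_def sum_chi flip: sum_distrib_left)
    finally have N: "N1 = 0" by simp
    define W where "W = (\<Sum>s<p. chi s * ln_Gamma (real s / real p))"
    have "W + W = (\<Sum>s<p. chi s * ln_Gamma (real s / real p)) + (\<Sum>s<p. chi s * ln_Gamma (real (p - s) / real p))"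
      using refl[of "\<lambda>s. ln_Gamma (real s / real p)"] by (simp add: W_def)
    also have "\<dots> = (\<Sum>s<p. chi s * ln pi - chi s * ln (sin (pi * real s / real p)))"
      unfolding sum.distrib[symmetric]
    proof (rule sum.cong)
      fix s assume s: "s \<in> {..<p}"
      show "chi s * ln_Gamma (real s / real p) + chi s * ln_Gamma (real (p - s) / real p)
          = chi s * ln pi - chi s * ln (sin (pi * real s / real p))"
      proof (cases "s = 0")
        case False
        define x where "x = real s / real p"
        have "0 < x" "x < 1" using False s by (auto simp: x_def)
        note r = ln_Gamma_reflection[OF this]
        have "real (p - s) / real p = 1 - x" using s by (simp add: x_def of_nat_diff diff_divide_distrib)
        then show ?thesis using r by (simp add: x_def flip: distrib_left right_diff_distrib)
      qed simp
    qed simp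
    also have "\<dots> = sqrt (real p) * L1"
      by (simp add: L1_even[OF True] sum_subtractf sum_chi flip: sum_distrib_right)
    finally have "W > 0" using L by simp
    then show ?thesis by (intro limit) (auto simp: moment_eq N c2 W_def)
  next
    case False
    have "sqrt (real p) * L1 = - (pi / real p) * N1" using L1_odd[OF False] by (simp add: N1_def)
    then have "(pi / real p) * N1 < 0" using L by simp
    then have N: "N1 < 0" using p_pos by (simp add: mult_less_0_iff divide_less_0_iff zero_less_mult_iff)
    have "\<not> p dvd 2" using p_ge_3 by (auto dest: dvd_imp_le)
    then consider "chi 2 = 1" | "chi 2 = -1" using chi_values[of 2] chi_eq_0_iff[of 2] by auto
    then show ?thesis
    proof cases
      \<comment> \<open>The factor \<open>1 - chi 2\<close> removes both the moment and the Gamma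
        sum; the limit of \<open>Q\<close> is \<open>- N1 * ln 2 / (2 * p)\<close>.\<close>
      case 1
      have "N1 / real p * ln 2 < 0" using N p_pos by (simp add: mult_less_0_iff divide_less_0_iff)
      then show ?thesis by (intro limit) (auto simp: moment_eq 1)
    next
      case 2
      then have "moment < 0" using N by (simp add: moment_eq)
      then have "\<forall>\<^sub>F t in at_right 0. Q t > 1" by (rule Q_eventually_gt_1)
      then have "\<forall>\<^sub>F t in at_right 0. Q t \<ge> 1" by eventually_elim auto
      then show ?thesis by (intro exI[of _ 1]) auto
    qed
  qed
qed

end

section \<open>The generating function\<close>

definition bounded_partitions :: "nat \<Rightarrow> nat \<Rightarrow> nat list set" where
  "bounded_partitions N n = {as \<in> partitions_of n. \<forall>a\<in>set as. a \<le> N}"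

lemma finite_bounded_partitions: "finite (bounded_partitions N n)"
  unfolding bounded_partitions_def using finite_partitions_of by simp

lemma bounded_partitions_0: "bounded_partitions 0 n = (if n = 0 then {[]} else {})"
proof -
  have "as = []" if "as \<in> bounded_partitions 0 n" for as
    using that by (cases as) (auto simp: bounded_partitions_def partitions_of_def)
  moreover have "[] \<in> bounded_partitions 0 0" by (simp add: bounded_partitions_def partitions_of_def)
  moreover have "[] \<in> bounded_partitions 0 n \<Longrightarrow> n = 0" by (simp add: bounded_partitions_def partitions_of_def)
  ultimately show ?thesis by auto
qed

lemma bounded_partitions_self: "n \<le> N \<Longrightarrow> bounded_partitions N n = partitions_of n"
  by (auto simp: bounded_partitions_def partitions_of_def dest!: member_le_sum_list)

text \<open>Partitions are weakly decreasing lists, so a part \<open>Suc N\<close>, if it occurs, is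
  the head.\<close>

lemma bounded_partitions_Suc:
  "bounded_partitions (Suc N) n = bounded_partitions N n \<union>
     (if Suc N \<le> n then (#) (Suc N) ` bounded_partitions (Suc N) (n - Suc N) else {})"
proof (intro equalityI subsetI)
  fix as assume as: "as \<in> bounded_partitions (Suc N) n"
  show "as \<in> bounded_partitions N n \<union> (if Suc N \<le> n then (#) (Suc N) ` bounded_partitions (Suc N) (n - Suc N) else {})"
  proof (cases "\<forall>a\<in>set as. a \<le> N")
    case True
    then show ?thesis using as by (auto simp: bounded_partitions_def)
  next
    case False
    then obtain x where x: "x \<in> set as" "x > N" by auto
    then obtain b bs where b: "as = b # bs" by (cases as) auto
    have "b = Suc N" using as x by (auto simp: b bounded_partitions_def partitions_of_def)
    moreover have "bs \<in> bounded_partitions (Suc N) (n - Suc N)"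
      using as \<open>b = Suc N\<close> by (auto simp: b bounded_partitions_def partitions_of_def)
    moreover have "Suc N \<le> n" using as \<open>b = Suc N\<close> by (auto simp: b bounded_partitions_def partitions_of_def)
    ultimately show ?thesis using b by auto
  qed
next
  fix as assume "as \<in> bounded_partitions N n \<union> (if Suc N \<le> n then (#) (Suc N) ` bounded_partitions (Suc N) (n - Suc N) else {})"
  then show "as \<in> bounded_partitions (Suc N) n"
    by (auto simp: bounded_partitions_def partitions_of_def split: if_splits)
qed

section \<open>Recursion for the coefficients and the analytic generating function\<close>

context
  fixes f :: "nat \<Rightarrow> int"
begin

definition bounded_number :: "nat \<Rightarrow> nat \<Rightarrow> int" where
  "bounded_number N n = (\<Sum>as\<in>bounded_partitions N n. prod_list (map f as))"

lemma bounded_number_Suc: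
  "bounded_number (Suc N) n = bounded_number N n + (if Suc N \<le> n then f (Suc N) * bounded_number (Suc N) (n - Suc N) else 0)"
proof (cases "Suc N \<le> n")
  case True
  have "bounded_partitions N n \<inter> (#) (Suc N) ` bounded_partitions (Suc N) (n - Suc N) = {}"
    by (auto simp: bounded_partitions_def)
  then have "bounded_number (Suc N) n = bounded_number N n
      + (\<Sum>as\<in>(#) (Suc N) ` bounded_partitions (Suc N) (n - Suc N). prod_list (map f as))"
    unfolding bounded_number_def bounded_partitions_Suc[of N n] using True
    by (simp add: sum.union_disjoint finite_bounded_partitions)
  also have "(\<Sum>as\<in>(#) (Suc N) ` bounded_partitions (Suc N) (n - Suc N). prod_list (map f as))
      = f (Suc N) * bounded_number (Suc N) (n - Suc N)"
    by (subst sum.reindex) (auto simp: bounded_number_def sum_distrib_left)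
  finally show ?thesis using True by simp
next
  case False
  then show ?thesis unfolding bounded_number_def bounded_partitions_Suc[of N n] by simp
qed

definition bounded_fps :: "nat \<Rightarrow> real fps" where
  "bounded_fps N = Abs_fps (\<lambda>n. of_int (bounded_number N n))"

text \<open>\<open>x\<close> times the logarithmic derivative of the product of
  \<open>1 / (1 - f d * x ^ d)\<close> over \<open>1 \<le> d \<le> N\<close>.\<close>

definition bounded_divisor_fps :: "nat \<Rightarrow> real fps" where
  "bounded_divisor_fps N = Abs_fps (\<lambda>j. if j = 0 then 0 else \<Sum>d | d dvd j \<and> d \<le> N. real d * of_int (f d) ^ (j div d))"

lemma bounded_fps_Suc:
  "bounded_fps (Suc N) * (1 - fps_const (of_int (f (Suc N))) * fps_X ^ Suc N) = bounded_fps N"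
proof (rule fps_ext)
  fix n
  have "bounded_fps (Suc N) * (1 - fps_const (of_int (f (Suc N))) * fps_X ^ Suc N)
      = bounded_fps (Suc N) - fps_const (of_int (f (Suc N))) * (bounded_fps (Suc N) * fps_X ^ Suc N)"
    by (simp add: algebra_simps)
  then show "(bounded_fps (Suc N) * (1 - fps_const (of_int (f (Suc N))) * fps_X ^ Suc N)) $ n = bounded_fps N $ n"
    using bounded_number_Suc[of N n]
    by (simp add: fps_X_power_mult_right_nth bounded_fps_def del: power_Suc)
qed

text \<open>The new divisor \<open>M = Suc N\<close> adds \<open>M * U / (1 - U)\<close> with
  \<open>U = f M * x ^ M\<close>. Multiplying by \<open>1 - U\<close>, as in
  \<open>bounded_fps_Suc\<close>, avoids inverses of power series.\<close>

lemma bounded_divisor_fps_Suc: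
  "bounded_divisor_fps (Suc N) * (1 - fps_const (of_int (f (Suc N))) * fps_X ^ Suc N)
    = bounded_divisor_fps N * (1 - fps_const (of_int (f (Suc N))) * fps_X ^ Suc N)
      + of_nat (Suc N) * (fps_const (of_int (f (Suc N))) * fps_X ^ Suc N)"
proof -
  define M where "M = Suc N"
  define c :: real where "c = of_int (f M)"
  define D where "D = Abs_fps (\<lambda>j. if j > 0 \<and> M dvd j then real M * c ^ (j div M) else 0)"
  have 1: "bounded_divisor_fps M = bounded_divisor_fps N + D"
  proof (rule fps_ext)
    fix j
    show "bounded_divisor_fps M $ j = (bounded_divisor_fps N + D) $ j"
    proof (cases "j = 0")
      case False
      have fin: "finite {d. d dvd j \<and> d \<le> N}" by simp
      show ?thesis
      proof (cases "M dvd j")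
        case True
        have "{d. d dvd j \<and> d \<le> M} = insert M {d. d dvd j \<and> d \<le> N}" using True by (auto simp: M_def le_Suc_eq)
        moreover have "M \<notin> {d. d dvd j \<and> d \<le> N}" by (simp add: M_def)
        ultimately show ?thesis using False True fin by (simp add: bounded_divisor_fps_def D_def c_def)
      next
        case nd: False
        have "{d. d dvd j \<and> d \<le> M} = {d. d dvd j \<and> d \<le> N}" using nd by (auto simp: M_def le_Suc_eq)
        then show ?thesis using False nd by (simp add: bounded_divisor_fps_def D_def)
      qed
    qed (simp add: bounded_divisor_fps_def D_def)
  qed
  have 2: "D * (1 - fps_const c * fps_X ^ M) = of_nat M * (fps_const c * fps_X ^ M)"
  proof (rule fps_ext)
    fix j
    have e: "D * (1 - fps_const c * fps_X ^ M) = D - fps_const c * (D * fps_X ^ M)" by (simp add: algebra_simps)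
    have e': "of_nat M * (fps_const c * fps_X ^ M) = fps_const (real M * c) * fps_X ^ M"
      by (simp add: fps_of_nat[symmetric] mult.assoc[symmetric] del: fps_of_nat)
    consider "j < M" | "j = M" | k where "j = M + k" "k > 0" by (metis less_imp_add_positive nat_neq_iff)
    then show "(D * (1 - fps_const c * fps_X ^ M)) $ j = (of_nat M * (fps_const c * fps_X ^ M)) $ j"
    proof cases
      case 1
      then have "\<not> (j > 0 \<and> M dvd j)" by (auto dest: dvd_imp_le)
      then show ?thesis unfolding e e' using 1 by (simp add: fps_X_power_mult_right_nth D_def)
    next
      case 2
      have "M > 0" by (simp add: M_def)
      then show ?thesis unfolding e e' 2 by (simp add: fps_X_power_mult_right_nth D_def)
    next
      case (3 k)
      have M: "M > 0" by (simp add: M_def)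
      have "D $ (M + k) = c * D $ k"
        using 3 M by (cases "M dvd k") (auto simp: D_def)
      then show ?thesis unfolding e e' using 3 by (simp add: fps_X_power_mult_right_nth)
    qed
  qed
  show ?thesis
    unfolding M_def[symmetric] c_def[symmetric] 1 distrib_right 2 ..
qed

text \<open>Logarithmic differentiation of a finite product, by induction over its factors; both
  sides are multiplied by \<open>1 - U\<close>, which is cancelled at the end.\<close>

lemma fps_X_mult_deriv_bounded_fps:
  "fps_X * fps_deriv (bounded_fps N) = bounded_fps N * bounded_divisor_fps N"
proof (induction N)
  case 0
  have "bounded_fps 0 = 1"
    by (rule fps_ext) (simp add: bounded_fps_def bounded_number_def bounded_partitions_0)
  moreover have "bounded_divisor_fps 0 = 0"
    by (rule fps_ext) (simp add: bounded_divisor_fps_def)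
  ultimately show ?case by simp
next
  case (Suc N)
  define G E G' E' where "G = bounded_fps N" and "E = bounded_divisor_fps N"
    and "G' = bounded_fps (Suc N)" and "E' = bounded_divisor_fps (Suc N)"
  define U where "U = fps_const (of_int (f (Suc N)) :: real) * fps_X ^ Suc N"
  have g: "G' * (1 - U) = G" unfolding G'_def G_def U_def by (rule bounded_fps_Suc)
  have e: "E' * (1 - U) = E * (1 - U) + of_nat (Suc N) * U"
    unfolding E'_def E_def U_def by (rule bounded_divisor_fps_Suc)
  have dU: "fps_X * fps_deriv U = of_nat (Suc N) * U"
  proof (rule fps_ext)
    fix j
    have "U $ j = (if j = Suc N then of_int (f (Suc N)) else 0)"
      unfolding U_def fps_mult_left_const_nth by (simp add: fps_X_power_nth del: power_Suc)
    moreover have "(fps_X * fps_deriv U) $ j = real j * U $ j" by (cases j) auto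
    moreover have "(of_nat (Suc N) * U) $ j = real (Suc N) * U $ j"
      by (simp only: fps_of_nat[symmetric] fps_mult_left_const_nth)
    ultimately show "(fps_X * fps_deriv U) $ j = (of_nat (Suc N) * U) $ j" by simp
  qed
  have "(1 - U) $ 0 = 1" by (simp add: U_def)
  then have ne: "1 - U \<noteq> 0" by (metis fps_zero_nth zero_neq_one)
  have "(fps_X * fps_deriv G') * (1 - U) = fps_X * fps_deriv (G' * (1 - U)) + G' * (fps_X * fps_deriv U)"
    by (simp add: algebra_simps)
  also have "fps_X * fps_deriv (G' * (1 - U)) = G' * (1 - U) * E"
    unfolding g using Suc.IH by (simp add: G_def E_def)
  also have "G' * (1 - U) * E + G' * (fps_X * fps_deriv U) = G' * (E * (1 - U) + of_nat (Suc N) * U)"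
    unfolding dU by (simp add: algebra_simps)
  also have "\<dots> = (G' * E') * (1 - U)" unfolding e[symmetric] by (simp add: mult.assoc)
  finally show ?case using ne unfolding G'_def E'_def by simp
qed

definition divisor_coeff :: "nat \<Rightarrow> real" where
  "divisor_coeff j = (if j = 0 then 0 else \<Sum>d | d dvd j. real d * of_int (f d) ^ (j div d))"

text \<open>Bounding the parts by \<open>n\<close> leaves all coefficients up to \<open>n\<close>
  unchanged, so the identity for finite products already yields the full recursion.\<close>

lemma signed_partition_number_rec:
  "real n * of_int (signed_partition_number n f)
    = (\<Sum>i=0..n. of_int (signed_partition_number i f) * divisor_coeff (n - i))"
proof -
  have a: "bounded_fps n $ i = of_int (signed_partition_number i f)" if "i \<le> n" for i
    using that by (simp add: bounded_fps_def bounded_number_def bounded_partitions_self signed_partition_number_def)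
  have e: "bounded_divisor_fps n $ j = divisor_coeff j" if "j \<le> n" for j
  proof (cases "j = 0")
    case False
    then have "{d. d dvd j \<and> d \<le> n} = {d. d dvd j}" using that by (auto dest: dvd_imp_le)
    then show ?thesis using False by (simp add: bounded_divisor_fps_def divisor_coeff_def)
  qed (simp add: bounded_divisor_fps_def divisor_coeff_def)
  have "(fps_X * fps_deriv (bounded_fps n)) $ n = real n * bounded_fps n $ n"
    by (cases n) auto
  then have "real n * bounded_fps n $ n = (\<Sum>i=0..n. bounded_fps n $ i * bounded_divisor_fps n $ (n - i))"
    unfolding fps_X_mult_deriv_bounded_fps by (simp add: fps_mult_nth)
  also have "\<dots> = (\<Sum>i=0..n. of_int (signed_partition_number i f) * divisor_coeff (n - i))"
    by (rule sum.cong) (auto simp: a e)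
  finally show ?thesis by (simp add: a)
qed

lemma signed_partition_number_0: "signed_partition_number 0 f = 1"
  unfolding signed_partition_number_def bounded_partitions_self[OF order_refl, symmetric]
  by (simp add: bounded_partitions_0)

definition log_coeff :: "nat \<Rightarrow> real" where
  "log_coeff n = divisor_coeff n / real n"

definition log_fps :: "complex fps" where
  "log_fps = Abs_fps (\<lambda>n. of_real (log_coeff n))"

text \<open>Defined through its logarithm, so that \<open>log_fps\<close> is a logarithm on the
  whole disc; that the coefficients are the signed partition numbers is
  \<open>gen_fun_expansion\<close>.\<close>

definition gen_fun :: "complex \<Rightarrow> complex" where
  "gen_fun z = exp (eval_fps log_fps z)"

context
  assumes f_le: "\<And>n. \<bar>f n\<bar> \<le> 1"
begin

lemma abs_log_coeff_le: "\<bar>log_coeff n\<bar> \<le> real n"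
proof (cases "n = 0")
  case False
  have "\<bar>\<Sum>d | d dvd n. real d * of_int (f d) ^ (n div d)\<bar> \<le> (\<Sum>d | d dvd n. real n)"
  proof (rule order_trans[OF sum_abs sum_mono])
    fix d assume "d \<in> {d. d dvd n}"
    then have "d \<le> n" using False by (auto dest: dvd_imp_le)
    have "\<bar>real_of_int (f d)\<bar> \<le> 1" using f_le[of d] by linarith
    then have "\<bar>real_of_int (f d)\<bar> ^ (n div d) \<le> 1" by (rule power_le_one[OF abs_ge_zero])
    then have "real d * \<bar>real_of_int (f d)\<bar> ^ (n div d) \<le> real n * 1"
      using \<open>d \<le> n\<close> by (intro mult_mono) auto
    then show "\<bar>real d * of_int (f d) ^ (n div d)\<bar> \<le> real n" by (simp add: abs_mult power_abs)
  qed
  also have "\<dots> = real (card {d. d dvd n}) * real n" by simp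
  also have "\<dots> \<le> real n * real n"
  proof -
    have "{d. d dvd n} \<subseteq> {1..n}" using False by (auto dest: dvd_imp_le intro!: Suc_leI Nat.gr0I)
    then have "card {d. d dvd n} \<le> n" using card_mono[of "{1..n}"] by simp
    then show ?thesis by (intro mult_right_mono) auto
  qed
  finally show ?thesis using False by (simp add: log_coeff_def divisor_coeff_def field_simps)
qed (simp add: log_coeff_def)

lemma conv_radius_log_fps: "fps_conv_radius log_fps \<ge> 1"
proof -
  have "conv_radius (\<lambda>n. complex_of_real (log_coeff n)) \<ge> 1"
  proof (rule conv_radius_geI_ex')
    fix r :: real assume r: "0 < r" "ereal r < 1"
    show "summable (\<lambda>n. complex_of_real (log_coeff n) * of_real r ^ n)"
    proof (rule summable_comparison_test')
      show "summable (\<lambda>n. real (Suc n) ^ 1 * r ^ n)" using r by (intro summable_Suc_power_mult) auto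
      fix n
      have "\<bar>log_coeff n\<bar> \<le> real (Suc n)" using abs_log_coeff_le[of n] by simp
      then show "norm (complex_of_real (log_coeff n) * of_real r ^ n) \<le> real (Suc n) ^ 1 * r ^ n"
        using r by (simp add: norm_mult norm_power mult_right_mono del: of_nat_Suc)
    qed
  qed
  then show ?thesis by (simp add: fps_conv_radius_def log_fps_def)
qed

lemma log_fps_holomorphic: "eval_fps log_fps holomorphic_on ball 0 1"
proof -
  have "ball (0 :: complex) 1 \<subseteq> eball 0 (fps_conv_radius log_fps)"
  proof
    fix z :: complex assume "z \<in> ball 0 1"
    then have "ereal (norm z) < 1" by simp
    then have "ereal (norm z) < fps_conv_radius log_fps" using conv_radius_log_fps by (rule less_le_trans)
    then show "z \<in> eball 0 (fps_conv_radius log_fps)" by (simp add: in_eball_iff)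
  qed
  then show ?thesis by (rule holomorphic_on_eval_fps)
qed

lemma gen_fun_holomorphic: "gen_fun holomorphic_on ball 0 1"
  unfolding gen_fun_def by (intro holomorphic_intros log_fps_holomorphic)

text \<open>The differential equation \<open>F' = log_fps' * F\<close> is, coefficientwise, the
  recursion \<open>signed_partition_number_rec\<close>; both sequences start with 1.\<close>

lemma gen_fun_expansion:
  "fps_expansion gen_fun 0 $ n = of_int (signed_partition_number n f)"
proof -
  define F where "F = fps_expansion gen_fun 0"
  have an: "gen_fun analytic_on {0}"
    using gen_fun_holomorphic by (metis analytic_at centre_in_ball open_ball zero_less_one)
  have exF: "gen_fun has_fps_expansion F" unfolding F_def by (rule analytic_at_imp_has_fps_expansion_0[OF an])
  have exL: "eval_fps log_fps has_fps_expansion log_fps"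
    by (rule eval_fps_has_fps_expansion, rule less_le_trans[OF _ conv_radius_log_fps]) simp
  have "(\<lambda>z. deriv (eval_fps log_fps) z * gen_fun z) has_fps_expansion (fps_deriv log_fps * F)"
    by (intro has_fps_expansion_mult has_fps_expansion_deriv exL exF)
  moreover have "deriv gen_fun has_fps_expansion fps_deriv F"
    by (intro has_fps_expansion_deriv exF)
  moreover have "\<forall>\<^sub>F z in nhds 0. deriv gen_fun z = deriv (eval_fps log_fps) z * gen_fun z"
  proof -
    have "\<forall>\<^sub>F z in nhds (0 :: complex). z \<in> ball 0 1" by (rule eventually_nhds_in_open) auto
    then show ?thesis
    proof eventually_elim
      case (elim z)
      have "(eval_fps log_fps has_field_derivative deriv (eval_fps log_fps) z) (at z)"
        by (rule holomorphic_derivI[OF log_fps_holomorphic open_ball elim])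
      then have "(gen_fun has_field_derivative exp (eval_fps log_fps z) * deriv (eval_fps log_fps) z) (at z)"
        unfolding gen_fun_def by (intro DERIV_chain2[OF DERIV_exp])
      then show ?case by (simp add: DERIV_imp_deriv gen_fun_def)
    qed
  qed
  ultimately have d: "fps_deriv F = fps_deriv log_fps * F"
    by (metis fps_expansion_unique_complex has_fps_expansion_cong)
  have rec: "of_nat n * F $ n = (\<Sum>i=0..n. F $ i * of_real (divisor_coeff (n - i)))" for n
  proof -
    have c: "(fps_X * fps_deriv log_fps) $ j = of_real (divisor_coeff j)" for j
      by (cases j) (auto simp: log_fps_def log_coeff_def divisor_coeff_def simp flip: of_nat_Suc)
    have "of_nat n * F $ n = (fps_X * fps_deriv F) $ n" by (cases n) auto
    also have "\<dots> = (F * (fps_X * fps_deriv log_fps)) $ n" unfolding d by (simp only: mult_ac)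
    finally show ?thesis
      unfolding fps_mult_nth[of F "fps_X * fps_deriv log_fps"] by (simp only: c)
  qed
  have F0: "F $ 0 = 1"
    using has_fps_expansion_imp_0_eq_fps_nth_0[OF exF] 
    by (simp add: gen_fun_def eval_fps_at_0 log_fps_def log_coeff_def)
  have "F $ n = of_int (signed_partition_number n f)" for n
  proof (induction n rule: less_induct)
    case (less n)
    show ?case
    proof (cases "n = 0")
      case True
      then show ?thesis using F0 signed_partition_number_0 by simp
    next
      case False
      have "of_nat n * F $ n = (\<Sum>i=0..n. F $ i * of_real (divisor_coeff (n - i)))" by (rule rec)
      also have "\<dots> = (\<Sum>i=0..n. of_int (signed_partition_number i f) * of_real (divisor_coeff (n - i)))"
      proof (rule sum.cong)
        fix i assume "i \<in> {0..n}"
        then show "F $ i * of_real (divisor_coeff (n - i)) = of_int (signed_partition_number i f) * of_real (divisor_coeff (n - i))"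
          using less by (cases "i = n") (auto simp: divisor_coeff_def)
      qed simp
      also have "\<dots> = of_real (real n * of_int (signed_partition_number n f))"
        unfolding signed_partition_number_rec by simp
      finally show ?thesis using False by simp
    qed
  qed
  then show ?thesis by (simp add: F_def)
qed

lemma signed_partition_number_integral:
  assumes r: "0 < r" "r < 1"
  shows "((\<lambda>x. gen_fun (of_real r * cis x) * cis (- (real n * x))) has_integral
      of_real (2 * pi * r ^ n * of_int (signed_partition_number n f))) {- (pi / 2)..3 * pi / 2}"
proof -
  \<comment> \<open>The rotation by \<open>- \<i>\<close> moves the parameter interval of
    \<open>circlepath\<close> from \<open>{0..2 * pi}\<close> to
    \<open>{- (pi / 2)..3 * pi / 2}\<close>, where both dominant angles 0 and \<open>pi\<close> are
    interior.\<close>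
  define h where "h z = gen_fun (- \<i> * z)" for z
  define a :: complex where "a = of_int (signed_partition_number n f)"
  have holh: "h holomorphic_on ball 0 1"
  proof -
    have "(gen_fun \<circ> (\<lambda>z. - \<i> * z)) holomorphic_on ball 0 1"
      by (rule holomorphic_on_compose_gen[OF _ gen_fun_holomorphic])
         (auto intro!: holomorphic_intros simp: norm_mult)
    then show ?thesis by (simp add: h_def[abs_def] o_def)
  qed
  have dh: "(deriv ^^ n) h 0 = (- \<i>) ^ n * (fact n * a)"
  proof -
    have "(deriv ^^ n) (\<lambda>w. gen_fun ((- \<i>) * w)) 0 = (- \<i>) ^ n * (deriv ^^ n) gen_fun ((- \<i>) * 0)"
      by (rule higher_deriv_compose_linear[OF gen_fun_holomorphic, where S = "ball 0 1"]) (auto simp: norm_mult)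
    moreover have "(deriv ^^ n) gen_fun 0 = fact n * a"
      using gen_fun_expansion[of n] by (simp add: fps_expansion_def a_def field_simps)
    ultimately show ?thesis by (simp add: h_def[abs_def])
  qed
  have sub: "cball 0 r \<subseteq> ball (0 :: complex) 1" using r by auto
  have "((\<lambda>u. h u / (u - 0) ^ Suc n) has_contour_integral (2 * pi * \<i> / fact n * (deriv ^^ n) h 0)) (circlepath 0 r)"
    using r sub by (intro Cauchy_has_contour_integral_higher_derivative_circlepath)
      (auto intro!: holomorphic_on_imp_continuous_on holomorphic_on_subset[OF holh])
  then have "((\<lambda>u. h u / u ^ Suc n) has_contour_integral (2 * pi * \<i> * (- \<i>) ^ n * a)) (part_circlepath 0 r 0 (2 * pi))"
    unfolding dh circlepath_def by (simp add: mult_ac)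
  then have I0: "((\<lambda>t. h (of_real r * cis t) / (of_real r * cis t) ^ Suc n * r * \<i> * cis t) has_integral
      (2 * pi * \<i> * (- \<i>) ^ n * a)) {0..2 * pi}"
    by (subst (asm) has_contour_integral_part_circlepath_iff) auto
  define g where "g x = gen_fun (of_real r * cis x) * cis (- (real n * x))" for x
  have cs: "cis (pi / 2) = \<i>" by (simp add: complex_eq_iff)
  have mi: "cis (- (pi / 2)) = - \<i>" by (simp add: complex_eq_iff)
  have ii: "(- \<i>) ^ n * \<i> ^ n = 1" by (simp flip: power_mult_distrib)
  have I1: "((\<lambda>t. (\<i> ^ n * r ^ n / \<i>) * (h (of_real r * cis t) / (of_real r * cis t) ^ Suc n * r * \<i> * cis t)) has_integral
      (\<i> ^ n * r ^ n / \<i>) * (2 * pi * \<i> * (- \<i>) ^ n * a)) {0..2 * pi}"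
    using I0 by (rule has_integral_mult_right)
  have I2: "(\<i> ^ n * r ^ n / \<i>) * (h (of_real r * cis t) / (of_real r * cis t) ^ Suc n * r * \<i> * cis t) = g (t - pi / 2)" for t
  proof -
    have c: "cis t ^ Suc n = cis t * cis (real n * t)" by (simp add: Complex.DeMoivre)
    have in': "\<i> ^ n = cis (real n * (pi / 2))" unfolding cs[symmetric] Complex.DeMoivre ..
    have "g (t - pi / 2) = h (of_real r * cis t) * (\<i> ^ n * inverse (cis (real n * t)))"
    proof -
      have "cis (t - pi / 2) = - \<i> * cis t" unfolding mi[symmetric] cis_mult by (simp add: algebra_simps)
      moreover have "cis (- (real n * (t - pi / 2))) = \<i> ^ n * inverse (cis (real n * t))"
        unfolding in' cis_inverse cis_mult by (simp add: algebra_simps)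
      ultimately show ?thesis by (simp add: g_def h_def mult_ac)
    qed
    moreover have "(\<i> ^ n * r ^ n / \<i>) * (h (of_real r * cis t) / (of_real r * cis t) ^ Suc n * r * \<i> * cis t)
        = h (of_real r * cis t) * (\<i> ^ n * inverse (cis (real n * t)))"
      unfolding power_mult_distrib c using r by (simp add: field_simps)
    ultimately show ?thesis by simp
  qed
  have I3: "(\<i> ^ n * r ^ n / \<i>) * (2 * pi * \<i> * (- \<i>) ^ n * a) = of_real (2 * pi * r ^ n * of_int (signed_partition_number n f))"
  proof -
    have e1: "(\<i> ^ n * r ^ n / \<i>) * (2 * pi * \<i> * (- \<i>) ^ n * a) = ((- \<i>) ^ n * \<i> ^ n) * (2 * pi * r ^ n * a)"
    proof -
      have *: "(x * y / w) * (c * w * b * a) = (b * x) * (c * y * a)" if "w \<noteq> 0" for x y w b c :: complex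
        using that by (simp add: field_simps)
      show ?thesis by (rule trans[OF *]) (simp, simp only: of_real_mult mult.assoc)
    qed
    show ?thesis unfolding e1 ii by (simp add: a_def)
  qed
  from I1 have "((\<lambda>t. g (t - pi / 2)) has_integral of_real (2 * pi * r ^ n * of_int (signed_partition_number n f))) {0..2 * pi}"
    unfolding I2 I3 .
  then have "((\<lambda>t. g (t - pi / 2)) has_integral of_real (2 * pi * r ^ n * of_int (signed_partition_number n f))) (cbox 0 (2 * pi))"
    by simp
  from has_integral_affinity[OF this, of 1 "pi / 2"]
  have "(g has_integral of_real (2 * pi * r ^ n * of_int (signed_partition_number n f))) ((\<lambda>x. x + - (pi / 2)) ` {0..2 * pi})"
    by simp
  also have "(\<lambda>x. x + - (pi / 2)) ` {0..2 * pi} = {- (pi / 2)..3 * pi / 2}"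
    unfolding image_add_atLeastAtMost' by (simp add: field_simps)
  finally show ?thesis by (simp only: g_def[abs_def])
qed

end

end

section \<open>Radial asymptotics\<close>

lemma summable_power_exp:
  assumes "x > 0" shows "summable (\<lambda>m. real m ^ j * exp (- (real m * x)))"
proof (rule summable_comparison_test')
  show "summable (\<lambda>m. real (Suc m) ^ j * exp (- x) ^ m)"
    using assms by (intro summable_Suc_power_mult) auto
  fix m
  have "exp (- (real m * x)) = exp (- x) ^ m" by (simp flip: exp_of_nat_mult)
  then show "norm (real m ^ j * exp (- (real m * x))) \<le> real (Suc m) ^ j * exp (- x) ^ m"
    by (simp add: mult_right_mono power_mono)
qed

text \<open>Half of the exponential absorbs the power, by \<open>v ^ j \<le> fact j * exp v\<close>
  with \<open>v = Suc m * x / 2\<close>; the other half is a geometric series with sum at most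
  \<open>2 / x\<close>.\<close>

lemma power_exp_sum_bound:
  assumes x: "x > 0"
  shows "x ^ Suc j * (\<Sum>m. real (Suc m) ^ j * exp (- (real (Suc m) * x))) \<le> fact j * 2 ^ Suc j"
proof -
  define y where "y = exp (- x / 2)"
  have y: "0 < y" "y < 1" using x by (auto simp: y_def)
  have le: "x ^ j * (real (Suc m) ^ j * exp (- (real (Suc m) * x))) \<le> fact j * 2 ^ j * (y * y ^ m)" for m
  proof -
    define v where "v = real (Suc m) * x / 2"
    have v: "v > 0" using x by (simp add: v_def)
    have "v ^ j / fact j \<le> exp v"
    proof -
      have "(\<lambda>n. v ^ n /\<^sub>R fact n) sums exp v" by (rule exp_converges)
      then have "sum (\<lambda>n. v ^ n /\<^sub>R fact n) {j} \<le> exp v"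
        using v by (subst sums_unique[OF \<open>_ sums exp v\<close>]) (intro sum_le_suminf, auto simp: sums_iff)
      then show ?thesis by (simp add: divide_inverse mult.commute)
    qed
    then have vj: "v ^ j \<le> fact j * exp v" by (simp add: field_simps)
    have vx: "real (Suc m) * x = 2 * v" by (simp add: v_def)
    have "x ^ j * (real (Suc m) ^ j * exp (- (real (Suc m) * x))) = (real (Suc m) * x) ^ j * exp (- (real (Suc m) * x))"
      by (simp add: power_mult_distrib del: of_nat_Suc)
    also have "\<dots> = 2 ^ j * v ^ j * exp (- (2 * v))" by (simp only: vx power_mult_distrib)
    also have "\<dots> \<le> 2 ^ j * (fact j * exp v) * exp (- (2 * v))"
      using vj by (intro mult_right_mono mult_left_mono) auto
    also have "\<dots> = fact j * 2 ^ j * (exp v * exp (- (2 * v)))" by simp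
    also have "exp v * exp (- (2 * v)) = exp (- v)" by (simp flip: exp_add)
    also have "exp (- v) = y ^ Suc m"
      unfolding y_def exp_of_nat_mult[symmetric] by (simp add: v_def)
    finally show ?thesis by simp
  qed
  have g: "(\<lambda>m. fact j * 2 ^ j * (y * y ^ m)) sums (fact j * 2 ^ j * (y * (1 / (1 - y))))"
    using y by (intro sums_mult geometric_sums) auto
  have sm: "summable (\<lambda>m. real (Suc m) ^ j * exp (- (real (Suc m) * x)))"
    using summable_power_exp[OF x, of j] by (subst summable_Suc_iff)
  have "x ^ j * (\<Sum>m. real (Suc m) ^ j * exp (- (real (Suc m) * x)))
      = (\<Sum>m. x ^ j * (real (Suc m) ^ j * exp (- (real (Suc m) * x))))"
    by (rule suminf_mult[OF sm, symmetric])
  also have "\<dots> \<le> fact j * 2 ^ j * (y * (1 / (1 - y)))"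
    unfolding sums_unique[OF g] by (rule suminf_le[OF le summable_mult[OF sm] sums_summable[OF g]])
  also have "y * (1 / (1 - y)) \<le> 2 / x"
  proof -
    have "1 + x / 2 \<le> exp (x / 2)" by (rule exp_ge_add_one_self)
    then have "y * (1 + x / 2) \<le> y * exp (x / 2)" using y by (intro mult_left_mono) auto
    also have "\<dots> = 1" by (simp add: y_def flip: exp_add)
    finally have "y * x \<le> 2 * (1 - y)" by (simp add: field_simps)
    then show ?thesis using x y by (simp add: field_simps)
  qed
  finally have "x ^ j * (\<Sum>m. real (Suc m) ^ j * exp (- (real (Suc m) * x))) \<le> fact j * 2 ^ j * (2 / x)"
    by (simp add: mult_left_mono)
  then have "x * (x ^ j * (\<Sum>m. real (Suc m) ^ j * exp (- (real (Suc m) * x)))) \<le> x * (fact j * 2 ^ j * (2 / x))"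
    using x by (intro mult_left_mono) auto
  then show ?thesis using x by (simp add: mult_ac)
qed

section \<open>Periodic weights against \<open>m ^ j * exp (- m * x)\<close>\<close>

locale periodic_weights =
  fixes a :: "nat \<Rightarrow> real" and q :: nat
  assumes q_pos: "q > 0" and a_periodic: "a (m + q) = a m" and a_le: "\<bar>a m\<bar> \<le> 1"
begin

definition A :: "nat \<Rightarrow> real \<Rightarrow> real" where
  "A j x = (\<Sum>m. a m * (real m ^ j * exp (- (real m * x))))"

definition mean :: real where "mean = (\<Sum>r<q. a r) / real q"

lemma summable_A: "x > 0 \<Longrightarrow> summable (\<lambda>m. a m * (real m ^ j * exp (- (real m * x))))"
proof (rule summable_comparison_test'[OF summable_power_exp[of x j]])
  fix m
  show "norm (a m * (real m ^ j * exp (- (real m * x)))) \<le> real m ^ j * exp (- (real m * x))"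
    using a_le[of m] by (simp add: abs_mult mult_left_le_one_le)
qed

definition N :: "nat \<Rightarrow> real \<Rightarrow> real" where
  "N j x = (\<Sum>r<q. a r * (real r ^ j * exp (- (real r * x))))"

lemma A_shift:
  assumes x: "x > 0"
  shows "A j x = N j x + exp (- (real q * x)) * (\<Sum>m. a m * ((real m + real q) ^ j * exp (- (real m * x))))"
    and "summable (\<lambda>m. a m * ((real m + real q) ^ j * exp (- (real m * x))))"
proof -
  have e: "a (m + q) * (real (m + q) ^ j * exp (- (real (m + q) * x)))
      = exp (- (real q * x)) * (a m * ((real m + real q) ^ j * exp (- (real m * x))))" for m
    by (simp add: a_periodic algebra_simps exp_diff exp_minus exp_add divide_inverse)
  have s: "summable (\<lambda>m. a (m + q) * (real (m + q) ^ j * exp (- (real (m + q) * x))))"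
    using summable_A[OF x, of j] by (subst summable_iff_shift)
  then have s': "summable (\<lambda>m. exp (- (real q * x)) * (a m * ((real m + real q) ^ j * exp (- (real m * x)))))"
    unfolding e .
  then show sm: "summable (\<lambda>m. a m * ((real m + real q) ^ j * exp (- (real m * x))))"
    by (rule summable_mult_D) simp
  have "A j x = (\<Sum>m. a (m + q) * (real (m + q) ^ j * exp (- (real (m + q) * x)))) + N j x"
    unfolding A_def N_def by (rule suminf_split_initial_segment[OF summable_A[OF x]])
  also have "(\<Sum>m. a (m + q) * (real (m + q) ^ j * exp (- (real (m + q) * x))))
      = exp (- (real q * x)) * (\<Sum>m. a m * ((real m + real q) ^ j * exp (- (real m * x))))"
    unfolding e by (rule suminf_mult[OF sm])
  finally show "A j x = N j x + exp (- (real q * x)) * (\<Sum>m. a m * ((real m + real q) ^ j * exp (- (real m * x))))"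
    by simp
qed

text \<open>Shifting the index by a full period and expanding \<open>(m + q) ^ j\<close> expresses
  \<open>A j\<close> through itself, with the factor \<open>v\<close>, and through lower
  \<open>A i\<close>. Solving for \<open>A j\<close> yields closed forms recursively, in place of
  differentiation.\<close>

lemma A_rec:
  assumes x: "x > 0"
  defines "v \<equiv> exp (- (real q * x))"
  shows "A 0 x = N 0 x / (1 - v)"
    and "A 1 x = (N 1 x + v * (real q * A 0 x)) / (1 - v)"
    and "A 2 x = (N 2 x + v * (2 * real q * A 1 x + (real q)\<^sup>2 * A 0 x)) / (1 - v)"
proof -
  have v: "1 - v \<noteq> 0" using x q_pos by (simp add: v_def)
  have "A 0 x = N 0 x + v * A 0 x"
    using A_shift(1)[OF x, of 0] by (simp add: A_def v_def)
  then show "A 0 x = N 0 x / (1 - v)" using v by (simp add: field_simps)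
  have "(\<lambda>m. a m * (real m ^ 1 * exp (- (real m * x))) + real q * (a m * (real m ^ 0 * exp (- (real m * x)))))
      sums (A 1 x + real q * A 0 x)"
    unfolding A_def by (intro sums_add sums_mult summable_sums summable_A x)
  then have "(\<Sum>m. a m * ((real m + real q) ^ 1 * exp (- (real m * x)))) = A 1 x + real q * A 0 x"
    by (intro sums_unique[symmetric]) (simp add: algebra_simps)
  then have "A 1 x = N 1 x + v * (A 1 x + real q * A 0 x)"
    using A_shift(1)[OF x, of 1] by (simp add: v_def)
  then show "A 1 x = (N 1 x + v * (real q * A 0 x)) / (1 - v)" using v by (simp add: field_simps)
  have "(\<lambda>m. a m * (real m ^ 2 * exp (- (real m * x))) + (2 * real q * (a m * (real m ^ 1 * exp (- (real m * x))))
      + (real q)\<^sup>2 * (a m * (real m ^ 0 * exp (- (real m * x))))))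
      sums (A 2 x + (2 * real q * A 1 x + (real q)\<^sup>2 * A 0 x))"
    unfolding A_def by (intro sums_add sums_mult summable_sums summable_A x)
  then have "(\<Sum>m. a m * ((real m + real q) ^ 2 * exp (- (real m * x)))) = A 2 x + (2 * real q * A 1 x + (real q)\<^sup>2 * A 0 x)"
    by (intro sums_unique[symmetric]) (simp add: algebra_simps power2_eq_square)
  then have "A 2 x = N 2 x + v * (A 2 x + (2 * real q * A 1 x + (real q)\<^sup>2 * A 0 x))"
    using A_shift(1)[OF x, of 2] by (simp add: v_def)
  then show "A 2 x = (N 2 x + v * (2 * real q * A 1 x + (real q)\<^sup>2 * A 0 x)) / (1 - v)" using v by (simp add: field_simps)
qed

text \<open>Each division by \<open>1 - v\<close>, which is \<open>q * x\<close> to first order,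
  produces one more factor \<open>1 / x\<close>; the limits are
  \<open>fact j * mean\<close>.\<close>

lemma tendsto_A:
  shows "((\<lambda>x. x * A 0 x) \<longlongrightarrow> mean) (at_right 0)"
    and "((\<lambda>x. x\<^sup>2 * A 1 x) \<longlongrightarrow> mean) (at_right 0)"
    and "((\<lambda>x. x ^ 3 * A 2 x) \<longlongrightarrow> 2 * mean) (at_right 0)"
proof -
  define v where "v x = exp (- (real q * x))" for x
  have q: "real q > 0" using q_pos by simp
  have w: "((\<lambda>x. x / (1 - v x)) \<longlongrightarrow> inverse (real q)) (at_right 0)"
    unfolding v_def using q by real_asymp
  have v1: "(v \<longlongrightarrow> 1) (at_right 0)"
    unfolding v_def using q by real_asymp
  have x0: "((\<lambda>x. x) \<longlongrightarrow> (0::real)) (at_right 0)" by (rule tendsto_ident_at)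
  have NN: "(N j \<longlongrightarrow> (\<Sum>r<q. a r * (real r ^ j * exp (- (real r * 0))))) (at_right 0)" for j
    unfolding N_def by (intro tendsto_intros)
  have pos: "\<forall>\<^sub>F x in at_right (0::real). x > 0" by (rule eventually_at_right_less)
  have "((\<lambda>x. x / (1 - v x) * N 0 x) \<longlongrightarrow> inverse (real q) * (\<Sum>r<q. a r * (real r ^ 0 * exp (- (real r * 0))))) (at_right 0)"
    by (intro tendsto_mult w NN)
  moreover have "\<forall>\<^sub>F x in at_right 0. x / (1 - v x) * N 0 x = x * A 0 x"
    using pos by eventually_elim (simp add: A_rec(1) v_def)
  ultimately have "((\<lambda>x. x * A 0 x) \<longlongrightarrow> inverse (real q) * (\<Sum>r<q. a r * (real r ^ 0 * exp (- (real r * 0))))) (at_right 0)"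
    by (rule Lim_transform_eventually)
  then show l0: "((\<lambda>x. x * A 0 x) \<longlongrightarrow> mean) (at_right 0)"
    by (simp add: mean_def divide_inverse mult.commute)
  have "((\<lambda>x. x / (1 - v x) * (x * N 1 x + v x * (real q * (x * A 0 x)))) \<longlongrightarrow>
      inverse (real q) * (0 * (\<Sum>r<q. a r * (real r ^ 1 * exp (- (real r * 0)))) + 1 * (real q * mean))) (at_right 0)"
    by (intro tendsto_mult tendsto_add tendsto_const w NN v1 l0 x0)
  moreover have "\<forall>\<^sub>F x in at_right 0. x / (1 - v x) * (x * N 1 x + v x * (real q * (x * A 0 x))) = x\<^sup>2 * A 1 x"
    using pos
  proof eventually_elim
    case (elim x)
    show ?case unfolding A_rec(2)[OF elim]
      by (simp add: v_def power2_eq_square algebra_simps add_divide_distrib)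
  qed
  ultimately have "((\<lambda>x. x\<^sup>2 * A 1 x) \<longlongrightarrow> inverse (real q) * (0 * (\<Sum>r<q. a r * (real r ^ 1 * exp (- (real r * 0)))) + 1 * (real q * mean))) (at_right 0)"
    by (rule Lim_transform_eventually)
  moreover have "inverse (real q) * (real q * mean) = mean" using q by simp
  ultimately show l1: "((\<lambda>x. x\<^sup>2 * A 1 x) \<longlongrightarrow> mean) (at_right 0)" by simp
  have "((\<lambda>x. x / (1 - v x) * (x\<^sup>2 * N 2 x + v x * (2 * real q * (x\<^sup>2 * A 1 x) + (real q)\<^sup>2 * (x * (x * A 0 x))))) \<longlongrightarrow>
      inverse (real q) * (0\<^sup>2 * (\<Sum>r<q. a r * (real r ^ 2 * exp (- (real r * 0)))) + 1 * (2 * real q * mean + (real q)\<^sup>2 * (0 * mean)))) (at_right 0)"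
    by (intro tendsto_mult tendsto_add tendsto_const tendsto_power w NN v1 l0 l1 x0)
  moreover have "\<forall>\<^sub>F x in at_right 0. x / (1 - v x) * (x\<^sup>2 * N 2 x + v x * (2 * real q * (x\<^sup>2 * A 1 x) + (real q)\<^sup>2 * (x * (x * A 0 x)))) = x ^ 3 * A 2 x"
    using pos
  proof eventually_elim
    case (elim x)
    show ?case unfolding A_rec(3)[OF elim]
      by (simp add: v_def power2_eq_square power3_eq_cube algebra_simps add_divide_distrib)
  qed
  ultimately have "((\<lambda>x. x ^ 3 * A 2 x) \<longlongrightarrow> inverse (real q) * (0\<^sup>2 * (\<Sum>r<q. a r * (real r ^ 2 * exp (- (real r * 0)))) + 1 * (2 * real q * mean + (real q)\<^sup>2 * (0 * mean)))) (at_right 0)"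
    by (rule Lim_transform_eventually)
  moreover have "inverse (real q) * (2 * real q * mean) = 2 * mean" using q by simp
  ultimately show "((\<lambda>x. x ^ 3 * A 2 x) \<longlongrightarrow> 2 * mean) (at_right 0)" by simp
qed

lemma A_bound:
  assumes "x > 0" "a 0 = 0"
  shows "\<bar>x ^ Suc j * A j x\<bar> \<le> fact j * 2 ^ Suc j"
    and "A j x = (\<Sum>m. a (Suc m) * (real (Suc m) ^ j * exp (- (real (Suc m) * x))))"
proof -
  show e: "A j x = (\<Sum>m. a (Suc m) * (real (Suc m) ^ j * exp (- (real (Suc m) * x))))"
    using suminf_split_head[OF summable_A[OF assms(1), of j]] assms(2) by (simp add: A_def)
  have s: "summable (\<lambda>m. real (Suc m) ^ j * exp (- (real (Suc m) * x)))"
    using summable_power_exp[OF assms(1), of j] by (subst summable_Suc_iff)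
  have "\<bar>A j x\<bar> \<le> (\<Sum>m. real (Suc m) ^ j * exp (- (real (Suc m) * x)))"
  proof -
    have "norm (\<Sum>m. a (Suc m) * (real (Suc m) ^ j * exp (- (real (Suc m) * x)))) \<le> (\<Sum>m. real (Suc m) ^ j * exp (- (real (Suc m) * x)))"
    proof (rule norm_suminf_le[OF _ s])
      fix m
      show "norm (a (Suc m) * (real (Suc m) ^ j * exp (- (real (Suc m) * x)))) \<le> real (Suc m) ^ j * exp (- (real (Suc m) * x))"
        using a_le[of "Suc m"] by (simp add: abs_mult mult_left_le_one_le del: of_nat_Suc)
    qed
    then show ?thesis by (simp add: e)
  qed
  then have "x ^ Suc j * \<bar>A j x\<bar> \<le> x ^ Suc j * (\<Sum>m. real (Suc m) ^ j * exp (- (real (Suc m) * x)))"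
    using assms(1) by (intro mult_left_mono) auto
  also have "\<dots> \<le> fact j * 2 ^ Suc j" by (rule power_exp_sum_bound[OF assms(1)])
  finally show "\<bar>x ^ Suc j * A j x\<bar> \<le> fact j * 2 ^ Suc j"
    using assms(1) by (simp add: abs_mult del: power_Suc)
qed

end

lemma inverse_Suc_squares_sums: "(\<lambda>n. 1 / (real (Suc n))\<^sup>2) sums (pi\<^sup>2 / 6)"
  using inverse_squares_sums by (simp add: add.commute)

section \<open>The logarithm of the generating function on the rays towards 1 and -1\<close>

context odd_prime
begin

abbreviation lc :: "nat \<Rightarrow> real" where
  "lc \<equiv> log_coeff (legendre_char p)"

lemma legendre_char_le: "\<bar>legendre_char p n\<bar> \<le> 1"
  using legendre_char_values[of n] by auto

lemma lc_eq: "lc (Suc n) = (\<Sum>d | d dvd Suc n. chi d ^ (Suc n div d) / real (Suc n div d))"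
proof -
  have "lc (Suc n) = (\<Sum>d | d dvd Suc n. real d * chi d ^ (Suc n div d) / real (Suc n))"
    by (simp add: log_coeff_def divisor_coeff_def chi_def sum_divide_distrib)
  also have "\<dots> = (\<Sum>d | d dvd Suc n. chi d ^ (Suc n div d) / real (Suc n div d))"
  proof (rule sum.cong)
    fix d assume "d \<in> {d. d dvd Suc n}"
    then obtain c where c: "Suc n = d * c" by (auto elim: dvdE)
    then have "d > 0" "c > 0" by (auto intro!: Nat.gr0I)
    then show "real d * chi d ^ (Suc n div d) / real (Suc n) = chi d ^ (Suc n div d) / real (Suc n div d)"
      unfolding c by simp
  qed simp
  finally show ?thesis .
qed

lemma (in -) divisor_involution:
  fixes g :: "nat \<Rightarrow> nat \<Rightarrow> 'a::comm_monoid_add"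
  shows "(\<Sum>d | d dvd Suc n. g (Suc n div d) d) = (\<Sum>d | d dvd Suc n. g d (Suc n div d))"
proof -
  have dd: "Suc n div (Suc n div d) = d" if "d dvd Suc n" for d
  proof -
    obtain c where c: "Suc n = d * c" using \<open>d dvd Suc n\<close> by (rule dvdE)
    then have "d > 0" "c > 0" by (auto intro!: Nat.gr0I)
    then show ?thesis unfolding c by simp
  qed
  show ?thesis
    by (rule sum.reindex_bij_witness[of _ "\<lambda>d. Suc n div d" "\<lambda>d. Suc n div d"]) (auto simp: dd)
qed

lemma abs_chi_power_div_le: "\<bar>chi m ^ k / real k\<bar> \<le> 1"
proof (cases "k = 0")
  case False
  have "\<bar>chi m\<bar> ^ k \<le> 1" by (rule power_le_one[OF abs_ge_zero abs_chi_le_1])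
  then have "\<bar>chi m\<bar> ^ k / real k \<le> 1 / 1" using False by (intro frac_le) auto
  then show ?thesis by (simp add: power_abs)
qed simp

text \<open>The weight \<open>\<phi>\<close> is general because it is later both
  \<open>n ^ j * s ^ n * exp (- n * t)\<close> and \<open>z ^ n\<close>. The last claim sums in the
  other order and comes from the transposed \<open>g\<close>, with divisors and cofactors
  exchanged.\<close>

lemma lc_sums:
  fixes \<phi> :: "nat \<Rightarrow> 'a::{real_normed_field, banach}"
  assumes r: "0 \<le> r" "r < 1" and \<phi>: "\<And>n. norm (\<phi> (Suc n)) \<le> C * real (Suc n) ^ j * r ^ Suc n"
  shows "(\<lambda>n. of_real (lc (Suc n)) * \<phi> (Suc n)) sums
      (\<Sum>k. \<Sum>m. of_real (chi (Suc m) ^ Suc k / real (Suc k)) * \<phi> (Suc k * Suc m))"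
    and "summable (\<lambda>k. \<Sum>m. of_real (chi (Suc m) ^ Suc k / real (Suc k)) * \<phi> (Suc k * Suc m))"
    and "summable (\<lambda>m. of_real (chi (Suc m) ^ Suc k / real (Suc k)) * \<phi> (Suc k * Suc m))"
    and "(\<lambda>n. of_real (lc (Suc n)) * \<phi> (Suc n)) sums
      (\<Sum>m. \<Sum>k. of_real (chi (Suc m) ^ Suc k / real (Suc k)) * \<phi> (Suc k * Suc m))"
proof -
  define g where "g k m = (of_real (chi m ^ k / real k) :: 'a) * \<phi> (k * m)" for k m
  have b: "norm (g (Suc k) (Suc m)) \<le> C * real (Suc k * Suc m) ^ j * r ^ (Suc k * Suc m)" for k m
  proof -
    have "norm (g (Suc k) (Suc m)) \<le> 1 * norm (\<phi> (Suc k * Suc m))"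
      unfolding g_def norm_mult norm_of_real
      by (intro mult_right_mono abs_chi_power_div_le norm_ge_zero)
    also have "\<dots> \<le> C * real (Suc k * Suc m) ^ j * r ^ (Suc k * Suc m)"
      using \<phi>[of "Suc k * Suc m - 1"] by (simp del: power_Suc of_nat_Suc)
    finally show ?thesis .
  qed
  have b': "norm (g (Suc m) (Suc k)) \<le> C * real (Suc k * Suc m) ^ j * r ^ (Suc k * Suc m)" for k m
    using b[of m k] by (simp only: mult.commute)
  note S = sums_over_divisors[where g = g, OF summable_on_pairs[OF r b]]
  note S' = sums_over_divisors[where g = "\<lambda>m k. g k m", OF summable_on_pairs[OF r b']]
  have e: "(\<Sum>d | d dvd Suc n. g (Suc n div d) d) = of_real (lc (Suc n)) * \<phi> (Suc n)" for n
  proof -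
    have "(\<Sum>d | d dvd Suc n. g (Suc n div d) d)
        = (\<Sum>d | d dvd Suc n. of_real (chi d ^ (Suc n div d) / real (Suc n div d)) * \<phi> (Suc n))"
      by (rule sum.cong) (auto simp: g_def)
    also have "\<dots> = of_real (lc (Suc n)) * \<phi> (Suc n)"
      unfolding lc_eq of_real_sum sum_distrib_right ..
    finally show ?thesis .
  qed
  show "(\<lambda>n. of_real (lc (Suc n)) * \<phi> (Suc n)) sums
      (\<Sum>k. \<Sum>m. of_real (chi (Suc m) ^ Suc k / real (Suc k)) * \<phi> (Suc k * Suc m))"
    using S(1) unfolding e unfolding g_def .
  show "summable (\<lambda>k. \<Sum>m. of_real (chi (Suc m) ^ Suc k / real (Suc k)) * \<phi> (Suc k * Suc m))"
    using S(2) unfolding g_def .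
  show "summable (\<lambda>m. of_real (chi (Suc m) ^ Suc k / real (Suc k)) * \<phi> (Suc k * Suc m))"
    using S(3) unfolding g_def .
  have e': "(\<Sum>d | d dvd Suc n. g d (Suc n div d)) = of_real (lc (Suc n)) * \<phi> (Suc n)" for n
    unfolding divisor_involution[of g n, symmetric] by (rule e)
  show "(\<lambda>n. of_real (lc (Suc n)) * \<phi> (Suc n)) sums
      (\<Sum>m. \<Sum>k. of_real (chi (Suc m) ^ Suc k / real (Suc k)) * \<phi> (Suc k * Suc m))"
    using S'(1) unfolding e' unfolding g_def .
qed

text \<open>\<open>(-1) ^ j\<close> times the \<open>j\<close>-th derivative in \<open>t\<close> of
  the logarithm of the generating function at \<open>s * exp (- t)\<close>.\<close>

definition B :: "nat \<Rightarrow> real \<Rightarrow> real \<Rightarrow> real" where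
  "B j s t = (\<Sum>n. lc (Suc n) * (real (Suc n) ^ j * (s ^ Suc n * exp (- (real (Suc n) * t)))))"

definition main_const :: real where
  "main_const = (1 - 1 / real p) * pi\<^sup>2 / 24"

lemma main_const_pos: "main_const > 0"
  using p_ge_3 by (simp add: main_const_def)

lemma (in -) exp_mult_power: "exp (- (real n * t)) = exp (- t) ^ n"
  by (simp flip: exp_of_nat_mult)

lemma B_term_bound:
  assumes "s = 1 \<or> s = -1"
  shows "norm (real (Suc n) ^ j * (s ^ Suc n * exp (- (real (Suc n) * t)))) \<le> 1 * real (Suc n) ^ j * exp (- t) ^ Suc n"
proof -
  have "\<bar>s\<bar> ^ Suc n = 1" using assms by auto
  then show ?thesis unfolding exp_mult_power by (simp add: abs_mult power_abs del: power_Suc of_nat_Suc)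
qed

lemma B_sums:
  assumes t: "t > 0" and s: "s = 1 \<or> s = -1"
  shows "(\<lambda>n. lc (Suc n) * (real (Suc n) ^ j * (s ^ Suc n * exp (- (real (Suc n) * t))))) sums B j s t"
    and "(\<lambda>k. \<Sum>m. chi (Suc m) ^ Suc k / real (Suc k) * (real (Suc k * Suc m) ^ j * (s ^ (Suc k * Suc m) * exp (- (real (Suc k * Suc m) * t)))))
      sums B j s t"
proof -
  have r: "0 \<le> exp (- t)" "exp (- t) < 1" using t by auto
  note L = lc_sums[where \<phi> = "\<lambda>n. real n ^ j * (s ^ n * exp (- (real n * t)))", OF r B_term_bound[OF s]]
  show 1: "(\<lambda>n. lc (Suc n) * (real (Suc n) ^ j * (s ^ Suc n * exp (- (real (Suc n) * t))))) sums B j s t"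
    using L(1) unfolding B_def by (simp only: sums_iff of_real_eq_id id_apply)
  have "(\<Sum>k. \<Sum>m. chi (Suc m) ^ Suc k / real (Suc k) * (real (Suc k * Suc m) ^ j * (s ^ (Suc k * Suc m) * exp (- (real (Suc k * Suc m) * t)))))
      = B j s t"
    using sums_unique2[OF L(1)[unfolded of_real_eq_id id_apply] 1] .
  then show "(\<lambda>k. \<Sum>m. chi (Suc m) ^ Suc k / real (Suc k) * (real (Suc k * Suc m) ^ j * (s ^ (Suc k * Suc m) * exp (- (real (Suc k * Suc m) * t)))))
      sums B j s t"
    using L(2) by (simp only: sums_iff of_real_eq_id id_apply)
qed

text \<open>Index \<open>k\<close> belongs to the power \<open>Suc k\<close>, so the even powers of
  \<open>chi\<close> are those with odd \<open>k\<close>.\<close>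

definition kth_weight :: "nat \<Rightarrow> real \<Rightarrow> nat \<Rightarrow> real" where
  "kth_weight k s m = chi m ^ Suc k * s ^ (Suc k * m)"

lemma periodic_kth_weight:
  assumes s: "s = 1 \<or> s = -1"
  shows "periodic_weights (kth_weight k s) (2 * p)"
proof
  show "2 * p > 0" by simp
  show "kth_weight k s (m + 2 * p) = kth_weight k s m" for m
  proof -
    have "chi (m + 2 * p) = chi m" using chi_add_p_mult(1)[of m 2] by (simp only: mult.commute)
    moreover have "s ^ (Suc k * (m + 2 * p)) = s ^ (Suc k * m)"
      using s by (elim disjE) (simp, simp add: minus_one_power_iff del: mult_Suc)
    ultimately show ?thesis by (simp only: kth_weight_def)
  qed
  show "\<bar>kth_weight k s m\<bar> \<le> 1" for m
  proof -
    have "\<bar>chi m\<bar> ^ Suc k \<le> 1" by (rule power_le_one[OF abs_ge_zero abs_chi_le_1])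
    moreover have "\<bar>s\<bar> ^ (Suc k * m) = 1" using s by auto
    ultimately show ?thesis by (simp add: kth_weight_def abs_mult power_abs del: power_Suc)
  qed
qed

lemma kth_weight_0: "kth_weight k s 0 = 0"
  by (simp add: kth_weight_def)

text \<open>An even power of \<open>chi\<close> is the principal character, of density
  \<open>1 - 1 / p\<close>. For odd powers the two halves of the period combine to
  \<open>(1 + s ^ p) * (\<Sum>r<p. chi r * s ^ r)\<close>, where the first factor vanishes for
  \<open>s = -1\<close> and the second for \<open>s = 1\<close>.\<close>

lemma mean_kth_weight:
  assumes s: "s = 1 \<or> s = -1"
  shows "periodic_weights.mean (kth_weight k s) (2 * p) = (if odd k then 1 - 1 / real p else 0)"
proof (cases "odd k")
  case True
  have "kth_weight k s m = (if p dvd m then 0 else 1)" for m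
  proof -
    obtain i' where "k = 2 * i' + 1" using True by (rule oddE)
    define i where "i = Suc i'"
    have i: "Suc k = 2 * i" "i > 0" using \<open>k = _\<close> by (simp_all add: i_def)
    have "s ^ (Suc k * m) = 1" using s unfolding i by (auto simp: power_mult)
    moreover have "chi m ^ Suc k = (if p dvd m then 0 else 1)"
      unfolding i(1) power_mult using i(2) chi_power2[of m] chi_eq_0_iff[of m] by auto
    ultimately show ?thesis by (simp add: kth_weight_def del: power_Suc)
  qed
  then have "(\<Sum>r<2 * p. kth_weight k s r) = (\<Sum>r<p. if p dvd r then 0 else 1) + (\<Sum>r<p. if p dvd (r + p) then 0 else 1)"
    unfolding sum_lessThan_double by simp
  also have "(\<Sum>r<p. if p dvd (r + p) then 0 else 1 :: real) = (\<Sum>r<p. if p dvd r then 0 else 1)" by simp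
  also have "(\<Sum>r<p. if p dvd r then 0 else 1 :: real) = (\<Sum>r<p. 1 - (if r = 0 then 1 else 0))"
    by (rule sum.cong) (auto dest: nat_dvd_not_less)
  also have "\<dots> = real p - 1" by (simp add: sum_subtractf)
  finally have "(\<Sum>r<2 * p. kth_weight k s r) = 2 * (real p - 1)" by simp
  then show ?thesis using True p_pos
    unfolding periodic_weights.mean_def[OF periodic_kth_weight[OF s]] by (simp add: field_simps)
next
  case False
  have c: "chi m ^ Suc k = chi m" for m
    using chi_values[of m] False by auto
  have s2: "s ^ (Suc k * m) = s ^ m" for m
  proof -
    have "s ^ Suc k = s" using s False by auto
    then show ?thesis by (simp only: power_mult)
  qed
  have sp: "s ^ (m + p) = s ^ p * s ^ m" for m by (simp add: power_add)
  have "(\<Sum>r<2 * p. kth_weight k s r) = (\<Sum>r<p. chi r * s ^ r) + (\<Sum>r<p. chi (r + p) * s ^ (r + p))"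
    unfolding sum_lessThan_double kth_weight_def c s2 ..
  also have "\<dots> = (1 + s ^ p) * (\<Sum>r<p. chi r * s ^ r)"
    unfolding sp chi_add_p by (simp add: sum_distrib_left sum.distrib algebra_simps)
  also have "\<dots> = 0" using s sum_chi odd_p by auto
  finally show ?thesis using False
    unfolding periodic_weights.mean_def[OF periodic_kth_weight[OF s]] by simp
qed

text \<open>Only the even powers \<open>2 * i + 2\<close> count, and the sum of
  \<open>1 / (2 * i + 2)\<^sup>2\<close> is \<open>pi\<^sup>2 / 24\<close>.\<close>

lemma main_const_sums: "(\<lambda>k. (if odd k then 1 - 1 / real p else 0) / (real (Suc k))\<^sup>2) sums main_const"
proof -
  have S: "(\<lambda>i. (1 - 1 / real p) / 4 * (1 / (real (Suc i))\<^sup>2)) sums ((1 - 1 / real p) / 4 * (pi\<^sup>2 / 6))"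
    by (intro sums_mult inverse_Suc_squares_sums)
  have E: "(1 - 1 / real p) / 4 * (1 / (real (Suc i))\<^sup>2) = (if odd (2 * i + 1) then 1 - 1 / real p else 0) / (real (Suc (2 * i + 1)))\<^sup>2" for i
  proof -
    have e: "real (Suc (2 * i + 1)) = 2 * real (Suc i)" by simp
    show ?thesis unfolding e power_mult_distrib by simp
  qed
  have "(1 - 1 / real p) / 4 * (pi\<^sup>2 / 6) = main_const" by (simp add: main_const_def)
  then have "(\<lambda>i. (if odd (2 * i + 1) then 1 - 1 / real p else 0) / (real (Suc (2 * i + 1)))\<^sup>2) sums main_const"
    using S unfolding E by (simp only:)
  then show ?thesis
    by (subst (asm) sums_mono_reindex[of "\<lambda>i. 2 * i + 1" "\<lambda>k. (if odd k then 1 - 1 / real p else 0) / (real (Suc k))\<^sup>2"])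
       (auto simp: strict_mono_def elim!: oddE)
qed

text \<open>With \<open>x = Suc k * t\<close>, the inner sum for \<open>k\<close> times
  \<open>t ^ Suc j\<close> is \<open>x ^ Suc j * A j x / (Suc k)\<^sup>2\<close>, whose numerator is
  bounded uniformly in \<open>x\<close> and \<open>k\<close>; Tannery's theorem then passes to the
  limit under the sum over \<open>k\<close>.\<close>

lemma tendsto_B_aux:
  assumes s: "s = 1 \<or> s = -1"
    and lim: "\<And>k. ((\<lambda>x. x ^ Suc j * periodic_weights.A (kth_weight k s) j x) \<longlongrightarrow>
        C * periodic_weights.mean (kth_weight k s) (2 * p)) (at_right 0)"
  shows "((\<lambda>t. t ^ Suc j * B j s t) \<longlongrightarrow> C * main_const) (at_right 0)"
proof -
  define A where "A k = periodic_weights.A (kth_weight k s) j" for k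
  note pw = periodic_kth_weight[OF s]
  define h where "h k t = ((real (Suc k) * t) ^ Suc j * A k (real (Suc k) * t)) / (real (Suc k))\<^sup>2" for k t
  define c where "c k = (if odd k then 1 - 1 / real p else 0) / (real (Suc k))\<^sup>2" for k
  have hl: "((\<lambda>t. h k t) \<longlongrightarrow> C * c k) (at_right 0)" for k
  proof -
    have "filterlim (\<lambda>t. real (Suc k) * t) (at_right 0) (at_right 0)" by real_asymp
    from filterlim_compose[OF lim[of k] this]
    have "((\<lambda>t. (real (Suc k) * t) ^ Suc j * A k (real (Suc k) * t)) \<longlongrightarrow> C * (if odd k then 1 - 1 / real p else 0)) (at_right 0)"
      unfolding A_def mean_kth_weight[OF s] .
    then have "((\<lambda>t. ((real (Suc k) * t) ^ Suc j * A k (real (Suc k) * t)) / (real (Suc k))\<^sup>2) \<longlongrightarrow> C * (if odd k then 1 - 1 / real p else 0) / (real (Suc k))\<^sup>2) (at_right 0)"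
      by (intro tendsto_divide tendsto_const) auto
    then show ?thesis by (simp only: h_def c_def times_divide_eq_right)
  qed
  have hb: "\<forall>\<^sub>F (k, t) in at_top \<times>\<^sub>F at_right 0. norm (h k t) \<le> fact j * 2 ^ Suc j * (1 / (real (Suc k))\<^sup>2)"
    using eventually_prodI[OF eventually_True[of at_top] eventually_at_right_less[of "0::real"]]
  proof eventually_elim
    case (elim x)
    obtain k t where x: "x = (k, t)" by (cases x)
    have kt: "real (Suc k) * t > 0" using elim x by simp
    have "\<bar>(real (Suc k) * t) ^ Suc j * A k (real (Suc k) * t)\<bar> \<le> fact j * 2 ^ Suc j"
      unfolding A_def by (rule periodic_weights.A_bound(1)[OF pw kt kth_weight_0])
    then have "\<bar>(real (Suc k) * t) ^ Suc j * A k (real (Suc k) * t)\<bar> / (real (Suc k))\<^sup>2 \<le> fact j * 2 ^ Suc j / (real (Suc k))\<^sup>2"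
      by (rule divide_right_mono) simp
    then show ?case unfolding x h_def by (simp add: abs_divide del: of_nat_Suc power_Suc)
  qed
  have hs: "summable (\<lambda>k. fact j * 2 ^ Suc j * (1 / (real (Suc k))\<^sup>2))"
    by (intro summable_mult sums_summable[OF inverse_Suc_squares_sums])
  have T: "((\<lambda>t. \<Sum>k. h k t) \<longlongrightarrow> (\<Sum>k. C * c k)) (at_right 0)"
    using tannerys_theorem[where a = h and b = "\<lambda>k. C * c k", OF hl hb hs trivial_limit_at_right_real] by blast
  have "\<forall>\<^sub>F t in at_right 0. (\<Sum>k. h k t) = t ^ Suc j * B j s t"
    using eventually_at_right_less[of "0::real"]
  proof eventually_elim
    case (elim t)
    have "(\<Sum>m. chi (Suc m) ^ Suc k / real (Suc k) * (real (Suc k * Suc m) ^ j * (s ^ (Suc k * Suc m) * exp (- (real (Suc k * Suc m) * t)))))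
        = real (Suc k) ^ j / real (Suc k) * A k (real (Suc k) * t)" for k
    proof -
      define x where "x = real (Suc k) * t"
      have x: "x > 0" using elim by (simp add: x_def)
      have sm: "summable (\<lambda>m. kth_weight k s (Suc m) * (real (Suc m) ^ j * exp (- (real (Suc m) * x))))"
        using periodic_weights.summable_A[where j = j, OF pw x] by (subst summable_Suc_iff)
      have "chi (Suc m) ^ Suc k / real (Suc k) * (real (Suc k * Suc m) ^ j * (s ^ (Suc k * Suc m) * exp (- (real (Suc k * Suc m) * t))))
          = real (Suc k) ^ j / real (Suc k) * (kth_weight k s (Suc m) * (real (Suc m) ^ j * exp (- (real (Suc m) * x))))" for m
        unfolding kth_weight_def of_nat_mult power_mult_distrib x_def by (simp add: mult_ac del: of_nat_Suc power_Suc)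
      then show ?thesis
        unfolding A_def periodic_weights.A_bound(2)[OF pw x kth_weight_0] x_def[symmetric]
        by (simp only: suminf_mult[OF sm])
    qed
    then have "(\<lambda>k. real (Suc k) ^ j / real (Suc k) * A k (real (Suc k) * t)) sums B j s t"
      using B_sums(2)[OF elim s, of j] by (simp only:)
    then have "(\<lambda>k. t ^ Suc j * (real (Suc k) ^ j / real (Suc k) * A k (real (Suc k) * t))) sums (t ^ Suc j * B j s t)"
      by (rule sums_mult)
    moreover have "t ^ Suc j * (real (Suc k) ^ j / real (Suc k) * A k (real (Suc k) * t)) = h k t" for k
    proof -
      have "X ^ j / X = X ^ Suc j / X\<^sup>2" if "X > 0" for X :: real
        using that by (simp add: power2_eq_square)
      from this[of "real (Suc k)"] show ?thesis
        unfolding h_def power_mult_distrib by (simp del: of_nat_Suc power_Suc)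
    qed
    ultimately show ?case by (simp add: sums_iff)
  qed
  from Lim_transform_eventually[OF T this]
  have "((\<lambda>t. t ^ Suc j * B j s t) \<longlongrightarrow> (\<Sum>k. C * c k)) (at_right 0)" .
  moreover have "(\<Sum>k. C * c k) = C * main_const"
    using sums_mult[OF main_const_sums, of C] unfolding c_def by (simp add: sums_iff)
  ultimately show ?thesis by simp
qed

lemma tendsto_B:
  assumes s: "s = 1 \<or> s = -1"
  shows "((\<lambda>t. t * B 0 s t) \<longlongrightarrow> main_const) (at_right 0)"
    and "((\<lambda>t. t\<^sup>2 * B 1 s t) \<longlongrightarrow> main_const) (at_right 0)"
    and "((\<lambda>t. t ^ 3 * B 2 s t) \<longlongrightarrow> 2 * main_const) (at_right 0)"
proof -
  note pt = periodic_weights.tendsto_A[OF periodic_kth_weight[OF s]]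
  show "((\<lambda>t. t * B 0 s t) \<longlongrightarrow> main_const) (at_right 0)"
    using tendsto_B_aux[OF s, of 0 1] pt(1) by simp
  show "((\<lambda>t. t\<^sup>2 * B 1 s t) \<longlongrightarrow> main_const) (at_right 0)"
    using tendsto_B_aux[OF s, of 1 1] pt(2) by (simp add: power2_eq_square)
  show "((\<lambda>t. t ^ 3 * B 2 s t) \<longlongrightarrow> 2 * main_const) (at_right 0)"
    using tendsto_B_aux[OF s, of 2 2] pt(3) by (simp only: eval_nat_numeral)
qed

text \<open>This serves the cubic Taylor remainder in the angle. With \<open>chi\<close> bounded by
  1, the row for \<open>k\<close> is at most a multiple of
  \<open>1 / (t ^ 4 * (Suc k)\<^sup>2)\<close>.\<close>

lemma abs_lc_cube_sum_bound:
  "\<exists>C>0. \<forall>t>0. summable (\<lambda>n. \<bar>lc (Suc n)\<bar> * (real (Suc n) ^ 3 * exp (- (real (Suc n) * t))))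
     \<and> (\<Sum>n. \<bar>lc (Suc n)\<bar> * (real (Suc n) ^ 3 * exp (- (real (Suc n) * t)))) \<le> C / t ^ 4"
proof -
  define Z where "Z = (\<Sum>k. 1 / (real (Suc k))\<^sup>2)"
  have Zs: "summable (\<lambda>k. 1 / (real (Suc k))\<^sup>2)"
    by (rule sums_summable[OF inverse_Suc_squares_sums])
  define C where "C = fact 3 * 2 ^ 4 * Z"
  have "Z > 0" unfolding Z_def by (rule suminf_pos[OF Zs]) simp
  then have C: "C > 0" by (simp add: C_def)
  have main: "summable (\<lambda>n. \<bar>lc (Suc n)\<bar> * (real (Suc n) ^ 3 * exp (- (real (Suc n) * t))))
     \<and> (\<Sum>n. \<bar>lc (Suc n)\<bar> * (real (Suc n) ^ 3 * exp (- (real (Suc n) * t)))) \<le> C / t ^ 4" if t: "t > 0" for t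
  proof -
    define g where "g k m = 1 / real k * (real (k * m) ^ 3 * exp (- (real (k * m) * t)))" for k m :: nat
    have b: "norm (g (Suc k) (Suc m)) \<le> 1 * real (Suc k * Suc m) ^ 3 * exp (- t) ^ (Suc k * Suc m)" for k m
    proof -
      have "1 / real (Suc k) * (real (Suc k * Suc m) ^ 3 * exp (- (real (Suc k * Suc m) * t)))
          \<le> 1 * (real (Suc k * Suc m) ^ 3 * exp (- (real (Suc k * Suc m) * t)))"
        by (intro mult_right_mono) auto
      then show ?thesis unfolding g_def exp_mult_power
        by (simp add: abs_mult abs_of_nonneg del: power_Suc of_nat_Suc of_nat_mult mult_Suc mult_Suc_right)
    qed
    note S = sums_over_divisors[where g = g, OF summable_on_pairs[OF _ _ b]]
    have S1: "(\<lambda>n. \<Sum>d | d dvd Suc n. g (Suc n div d) d) sums (\<Sum>k. \<Sum>m. g (Suc k) (Suc m))"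
      "summable (\<lambda>k. \<Sum>m. g (Suc k) (Suc m))"
      by (rule S; use t in simp)+
    have le: "\<bar>lc (Suc n)\<bar> * (real (Suc n) ^ 3 * exp (- (real (Suc n) * t))) \<le> (\<Sum>d | d dvd Suc n. g (Suc n div d) d)" for n
    proof -
      have "\<bar>lc (Suc n)\<bar> \<le> (\<Sum>d | d dvd Suc n. 1 / real (Suc n div d))"
        unfolding lc_eq
      proof (rule order_trans[OF sum_abs sum_mono])
        fix d
        have "\<bar>chi d\<bar> ^ (Suc n div d) \<le> 1" by (rule power_le_one[OF abs_ge_zero abs_chi_le_1])
        then have "\<bar>chi d\<bar> ^ (Suc n div d) / real (Suc n div d) \<le> 1 / real (Suc n div d)"
          by (rule divide_right_mono) simp
        then show "\<bar>chi d ^ (Suc n div d) / real (Suc n div d)\<bar> \<le> 1 / real (Suc n div d)"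
          by (simp add: power_abs)
      qed
      then have "\<bar>lc (Suc n)\<bar> * (real (Suc n) ^ 3 * exp (- (real (Suc n) * t)))
          \<le> (\<Sum>d | d dvd Suc n. 1 / real (Suc n div d)) * (real (Suc n) ^ 3 * exp (- (real (Suc n) * t)))"
        by (intro mult_right_mono) auto
      also have "\<dots> = (\<Sum>d | d dvd Suc n. g (Suc n div d) d)"
        unfolding sum_distrib_right by (rule sum.cong) (auto simp: g_def simp del: of_nat_Suc)
      finally show ?thesis .
    qed
    have sm: "summable (\<lambda>n. \<bar>lc (Suc n)\<bar> * (real (Suc n) ^ 3 * exp (- (real (Suc n) * t))))"
      by (rule summable_comparison_test'[OF sums_summable[OF S1(1)], of 0]) (use le in simp)
    have "(\<Sum>n. \<bar>lc (Suc n)\<bar> * (real (Suc n) ^ 3 * exp (- (real (Suc n) * t)))) \<le> (\<Sum>k. \<Sum>m. g (Suc k) (Suc m))"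
      unfolding sums_unique[OF S1(1)] by (rule suminf_le[OF le sm sums_summable[OF S1(1)]])
    also have "\<dots> \<le> (\<Sum>k. fact 3 * 2 ^ 4 / t ^ 4 * (1 / (real (Suc k))\<^sup>2))"
    proof (rule suminf_le[OF _ S1(2) summable_mult[OF Zs]])
      fix k
      define K where "K = real (Suc k)"
      define x where "x = K * t"
      have K: "K > 0" by (simp add: K_def)
      have x: "x > 0" using t K by (simp add: x_def)
      have sx: "summable (\<lambda>m. real (Suc m) ^ 3 * exp (- (real (Suc m) * x)))"
        using summable_power_exp[OF x, of 3] by (subst summable_Suc_iff)
      have "g (Suc k) (Suc m) = K ^ 3 / K * (real (Suc m) ^ 3 * exp (- (real (Suc m) * x)))" for m
        unfolding g_def of_nat_mult K_def[symmetric] power_mult_distrib x_def by (simp add: mult_ac del: of_nat_Suc)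
      then have "(\<Sum>m. g (Suc k) (Suc m)) = K ^ 3 / K * (\<Sum>m. real (Suc m) ^ 3 * exp (- (real (Suc m) * x)))"
        by (simp only: suminf_mult[OF sx])
      also have "K ^ 3 / K * (\<Sum>m. real (Suc m) ^ 3 * exp (- (real (Suc m) * x))) 
          = (x ^ Suc 3 * (\<Sum>m. real (Suc m) ^ 3 * exp (- (real (Suc m) * x)))) * (1 / (t ^ 4 * K\<^sup>2))"
      proof -
        have "K ^ 3 / K = x ^ Suc 3 * (1 / (t ^ 4 * K\<^sup>2))"
          using K t by (simp add: x_def field_simps eval_nat_numeral)
        then show ?thesis by (simp only: mult_ac)
      qed
      also have "\<dots> \<le> (fact 3 * 2 ^ Suc 3) * (1 / (t ^ 4 * K\<^sup>2))"
        using K t by (intro mult_right_mono power_exp_sum_bound x) auto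
      also have "\<dots> = fact 3 * 2 ^ 4 / t ^ 4 * (1 / (real (Suc k))\<^sup>2)" by (simp add: K_def)
      finally show "(\<Sum>m. g (Suc k) (Suc m)) \<le> fact 3 * 2 ^ 4 / t ^ 4 * (1 / (real (Suc k))\<^sup>2)" .
    qed
    also have "\<dots> = C / t ^ 4" unfolding C_def Z_def suminf_mult[OF Zs] by simp
    finally show ?thesis using sm by blast
  qed
  show ?thesis by (intro exI[of _ C] conjI C allI impI main)
qed

lemma (in -) artanh_series:
  fixes x :: real
  assumes "\<bar>x\<bar> < 1"
  shows "(\<lambda>n. (1 - (-1) ^ n) * x ^ n / real n) sums (ln (1 + x) - ln (1 - x))"
proof -
  have 1: "(\<lambda>n. - ((- x) ^ n) / real n) sums ln (1 + x)" using ln_series'[OF assms] .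
  have 2: "(\<lambda>n. - ((- (- x)) ^ n) / real n) sums ln (1 + - x)" using ln_series'[of "- x"] assms by simp
  have "(- x) ^ n = (-1) ^ n * x ^ n" for n by (metis mult_minus1 power_mult_distrib)
  then show ?thesis using sums_diff[OF 1 2] by (simp add: left_diff_distrib diff_divide_distrib)
qed

lemma B_diff_eq_Q:
  assumes t: "t > 0"
  shows "B 0 1 t - B 0 (-1) t = 2 * Q t"
proof -
  define \<phi> where "\<phi> n = (1 - (-1) ^ n) * exp (- (real n * t))" for n
  have r: "0 \<le> exp (- t)" "exp (- t) < 1" using t by auto
  have pb: "norm (\<phi> (Suc n)) \<le> 2 * real (Suc n) ^ 0 * exp (- t) ^ Suc n" for n
  proof -
    have "\<bar>1 - (-1 :: real) ^ Suc n\<bar> \<le> 2" by (cases "even n") auto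
    then show ?thesis unfolding \<phi>_def exp_mult_power by (simp add: abs_mult mult_right_mono del: power_Suc)
  qed
  \<comment> \<open>In this order the sum over \<open>k\<close> is inside, and for fixed odd
    \<open>m\<close> it is twice the series of \<open>artanh\<close>.\<close>
  note L = lc_sums(4)[where \<phi> = \<phi>, OF r pb]
  have "(\<lambda>n. lc (Suc n) * (real (Suc n) ^ 0 * (1 ^ Suc n * exp (- (real (Suc n) * t))))
      - lc (Suc n) * (real (Suc n) ^ 0 * ((-1) ^ Suc n * exp (- (real (Suc n) * t))))) sums (B 0 1 t - B 0 (-1) t)"
    by (intro sums_diff B_sums(1)[OF t]) auto
  then have "(\<lambda>n. lc (Suc n) * \<phi> (Suc n)) sums (B 0 1 t - B 0 (-1) t)"
    by (simp add: \<phi>_def algebra_simps)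
  then have "B 0 1 t - B 0 (-1) t = (\<Sum>m. \<Sum>k. chi (Suc m) ^ Suc k / real (Suc k) * \<phi> (Suc k * Suc m))"
    using L by (simp only: of_real_eq_id id_apply sums_unique2)
  also have "\<dots> = (\<Sum>m. 2 * (odd_chi (Suc m) * artanh_exp (real (Suc m) * t)))"
  proof (rule suminf_cong)
    fix m
    define M where "M = Suc m"
    define x where "x = exp (- (real M * t))"
    have x: "0 < x" "x < 1" using t by (auto simp: x_def M_def)
    show "(\<Sum>k. chi (Suc m) ^ Suc k / real (Suc k) * \<phi> (Suc k * Suc m)) = 2 * (odd_chi (Suc m) * artanh_exp (real (Suc m) * t))"
      unfolding M_def[symmetric]
    proof (cases "odd M")
      case True
      have "(\<lambda>n. (1 - (-1) ^ n) * x ^ n / real n) sums (ln (1 + x) - ln (1 - x))"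
        using x by (intro artanh_series) auto
      then have "(\<lambda>k. (1 - (-1) ^ Suc k) * x ^ Suc k / real (Suc k)) sums (ln (1 + x) - ln (1 - x))"
        by (subst sums_Suc_iff) simp
      then have *: "(\<lambda>k. chi M * ((1 - (-1) ^ Suc k) * x ^ Suc k / real (Suc k))) sums (chi M * (ln (1 + x) - ln (1 - x)))"
        by (rule sums_mult)
      have "chi M ^ Suc k / real (Suc k) * \<phi> (Suc k * M) = chi M * ((1 - (-1) ^ Suc k) * x ^ Suc k / real (Suc k))" for k
      proof (cases "even k")
        case ek: True
        have "chi M ^ Suc k = chi M" using chi_values[of M] ek by auto
        moreover have "(-1 :: real) ^ (Suc k * M) = (-1) ^ Suc k" using True ek by simp
        moreover have "exp (- (real (Suc k * M) * t)) = x ^ Suc k"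
          unfolding x_def exp_of_nat_mult[symmetric] by (simp add: algebra_simps)
        ultimately show ?thesis unfolding \<phi>_def by (simp only: times_divide_eq_left times_divide_eq_right mult_ac)
      next
        case False
        then have "(-1 :: real) ^ (Suc k * M) = 1" "(-1 :: real) ^ Suc k = 1" by auto
        then show ?thesis unfolding \<phi>_def by (simp del: power_Suc mult_Suc)
      qed
      then have "(\<Sum>k. chi M ^ Suc k / real (Suc k) * \<phi> (Suc k * M)) = chi M * (ln (1 + x) - ln (1 - x))"
        using * by (simp only: sums_iff)
      then show "(\<Sum>k. chi M ^ Suc k / real (Suc k) * \<phi> (Suc k * M)) = 2 * (odd_chi M * artanh_exp (real M * t))"
        using True by (simp add: odd_chi_def artanh_exp_def x_def)
    next
      case False
      then have "\<phi> (Suc k * M) = 0" for k by (simp add: \<phi>_def)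
      then show "(\<Sum>k. chi M ^ Suc k / real (Suc k) * \<phi> (Suc k * M)) = 2 * (odd_chi M * artanh_exp (real M * t))"
        using False by (simp add: odd_chi_def)
    qed
  qed
  also have "\<dots> = 2 * (\<Sum>m. odd_chi (Suc m) * artanh_exp (real (Suc m) * t))"
    using summable_Q[OF t] by (intro suminf_mult) (subst summable_Suc_iff)
  also have "(\<Sum>m. odd_chi (Suc m) * artanh_exp (real (Suc m) * t)) = Q t"
    using suminf_split_head[OF summable_Q[OF t]] by (simp add: Q_def odd_chi_def)
  finally show ?thesis .
qed

lemma B_minus_one_le:
  assumes "p mod 8 \<noteq> 1"
  shows "\<exists>\<delta>>0. \<forall>\<^sub>F t in at_right 0. B 0 (-1) t \<le> B 0 1 t - \<delta>"
proof -
  obtain \<delta> where \<delta>: "\<delta> > 0" "\<forall>\<^sub>F t in at_right 0. Q t \<ge> \<delta>" using Q_eventually_pos[OF assms] by blast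
  have "\<forall>\<^sub>F t in at_right 0. B 0 (-1) t \<le> B 0 1 t - \<delta>"
    using \<delta>(2) eventually_at_right_less[of "0::real"]
  proof eventually_elim
    case (elim t)
    then show ?case using B_diff_eq_Q[of t] \<delta>(1) by simp
  qed
  then show ?thesis using \<delta>(1) by blast
qed

end

section \<open>Minor arcs\<close>

context odd_prime
begin

text \<open>\<open>chi_power_mean \<zeta> k\<close> is the mean of \<open>\<chi>(m) ^ k \<zeta> ^ (k m)\<close> over all \<open>m\<close>; so \<open>cusp_value \<zeta>\<close> is the limit of \<open>w ln F(\<zeta> exp (-w))\<close>
  as \<open>w \<longlongrightarrow> 0\<close> in a sector.\<close>

definition chi_power_mean :: "complex \<Rightarrow> nat \<Rightarrow> complex" where
  "chi_power_mean \<zeta> k = (if \<zeta> ^ (k * p) = 1 then (\<Sum>r<p. of_real (chi r ^ k) * \<zeta> ^ (k * r)) / of_nat p else 0)"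

definition cusp_value :: "complex \<Rightarrow> complex" where
  "cusp_value \<zeta> = (\<Sum>k. chi_power_mean \<zeta> (Suc k) / of_real ((real (Suc k))\<^sup>2))"

lemma norm_chi_power_mean_le:
  assumes "norm \<zeta> = 1" shows "norm (chi_power_mean \<zeta> k) \<le> 1"
proof -
  have "norm (\<Sum>r<p. of_real (chi r ^ k) * \<zeta> ^ (k * r)) \<le> (\<Sum>r<p. 1)"
  proof (rule order_trans[OF norm_sum sum_mono])
    fix r
    have "\<bar>chi r\<bar> ^ k \<le> 1" by (rule power_le_one[OF abs_ge_zero abs_chi_le_1])
    then show "norm (of_real (chi r ^ k) * \<zeta> ^ (k * r)) \<le> 1"
      using assms by (simp add: norm_mult norm_power power_abs del: of_real_power)
  qed
  then show ?thesis using p_pos by (simp add: chi_power_mean_def norm_divide divide_le_eq)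
qed

lemma cusp_value_summable:
  assumes "norm \<zeta> = 1"
  shows "summable (\<lambda>k. chi_power_mean \<zeta> (Suc k) / of_real ((real (Suc k))\<^sup>2))"
proof (rule summable_comparison_test'[OF sums_summable[OF inverse_Suc_squares_sums]])
  fix k
  show "norm (chi_power_mean \<zeta> (Suc k) / of_real ((real (Suc k))\<^sup>2)) \<le> 1 / (real (Suc k))\<^sup>2"
    unfolding norm_divide norm_of_real abs_power2
    by (intro divide_right_mono norm_chi_power_mean_le assms) simp
qed

lemma (in -) inverse_squares_dvd_sums:
  fixes d :: nat
  assumes "d > 0"
  shows "(\<lambda>k. (if d dvd Suc k then 1 else 0) / (real (Suc k))\<^sup>2) sums (pi\<^sup>2 / 6 / (real d)\<^sup>2)"
proof -
  define g where "g i = d * Suc i - 1" for i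
  have g: "Suc (g i) = d * Suc i" for i using assms by (simp add: g_def)
  have "(\<lambda>i. 1 / (real (Suc i))\<^sup>2 / (real d)\<^sup>2) sums (pi\<^sup>2 / 6 / (real d)\<^sup>2)"
    by (intro sums_divide inverse_Suc_squares_sums)
  moreover have "1 / (real (Suc i))\<^sup>2 / (real d)\<^sup>2 = (if d dvd Suc (g i) then 1 else 0) / (real (Suc (g i)))\<^sup>2" for i
    unfolding g by (simp add: power_mult_distrib del: of_nat_Suc mult_Suc_right)
  ultimately have "(\<lambda>i. (if d dvd Suc (g i) then 1 else 0) / (real (Suc (g i)))\<^sup>2) sums (pi\<^sup>2 / 6 / (real d)\<^sup>2)"
    by (simp only:)
  moreover have "strict_mono g"
  proof (rule strict_monoI_Suc)
    fix i
    have "Suc (g i) < Suc (g (Suc i))" unfolding g using assms by simp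
    then show "g i < g (Suc i)" by simp
  qed
  moreover have "(if d dvd Suc n then 1 else 0) / (real (Suc n))\<^sup>2 = (0 :: real)" if "n \<notin> range g" for n
  proof -
    have "\<not> d dvd Suc n"
    proof
      assume "d dvd Suc n"
      then obtain c where c: "Suc n = d * c" by (rule dvdE)
      then have "c > 0" by (auto intro!: Nat.gr0I)
      then have "n = g (c - 1)" using c by (simp add: g_def)
      then show False using that by blast
    qed
    then show ?thesis by simp
  qed
  ultimately show ?thesis by (subst (asm) sums_mono_reindex)
qed

lemma (in -) least_power_eq_1:
  fixes x :: complex
  assumes "k0 > 0" "x ^ k0 = 1"
  obtains g where "g > 0" "\<And>k. x ^ k = 1 \<longleftrightarrow> g dvd k"
proof -
  define g where "g = (LEAST k. k > 0 \<and> x ^ k = 1)"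
  have g: "g > 0" "x ^ g = 1"
    using LeastI[of "\<lambda>k. k > 0 \<and> x ^ k = 1" k0] assms unfolding g_def by auto
  have "x ^ k = 1 \<longleftrightarrow> g dvd k" for k
  proof
    assume "x ^ k = 1"
    moreover have "x ^ k = (x ^ g) ^ (k div g) * x ^ (k mod g)"
      by (simp only: power_mult[symmetric] power_add[symmetric] mult_div_mod_eq)
    ultimately have "x ^ (k mod g) = 1" using g by simp
    moreover have "k mod g < g" using g by simp
    ultimately have "k mod g = 0"
      using not_less_Least[of "k mod g" "\<lambda>k. k > 0 \<and> x ^ k = 1"] unfolding g_def by auto
    then show "g dvd k" by auto
  next
    assume "g dvd k"
    then show "x ^ k = 1" using g by (auto simp: power_mult elim!: dvdE)
  qed
  then show ?thesis using g that by blast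
qed

lemma root_of_unity_eq_om_power:
  assumes "w ^ p = 1" obtains a where "w = om ^ a"
proof -
  have "w \<in> {z. z ^ p = 1}" using assms by simp
  also have "\<dots> = (\<lambda>k. cis (2 * pi * real k / real p)) ` {..<p}"
    using Complex.bij_betw_roots_unity[OF p_pos] by (simp add: bij_betw_def)
  finally obtain k where "w = cis (2 * pi * real k / real p)" by auto
  then show ?thesis using that[of k] by (simp add: om_power)
qed

lemma chi_power_even: "even k \<Longrightarrow> k > 0 \<Longrightarrow> chi r ^ k = (if p dvd r then 0 else 1)"
  using chi_power2[of r] chi_eq_0_iff[of r] by (auto elim!: evenE simp: power_mult)

lemma chi_power_odd: "odd k \<Longrightarrow> chi r ^ k = chi r"
  using chi_values[of r] by (auto elim: oddE)

lemma sum_coprime_om_power: "(\<Sum>r<p. (if p dvd r then 0 else 1) * om ^ (k * r)) = (if p dvd k then of_nat p else 0) - 1"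
proof -
  have "(\<Sum>r<p. (if p dvd r then 0 else 1) * om ^ (k * r)) = (\<Sum>r<p. om ^ (k * r) - (if r = 0 then 1 else 0))"
    by (rule sum.cong) (auto dest: nat_dvd_not_less)
  also have "\<dots> = (\<Sum>r<p. om ^ (k * r)) - 1" by (simp add: sum_subtractf)
  finally show ?thesis by (simp add: sum_om_power)
qed

text \<open>The Dirichlet series of \<open>chi\<close> at 2 without its Euler factor at the prime 2;
  together with the Gauss sum it is the contribution of odd powers to
  \<open>cusp_value\<close>.\<close>

definition odd_L :: real where
  "odd_L = (\<Sum>k. odd_chi (Suc k) / (real (Suc k))\<^sup>2)"

lemma odd_L_summable: "summable (\<lambda>k. odd_chi (Suc k) / (real (Suc k))\<^sup>2)"
proof (rule summable_comparison_test'[OF sums_summable[OF inverse_Suc_squares_sums]])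
  fix k
  show "norm (odd_chi (Suc k) / (real (Suc k))\<^sup>2) \<le> 1 / (real (Suc k))\<^sup>2"
    using w_le[of "Suc k"] by (simp add: abs_divide divide_right_mono del: of_nat_Suc)
qed

lemma abs_odd_L_le: "\<bar>odd_L\<bar> \<le> pi\<^sup>2 / 8"
proof -
  have "(\<lambda>k. 1 / (real (Suc k))\<^sup>2 - (if 2 dvd Suc k then 1 else 0) / (real (Suc k))\<^sup>2) sums (pi\<^sup>2 / 6 - pi\<^sup>2 / 6 / (real 2)\<^sup>2)"
    by (intro sums_diff inverse_Suc_squares_sums inverse_squares_dvd_sums) simp
  moreover have "pi\<^sup>2 / 6 - pi\<^sup>2 / 6 / (real 2)\<^sup>2 = pi\<^sup>2 / 8" by simp
  ultimately have s: "(\<lambda>k. 1 / (real (Suc k))\<^sup>2 - (if 2 dvd Suc k then 1 else 0) / (real (Suc k))\<^sup>2) sums (pi\<^sup>2 / 8)"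
    by (simp only:)
  have "norm odd_L \<le> (\<Sum>k. 1 / (real (Suc k))\<^sup>2 - (if 2 dvd Suc k then 1 else 0) / (real (Suc k))\<^sup>2)"
    unfolding odd_L_def
  proof (rule norm_suminf_le[OF _ sums_summable[OF s]])
    fix k
    show "norm (odd_chi (Suc k) / (real (Suc k))\<^sup>2) \<le> 1 / (real (Suc k))\<^sup>2 - (if 2 dvd Suc k then 1 else 0) / (real (Suc k))\<^sup>2"
      using abs_chi_le_1[of "Suc k"] by (auto simp: odd_chi_def abs_divide divide_right_mono simp del: of_nat_Suc)
  qed
  then show ?thesis using s by (simp add: sums_iff)
qed

text \<open>For \<open>p = 3\<close> the signs alternate along 1, 5, 7, 11, ..., so the partial sums
  are 0 or 1 and Abel's bound is the first term.\<close>

lemma odd_L_3: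
  assumes "p = 3" shows "\<bar>odd_L\<bar> \<le> 1"
proof -
  have p3: "p mod 4 \<noteq> 1" "p - 1 = 2" using assms by simp_all
  have "chi (p - 1) = - chi 1" using chi_minus[of 1] p3(1) p_ge_3 by simp
  then have c: "chi 0 = 0" "chi 1 = 1" "chi 2 = -1" unfolding p3(2) by simp_all
  have v: "odd_chi n = (if n mod 6 = 1 then 1 else if n mod 6 = 5 then -1 else 0)" for n
  proof -
    have m: "chi n = chi (n mod 3)" by (metis assms chi_mod)
    have "n mod 6 < 6" by simp
    then consider "n mod 6 = 0" | "n mod 6 = 1" | "n mod 6 = 2" | "n mod 6 = 3" | "n mod 6 = 4" | "n mod 6 = 5"
      by linarith
    then show ?thesis
    proof cases
      case 2
      then have "odd n" "n mod 3 = 1" by presburger+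
      then show ?thesis using 2 c by (simp add: odd_chi_def m)
    next
      case 4
      then have "n mod 3 = 0" by presburger
      then show ?thesis using 4 c by (simp add: odd_chi_def m)
    next
      case 6
      then have "odd n" "n mod 3 = 2" by presburger+
      then show ?thesis using 6 c by (simp add: odd_chi_def m)
    next
      case 1
      then have "even n" by presburger
      then show ?thesis using 1 by (simp add: odd_chi_def)
    next
      case 3
      then have "even n" by presburger
      then show ?thesis using 3 by (simp add: odd_chi_def)
    next
      case 5
      then have "even n" by presburger
      then show ?thesis using 5 by (simp add: odd_chi_def)
    qed
  qed
  have ps: "(\<Sum>i<n. odd_chi i) = (if 2 \<le> n mod 6 then 1 else 0)" for n
  proof (induction n)
    case (Suc n)
    have "n mod 6 < 6" by simp
    then consider "n mod 6 = 0" | "n mod 6 = 1" | "n mod 6 = 2" | "n mod 6 = 3" | "n mod 6 = 4" | "n mod 6 = 5"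
      by linarith
    then show ?case by cases (simp_all add: Suc v[of n] mod_Suc)
  qed simp
  have ps': "\<bar>\<Sum>i<n. odd_chi (Suc i)\<bar> \<le> 1" for n
  proof -
    have "(\<Sum>i<Suc n. odd_chi i) = odd_chi 0 + (\<Sum>i<n. odd_chi (Suc i))" by (rule sum.lessThan_Suc_shift)
    then show ?thesis using ps[of "Suc n"] by (simp add: w_0 split: if_splits)
  qed
  have "\<bar>\<Sum>k. odd_chi (Suc k) * (1 / (real (Suc k))\<^sup>2)\<bar> \<le> 1 * (1 / (real (Suc 0))\<^sup>2)"
  proof (rule suminf_abel_bound[where c = "\<lambda>k. odd_chi (Suc k)" and a = "\<lambda>k. 1 / (real (Suc k))\<^sup>2", OF ps'])
    show "1 / (real (Suc (Suc n)))\<^sup>2 \<le> 1 / (real (Suc n))\<^sup>2" for n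
      by (intro divide_left_mono power_mono) auto
    show "(\<lambda>n. 1 / (real (Suc n))\<^sup>2) \<longlonglongrightarrow> 0" by real_asymp
  qed
  then show ?thesis by (simp add: odd_L_def)
qed

text \<open>The condition on \<open>v\<close> describes the limits of \<open>Re w / w\<close>. For \<open>p = 5\<close>, \<open>v = 1\<close> and \<open>\<zeta> = om\<close> there is equality.
  The bound on \<open>odd_L\<close> used for all other \<open>p\<close> is too weak for \<open>p = 3\<close>.\<close>

lemma cusp_value_Re_less:
  assumes \<zeta>: "norm \<zeta> = 1" "\<zeta>\<^sup>2 \<noteq> 1" and v: "Re v = (norm v)\<^sup>2"
    and p: "p \<noteq> 5" "p mod 8 \<noteq> 1"
  shows "Re (cusp_value \<zeta> * v) < main_const"
proof -
  define x y where "x = Re v" and "y = Im v"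
  \<comment> \<open>\<open>v\<close> lies on the circle with diameter from 0 to 1; hence
    \<open>0 \<le> x \<le> 1\<close> and \<open>\<bar>y\<bar> \<le> 1 / 2\<close>.\<close>
  have xy: "x = x\<^sup>2 + y\<^sup>2" using v by (simp add: x_def y_def cmod_power2)
  have x01: "0 \<le> x" "x \<le> 1"
  proof -
    show "0 \<le> x" using xy zero_le_power2[of x] zero_le_power2[of y] by linarith
    have "x\<^sup>2 \<le> x" using xy zero_le_power2[of y] by linarith
    show "x \<le> 1"
    proof (rule ccontr)
      assume "\<not> x \<le> 1"
      then have "1 * x < x * x" by (intro mult_strict_right_mono) auto
      then show False using \<open>x\<^sup>2 \<le> x\<close> by (simp add: power2_eq_square)
    qed
  qed
  have yy: "y\<^sup>2 = x - x\<^sup>2" using xy by linarith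
  have y: "\<bar>y\<bar> \<le> 1 / 2"
  proof -
    have "x - x\<^sup>2 = 1 / 4 - (x - 1 / 2)\<^sup>2" by (simp add: power2_eq_square algebra_simps)
    then have "y\<^sup>2 = 1 / 4 - (x - 1 / 2)\<^sup>2" by (simp only: yy)
    then have "y\<^sup>2 \<le> (1 / 2)\<^sup>2" by (simp add: power2_eq_square)
    then show ?thesis using abs_le_square_iff[of y "1/2"] by simp
  qed
  define Z where "Z = pi\<^sup>2 / 6"
  have Z: "Z > 0" by (simp add: Z_def)
  have mc: "main_const = (1 - 1 / real p) * Z / 4" by (simp add: main_const_def Z_def)
  show ?thesis
  proof (cases "\<exists>k>0. (\<zeta> ^ p) ^ k = 1")
    \<comment> \<open>If \<open>\<zeta>\<close> is not a root of unity, all means vanish.\<close>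
    case False
    have "chi_power_mean \<zeta> (Suc k) = 0" for k
    proof -
      have "(\<zeta> ^ p) ^ Suc k \<noteq> 1" using False zero_less_Suc by blast
      then have "\<zeta> ^ (Suc k * p) \<noteq> 1" by (metis power_mult mult.commute)
      then show ?thesis by (simp only: chi_power_mean_def if_False)
    qed
    then show ?thesis using main_const_pos by (simp add: cusp_value_def)
  next
    case True
    then obtain k0 where k0: "k0 > 0" "(\<zeta> ^ p) ^ k0 = 1" by blast
    obtain g where g: "g > 0" "\<And>k. (\<zeta> ^ p) ^ k = 1 \<longleftrightarrow> g dvd k"
      using least_power_eq_1[OF k0] by metis
    have gk: "\<zeta> ^ (k * p) = 1 \<longleftrightarrow> g dvd k" for k
      using g(2)[of k] by (metis power_mult mult.commute)
    \<comment> \<open>Only exponents divisible by \<open>g\<close>, the order of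
      \<open>\<zeta> ^ p\<close>, contribute, and \<open>\<zeta> ^ g\<close> is a
      \<open>p\<close>-th root of unity. Writing the exponent as \<open>g * K\<close> pulls out a
      factor \<open>1 / g\<^sup>2\<close>, so it suffices to bound the remaining series
      \<open>D\<close>.\<close>
    define w where "w = \<zeta> ^ g"
    have "w ^ p = 1" using g(2)[of g] by (simp add: w_def mult.commute flip: power_mult)
    then obtain a where a: "w = om ^ a" by (rule root_of_unity_eq_om_power)
    define d where "d K = (\<Sum>r<p. of_real (chi r ^ (g * K)) * w ^ (K * r)) / of_nat p" for K
    have ckd: "chi_power_mean \<zeta> (g * K) = d K" for K
      using gk[of "g * K"] by (simp add: chi_power_mean_def d_def w_def mult.assoc flip: power_mult)
    have "(\<lambda>i. chi_power_mean \<zeta> (g * Suc i) / of_real ((real (g * Suc i))\<^sup>2)) sums cusp_value \<zeta>"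
    proof -
      define h where "h i = g * Suc i - 1" for i
      have h: "Suc (h i) = g * Suc i" for i using g by (simp add: h_def)
      have "strict_mono h"
      proof (rule strict_monoI_Suc)
        fix i
        have "Suc (h i) < Suc (h (Suc i))" unfolding h using g by simp
        then show "h i < h (Suc i)" by simp
      qed
      moreover have "chi_power_mean \<zeta> (Suc n) / of_real ((real (Suc n))\<^sup>2) = 0" if "n \<notin> range h" for n
      proof -
        have "\<not> g dvd Suc n"
        proof
          assume "g dvd Suc n"
          then obtain c where c: "Suc n = g * c" by (rule dvdE)
          then have "c > 0" by (auto intro!: Nat.gr0I)
          then have "n = h (c - 1)" using c by (simp add: h_def)
          then show False using that by blast
        qed
        then have "chi_power_mean \<zeta> (Suc n) = 0" by (simp only: chi_power_mean_def gk if_False)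
        then show ?thesis by simp
      qed
      moreover have "(\<lambda>k. chi_power_mean \<zeta> (Suc k) / of_real ((real (Suc k))\<^sup>2)) sums cusp_value \<zeta>"
        unfolding cusp_value_def by (rule summable_sums[OF cusp_value_summable[OF \<zeta>(1)]])
      ultimately have "(\<lambda>i. chi_power_mean \<zeta> (Suc (h i)) / of_real ((real (Suc (h i)))\<^sup>2)) sums cusp_value \<zeta>"
        by (subst sums_mono_reindex)
      then show ?thesis unfolding h .
    qed
    then have "(\<lambda>i. of_real ((real g)\<^sup>2) * (chi_power_mean \<zeta> (g * Suc i) / of_real ((real (g * Suc i))\<^sup>2))) sums (of_real ((real g)\<^sup>2) * cusp_value \<zeta>)"
      by (rule sums_mult)
    moreover have "of_real ((real g)\<^sup>2) * (chi_power_mean \<zeta> (g * Suc i) / of_real ((real (g * Suc i))\<^sup>2)) = d (Suc i) / of_real ((real (Suc i))\<^sup>2)" for i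
      unfolding ckd using g(1) by (simp add: power_mult_distrib del: of_nat_Suc mult_Suc_right)
    ultimately have D': "(\<lambda>i. d (Suc i) / of_real ((real (Suc i))\<^sup>2)) sums (of_real ((real g)\<^sup>2) * cusp_value \<zeta>)"
      by (simp only:)
    define D where "D = of_real ((real g)\<^sup>2) * cusp_value \<zeta>"
    have Dg: "Re (D * v) = (real g)\<^sup>2 * Re (cusp_value \<zeta> * v)"
    proof -
      have "Re (of_real c * z * v) = c * Re (z * v)" for c z by (simp add: algebra_simps)
      then show ?thesis unfolding D_def .
    qed
    have g1: "1 \<le> (real g)\<^sup>2" using g(1) by (simp add: one_le_power)
    have suff: ?thesis if "Re (D * v) < main_const"
    proof (rule ccontr)
      assume n: "\<not> Re (cusp_value \<zeta> * v) < main_const"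
      then have "1 * Re (cusp_value \<zeta> * v) \<le> (real g)\<^sup>2 * Re (cusp_value \<zeta> * v)"
        using g1 main_const_pos by (intro mult_right_mono) auto
      then show False using n that Dg by simp
    qed
    have dev: "d (Suc K) = of_real ((if p dvd a * Suc K then 1 else 0) - 1 / real p)" if "even (g * Suc K)" for K
    proof -
      have "(\<Sum>r<p. of_real (chi r ^ (g * Suc K)) * w ^ (Suc K * r))
          = (\<Sum>r<p. (if p dvd r then 0 else 1) * om ^ ((a * Suc K) * r))"
      proof (rule sum.cong)
        fix r
        have "chi r ^ (g * Suc K) = (if p dvd r then 0 else 1)" using that g(1) by (intro chi_power_even) auto
        moreover have "w ^ (Suc K * r) = om ^ ((a * Suc K) * r)"
          unfolding a power_mult[symmetric] by (simp only: mult.assoc)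
        ultimately show "of_real (chi r ^ (g * Suc K)) * w ^ (Suc K * r) = (if p dvd r then 0 else 1) * om ^ ((a * Suc K) * r)"
          by simp
      qed simp
      also have "\<dots> = (if p dvd a * Suc K then of_nat p else 0) - 1" by (rule sum_coprime_om_power)
      finally have S: "(\<Sum>r<p. of_real (chi r ^ (g * Suc K)) * w ^ (Suc K * r)) = (if p dvd a * Suc K then of_nat p else 0) - 1" .
      show ?thesis unfolding d_def S
        using p_pos by (cases "p dvd a * Suc K") (simp_all add: diff_divide_distrib del: mult_Suc_right)
    qed
    have dod: "d (Suc K) = of_real (chi a * chi (Suc K) / real p) * gauss_sum om" if "odd (g * Suc K)" for K
    proof -
      have "(\<Sum>r<p. of_real (chi r ^ (g * Suc K)) * w ^ (Suc K * r)) = gauss_sum (om ^ (a * Suc K))"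
        unfolding gauss_sum_def a chi_power_odd[OF that] by (simp only: power_mult)
      then show ?thesis unfolding d_def gauss_sum_power chi_mult by simp
    qed
    show ?thesis
    proof (cases "p dvd a")
      case True
      then have w1: "w = 1" by (simp add: a om_power_eq_1_iff)
      have "g \<noteq> 1" using w1 \<zeta> by (auto simp: w_def)
      moreover have "g \<noteq> 2" using w1 \<zeta> by (auto simp: w_def)
      \<comment> \<open>\<open>\<zeta> ^ g = 1\<close> and \<open>\<zeta>\<^sup>2 \<noteq> 1\<close>
        exclude 1 and 2. Counting all powers gives at most \<open>R \<le> 4 * main_const\<close>,
        against \<open>g\<^sup>2 \<ge> 9\<close>.\<close>
      ultimately have g3: "g \<ge> 3" using g(1) by linarith
      have ca: "chi a = 0" using True by (simp add: chi_eq_0_iff)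
      have dn: "d (Suc K) = of_real (if even (g * Suc K) then 1 - 1 / real p else 0)" for K
        using dev[of K] dod[of K] True ca by auto
      define R where "R = (\<Sum>i. (if even (g * Suc i) then 1 - 1 / real p else 0) / (real (Suc i))\<^sup>2)"
      have Rs: "(\<lambda>i. (if even (g * Suc i) then 1 - 1 / real p else 0) / (real (Suc i))\<^sup>2) sums R"
        unfolding R_def
      proof (rule summable_sums, rule summable_comparison_test'[OF sums_summable[OF inverse_Suc_squares_sums]])
        fix n
        show "norm ((if even (g * Suc n) then 1 - 1 / real p else 0) / (real (Suc n))\<^sup>2) \<le> 1 / (real (Suc n))\<^sup>2"
          using p_ge_3 by (auto simp: abs_divide divide_right_mono simp del: of_nat_Suc)
      qed
      have DR: "D = of_real R"
      proof -
        have "complex_of_real ((if even (g * Suc i) then 1 - 1 / real p else 0) / (real (Suc i))\<^sup>2) = d (Suc i) / of_real ((real (Suc i))\<^sup>2)" for i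
          unfolding dn by (rule of_real_divide)
        then have "(\<lambda>i. d (Suc i) / of_real ((real (Suc i))\<^sup>2)) sums complex_of_real R"
          using sums_of_real[OF Rs, where 'a = complex] by (simp only:)
        then show ?thesis unfolding D_def by (rule sums_unique2[OF D'])
      qed
      have "R \<le> (1 - 1 / real p) * Z"
      proof -
        have "(\<lambda>i. (1 - 1 / real p) * (1 / (real (Suc i))\<^sup>2)) sums ((1 - 1 / real p) * Z)"
          unfolding Z_def by (intro sums_mult inverse_Suc_squares_sums)
        then show ?thesis
          by (rule sums_le[rotated, OF Rs]) (use p_ge_3 in \<open>auto simp: divide_right_mono simp del: of_nat_Suc\<close>)
      qed
      then have R4: "R \<le> 4 * main_const" by (simp add: mc)
      have "Re (D * v) = R * x" by (simp add: DR x_def)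
      also have "\<dots> \<le> 4 * main_const * 1"
      proof (cases "R \<ge> 0")
        case True
        then show ?thesis using R4 x01 main_const_pos by (intro mult_mono) auto
      next
        case False
        then have "R * x \<le> 0" using x01 by (simp add: mult_nonpos_nonneg)
        then show ?thesis using main_const_pos by simp
      qed
      finally have A: "(real g)\<^sup>2 * Re (cusp_value \<zeta> * v) \<le> 4 * main_const" unfolding Dg by simp
      have B: "(real g)\<^sup>2 \<ge> 9"
      proof -
        have "(real g)\<^sup>2 \<ge> 3\<^sup>2" using g3 by (intro power_mono) auto
        then show ?thesis by simp
      qed
      show ?thesis
      proof (rule ccontr)
        assume "\<not> ?thesis"
        then have "9 * main_const \<le> (real g)\<^sup>2 * Re (cusp_value \<zeta> * v)"
          using B main_const_pos by (intro mult_mono) auto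
        then show False using A main_const_pos by simp
      qed
    next
      case False
      then have pa: "p dvd a * K \<longleftrightarrow> p dvd K" for K
        using prime_p by (simp add: prime_dvd_mult_iff)
      have Zs: "(\<lambda>i. c * ((if e dvd Suc i then 1 else 0) / (real (Suc i))\<^sup>2)) sums (c * (Z / (real e)\<^sup>2))" if "e > 0" for c e
        unfolding Z_def by (intro sums_mult inverse_squares_dvd_sums that)
      show ?thesis
      proof (cases "even g")
        \<comment> \<open>All exponents are even, and powers of a nontrivial \<open>p\<close>-th
          root of unity sum to -1 over the nonzero residues; so
          \<open>D = Z / p\<^sup>2 - Z / p\<close> is negative.\<close>
        case True
        have "(\<lambda>i. complex_of_real (1 * ((if p dvd Suc i then 1 else 0) / (real (Suc i))\<^sup>2)
            + (- (1 / real p)) * ((if 1 dvd Suc i then 1 else 0) / (real (Suc i))\<^sup>2)))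
          sums complex_of_real (1 * (Z / (real p)\<^sup>2) + (- (1 / real p)) * (Z / (real 1)\<^sup>2))"
          by (intro sums_of_real sums_add Zs) auto
        moreover have "complex_of_real (1 * ((if p dvd Suc i then 1 else 0) / (real (Suc i))\<^sup>2)
            + (- (1 / real p)) * ((if 1 dvd Suc i then 1 else 0) / (real (Suc i))\<^sup>2)) = d (Suc i) / of_real ((real (Suc i))\<^sup>2)" for i
        proof -
          have e: "even (g * Suc i)" using True by simp
          show ?thesis unfolding dev[OF e] pa of_real_divide[symmetric]
            by (intro arg_cong[where f = complex_of_real]) (simp add: diff_divide_distrib del: of_nat_Suc)
        qed
        ultimately have "(\<lambda>i. d (Suc i) / of_real ((real (Suc i))\<^sup>2)) sums
            complex_of_real (1 * (Z / (real p)\<^sup>2) + (- (1 / real p)) * (Z / (real 1)\<^sup>2))" by (simp only:)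
        then have "D = complex_of_real (1 * (Z / (real p)\<^sup>2) + (- (1 / real p)) * (Z / (real 1)\<^sup>2))"
          unfolding D_def by (rule sums_unique2[OF D'])
        then have "Re (D * v) = (Z / (real p)\<^sup>2 - Z / real p) * x" by (simp add: x_def)
        also have "\<dots> \<le> 0"
        proof -
          have "Z / (real p)\<^sup>2 \<le> Z / real p" using Z p_ge_3
            by (intro divide_left_mono) (auto simp: power2_eq_square)
          then show ?thesis using x01 by (intro mult_nonpos_nonneg) auto
        qed
        also have "\<dots> < main_const" by (rule main_const_pos)
        finally show ?thesis by (rule suff)
      next
        case og: False
        \<comment> \<open>\<open>E \<le> 0\<close> collects the even \<open>K\<close>. The odd
          \<open>K\<close>, whose means are Gauss sums, form \<open>O'\<close>, and only this part
          can compete with \<open>main_const\<close>.\<close>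
        define E where "E = - ((1 - 1 / real p) * Z / (4 * real p))"
        define O' where "O' = of_real (chi a / real p * odd_L) * gauss_sum om"
        have "(\<lambda>i. complex_of_real (1 * ((if 2 * p dvd Suc i then 1 else 0) / (real (Suc i))\<^sup>2)
            + (- (1 / real p)) * ((if 2 dvd Suc i then 1 else 0) / (real (Suc i))\<^sup>2))
            + complex_of_real (chi a / real p * (odd_chi (Suc i) / (real (Suc i))\<^sup>2)) * gauss_sum om)
          sums (complex_of_real (1 * (Z / (real (2 * p))\<^sup>2) + (- (1 / real p)) * (Z / (real 2)\<^sup>2))
            + complex_of_real (chi a / real p * odd_L) * gauss_sum om)"
          unfolding odd_L_def
          by (intro sums_add sums_mult2 sums_of_real sums_mult Zs summable_sums odd_L_summable) auto
        moreover have "complex_of_real (1 * ((if 2 * p dvd Suc i then 1 else 0) / (real (Suc i))\<^sup>2)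
            + (- (1 / real p)) * ((if 2 dvd Suc i then 1 else 0) / (real (Suc i))\<^sup>2))
            + complex_of_real (chi a / real p * (odd_chi (Suc i) / (real (Suc i))\<^sup>2)) * gauss_sum om
            = d (Suc i) / of_real ((real (Suc i))\<^sup>2)" for i
        proof (cases "even (Suc i)")
          case True
          then have e: "even (g * Suc i)" by simp
          have c2: "coprime 2 p" using odd_p by simp
          have "2 * p dvd Suc i \<longleftrightarrow> p dvd Suc i"
            using True divides_mult[OF _ _ c2] by (metis dvd_mult_right)
          then show ?thesis using True unfolding dev[OF e] pa of_real_divide[symmetric]
            by (simp add: odd_chi_def diff_divide_distrib del: of_nat_Suc)
        next
          case False
          then have e: "odd (g * Suc i)" using og by simp
          have "\<not> 2 * p dvd Suc i" using False by (metis dvd_mult_left)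
          then show ?thesis using False unfolding dod[OF e]
            by (simp add: odd_chi_def del: of_nat_Suc)
        qed
        ultimately have "(\<lambda>i. d (Suc i) / of_real ((real (Suc i))\<^sup>2)) sums
            (complex_of_real (1 * (Z / (real (2 * p))\<^sup>2) + (- (1 / real p)) * (Z / (real 2)\<^sup>2))
            + complex_of_real (chi a / real p * odd_L) * gauss_sum om)" by (simp only:)
        then have D1: "D = complex_of_real (1 * (Z / (real (2 * p))\<^sup>2) + (- (1 / real p)) * (Z / (real 2)\<^sup>2))
            + complex_of_real (chi a / real p * odd_L) * gauss_sum om"
          unfolding D_def by (rule sums_unique2[OF D'])
        have XE: "1 * (Z / (real (2 * p))\<^sup>2) + (- (1 / real p)) * (Z / (real 2)\<^sup>2) = E"
          using p_pos by (simp add: E_def field_simps power2_eq_square)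
        have DE: "D = of_real E + O'" unfolding D1 XE O'_def ..
        have E0: "E * x \<le> 0"
        proof -
          have "E \<le> 0" using Z p_ge_3 by (simp add: E_def)
          then show ?thesis using x01 by (intro mult_nonpos_nonneg) auto
        qed
        have ca1: "\<bar>chi a\<bar> = 1" using False chi_values[of a] by (auto simp: chi_eq_0_iff)
        define \<beta> where "\<beta> = chi a * odd_L / real p * sqrt (real p)"
        have \<beta>: "\<bar>\<beta>\<bar> = \<bar>odd_L\<bar> / sqrt (real p)"
          using p_pos ca1 by (simp add: \<beta>_def abs_mult abs_divide) (simp add: field_simps)
        have sp: "sqrt (real p) > 0" by simp
        have \<beta>_le: "\<bar>\<beta>\<bar> \<le> 3 * Z / 4 / sqrt (real p)"
          unfolding \<beta> using abs_odd_L_le by (intro divide_right_mono) (auto simp: Z_def)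
        have spp: "sqrt (real p) * sqrt (real p) = real p" by simp
        show ?thesis
        proof (cases "p mod 4 = 1")
          case True
          have "O' = of_real \<beta>" unfolding O'_def \<beta>_def gauss_sum_value using True by simp
          then have "Re (D * v) = E * x + \<beta> * x" by (simp add: DE x_def distrib_right)
          also have "\<dots> \<le> \<bar>\<beta>\<bar> * 1"
          proof -
            have "\<beta> * x \<le> \<bar>\<beta>\<bar> * 1" using x01 by (intro mult_mono) auto
            then show ?thesis using E0 by linarith
          qed
          also have "\<dots> < main_const"
          proof -
            \<comment> \<open>The bound \<open>\<bar>odd_L\<bar> \<le> 3 * Z / 4\<close> suffices
              once \<open>3 * s < s * s - 1\<close> for \<open>s = sqrt p\<close>, which holds from
              \<open>p = 13\<close> on; 3.6 is just below \<open>sqrt 13\<close>.\<close>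
            have "p \<ge> 13"
            proof -
              have "p \<noteq> 9" using prime_p by (auto simp: prime_nat_iff dest: spec[of _ 3])
              moreover have "p mod 8 = 5" using True p(2) by presburger
              ultimately show ?thesis using p(1) by presburger
            qed
            define s where "s = sqrt (real p)"
            have s: "s \<ge> 3.6"
            proof -
              have "sqrt (3.6 ^ 2) \<le> s" unfolding s_def using \<open>p \<ge> 13\<close> by (intro real_sqrt_le_mono) (simp add: power2_eq_square)
              then show ?thesis by simp
            qed
            have ps: "real p = s * s" by (simp add: s_def)
            have "3 * Z / 4 / s < (1 - 1 / (s * s)) * Z / 4"
            proof -
              have "3 * s < s * s - 1"
              proof -
                have "(s - 3.6) * (s + 0.6) \<ge> 0" using s by simp
                then show ?thesis using s by (simp add: algebra_simps)
              qed
              then have "3 / s < 1 - 1 / (s * s)" using s by (simp add: field_simps)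
              then have "(3 / s) * (Z / 4) < (1 - 1 / (s * s)) * (Z / 4)" using Z by (intro mult_strict_right_mono) auto
              then show ?thesis by simp
            qed
            moreover have "\<bar>\<beta>\<bar> \<le> 3 * Z / 4 / s" using \<beta>_le by (simp only: s_def)
            moreover have "main_const = (1 - 1 / (s * s)) * Z / 4" by (simp only: mc ps)
            ultimately show ?thesis by linarith
          qed
          finally show ?thesis by (rule suff)
        next
          case False
          \<comment> \<open>An imaginary Gauss sum couples to \<open>y\<close>, and
            \<open>\<bar>y\<bar> \<le> 1 / 2\<close> gains a factor 2. For \<open>p \<ge> 7\<close>,
            where \<open>s = sqrt p \<ge> 2.5\<close>, this gives
            \<open>3 / 2 * s < s * s - 1\<close>, which suffices.\<close>
          have "O' = \<i> * of_real \<beta>" unfolding O'_def \<beta>_def gauss_sum_value using False by simp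
          then have Re: "Re (D * v) = E * x - \<beta> * y" by (simp add: DE x_def y_def)
          show ?thesis
          proof (cases "p = 3")
            case p3: True
            have \<beta>3: "\<bar>\<beta>\<bar> \<le> 1 / sqrt 3" unfolding \<beta> using odd_L_3[OF p3] by (simp add: p3 divide_right_mono)
            have p3r: "real p = 3" using p3 by simp
            have mc3: "main_const = Z / 6" unfolding mc p3r by simp
            define A where "A = main_const"
            have A: "A > 1 / 4"
            proof -
              have "pi * pi > 3 * 3" using pi_gt3 by (intro mult_strict_mono) auto
              then show ?thesis unfolding A_def mc3 Z_def by (simp add: power2_eq_square)
            qed
            have EA: "E = - A / 3" unfolding A_def mc3 E_def p3r by simp
            show ?thesis
            proof (cases "x = 0")
              case True
              then have "y = 0" using yy by simp
              then have "Re (D * v) < main_const" using Re True main_const_pos by simp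
              then show ?thesis by (rule suff)
            next
              case xn: False
              then have x: "x > 0" using x01 by simp
              \<comment> \<open>On the circle \<open>x = 1 / (1 + u\<^sup>2)\<close>, so the claim
                becomes a quadratic inequality in \<open>u\<close>, with \<open>A > 1 / 4\<close>
                because \<open>pi > 3\<close>.\<close>
              define u where "u = \<bar>y\<bar> / x"
              have yu: "\<bar>y\<bar> = u * x" using x by (simp add: u_def)
              have xu: "x * (1 + u\<^sup>2) = 1"
              proof -
                have "(u * x)\<^sup>2 = x - x\<^sup>2" using yu yy by (metis power2_abs)
                then have "x * 1 = x * (x * (1 + u\<^sup>2))" by (simp add: power2_eq_square algebra_simps)
                then show ?thesis by (simp only: mult_left_cancel[OF xn])
              qed
              have "E * x - \<beta> * y \<le> - A / 3 * x + \<bar>\<beta>\<bar> * \<bar>y\<bar>"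
                using abs_ge_minus_self[of "\<beta> * y"] by (simp add: EA abs_mult)
              also have "\<dots> \<le> - A / 3 * x + 1 / sqrt 3 * \<bar>y\<bar>"
                using \<beta>3 by (intro add_left_mono mult_right_mono) auto
              also have "\<dots> = x * (u / sqrt 3 - A / 3)" unfolding yu by (simp add: algebra_simps)
              also have "\<dots> < x * (A * (1 + u\<^sup>2))"
              proof -
                have s3: "sqrt 3 * sqrt 3 = (3 :: real)" by simp
                \<comment> \<open>The square is chosen to give
                  \<open>u / sqrt 3 \<le> u\<^sup>2 / 4 + 1 / 3\<close>; replacing
                  \<open>1 / 4\<close> by the larger \<open>A\<close> makes this strict.\<close>
                have "0 \<le> (sqrt 3 * u / 2 - 1)\<^sup>2" by simp
                also have "\<dots> = 3 * u\<^sup>2 / 4 - sqrt 3 * u + 1"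
                  using s3 by (simp add: power2_eq_square algebra_simps)
                finally have "sqrt 3 * u \<le> 3 * u\<^sup>2 / 4 + 1" by simp
                moreover have "u / sqrt 3 = sqrt 3 * u / 3" using s3 by (simp add: field_simps)
                ultimately have 1: "u / sqrt 3 \<le> u\<^sup>2 / 4 + 1 / 3" by simp
                have "u\<^sup>2 / 4 \<le> A * u\<^sup>2" using A mult_right_mono[of "1/4" A "u\<^sup>2"] by simp
                then have "u / sqrt 3 < A * u\<^sup>2 + 4 * A / 3" using 1 A by linarith
                then have "u / sqrt 3 - A / 3 < A * (1 + u\<^sup>2)" by (simp add: algebra_simps)
                then show ?thesis using x by (rule mult_strict_left_mono)
              qed
              also have "\<dots> = A" using xu by (metis mult.assoc mult.commute mult.right_neutral)
              finally have "Re (D * v) < main_const" using Re by (simp add: A_def)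
              then show ?thesis by (rule suff)
            qed
          next
            case p3: False
            have "p \<ge> 7"
            proof -
              have "p \<noteq> 4" using odd_p by auto
              then show ?thesis using p_ge_3 p3 p(1) odd_p False by presburger
            qed
            have "Re (D * v) \<le> \<bar>\<beta>\<bar> * \<bar>y\<bar>"
              using Re E0 abs_ge_minus_self[of "\<beta> * y"] by (simp add: abs_mult)
            also have "\<dots> \<le> \<bar>\<beta>\<bar> * (1 / 2)" using y by (intro mult_left_mono) auto
            also have "\<dots> < main_const"
            proof -
              define s where "s = sqrt (real p)"
              have s: "s \<ge> 2.5"
              proof -
                have "sqrt (2.5 ^ 2) \<le> s" unfolding s_def using \<open>p \<ge> 7\<close> by (intro real_sqrt_le_mono) (simp add: power2_eq_square)
                then show ?thesis by simp
              qed
              have ps: "real p = s * s" by (simp add: s_def)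
              have "3 * Z / 4 / s * (1 / 2) < (1 - 1 / (s * s)) * Z / 4"
              proof -
                have "3 / 2 * s < s * s - 1"
                proof -
                  have "(s - 2.5) * (s + 1) \<ge> 0" using s by simp
                  then show ?thesis using s by (simp add: algebra_simps)
                qed
                then have "3 / s / 2 < 1 - 1 / (s * s)" using s by (simp add: field_simps)
                then have "(3 / s / 2) * (Z / 4) < (1 - 1 / (s * s)) * (Z / 4)" using Z by (intro mult_strict_right_mono) auto
                then show ?thesis by simp
              qed
              moreover have "\<bar>\<beta>\<bar> * (1 / 2) \<le> 3 * Z / 4 / s * (1 / 2)"
            proof (rule mult_right_mono)
              show "\<bar>\<beta>\<bar> \<le> 3 * Z / 4 / s" using \<beta>_le by (simp only: s_def)
            qed simp
            moreover have "main_const = (1 - 1 / (s * s)) * Z / 4" by (simp only: mc ps)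
            ultimately show ?thesis by simp
            qed
            finally show ?thesis by (rule suff)
          qed
        qed
      qed
    qed
  qed
qed

end

section \<open>Approach to a point of the circle and the uniform gap\<close>

context odd_prime
begin

definition log_gf :: "complex \<Rightarrow> complex" where
  "log_gf z = (\<Sum>n. of_real (lc (Suc n)) * z ^ Suc n)"

definition chi_power_series :: "nat \<Rightarrow> complex \<Rightarrow> complex" where
  "chi_power_series k z = (\<Sum>m. of_real (chi (Suc m) ^ Suc k) * z ^ (Suc k * Suc m))"

lemma log_gf_sums:
  assumes z: "norm z < 1"
  shows "(\<lambda>n. of_real (lc (Suc n)) * z ^ Suc n) sums log_gf z"
    and "(\<lambda>k. chi_power_series k z / of_nat (Suc k)) sums log_gf z"
proof -
  have b: "norm (z ^ Suc n) \<le> 1 * real (Suc n) ^ 0 * norm z ^ Suc n" for n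
    by (simp add: norm_power norm_mult)
  have b0: "0 \<le> norm z" by simp
  note L = lc_sums[where \<phi> = "\<lambda>n. z ^ n" and r = "norm z" and C = 1 and j = 0, OF b0 z b]
  show 1: "(\<lambda>n. of_real (lc (Suc n)) * z ^ Suc n) sums log_gf z"
    unfolding log_gf_def by (rule summable_sums[OF sums_summable[OF L(1)]])
  have "(\<Sum>m. of_real (chi (Suc m) ^ Suc k / real (Suc k)) * z ^ (Suc k * Suc m)) = chi_power_series k z / of_nat (Suc k)" for k
  proof -
    have s: "summable (\<lambda>m. of_real (chi (Suc m) ^ Suc k / real (Suc k)) * z ^ (Suc k * Suc m))"
      by (rule L(3))
    have e: "of_nat (Suc k) * (of_real (chi (Suc m) ^ Suc k / real (Suc k)) * z ^ (Suc k * Suc m))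
        = of_real (chi (Suc m) ^ Suc k) * z ^ (Suc k * Suc m)" for m
    proof -
      have "complex_of_nat (Suc k) * of_real (c / real (Suc k)) = of_real c" for c
        by (simp add: of_real_divide del: of_nat_Suc)
      then show ?thesis by (simp only: mult.assoc[symmetric])
    qed
    have "of_nat (Suc k) * (\<Sum>m. of_real (chi (Suc m) ^ Suc k / real (Suc k)) * z ^ (Suc k * Suc m)) = chi_power_series k z"
    proof -
      have "of_nat (Suc k) * (\<Sum>m. of_real (chi (Suc m) ^ Suc k / real (Suc k)) * z ^ (Suc k * Suc m))
          = (\<Sum>m. of_nat (Suc k) * (of_real (chi (Suc m) ^ Suc k / real (Suc k)) * z ^ (Suc k * Suc m)))"
        by (rule suminf_mult[OF s, symmetric])
      also have "\<dots> = chi_power_series k z" unfolding chi_power_series_def by (rule suminf_cong) (rule e)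
      finally show ?thesis .
    qed
    then show ?thesis by (simp add: eq_divide_eq mult.commute del: of_nat_Suc)
  qed
  then have "(\<lambda>k. chi_power_series k z / of_nat (Suc k)) sums (\<Sum>k. \<Sum>m. of_real (chi (Suc m) ^ Suc k / real (Suc k)) * z ^ (Suc k * Suc m))"
    using summable_sums[OF L(2)] by (simp only:)
  then show "(\<lambda>k. chi_power_series k z / of_nat (Suc k)) sums log_gf z"
    using sums_unique2[OF L(1) 1] by (simp only:)
qed

lemma norm_chi_power_le: "norm (of_real (chi m ^ k) :: complex) \<le> 1"
  using power_le_one[OF abs_ge_zero abs_chi_le_1, of m k] by (simp add: norm_power)

lemma chi_power_series_closed:
  assumes z: "norm z < 1"
  shows "chi_power_series k z = (\<Sum>r<p. of_real (chi r ^ Suc k) * z ^ (Suc k * r)) / (1 - z ^ (Suc k * p))"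
proof -
  define u where "u = z ^ Suc k"
  have u: "norm u < 1" using z power_Suc_less_one[of "norm z" k] unfolding u_def norm_power
    by (cases "z = 0") auto
  define a :: "nat \<Rightarrow> complex" where "a m = of_real (chi m ^ Suc k)" for m
  have s: "summable (\<lambda>m. a m * u ^ m)"
  proof (rule summable_comparison_test'[OF summable_geometric[of "norm u"]])
    show "norm (norm u) < 1" using u by simp
    show "norm (a m * u ^ m) \<le> norm u ^ m" for m
      using mult_right_mono[OF norm_chi_power_le[of m "Suc k"], of "norm u ^ m"]
      unfolding a_def norm_mult norm_power by simp
  qed
  define S where "S = (\<Sum>m. a m * u ^ m)"
  define N where "N = (\<Sum>r<p. a r * u ^ r)"
  have "S = (\<Sum>m. a (m + p) * u ^ (m + p)) + N"
    unfolding S_def N_def by (rule suminf_split_initial_segment[OF s])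
  also have "(\<Sum>m. a (m + p) * u ^ (m + p)) = (\<Sum>m. u ^ p * (a m * u ^ m))"
    by (rule suminf_cong) (simp add: a_def power_add)
  also have "\<dots> = u ^ p * S" unfolding S_def by (rule suminf_mult[OF s])
  finally have "S = u ^ p * S + N" .
  then have "S * (1 - u ^ p) = N" by (simp add: algebra_simps)
  moreover have "1 - u ^ p \<noteq> 0"
  proof
    assume "1 - u ^ p = 0"
    then have "norm u ^ p = 1" by (metis eq_iff_diff_eq_0 norm_one norm_power)
    moreover have "norm u ^ p < 1" using u p_pos by (cases "u = 0") (auto intro: power_less_one_iff[THEN iffD2])
    ultimately show False by simp
  qed
  ultimately have "S = N / (1 - u ^ p)" by (simp add: field_simps)
  moreover have "chi_power_series k z = S"
  proof -
    have "S = a 0 * u ^ 0 + (\<Sum>m. a (Suc m) * u ^ Suc m)"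
      unfolding S_def using suminf_split_head[OF s] by simp
    then show ?thesis by (simp add: chi_power_series_def a_def u_def power_mult[symmetric] del: power_Suc mult_Suc mult_Suc_right)
  qed
  ultimately show ?thesis by (simp only: N_def a_def u_def power_mult)
qed

text \<open>The bound is independent of the argument of \<open>z\<close>, so it dominates along
  every sequence of points in \<open>minor_arcs\<close>; its core is
  \<open>q / (1 - q) \<le> 1 / (K * t)\<close> for \<open>q = exp (- (K * t))\<close>.\<close>

lemma chi_power_series_bound:
  assumes t: "t > 0" and z: "norm z = exp (- t)"
  shows "t * norm (chi_power_series k z / of_nat (Suc k)) \<le> 1 / (real (Suc k))\<^sup>2"
proof -
  define K where "K = real (Suc k)"
  have K: "K > 0" by (simp add: K_def)
  define q where "q = exp (- (K * t))"
  have q: "0 < q" "q < 1" using K t by (auto simp: q_def)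
  have zq: "norm z ^ (Suc k * n) = q ^ n" for n
    unfolding z q_def K_def exp_of_nat_mult[symmetric] by (simp add: algebra_simps)
  have g: "(\<lambda>m. q * q ^ m) sums (q * (1 / (1 - q)))" using q by (intro sums_mult geometric_sums) auto
  have "norm (chi_power_series k z) \<le> (\<Sum>m. q * q ^ m)"
    unfolding chi_power_series_def
  proof (rule norm_suminf_le[OF _ sums_summable[OF g]])
    fix m
    show "norm (of_real (chi (Suc m) ^ Suc k) * z ^ (Suc k * Suc m)) \<le> q * q ^ m"
      using mult_right_mono[OF norm_chi_power_le[of "Suc m" "Suc k"], of "q ^ Suc m"] q
      unfolding norm_mult norm_power zq by simp
  qed
  also have "\<dots> = q * (1 / (1 - q))" using g by (simp add: sums_iff)
  also have "\<dots> \<le> 1 / (K * t)"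
  proof -
    have "1 + K * t \<le> exp (K * t)" by (rule exp_ge_add_one_self)
    then have "q * (1 + K * t) \<le> q * exp (K * t)" using q by (intro mult_left_mono) auto
    also have "\<dots> = 1" by (simp add: q_def flip: exp_add)
    finally have "q * (K * t) \<le> 1 - q" by (simp add: algebra_simps)
    then show ?thesis using q K t by (simp add: field_simps)
  qed
  finally have "t * norm (chi_power_series k z) \<le> t * (1 / (K * t))" using t by (intro mult_left_mono) auto
  then have "t * norm (chi_power_series k z) \<le> 1 / K" using t by simp
  then have "t * norm (chi_power_series k z) / K \<le> 1 / K / K" using K by (intro divide_right_mono) auto
  then show ?thesis unfolding norm_divide norm_of_nat K_def[symmetric] by (simp add: power2_eq_square)
qed

text \<open>In the closed form \<open>1 - z ^ (K * p)\<close> has a nonzero limit unless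
  \<open>\<zeta> ^ (K * p) = 1\<close>; in that case it is \<open>K * p * w\<close> to first order,
  and \<open>t / w\<close> tends to \<open>v\<close>.\<close>

lemma tendsto_chi_power_series:
  fixes t :: "nat \<Rightarrow> real" and \<zeta> v :: complex
  assumes t: "\<And>n. t n > 0" "t \<longlonglongrightarrow> 0" and w: "\<And>n. Re (w n) = t n" "w \<longlonglongrightarrow> 0"
    and v: "(\<lambda>n. of_real (t n) / w n) \<longlonglongrightarrow> v" and \<zeta>: "norm \<zeta> = 1"
  shows "(\<lambda>n. of_real (t n) * (chi_power_series k (\<zeta> * exp (- w n)) / of_nat (Suc k))) \<longlonglongrightarrow> chi_power_mean \<zeta> (Suc k) / of_real ((real (Suc k))\<^sup>2) * v"
proof -
  define K where "K = Suc k"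
  have Kn: "of_nat K \<noteq> (0 :: complex)" unfolding K_def by (rule of_nat_neq_0)
  define z where "z n = \<zeta> * exp (- w n)" for n
  have z1: "norm (z n) < 1" for n using t(1)[of n] \<zeta> by (simp add: z_def norm_mult w)
  have zl: "z \<longlonglongrightarrow> \<zeta>"
  proof -
    have "(\<lambda>n. \<zeta> * exp (- w n)) \<longlonglongrightarrow> \<zeta> * exp (- 0)" by (intro tendsto_intros w)
    then show ?thesis by (simp add: z_def[abs_def])
  qed
  define N where "N x = (\<Sum>r<p. of_real (chi r ^ K) * x ^ (K * r))" for x :: complex
  have Nl: "(\<lambda>n. N (z n)) \<longlonglongrightarrow> N \<zeta>" unfolding N_def by (intro tendsto_intros zl)
  have tl: "(\<lambda>n. complex_of_real (t n)) \<longlonglongrightarrow> 0" using tendsto_of_real[OF t(2)] by simp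
  have fkz: "of_real (t n) * (chi_power_series k (z n) / of_nat K) = of_real (t n) / (1 - z n ^ (K * p)) * N (z n) / of_nat K" for n
    unfolding chi_power_series_closed[OF z1] K_def[symmetric] N_def by simp
  have "(\<lambda>n. of_real (t n) / (1 - z n ^ (K * p)) * N (z n) / of_nat K) \<longlonglongrightarrow> chi_power_mean \<zeta> K / of_real ((real K)\<^sup>2) * v"
  proof (cases "\<zeta> ^ (K * p) = 1")
    case False
    have "(\<lambda>n. of_real (t n) / (1 - z n ^ (K * p)) * N (z n) / of_nat K) \<longlonglongrightarrow> 0 / (1 - \<zeta> ^ (K * p)) * N \<zeta> / of_nat K"
      by (intro tendsto_intros tl zl Nl) (use False Kn in auto)
    then show ?thesis using False by (simp add: chi_power_mean_def)
  next
    case True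
    define c :: complex where "c = of_nat (K * p)"
    have c: "c \<noteq> 0" unfolding c_def of_nat_eq_0_iff using p_pos by (simp add: K_def)
    have wn: "w n \<noteq> 0" for n using w(1)[of n] t(1)[of n] by auto
    define x where "x n = - c * w n" for n
    have x0: "x n \<noteq> 0" for n using c wn by (simp add: x_def)
    have "x \<longlonglongrightarrow> - c * 0" unfolding x_def[abs_def] by (intro tendsto_intros w)
    then have xl: "x \<longlonglongrightarrow> 0" by simp
    have "filterlim x (at 0) sequentially" using xl x0 by (auto simp: filterlim_at)
    from filterlim_compose[OF lim_exp_minus_1 this]
    have el: "(\<lambda>n. (exp (x n) - 1) / x n) \<longlonglongrightarrow> 1" .
    have "(\<lambda>n. of_real (t n) / w n * (1 / (c * ((exp (x n) - 1) / x n))) * N (z n) / of_nat K) \<longlonglongrightarrow> v * (1 / (c * 1)) * N \<zeta> / of_nat K"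
      by (intro tendsto_intros v el Nl) (use c Kn in auto)
    moreover have "of_real (t n) / w n * (1 / (c * ((exp (x n) - 1) / x n))) = of_real (t n) / (1 - z n ^ (K * p))" for n
    proof -
      have "z n ^ (K * p) = exp (x n)"
      proof -
        have "z n ^ (K * p) = exp (- w n) ^ (K * p)" unfolding z_def power_mult_distrib True by simp
        also have "\<dots> = exp (x n)" unfolding exp_of_nat_mult[symmetric] by (simp add: x_def c_def)
        finally show ?thesis .
      qed
      moreover have "1 / (c * ((exp (x n) - 1) / x n)) = w n / (1 - exp (x n))"
      proof -
        have "c * ((exp (x n) - 1) / x n) = (1 - exp (x n)) / w n"
          using c wn[of n] by (simp add: x_def field_simps)
        then show ?thesis by simp
      qed
      ultimately show ?thesis using wn[of n] by simp
    qed
    moreover have "v * (1 / (c * 1)) * N \<zeta> / of_nat K = chi_power_mean \<zeta> K / of_real ((real K)\<^sup>2) * v"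
      using True by (simp add: chi_power_mean_def N_def c_def power2_eq_square mult_ac)
    ultimately show ?thesis by (simp only:)
  qed
  then show ?thesis unfolding fkz[symmetric] by (simp only: K_def z_def)
qed

lemma cusp_value_real:
  assumes "\<zeta> = 1 \<or> \<zeta> = -1" shows "cusp_value \<zeta> = of_real main_const"
proof -
  have "chi_power_mean \<zeta> (Suc k) = of_real (if odd k then 1 - 1 / real p else 0)" for k
  proof (cases "odd k")
    case True
    then have e: "even (Suc k)" by simp
    have z1: "\<zeta> ^ (Suc k * n) = 1" for n
      using assms e by (elim disjE) (simp, simp only: power_mult power_minus_even power_one)
    \<comment> \<open>The factor \<open>om ^ (p * r) = 1\<close> is inserted so that
      \<open>sum_coprime_om_power\<close> applies at \<open>k = p\<close>.\<close>
    have "(\<Sum>r<p. of_real (chi r ^ Suc k) * \<zeta> ^ (Suc k * r)) = (\<Sum>r<p. (if p dvd r then 0 else 1) * om ^ (p * r))"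
      unfolding z1 chi_power_even[OF e zero_less_Suc] by (rule sum.cong) (auto simp: power_mult)
    also have "\<dots> = of_nat p - 1" unfolding sum_coprime_om_power by simp
    finally have S: "(\<Sum>r<p. of_real (chi r ^ Suc k) * \<zeta> ^ (Suc k * r)) = of_nat p - 1" .
    have "chi_power_mean \<zeta> (Suc k) = (of_nat p - 1) / of_nat p"
      unfolding chi_power_mean_def S by (simp only: z1[of p] simp_thms if_True)
    then show ?thesis using True p_pos by (simp add: diff_divide_distrib)
  next
    case False
    then have o: "odd (Suc k)" by simp
    show ?thesis
    proof (cases "\<zeta> = 1")
      case True
      have "(\<Sum>r<p. complex_of_real (chi r ^ Suc k) * \<zeta> ^ (Suc k * r)) = of_real (\<Sum>r<p. chi r)"
        unfolding chi_power_odd[OF o] True by simp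
      then show ?thesis using False unfolding chi_power_mean_def sum_chi by simp
    next
      case n1: False
      have "\<zeta> = -1" using assms n1 by simp
      have "odd (Suc k * p)" using o odd_p by simp
      then have "\<zeta> ^ (Suc k * p) = -1" unfolding \<open>\<zeta> = -1\<close> by (rule neg_one_odd_power)
      then show ?thesis using False by (simp add: chi_power_mean_def del: mult_Suc)
    qed
  qed
  then have "cusp_value \<zeta> = (\<Sum>k. complex_of_real ((if odd k then 1 - 1 / real p else 0) / (real (Suc k))\<^sup>2))"
    unfolding cusp_value_def by (simp only: of_real_divide)
  also have "\<dots> = of_real main_const"
    using sums_of_real[OF main_const_sums, where 'a = complex] by (simp only: sums_iff)
  finally show ?thesis .
qed

text \<open>Counterexamples for \<open>\<delta> = 1 / Suc n\<close> have a subsequence along which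
  the angles tend to some \<open>\<theta>\<close> and \<open>T / W\<close> to some \<open>v\<close>.
  Tannery's theorem gives the limit \<open>Re (cusp_value \<zeta> * v)\<close>, at least
  \<open>main_const\<close>. For \<open>\<zeta>\<^sup>2 \<noteq> 1\<close> this contradicts
  \<open>cusp_value_Re_less\<close>; at 1 and -1 the excluded arcs force
  \<open>Re v < 1\<close>.\<close>

lemma minor_arcs:
  assumes p: "p \<noteq> 5" "p mod 8 \<noteq> 1" and \<eta>: "\<eta> > 0"
  shows "\<exists>\<delta>>0. \<forall>t \<theta>. 0 < t \<longrightarrow> t < \<delta> \<longrightarrow> - (pi / 2) \<le> \<theta> \<longrightarrow> \<theta> \<le> 3 * pi / 2 \<longrightarrow> \<eta> * t \<le> \<bar>\<theta>\<bar> \<longrightarrow> \<eta> * t \<le> \<bar>\<theta> - pi\<bar>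
    \<longrightarrow> t * Re (log_gf (of_real (exp (- t)) * cis \<theta>)) \<le> main_const - \<delta>"
proof (rule ccontr)
  assume "\<not> ?thesis"
  then have neg: "\<exists>t \<theta>. 0 < t \<and> t < \<delta> \<and> - (pi / 2) \<le> \<theta> \<and> \<theta> \<le> 3 * pi / 2 \<and> \<eta> * t \<le> \<bar>\<theta>\<bar> \<and> \<eta> * t \<le> \<bar>\<theta> - pi\<bar>
    \<and> t * Re (log_gf (of_real (exp (- t)) * cis \<theta>)) > main_const - \<delta>" if "\<delta> > 0" for \<delta>
    using that by (metis linorder_not_le)
  define e where "e n = 1 / real (Suc n)" for n
  have e: "e n > 0" for n by (simp add: e_def)
  have el: "e \<longlonglongrightarrow> 0" unfolding e_def[abs_def] by real_asymp
  from neg[OF e] obtain T \<Theta> where T: "\<And>n. 0 < T n" "\<And>n. T n < e n"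
    and \<Theta>: "\<And>n. - (pi / 2) \<le> \<Theta> n" "\<And>n. \<Theta> n \<le> 3 * pi / 2" "\<And>n. \<eta> * T n \<le> \<bar>\<Theta> n\<bar>" "\<And>n. \<eta> * T n \<le> \<bar>\<Theta> n - pi\<bar>"
    and big: "\<And>n. T n * Re (log_gf (of_real (exp (- T n)) * cis (\<Theta> n))) > main_const - e n"
    by metis
  have Tl: "T \<longlonglongrightarrow> 0"
    by (rule tendsto_sandwich[OF always_eventually always_eventually tendsto_const el]) (use T in \<open>auto intro: less_imp_le\<close>)
  have "\<forall>n. \<Theta> n \<in> {- (pi / 2)..3 * pi / 2}" using \<Theta> by simp
  then obtain \<theta> r1 where r1: "\<theta> \<in> {- (pi / 2)..3 * pi / 2}" "strict_mono r1" "(\<Theta> \<circ> r1) \<longlonglongrightarrow> \<theta>"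
    using seq_compactE[OF compact_imp_seq_compact[OF compact_Icc]] by metis
  \<comment> \<open>The points are \<open>\<zeta> * exp (- W n)\<close> with
    \<open>\<zeta> = cis \<theta>\<close>. Since \<open>Re (W n) = T n\<close>, the quotients
    \<open>V n\<close> satisfy \<open>Re (V n) = (norm (V n))\<^sup>2\<close>, so they stay in the
    unit disc and accumulate.\<close>
  define W where "W n = Complex (T n) (- (\<Theta> n - \<theta>))" for n
  define V where "V n = complex_of_real (T n) / W n" for n
  have W: "Re (W n) = T n" for n by (simp add: W_def)
  have W0: "W n \<noteq> 0" for n using W[of n] T(1)[of n] by auto
  have Wn: "(norm (W n))\<^sup>2 = (T n)\<^sup>2 + (\<Theta> n - \<theta>)\<^sup>2" for n by (simp add: W_def cmod_power2 power2_commute)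
  have Vn: "(norm (V n))\<^sup>2 = (T n)\<^sup>2 / ((T n)\<^sup>2 + (\<Theta> n - \<theta>)\<^sup>2)" for n
    by (simp add: V_def norm_divide power_divide Wn)
  have VRe: "Re (V n) = (norm (V n))\<^sup>2" for n
  proof -
    have "(\<theta> - \<Theta> n) * (\<theta> - \<Theta> n) = (\<Theta> n - \<theta>) * (\<Theta> n - \<theta>)" by (simp add: algebra_simps)
    then show ?thesis unfolding Vn by (simp add: V_def W_def Re_divide power2_eq_square)
  qed
  have V1: "norm (V n) \<le> 1" for n
  proof -
    have "(norm (V n))\<^sup>2 \<le> 1" unfolding Vn using T(1)[of n] by (simp add: divide_le_eq_1 add_pos_nonneg)
    then show ?thesis using abs_square_le_1[of "norm (V n)"] by simp
  qed
  have "\<forall>n. (V \<circ> r1) n \<in> cball 0 1" using V1 by simp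
  then obtain v r2 where r2: "strict_mono r2" "((V \<circ> r1) \<circ> r2) \<longlonglongrightarrow> v"
    using seq_compactE[OF compact_imp_seq_compact[OF compact_cball[of "0::complex" 1]]] by metis
  define r where "r = r1 \<circ> r2"
  have r: "strict_mono r" unfolding r_def using r1(2) r2(1) by (rule strict_mono_o)
  define t where "t = T \<circ> r"
  define w where "w = W \<circ> r"
  have tl: "t \<longlonglongrightarrow> 0" unfolding t_def by (rule LIMSEQ_subseq_LIMSEQ[OF Tl r])
  have \<Theta>l: "(\<Theta> \<circ> r) \<longlonglongrightarrow> \<theta>" unfolding r_def comp_assoc[symmetric] by (rule LIMSEQ_subseq_LIMSEQ[OF r1(3) r2(1)])
  have wl: "w \<longlonglongrightarrow> 0"
  proof -
    have "(\<lambda>n. Complex (t n) (- ((\<Theta> \<circ> r) n - \<theta>))) \<longlonglongrightarrow> Complex 0 (- (\<theta> - \<theta>))"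
      by (intro tendsto_Complex tendsto_minus tendsto_diff tl \<Theta>l tendsto_const)
    then show ?thesis by (simp add: w_def W_def t_def o_def zero_complex.code)
  qed
  have vl: "(\<lambda>n. of_real (t n) / w n) \<longlonglongrightarrow> v"
    using r2(2) by (simp add: o_def r_def t_def w_def V_def)
  define \<zeta> where "\<zeta> = cis \<theta>"
  have \<zeta>: "norm \<zeta> = 1" by (simp add: \<zeta>_def)
  have zw: "of_real (exp (- t n)) * cis (\<Theta> (r n)) = \<zeta> * exp (- w n)" for n
  proof -
    have "exp (- w n) = of_real (exp (- t n)) * cis (\<Theta> (r n) - \<theta>)"
      by (simp add: w_def W_def t_def exp_eq_polar)
    moreover have "cis (\<Theta> (r n)) = \<zeta> * cis (\<Theta> (r n) - \<theta>)" by (simp add: \<zeta>_def cis_mult)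
    ultimately show ?thesis by simp
  qed
  have t0: "t n > 0" for n by (simp add: t_def T)
  have wt: "Re (w n) = t n" for n by (simp add: w_def t_def W)
  define a where "a k n = complex_of_real (t n) * (chi_power_series k (\<zeta> * exp (- w n)) / of_nat (Suc k))" for k n
  have nz: "norm (\<zeta> * exp (- w n)) = exp (- t n)" for n by (simp add: norm_mult \<zeta> wt)
  have lim: "(\<lambda>n. a k n) \<longlonglongrightarrow> chi_power_mean \<zeta> (Suc k) / of_real ((real (Suc k))\<^sup>2) * v" for k
    unfolding a_def by (rule tendsto_chi_power_series[OF t0 tl wt wl vl \<zeta>])
  have bnd: "\<forall>\<^sub>F (k, n) in at_top \<times>\<^sub>F sequentially. norm (a k n) \<le> 1 / (real (Suc k))\<^sup>2"
  proof (rule always_eventually, safe)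
    fix k n
    show "norm (a k n) \<le> 1 / (real (Suc k))\<^sup>2"
      using chi_power_series_bound[OF t0[of n] nz, of k] unfolding a_def norm_mult norm_of_real abs_of_pos[OF t0] .
  qed
  have "(\<lambda>n. \<Sum>k. a k n) \<longlonglongrightarrow> (\<Sum>k. chi_power_mean \<zeta> (Suc k) / of_real ((real (Suc k))\<^sup>2) * v)"
    using tannerys_theorem[where a = a, OF lim bnd sums_summable[OF inverse_Suc_squares_sums]] by simp
  also have "(\<Sum>k. chi_power_mean \<zeta> (Suc k) / of_real ((real (Suc k))\<^sup>2) * v) = cusp_value \<zeta> * v"
    unfolding cusp_value_def by (rule suminf_mult2[OF cusp_value_summable[OF \<zeta>], symmetric])
  also have "(\<lambda>n. \<Sum>k. a k n) = (\<lambda>n. of_real (t n) * log_gf (\<zeta> * exp (- w n)))"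
  proof
    fix n
    have "norm (\<zeta> * exp (- w n)) < 1" unfolding nz using t0[of n] by simp
    then have "(\<lambda>k. a k n) sums (of_real (t n) * log_gf (\<zeta> * exp (- w n)))"
      unfolding a_def by (intro sums_mult log_gf_sums(2))
    then show "(\<Sum>k. a k n) = of_real (t n) * log_gf (\<zeta> * exp (- w n))" by (simp add: sums_iff)
  qed
  finally have "(\<lambda>n. Re (of_real (t n) * log_gf (\<zeta> * exp (- w n)))) \<longlonglongrightarrow> Re (cusp_value \<zeta> * v)"
    by (rule tendsto_Re)
  then have lm: "(\<lambda>n. t n * Re (log_gf (\<zeta> * exp (- w n)))) \<longlonglongrightarrow> Re (cusp_value \<zeta> * v)" by simp
  have lower: "(\<lambda>n. main_const - e (r n)) \<longlonglongrightarrow> main_const - 0"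
    using LIMSEQ_subseq_LIMSEQ[OF el r] by (intro tendsto_diff tendsto_const) (simp add: o_def)
  have "main_const - 0 \<le> Re (cusp_value \<zeta> * v)"
  proof (rule LIMSEQ_le[OF lower lm], intro exI[of _ 0] allI impI)
    fix n
    show "main_const - e (r n) \<le> t n * Re (log_gf (\<zeta> * exp (- w n)))"
      using big[of "r n"] zw[of n] by (simp add: t_def)
  qed
  then have ge: "main_const \<le> Re (cusp_value \<zeta> * v)" by simp
  have Vl: "(\<lambda>n. V (r n)) \<longlonglongrightarrow> v" using vl by (simp add: V_def t_def w_def)
  have vRe: "Re v = (norm v)\<^sup>2"
  proof (rule LIMSEQ_unique[OF tendsto_Re[OF Vl]])
    show "(\<lambda>n. Re (V (r n))) \<longlonglongrightarrow> (norm v)\<^sup>2"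
      unfolding VRe by (intro tendsto_power tendsto_norm Vl)
  qed
  show False
  proof (cases "\<zeta>\<^sup>2 = 1")
    case False
    then show False using cusp_value_Re_less[OF \<zeta> False vRe p] ge by simp
  next
    case True
    then have z: "\<zeta> = 1 \<or> \<zeta> = -1" by (simp add: power2_eq_1_iff)
    have \<theta>: "\<theta> = 0 \<or> \<theta> = pi"
    proof -
      have "sin \<theta> = 0" using z by (auto simp: \<zeta>_def complex_eq_iff)
      then obtain i :: int where i: "\<theta> = of_int i * pi" by (auto simp: sin_zero_iff_int2)
      have "- (1/2) * pi \<le> of_int i * pi" "of_int i * pi \<le> (3/2) * pi" using r1(1) i by auto
      then have "- (1/2) \<le> real_of_int i" "real_of_int i \<le> 3/2" by (simp_all only: mult_le_cancel_right_pos[OF pi_gt_zero])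
      then have "i = 0 \<or> i = 1" by linarith
      then show ?thesis using i by auto
    qed
    have "(norm (V n))\<^sup>2 \<le> 1 / (1 + \<eta>\<^sup>2)" for n
    proof -
      have "\<eta> * T n \<le> \<bar>\<Theta> n - \<theta>\<bar>" using \<theta> \<Theta>(3,4)[of n] by auto
      then have "(\<eta> * T n)\<^sup>2 \<le> \<bar>\<Theta> n - \<theta>\<bar>\<^sup>2" using \<eta> T(1)[of n] by (intro power_mono) auto
      then have "(T n)\<^sup>2 * (1 + \<eta>\<^sup>2) \<le> (T n)\<^sup>2 + (\<Theta> n - \<theta>)\<^sup>2" by (simp add: power_mult_distrib algebra_simps)
      then have "(T n)\<^sup>2 / ((T n)\<^sup>2 + (\<Theta> n - \<theta>)\<^sup>2) \<le> (T n)\<^sup>2 / ((T n)\<^sup>2 * (1 + \<eta>\<^sup>2))"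
        using T(1)[of n] by (intro divide_left_mono mult_pos_pos add_pos_nonneg) auto
      also have "\<dots> = 1 / (1 + \<eta>\<^sup>2)" using T(1)[of n] by simp
      finally show ?thesis unfolding Vn .
    qed
    then have "(norm v)\<^sup>2 \<le> 1 / (1 + \<eta>\<^sup>2)"
      by (intro LIMSEQ_le_const2[OF tendsto_power[OF tendsto_norm[OF Vl]]]) auto
    also have "\<dots> < 1" using \<eta> by (simp add: add_pos_pos)
    finally have "Re v < 1" unfolding vRe .
    then have "main_const * Re v < main_const * 1" using main_const_pos by (intro mult_strict_left_mono)
    moreover have "Re (cusp_value \<zeta> * v) = main_const * Re v" unfolding cusp_value_real[OF z] by simp
    ultimately show False using ge by simp
  qed
qed

end

section \<open>The saddle point\<close>

lemma gaussian_integrable_on: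
  fixes a :: real
  assumes "a > 0" shows "(\<lambda>x. exp (- (a * x\<^sup>2))) integrable_on UNIV"
proof -
  define \<sigma> where "\<sigma> = 1 / sqrt (2 * a)"
  have \<sigma>: "\<sigma> > 0" "2 * \<sigma>\<^sup>2 = 1 / a" using assms by (simp_all add: \<sigma>_def power_divide)
  have "(\<lambda>x. normal_density 0 \<sigma> x) integrable_on UNIV"
    by (rule integrable_on_lborel) (rule integrable_normal_density[OF \<sigma>(1)])
  then have "(\<lambda>x. sqrt (2 * pi * \<sigma>\<^sup>2) * normal_density 0 \<sigma> x) integrable_on UNIV"
    by (rule integrable_on_mult_right)
  moreover have "sqrt (2 * pi * \<sigma>\<^sup>2) * normal_density 0 \<sigma> x = exp (- (a * x\<^sup>2))" for x
  proof -
    have "- ((x - 0)\<^sup>2) / (2 * \<sigma>\<^sup>2) = - (a * x\<^sup>2)" unfolding \<sigma>(2) using assms by simp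
    moreover have "sqrt (2 * pi * \<sigma>\<^sup>2) > 0" using \<sigma> by simp
    ultimately show ?thesis using \<sigma>(1) unfolding normal_density_def by simp
  qed
  ultimately show ?thesis by (simp only:)
qed

lemma cis_taylor: "norm (cis x - (1 + \<i> * of_real x - of_real (x\<^sup>2 / 2))) \<le> \<bar>x\<bar> ^ 3"
proof -
  have "norm (exp (\<i> * of_real x) - (\<Sum>k\<le>2. (\<i> * of_real x) ^ k / fact k)) \<le> exp \<bar>Re (\<i> * of_real x)\<bar> * norm (\<i> * of_real x) ^ Suc 2 / fact 2"
    by (rule Taylor_exp)
  moreover have "(\<Sum>k\<le>2. (\<i> * complex_of_real x) ^ k / fact k) = 1 + \<i> * of_real x - of_real (x\<^sup>2 / 2)"
    by (simp add: numeral_2_eq_2 power2_eq_square[unfolded numeral_2_eq_2] complex_eq_iff)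
  moreover have "exp \<bar>Re (\<i> * of_real x)\<bar> * norm (\<i> * of_real x) ^ Suc 2 / fact 2 = \<bar>x\<bar> ^ 3 / 2"
    by (simp add: norm_mult numeral_3_eq_3)
  ultimately have "norm (cis x - (1 + \<i> * of_real x - of_real (x\<^sup>2 / 2))) \<le> \<bar>x\<bar> ^ 3 / 2"
    by (simp only: cis_conv_exp)
  also have "\<dots> \<le> \<bar>x\<bar> ^ 3" by simp
  finally show ?thesis .
qed

section \<open>Taylor expansion on the arcs and the rescaled Gaussian integral\<close>

context odd_prime
begin

lemma log_gf_eq_eval_fps:
  assumes "norm z < 1" shows "log_gf z = eval_fps (log_fps (legendre_char p)) z"
proof -
  define h where "h n = complex_of_real (lc n) * z ^ n" for n
  have "(\<lambda>n. h (Suc n)) sums log_gf z" unfolding h_def by (rule log_gf_sums(1)[OF assms])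
  then have "h sums (log_gf z + h 0)" by (subst (asm) sums_Suc_iff)
  then have "h sums log_gf z" by (simp add: h_def log_coeff_def)
  then have "log_gf z = (\<Sum>n. h n)" by (rule sums_unique)
  then show ?thesis by (simp add: eval_fps_def log_fps_def h_def)
qed

lemma gen_fun_eq: "norm z < 1 \<Longrightarrow> gen_fun (legendre_char p) z = exp (log_gf z)"
  by (simp add: gen_fun_def log_gf_eq_eval_fps)

lemma continuous_on_log_gf: "continuous_on (ball 0 1) log_gf"
proof (rule continuous_on_eq)
  show "continuous_on (ball 0 1) (eval_fps (log_fps (legendre_char p)))"
    by (intro holomorphic_on_imp_continuous_on log_fps_holomorphic legendre_char_le)
qed (simp add: log_gf_eq_eval_fps)

definition log_gf_polar :: "real \<Rightarrow> real \<Rightarrow> real \<Rightarrow> complex" where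
  "log_gf_polar s t \<phi> = log_gf (of_real (s * exp (- t)) * cis \<phi>)"

definition remainder :: "real \<Rightarrow> real \<Rightarrow> real \<Rightarrow> complex" where
  "remainder s t \<phi> = log_gf_polar s t \<phi> - (of_real (B 0 s t) + \<i> * of_real (\<phi> * B 1 s t) - of_real (\<phi>\<^sup>2 / 2 * B 2 s t))"

text \<open>\<open>cis_taylor\<close> is applied term by term; the third absolute moment of
  \<open>lc\<close> is of order \<open>1 / t ^ 4\<close>, for both signs \<open>s\<close>
  alike.\<close>

lemma remainder_bound:
  "\<exists>C>0. \<forall>s t \<phi>. (s = 1 \<or> s = -1) \<longrightarrow> t > 0 \<longrightarrow> norm (remainder s t \<phi>) \<le> C * \<bar>\<phi>\<bar> ^ 3 / t ^ 4"
proof -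
  obtain C where C: "C > 0" "\<And>t. t > 0 \<Longrightarrow> summable (\<lambda>n. \<bar>lc (Suc n)\<bar> * (real (Suc n) ^ 3 * exp (- (real (Suc n) * t))))"
     "\<And>t. t > 0 \<Longrightarrow> (\<Sum>n. \<bar>lc (Suc n)\<bar> * (real (Suc n) ^ 3 * exp (- (real (Suc n) * t)))) \<le> C / t ^ 4"
    using abs_lc_cube_sum_bound by blast
  have "norm (remainder s t \<phi>) \<le> C * \<bar>\<phi>\<bar> ^ 3 / t ^ 4" if s: "s = 1 \<or> s = -1" and t: "t > 0" for s t \<phi>
  proof -
    define c where "c n = lc (Suc n) * (s ^ Suc n * exp (- (real (Suc n) * t)))" for n
    have nz: "norm (of_real (s * exp (- t)) * cis \<phi>) < 1"
      using s t by (auto simp: norm_mult)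
    have pw: "(of_real (s * exp (- t)) * cis \<phi>) ^ Suc n = of_real (s ^ Suc n * exp (- (real (Suc n) * t))) * cis (real (Suc n) * \<phi>)" for n
      unfolding power_mult_distrib Complex.DeMoivre exp_mult_power by (simp del: power_Suc of_nat_Suc add: power_mult_distrib)
    have h: "(\<lambda>n. of_real (c n) * cis (real (Suc n) * \<phi>)) sums log_gf_polar s t \<phi>"
      using log_gf_sums(1)[OF nz] unfolding pw log_gf_polar_def c_def by (simp only: of_real_mult mult.assoc)
    have b0: "(\<lambda>n. complex_of_real (c n)) sums of_real (B 0 s t)"
      using sums_of_real[OF B_sums(1)[OF t s, of 0], where 'a = complex] by (simp only: c_def power_0 mult_1)
    have b1: "(\<lambda>n. \<i> * of_real \<phi> * complex_of_real (c n * real (Suc n))) sums (\<i> * of_real \<phi> * of_real (B 1 s t))"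
    proof (intro sums_mult sums_of_real)
      have "c n * real (Suc n) = lc (Suc n) * (real (Suc n) ^ 1 * (s ^ Suc n * exp (- (real (Suc n) * t))))" for n
        by (simp only: c_def power_one_right mult_ac)
      then show "(\<lambda>n. c n * real (Suc n)) sums B 1 s t" using B_sums(1)[OF t s, of 1] by (simp only:)
    qed
    have b2: "(\<lambda>n. of_real (\<phi>\<^sup>2 / 2) * complex_of_real (c n * (real (Suc n))\<^sup>2)) sums (of_real (\<phi>\<^sup>2 / 2) * of_real (B 2 s t))"
    proof (intro sums_mult sums_of_real)
      have "c n * (real (Suc n))\<^sup>2 = lc (Suc n) * (real (Suc n) ^ 2 * (s ^ Suc n * exp (- (real (Suc n) * t))))" for n
        by (simp only: c_def mult_ac)
      then show "(\<lambda>n. c n * (real (Suc n))\<^sup>2) sums B 2 s t" using B_sums(1)[OF t s, of 2] by (simp only:)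
    qed
    define D where "D n = of_real (c n) * (cis (real (Suc n) * \<phi>) - (1 + \<i> * of_real (real (Suc n) * \<phi>) - of_real ((real (Suc n) * \<phi>)\<^sup>2 / 2)))" for n
    have "(\<lambda>n. of_real (c n) * cis (real (Suc n) * \<phi>) - (complex_of_real (c n) + \<i> * of_real \<phi> * complex_of_real (c n * real (Suc n))
        - of_real (\<phi>\<^sup>2 / 2) * complex_of_real (c n * (real (Suc n))\<^sup>2)))
      sums (log_gf_polar s t \<phi> - (of_real (B 0 s t) + \<i> * of_real \<phi> * of_real (B 1 s t) - of_real (\<phi>\<^sup>2 / 2) * of_real (B 2 s t)))"
      by (intro sums_diff sums_add h b0 b1 b2)
    moreover have "of_real (c n) * cis (real (Suc n) * \<phi>) - (complex_of_real (c n) + \<i> * of_real \<phi> * complex_of_real (c n * real (Suc n))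
        - of_real (\<phi>\<^sup>2 / 2) * complex_of_real (c n * (real (Suc n))\<^sup>2)) = D n" for n
      unfolding D_def power_mult_distrib by (simp add: algebra_simps del: of_nat_Suc)
    moreover have "log_gf_polar s t \<phi> - (of_real (B 0 s t) + \<i> * of_real \<phi> * of_real (B 1 s t) - of_real (\<phi>\<^sup>2 / 2) * of_real (B 2 s t)) = remainder s t \<phi>"
      unfolding remainder_def by (simp only: of_real_mult mult.assoc)
    ultimately have Ds: "D sums remainder s t \<phi>" by (simp only:)
    have Dn: "norm (D n) \<le> \<bar>\<phi>\<bar> ^ 3 * (\<bar>lc (Suc n)\<bar> * (real (Suc n) ^ 3 * exp (- (real (Suc n) * t))))" for n
    proof -
      have "\<bar>s\<bar> ^ Suc n = 1" using s by auto
      then have cn: "\<bar>c n\<bar> = \<bar>lc (Suc n)\<bar> * exp (- (real (Suc n) * t))"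
        unfolding c_def abs_mult power_abs by simp
      have "norm (D n) \<le> \<bar>c n\<bar> * \<bar>real (Suc n) * \<phi>\<bar> ^ 3"
        unfolding D_def norm_mult norm_of_real by (intro mult_left_mono cis_taylor) simp
      also have "\<dots> = \<bar>\<phi>\<bar> ^ 3 * (\<bar>lc (Suc n)\<bar> * (real (Suc n) ^ 3 * exp (- (real (Suc n) * t))))"
        unfolding cn abs_mult power_mult_distrib by (simp add: mult_ac del: of_nat_Suc)
      finally show ?thesis .
    qed
    have "norm (remainder s t \<phi>) \<le> (\<Sum>n. \<bar>\<phi>\<bar> ^ 3 * (\<bar>lc (Suc n)\<bar> * (real (Suc n) ^ 3 * exp (- (real (Suc n) * t)))))"
      unfolding sums_unique[OF Ds] by (rule norm_suminf_le[OF Dn summable_mult[OF C(2)[OF t]]])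
    also have "\<dots> = \<bar>\<phi>\<bar> ^ 3 * (\<Sum>n. \<bar>lc (Suc n)\<bar> * (real (Suc n) ^ 3 * exp (- (real (Suc n) * t))))"
      by (rule suminf_mult[OF C(2)[OF t]])
    also have "\<dots> \<le> \<bar>\<phi>\<bar> ^ 3 * (C / t ^ 4)" by (intro mult_left_mono C(3) t) simp
    finally show ?thesis by (simp add: mult.commute)
  qed
  then show ?thesis using C(1) by blast
qed

text \<open>The exponent is the limit of the quadratic term: \<open>B 2 s t\<close> is asymptotic to
  \<open>2 * main_const / t ^ 3\<close>, and with \<open>\<phi>\<^sup>2 = t ^ 3 * x\<^sup>2\<close>
  the factor 1/2 leaves \<open>main_const * x\<^sup>2\<close>.\<close>

definition gauss_int :: real where
  "gauss_int = integral UNIV (\<lambda>x :: real. exp (- (main_const * x\<^sup>2)))"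

lemma gauss_int_pos: "gauss_int > 0"
proof -
  have "0 < exp (- main_const)" by simp
  also have "exp (- main_const) = integral {0..1 :: real} (\<lambda>x. exp (- main_const))" by simp
  also have "\<dots> \<le> integral {0..1} (\<lambda>x :: real. exp (- (main_const * x\<^sup>2)))"
  proof (rule integral_le)
    show "(\<lambda>x :: real. exp (- (main_const * x\<^sup>2))) integrable_on {0..1}"
      by (intro integrable_continuous_real continuous_intros)
    fix x :: real assume "x \<in> {0..1}"
    then have "main_const * x\<^sup>2 \<le> main_const * 1"
      using main_const_pos by (intro mult_left_mono) (auto simp: power_le_one)
    then show "exp (- main_const) \<le> exp (- (main_const * x\<^sup>2))" by simp
  qed auto
  also have "\<dots> \<le> gauss_int"
    unfolding gauss_int_def
    by (intro integral_subset_le gaussian_integrable_on main_const_pos integrable_continuous_real continuous_intros) auto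
  finally show ?thesis .
qed

text \<open>The integrand on the arc \<open>\<bar>\<phi>\<bar> \<le> \<eta> t\<close>, rescaled by \<open>\<phi> = t sqrt t x\<close> to make the quadratic term of order 1.\<close>

definition arc_kernel :: "real \<Rightarrow> real \<Rightarrow> real \<Rightarrow> real \<Rightarrow> complex" where
  "arc_kernel \<eta> s t x = (if x \<in> {- (\<eta> / sqrt t)..\<eta> / sqrt t} then
     exp (log_gf_polar s t (t * sqrt t * x) - of_real (B 0 s t) - \<i> * of_real (t * sqrt t * x * B 1 s t)) else 0)"

lemma continuous_on_log_gf_polar:
  assumes "t > 0" "s = 1 \<or> s = -1"
  shows "continuous_on S (\<lambda>x. log_gf_polar s t (c * x))"
  unfolding log_gf_polar_def
proof (rule continuous_on_compose2[OF continuous_on_log_gf])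
  show "continuous_on S (\<lambda>x. of_real (s * exp (- t)) * cis (c * x))"
    by (intro continuous_intros)
  show "(\<lambda>x. of_real (s * exp (- t)) * cis (c * x)) ` S \<subseteq> ball 0 1"
    using assms by (auto simp: norm_mult)
qed

lemma arc_kernel_integrable:
  assumes "t > 0" "s = 1 \<or> s = -1"
  shows "arc_kernel \<eta> s t integrable_on UNIV" "(\<lambda>x. norm (arc_kernel \<eta> s t x)) integrable_on UNIV"
proof -
  define f where "f x = exp (log_gf_polar s t (t * sqrt t * x) - of_real (B 0 s t) - \<i> * of_real (t * sqrt t * x * B 1 s t))" for x
  have f: "continuous_on S f" for S
    unfolding f_def by (intro continuous_intros continuous_on_log_gf_polar assms)
  have K: "arc_kernel \<eta> s t = (\<lambda>x. if x \<in> {- (\<eta> / sqrt t)..\<eta> / sqrt t} then f x else 0)"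
    by (rule ext) (simp add: arc_kernel_def f_def)
  show "arc_kernel \<eta> s t integrable_on UNIV"
    unfolding K integrable_restrict_UNIV by (rule integrable_continuous_real[OF f])
  have K': "(\<lambda>x. norm (arc_kernel \<eta> s t x)) = (\<lambda>x. if x \<in> {- (\<eta> / sqrt t)..\<eta> / sqrt t} then norm (f x) else 0)"
    by (rule ext) (simp add: K)
  show "(\<lambda>x. norm (arc_kernel \<eta> s t x)) integrable_on UNIV"
    unfolding K' integrable_restrict_UNIV by (intro integrable_continuous_real continuous_on_norm f)
qed

text \<open>The rescaling makes the cubic remainder small pointwise:
  \<open>\<bar>\<phi>\<bar> ^ 3 / t ^ 4 = \<bar>x\<bar> ^ 3 * sqrt t\<close> for
  \<open>\<phi> = t * sqrt t * x\<close>.\<close>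

lemma arc_kernel_exponent:
  assumes t: "t > 0" and s: "s = 1 \<or> s = -1"
    and C: "\<And>\<phi>. norm (remainder s t \<phi>) \<le> C * \<bar>\<phi>\<bar> ^ 3 / t ^ 4"
  defines "E \<equiv> \<lambda>x. log_gf_polar s t (t * sqrt t * x) - of_real (B 0 s t) - \<i> * of_real (t * sqrt t * x * B 1 s t)"
  shows "norm (E x - of_real (- (x\<^sup>2 / 2 * (t ^ 3 * B 2 s t)))) \<le> C * \<bar>x\<bar> ^ 3 * sqrt t"
proof -
  define u where "u = sqrt t"
  have u: "u > 0" "t = u\<^sup>2" using t by (auto simp: u_def)
  define \<phi> where "\<phi> = t * sqrt t * x"
  have \<phi>: "\<phi> = u ^ 3 * x" unfolding \<phi>_def u_def[symmetric] by (subst u(2)) (simp add: power2_eq_square power3_eq_cube)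
  have p2: "\<phi>\<^sup>2 = x\<^sup>2 * t ^ 3" unfolding \<phi> by (subst u(2)) (simp add: power_mult_distrib flip: power_mult)
  have p3: "\<bar>\<phi>\<bar> ^ 3 / t ^ 4 = \<bar>x\<bar> ^ 3 * u"
  proof -
    have "\<bar>\<phi>\<bar> ^ 3 = \<bar>x\<bar> ^ 3 * (u * u ^ 8)" unfolding \<phi> using u(1)
      by (simp add: abs_mult power_mult_distrib power_abs eval_nat_numeral)
    moreover have "t ^ 4 = u ^ 8" by (subst u(2)) (simp flip: power_mult)
    ultimately show ?thesis using u(1) by simp
  qed
  have "E x - of_real (- (x\<^sup>2 / 2 * (t ^ 3 * B 2 s t))) = remainder s t \<phi>"
    unfolding E_def remainder_def \<phi>_def[symmetric] p2 by (simp add: algebra_simps)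
  then have "norm (E x - of_real (- (x\<^sup>2 / 2 * (t ^ 3 * B 2 s t)))) \<le> C * (\<bar>\<phi>\<bar> ^ 3 / t ^ 4)"
    using C[of \<phi>] by simp
  then show ?thesis unfolding p3 by (simp add: u_def mult.assoc)
qed

text \<open>The quadratic term is at least \<open>3 / 4 * main_const * x\<^sup>2\<close>. On the arc
  \<open>\<bar>x\<bar> * sqrt t \<le> \<eta>\<close>, so the cubic error is at most
  \<open>C * \<eta> * x\<^sup>2\<close>, a third of that. The remaining Gaussian dominates uniformly
  in \<open>t\<close>.\<close>

lemma arc_kernel_bound:
  assumes t: "t > 0" and s: "s = 1 \<or> s = -1"
    and C: "\<And>\<phi>. norm (remainder s t \<phi>) \<le> C * \<bar>\<phi>\<bar> ^ 3 / t ^ 4"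
    and C0: "C > 0" and \<eta>: "C * \<eta> \<le> main_const / 4" and b2: "t ^ 3 * B 2 s t \<ge> 3 / 2 * main_const"
  shows "norm (arc_kernel \<eta> s t x) \<le> exp (- (main_const / 2 * x\<^sup>2))"
proof (cases "x \<in> {- (\<eta> / sqrt t)..\<eta> / sqrt t}")
  case True
  define E where "E = log_gf_polar s t (t * sqrt t * x) - of_real (B 0 s t) - \<i> * of_real (t * sqrt t * x * B 1 s t)"
  define q where "q = x\<^sup>2 / 2 * (t ^ 3 * B 2 s t)"
  have "norm (E - of_real (- q)) \<le> C * \<bar>x\<bar> ^ 3 * sqrt t"
    unfolding E_def q_def by (rule arc_kernel_exponent[OF t s C])
  then have "Re (E - of_real (- q)) \<le> C * \<bar>x\<bar> ^ 3 * sqrt t" using complex_Re_le_cmod order_trans by blast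
  then have R: "Re E \<le> - q + C * \<bar>x\<bar> ^ 3 * sqrt t" by simp
  have st: "sqrt t > 0" using t by simp
  have "\<bar>x\<bar> \<le> \<eta> / sqrt t" using True by auto
  then have "\<bar>x\<bar> * sqrt t \<le> \<eta>" using st by (simp add: pos_le_divide_eq)
  then have "C * x\<^sup>2 * (\<bar>x\<bar> * sqrt t) \<le> C * x\<^sup>2 * \<eta>" using C0 by (intro mult_left_mono) auto
  also have "\<dots> = x\<^sup>2 * (C * \<eta>)" by simp
  also have "\<dots> \<le> x\<^sup>2 * (main_const / 4)" using \<eta> by (intro mult_left_mono) auto
  finally have 1: "C * \<bar>x\<bar> ^ 3 * sqrt t \<le> x\<^sup>2 * (main_const / 4)"
    by (simp add: power3_eq_cube power2_eq_square mult_ac)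
  have "q \<ge> x\<^sup>2 / 2 * (3 / 2 * main_const)" unfolding q_def using b2 by (intro mult_left_mono) auto
  then have "Re E \<le> - (main_const / 2 * x\<^sup>2)" using R 1 by (simp add: algebra_simps)
  then show ?thesis using True by (simp add: arc_kernel_def E_def)
next
  case False
  then show ?thesis unfolding arc_kernel_def if_not_P[OF False] by simp
qed

lemma tendsto_arc_kernel:
  assumes s: "s = 1 \<or> s = -1" and \<tau>: "\<And>n. \<tau> n > 0" "\<tau> \<longlonglongrightarrow> 0" and \<eta>: "\<eta> > 0"
    and C: "\<And>t \<phi>. t > 0 \<Longrightarrow> norm (remainder s t \<phi>) \<le> C * \<bar>\<phi>\<bar> ^ 3 / t ^ 4"
  shows "(\<lambda>n. arc_kernel \<eta> s (\<tau> n) x) \<longlonglongrightarrow> of_real (exp (- (main_const * x\<^sup>2)))"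
proof -
  define E where "E t = log_gf_polar s t (t * sqrt t * x) - of_real (B 0 s t) - \<i> * of_real (t * sqrt t * x * B 1 s t)" for t
  have \<tau>r: "filterlim \<tau> (at_right 0) sequentially"
    using \<tau>(2) \<tau>(1)[THEN less_imp_neq, THEN not_sym] \<tau>(1) by (auto simp: filterlim_at)
  have b2: "(\<lambda>n. \<tau> n ^ 3 * B 2 s (\<tau> n)) \<longlonglongrightarrow> 2 * main_const"
    by (rule filterlim_compose[OF tendsto_B(3)[OF s] \<tau>r])
  have st: "(\<lambda>n. sqrt (\<tau> n)) \<longlonglongrightarrow> 0" using tendsto_real_sqrt[OF \<tau>(2)] by simp
  have d: "(\<lambda>n. E (\<tau> n) - of_real (- (x\<^sup>2 / 2 * (\<tau> n ^ 3 * B 2 s (\<tau> n))))) \<longlonglongrightarrow> 0"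
  proof (rule Lim_null_comparison)
    show "\<forall>\<^sub>F n in sequentially. norm (E (\<tau> n) - of_real (- (x\<^sup>2 / 2 * (\<tau> n ^ 3 * B 2 s (\<tau> n))))) \<le> C * \<bar>x\<bar> ^ 3 * sqrt (\<tau> n)"
      unfolding E_def by (intro always_eventually allI arc_kernel_exponent \<tau> s C)
    show "(\<lambda>n. C * \<bar>x\<bar> ^ 3 * sqrt (\<tau> n)) \<longlonglongrightarrow> 0" using tendsto_mult[OF tendsto_const st, of "C * \<bar>x\<bar> ^ 3"] by simp
  qed
  have "(\<lambda>n. complex_of_real (- (x\<^sup>2 / 2 * (\<tau> n ^ 3 * B 2 s (\<tau> n))))) \<longlonglongrightarrow> of_real (- (x\<^sup>2 / 2 * (2 * main_const)))"
    by (intro tendsto_intros b2)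
  from tendsto_add[OF d this] have "(\<lambda>n. E (\<tau> n)) \<longlonglongrightarrow> of_real (- (main_const * x\<^sup>2))" by (simp add: mult.commute)
  then have "(\<lambda>n. exp (E (\<tau> n))) \<longlonglongrightarrow> exp (of_real (- (main_const * x\<^sup>2)))" by (rule tendsto_exp)
  then have ex: "(\<lambda>n. exp (E (\<tau> n))) \<longlonglongrightarrow> of_real (exp (- (main_const * x\<^sup>2)))" by (simp only: exp_of_real)
  have "(\<lambda>n. \<bar>x\<bar> * sqrt (\<tau> n)) \<longlonglongrightarrow> \<bar>x\<bar> * 0" by (intro tendsto_mult tendsto_const st)
  then have "\<forall>\<^sub>F n in sequentially. \<bar>x\<bar> * sqrt (\<tau> n) < \<eta>" using \<eta> by (intro order_tendstoD(2)) auto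
  then have "\<forall>\<^sub>F n in sequentially. exp (E (\<tau> n)) = arc_kernel \<eta> s (\<tau> n) x"
  proof eventually_elim
    case (elim n)
    have "sqrt (\<tau> n) > 0" using \<tau> by simp
    then have "\<bar>x\<bar> \<le> \<eta> / sqrt (\<tau> n)" using elim by (simp add: pos_le_divide_eq)
    then have "x \<in> {- (\<eta> / sqrt (\<tau> n))..\<eta> / sqrt (\<tau> n)}" by auto
    then show ?case by (simp add: arc_kernel_def E_def)
  qed
  from Lim_transform_eventually[OF ex this] show ?thesis .
qed

lemma integral_arc_kernel_limits:
  assumes s: "s = 1 \<or> s = -1" and \<eta>: "\<eta> > 0"
    and C: "\<And>t \<phi>. t > 0 \<Longrightarrow> norm (remainder s t \<phi>) \<le> C * \<bar>\<phi>\<bar> ^ 3 / t ^ 4"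
    and C0: "C > 0" and C\<eta>: "C * \<eta> \<le> main_const / 4"
  shows "((\<lambda>t. integral UNIV (arc_kernel \<eta> s t)) \<longlongrightarrow> of_real gauss_int) (at_right 0)"
    and "((\<lambda>t. integral UNIV (\<lambda>x. norm (arc_kernel \<eta> s t x))) \<longlongrightarrow> gauss_int) (at_right 0)"
proof -
  have "\<forall>\<^sub>F t in at_right 0. t ^ 3 * B 2 s t > 3 / 2 * main_const"
    by (rule order_tendstoD(1)[OF tendsto_B(3)[OF s]]) (use main_const_pos in simp)
  then obtain b where b: "b > 0" "\<And>t. 0 < t \<Longrightarrow> t < b \<Longrightarrow> t ^ 3 * B 2 s t > 3 / 2 * main_const"
    unfolding eventually_at_right_field by auto
  have h: "(\<lambda>x :: real. exp (- (main_const / 2 * x\<^sup>2))) integrable_on UNIV"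
    using main_const_pos by (intro gaussian_integrable_on) simp
  have bound: "norm (arc_kernel \<eta> s t x) \<le> exp (- (main_const / 2 * x\<^sup>2))" if "0 < t" "t < b" for t x
    by (rule arc_kernel_bound[where C = C, OF that(1) s C[OF that(1)] C0 C\<eta> less_imp_le[OF b(2)[OF that]]])
  have g: "(\<lambda>x :: real. exp (- (main_const * x\<^sup>2))) integrable_on UNIV"
    by (rule gaussian_integrable_on[OF main_const_pos])
  show "((\<lambda>t. integral UNIV (arc_kernel \<eta> s t)) \<longlongrightarrow> of_real gauss_int) (at_right 0)"
  proof (rule tendsto_at_right_sequentially[OF b(1)])
    fix \<tau> :: "nat \<Rightarrow> real" assume \<tau>: "\<And>n. 0 < \<tau> n" "\<And>n. \<tau> n < b" "\<tau> \<longlonglongrightarrow> 0"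
    have "(\<lambda>n. integral UNIV (arc_kernel \<eta> s (\<tau> n))) \<longlonglongrightarrow> integral UNIV (\<lambda>x :: real. complex_of_real (exp (- (main_const * x\<^sup>2))))"
      by (rule dominated_convergence(2)[OF arc_kernel_integrable(1)[OF \<tau>(1) s] h bound[OF \<tau>(1,2)] tendsto_arc_kernel[OF s \<tau>(1,3) \<eta> C]])
    also have "integral UNIV (\<lambda>x :: real. complex_of_real (exp (- (main_const * x\<^sup>2)))) = of_real gauss_int"
      unfolding gauss_int_def using has_integral_of_real[OF integrable_integral[OF g], where 'b = complex] by (rule integral_unique)
    finally show "(\<lambda>n. integral UNIV (arc_kernel \<eta> s (\<tau> n))) \<longlonglongrightarrow> of_real gauss_int" .
  qed
  show "((\<lambda>t. integral UNIV (\<lambda>x. norm (arc_kernel \<eta> s t x))) \<longlongrightarrow> gauss_int) (at_right 0)"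
  proof (rule tendsto_at_right_sequentially[OF b(1)])
    fix \<tau> :: "nat \<Rightarrow> real" assume \<tau>: "\<And>n. 0 < \<tau> n" "\<And>n. \<tau> n < b" "\<tau> \<longlonglongrightarrow> 0"
    have lim: "(\<lambda>n. norm (arc_kernel \<eta> s (\<tau> n) x)) \<longlonglongrightarrow> exp (- (main_const * x\<^sup>2))" for x
      using tendsto_norm[OF tendsto_arc_kernel[OF s \<tau>(1,3) \<eta> C, of x]] by simp
    show "(\<lambda>n. integral UNIV (\<lambda>x. norm (arc_kernel \<eta> s (\<tau> n) x))) \<longlonglongrightarrow> gauss_int"
      unfolding gauss_int_def
      by (rule dominated_convergence(2)[OF arc_kernel_integrable(2)[OF \<tau>(1) s] h _ lim]) (use bound[OF \<tau>(1,2)] in simp)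
  qed
qed

end

section \<open>Assembling the circle and taking logarithms\<close>

context odd_prime
begin

lemma signed_partition_number_log_gf_integral:
  assumes t: "t > 0"
  shows "((\<lambda>x. exp (log_gf_polar 1 t x) * cis (- (real n * x))) has_integral
      of_real (2 * pi * exp (- (real n * t)) * of_int (signed_partition_number n (legendre_char p)))) {- (pi / 2)..3 * pi / 2}"
proof -
  have r: "0 < exp (- t)" "exp (- t) < 1" using t by auto
  have g: "gen_fun (legendre_char p) (of_real (exp (- t)) * cis x) = exp (log_gf_polar 1 t x)" for x
    using t by (subst gen_fun_eq) (simp_all add: norm_mult log_gf_polar_def)
  show ?thesis
    using signed_partition_number_integral[where f = "legendre_char p", OF legendre_char_le r, of n]
    unfolding g exp_mult_power .
qed

lemma (in -) integral_rescale:
  fixes f :: "real \<Rightarrow> complex"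
  assumes t: "t > 0" and f: "continuous_on UNIV f"
  shows "integral {- (\<eta> * t)..\<eta> * t} f = of_real (t * sqrt t) * integral {- (\<eta> / sqrt t)..\<eta> / sqrt t} (\<lambda>x. f (t * sqrt t * x))"
proof -
  define m where "m = t * sqrt t"
  have m: "m > 0" using t by (simp add: m_def)
  have "(f has_integral integral {- (\<eta> * t)..\<eta> * t} f) {- (\<eta> * t)..\<eta> * t}"
    by (intro integrable_integral integrable_continuous_real continuous_on_subset[OF f]) auto
  from has_integral_stretch_real[OF this, of m] m
  have "((\<lambda>x. f (m * x)) has_integral (1 / m) *\<^sub>R integral {- (\<eta> * t)..\<eta> * t} f) ((\<lambda>x. x / m) ` {- (\<eta> * t)..\<eta> * t})"
    by simp
  also have "(\<lambda>x. x / m) ` {- (\<eta> * t)..\<eta> * t} = {- (\<eta> / sqrt t)..\<eta> / sqrt t}"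
  proof -
    have "(\<lambda>x. x / m) = (*) (1 / m)" by (rule ext) simp
    then have "(\<lambda>x. x / m) ` {- (\<eta> * t)..\<eta> * t} = {1 / m * - (\<eta> * t)..1 / m * (\<eta> * t)}"
      using m by (simp only: image_mult_atLeastAtMost zero_less_divide_1_iff)
    moreover have "1 / m * (\<eta> * t) = \<eta> / sqrt t" using t by (simp add: m_def)
    ultimately show ?thesis by simp
  qed
  finally have "integral {- (\<eta> / sqrt t)..\<eta> / sqrt t} (\<lambda>x. f (m * x)) = (1 / m) *\<^sub>R integral {- (\<eta> * t)..\<eta> * t} f"
    by (rule integral_unique)
  then show ?thesis using m by (simp add: m_def[symmetric] scaleR_conv_of_real)
qed

text \<open>At the saddle point \<open>B 1 1 t = n\<close> the linear phase of the logarithm cancels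
  \<open>cis (- (n * x))\<close> exactly.\<close>

lemma arc_at_one:
  assumes t: "t > 0" and n: "B 1 1 t = real n"
  shows "integral {- (\<eta> * t)..\<eta> * t} (\<lambda>x. exp (log_gf_polar 1 t x) * cis (- (real n * x)))
    = of_real (exp (B 0 1 t) * (t * sqrt t)) * integral UNIV (arc_kernel \<eta> 1 t)"
proof -
  define f where "f x = exp (log_gf_polar 1 t x) * cis (- (real n * x))" for x
  have cont: "continuous_on UNIV f"
    unfolding f_def using continuous_on_log_gf_polar[OF t, of 1 UNIV 1] by (intro continuous_intros) simp
  have "integral {- (\<eta> * t)..\<eta> * t} f = of_real (t * sqrt t) * integral {- (\<eta> / sqrt t)..\<eta> / sqrt t} (\<lambda>x. f (t * sqrt t * x))"
    by (rule integral_rescale[OF t cont])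
  also have "(\<lambda>x. f (t * sqrt t * x)) = (\<lambda>x. of_real (exp (B 0 1 t)) * exp (log_gf_polar 1 t (t * sqrt t * x) - of_real (B 0 1 t) - \<i> * of_real (t * sqrt t * x * B 1 1 t)))"
  proof
    fix x
    have "cis (- (real n * (t * sqrt t * x))) = exp (- (\<i> * of_real (t * sqrt t * x * B 1 1 t)))"
      unfolding n cis_conv_exp by (simp add: mult_ac)
    then have "f (t * sqrt t * x) = exp (log_gf_polar 1 t (t * sqrt t * x)) * exp (- (\<i> * of_real (t * sqrt t * x * B 1 1 t)))"
      by (simp only: f_def)
    also have "\<dots> = exp (of_real (B 0 1 t)) * exp (log_gf_polar 1 t (t * sqrt t * x) - of_real (B 0 1 t) - \<i> * of_real (t * sqrt t * x * B 1 1 t))"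
      unfolding exp_add[symmetric] by (rule arg_cong[where f = exp]) simp
    finally show "f (t * sqrt t * x) = of_real (exp (B 0 1 t)) * exp (log_gf_polar 1 t (t * sqrt t * x) - of_real (B 0 1 t) - \<i> * of_real (t * sqrt t * x * B 1 1 t))"
      by (simp only: exp_of_real)
  qed
  also have "integral {- (\<eta> / sqrt t)..\<eta> / sqrt t} \<dots> = of_real (exp (B 0 1 t)) * integral {- (\<eta> / sqrt t)..\<eta> / sqrt t}
      (\<lambda>x. exp (log_gf_polar 1 t (t * sqrt t * x) - of_real (B 0 1 t) - \<i> * of_real (t * sqrt t * x * B 1 1 t)))"
    by (rule integral_mult_right)
  also have "integral {- (\<eta> / sqrt t)..\<eta> / sqrt t} (\<lambda>x. exp (log_gf_polar 1 t (t * sqrt t * x) - of_real (B 0 1 t) - \<i> * of_real (t * sqrt t * x * B 1 1 t)))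
      = integral UNIV (arc_kernel \<eta> 1 t)"
    unfolding arc_kernel_def by (rule integral_restrict_UNIV[symmetric])
  finally show ?thesis unfolding f_def by (simp add: mult_ac)
qed

text \<open>Shifting the angle by \<open>pi\<close> replaces \<open>s = 1\<close> by
  \<open>s = -1\<close>. The saddle point was chosen for the arc at 1, so a phase
  \<open>n - B 1 (-1) t\<close> remains here, and absolute values are compared.\<close>

lemma arc_at_minus_one:
  assumes t: "t > 0"
  shows "norm (integral {pi - \<eta> * t..pi + \<eta> * t} (\<lambda>x. exp (log_gf_polar 1 t x) * cis (- (real n * x))))
    \<le> exp (B 0 (-1) t) * (t * sqrt t) * integral UNIV (\<lambda>x. norm (arc_kernel \<eta> (-1) t x))"
proof -
  define f where "f x = exp (log_gf_polar 1 t x) * cis (- (real n * x))" for x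
  have cont: "continuous_on S f" for S
    unfolding f_def using continuous_on_log_gf_polar[OF t, of 1 S 1] by (intro continuous_intros) simp
  define g where "g x = f (x + pi)" for x
  have contg: "continuous_on UNIV g"
    unfolding g_def by (rule continuous_on_compose2[OF cont[of UNIV]]) (auto intro!: continuous_intros)
  have "integral {pi - \<eta> * t..pi + \<eta> * t} f = integral {- (\<eta> * t)..\<eta> * t} g"
    using integral_shift[of "- (\<eta> * t)" pi "\<eta> * t" f, OF cont] by (simp add: g_def[abs_def] o_def add.commute)
  also have "\<dots> = of_real (t * sqrt t) * integral {- (\<eta> / sqrt t)..\<eta> / sqrt t} (\<lambda>x. g (t * sqrt t * x))"
    by (rule integral_rescale[OF t contg])
  finally have "norm (integral {pi - \<eta> * t..pi + \<eta> * t} f) = t * sqrt t * norm (integral {- (\<eta> / sqrt t)..\<eta> / sqrt t} (\<lambda>x. g (t * sqrt t * x)))"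
    using t by (simp add: norm_mult)
  also have "\<dots> \<le> t * sqrt t * (exp (B 0 (-1) t) * integral UNIV (\<lambda>x. norm (arc_kernel \<eta> (-1) t x)))"
  proof (rule mult_left_mono)
    define I where "I = {- (\<eta> / sqrt t)..\<eta> / sqrt t}"
    define k where "k x = norm (exp (log_gf_polar (-1) t (t * sqrt t * x) - of_real (B 0 (-1) t) - \<i> * of_real (t * sqrt t * x * B 1 (-1) t)))" for x
    have kc: "k integrable_on I"
      unfolding k_def I_def by (intro integrable_continuous_real continuous_intros continuous_on_log_gf_polar t) simp
    have gc: "(\<lambda>x. g (t * sqrt t * x)) integrable_on I"
      unfolding I_def by (intro integrable_continuous_real continuous_on_compose2[OF contg] continuous_intros) auto
    have "norm (g (t * sqrt t * x)) = exp (B 0 (-1) t) * k x" for x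
    proof -
      have "log_gf_polar 1 t (t * sqrt t * x + pi) = log_gf_polar (-1) t (t * sqrt t * x)"
        by (simp add: log_gf_polar_def flip: cis_mult)
      then have "norm (g (t * sqrt t * x)) = exp (Re (log_gf_polar (-1) t (t * sqrt t * x)))"
        by (simp add: g_def f_def norm_mult)
      also have "\<dots> = exp (B 0 (-1) t) * k x" by (simp add: k_def flip: exp_add)
      finally show ?thesis .
    qed
    then have "norm (integral I (\<lambda>x. g (t * sqrt t * x))) \<le> integral I (\<lambda>x. exp (B 0 (-1) t) * k x)"
      by (intro integral_norm_bound_integral gc integrable_on_mult_right kc) simp
    also have "\<dots> = exp (B 0 (-1) t) * integral I k" by (rule integral_mult_right)
    also have "integral I k = integral UNIV (\<lambda>x. norm (arc_kernel \<eta> (-1) t x))"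
    proof -
      have "(\<lambda>x. norm (arc_kernel \<eta> (-1) t x)) = (\<lambda>x. if x \<in> I then k x else 0)"
        by (rule ext) (simp add: arc_kernel_def k_def I_def)
      then show ?thesis by (simp only: integral_restrict_UNIV)
    qed
    finally show "norm (integral {- (\<eta> / sqrt t)..\<eta> / sqrt t} (\<lambda>x. g (t * sqrt t * x))) \<le> exp (B 0 (-1) t) * integral UNIV (\<lambda>x. norm (arc_kernel \<eta> (-1) t x))"
      unfolding I_def .
  qed (use t in simp)
  finally show ?thesis unfolding f_def by (simp add: mult_ac)
qed

lemma saddle_point_bounds:
  assumes p: "p \<noteq> 5" "p mod 8 \<noteq> 1"
  obtains c1 c2 t0 where "c1 > 0" "c2 > 0" "t0 > 0"
    "\<And>t n. 0 < t \<Longrightarrow> t < t0 \<Longrightarrow> B 1 1 t = real n \<Longrightarrow>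
      c1 * (exp (B 0 1 t + real n * t) * (t * sqrt t)) \<le> of_int (signed_partition_number n (legendre_char p)) \<and>
      of_int (signed_partition_number n (legendre_char p)) \<le> c2 * (exp (B 0 1 t + real n * t) * (t * sqrt t))"
proof -
  obtain C where C0: "C > 0" and C: "\<And>s t \<phi>. (s = 1 \<or> s = -1) \<Longrightarrow> t > 0 \<Longrightarrow> norm (remainder s t \<phi>) \<le> C * \<bar>\<phi>\<bar> ^ 3 / t ^ 4"
    using remainder_bound by blast
  \<comment> \<open>The widest arc on which \<open>arc_kernel_bound\<close> applies.\<close>
  define \<eta> where "\<eta> = main_const / (4 * C)"
  have \<eta>: "\<eta> > 0" "C * \<eta> \<le> main_const / 4" using C0 main_const_pos by (simp_all add: \<eta>_def)
  obtain \<delta> where \<delta>: "\<delta> > 0" and minor: "\<And>t \<theta>. 0 < t \<Longrightarrow> t < \<delta> \<Longrightarrow> - (pi / 2) \<le> \<theta> \<Longrightarrow> \<theta> \<le> 3 * pi / 2 \<Longrightarrow> \<eta> * t \<le> \<bar>\<theta>\<bar> \<Longrightarrow> \<eta> * t \<le> \<bar>\<theta> - pi\<bar>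
    \<Longrightarrow> t * Re (log_gf (of_real (exp (- t)) * cis \<theta>)) \<le> main_const - \<delta>"
    using minor_arcs[OF p \<eta>(1)] by blast
  obtain \<delta>' where \<delta>': "\<delta>' > 0" "\<forall>\<^sub>F t in at_right 0. B 0 (-1) t \<le> B 0 1 t - \<delta>'"
    using B_minus_one_le[OF p(2)] by blast
  define G where "G = gauss_int"
  have G: "G > 0" unfolding G_def by (rule gauss_int_pos)
  define \<rho> where "\<rho> = exp (- \<delta>')"
  have \<rho>: "0 < \<rho>" "\<rho> < 1" using \<delta>' by (auto simp: \<rho>_def)
  \<comment> \<open>The error budget relative to the main term \<open>G\<close>:
    \<open>\<epsilon>\<close> for the arc at 1, \<open>\<epsilon>\<close> for the minor arcs, and
    \<open>\<rho> * (G + \<epsilon>) \<le> G - 3 * \<epsilon>\<close> for the arc at -1, so that at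
    least \<open>\<epsilon>\<close> remains.\<close>
  define \<epsilon> where "\<epsilon> = G * (1 - \<rho>) / 4"
  have \<epsilon>: "\<epsilon> > 0" using G \<rho> by (simp add: \<epsilon>_def)
  have K1: "((\<lambda>t. integral UNIV (arc_kernel \<eta> 1 t)) \<longlongrightarrow> of_real G) (at_right 0)"
    unfolding G_def by (rule integral_arc_kernel_limits(1)[OF _ \<eta>(1) C C0 \<eta>(2)]) auto
  have K2: "((\<lambda>t. integral UNIV (\<lambda>x. norm (arc_kernel \<eta> (-1) t x))) \<longlongrightarrow> G) (at_right 0)"
    unfolding G_def by (rule integral_arc_kernel_limits(2)[OF _ \<eta>(1) C C0 \<eta>(2)]) auto
  have e1: "\<forall>\<^sub>F t in at_right 0. dist (integral UNIV (arc_kernel \<eta> 1 t)) (of_real G) < \<epsilon>"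
    using K1 \<epsilon> by (rule tendstoD)
  have e2: "\<forall>\<^sub>F t in at_right 0. integral UNIV (\<lambda>x. norm (arc_kernel \<eta> (-1) t x)) < G + \<epsilon>"
    by (rule order_tendstoD(2)[OF K2]) (use \<epsilon> in simp)
  have e3: "\<forall>\<^sub>F t in at_right 0. t * B 0 1 t > main_const - \<delta> / 2"
    by (rule order_tendstoD(1)[OF tendsto_B(1)]) (use \<delta> in auto)
  \<comment> \<open>There are three minor pieces, each of length at most \<open>2 * pi\<close>. Half
    of the gap \<open>\<delta> / t\<close> in the exponent is spent on approximating
    \<open>B 0 1 t\<close>; the other half beats \<open>t * sqrt t\<close>.\<close>
  have "((\<lambda>t. 6 * pi * exp (- (\<delta> / (2 * t))) / (t * sqrt t)) \<longlongrightarrow> 0) (at_right 0)"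
    using \<delta> by real_asymp
  then have e4: "\<forall>\<^sub>F t in at_right 0. 6 * pi * exp (- (\<delta> / (2 * t))) / (t * sqrt t) < \<epsilon>"
    by (rule order_tendstoD(2)) (rule \<epsilon>)
  have e5: "\<forall>\<^sub>F t in at_right 0. t < \<delta> \<and> t < pi / (2 * \<eta>)"
  proof -
    have "\<forall>\<^sub>F t in at_right (0::real). t \<in> {0<..<min \<delta> (pi / (2 * \<eta>))}"
      using \<delta> \<eta>(1) by (intro eventually_at_right_real) simp
    then show ?thesis by eventually_elim auto
  qed
  have "\<forall>\<^sub>F t in at_right 0. dist (integral UNIV (arc_kernel \<eta> 1 t)) (of_real G) < \<epsilon> \<and> integral UNIV (\<lambda>x. norm (arc_kernel \<eta> (-1) t x)) < G + \<epsilon>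
      \<and> t * B 0 1 t > main_const - \<delta> / 2 \<and> 6 * pi * exp (- (\<delta> / (2 * t))) / (t * sqrt t) < \<epsilon> \<and> t < \<delta> \<and> t < pi / (2 * \<eta>) \<and> B 0 (-1) t \<le> B 0 1 t - \<delta>'"
    using e1 e2 e3 e4 e5 \<delta>'(2) by eventually_elim auto
  then obtain t0 where t0: "t0 > 0" and ev: "\<And>t. 0 < t \<Longrightarrow> t < t0 \<Longrightarrow> dist (integral UNIV (arc_kernel \<eta> 1 t)) (of_real G) < \<epsilon> \<and> integral UNIV (\<lambda>x. norm (arc_kernel \<eta> (-1) t x)) < G + \<epsilon>
      \<and> t * B 0 1 t > main_const - \<delta> / 2 \<and> 6 * pi * exp (- (\<delta> / (2 * t))) / (t * sqrt t) < \<epsilon> \<and> t < \<delta> \<and> t < pi / (2 * \<eta>) \<and> B 0 (-1) t \<le> B 0 1 t - \<delta>'"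
    unfolding eventually_at_right_field by auto
  have main: "\<epsilon> / (2 * pi) * (exp (B 0 1 t + real n * t) * (t * sqrt t)) \<le> of_int (signed_partition_number n (legendre_char p)) \<and>
      of_int (signed_partition_number n (legendre_char p)) \<le> (5 * G) / (2 * pi) * (exp (B 0 1 t + real n * t) * (t * sqrt t))"
    if t: "0 < t" "t < t0" and n: "B 1 1 t = real n" for t n
  proof -
    define a :: real where "a = of_int (signed_partition_number n (legendre_char p))"
    define F where "F x = exp (log_gf_polar 1 t x) * cis (- (real n * x))" for x
    define W where "W = exp (B 0 1 t) * (t * sqrt t)"
    have W: "W > 0" using t by (simp add: W_def)
    define h where "h = \<eta> * t"
    note E = ev[OF t]
    have h: "0 < h" "h < pi / 2" using E t \<eta>(1) by (simp_all add: h_def field_simps)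
    have cont: "continuous_on S F" for S
      unfolding F_def using continuous_on_log_gf_polar[OF t(1), of 1 S 1] by (intro continuous_intros) simp
    have int: "F integrable_on {x..y}" for x y by (rule integrable_continuous_real[OF cont])
    have I: "integral {- (pi / 2)..3 * pi / 2} F = of_real (2 * pi * exp (- (real n * t)) * a)"
      unfolding F_def a_def by (rule integral_unique[OF signed_partition_number_log_gf_integral[OF t(1)]])
    define mb where "mb = exp ((main_const - \<delta>) / t)"
    have Fm: "norm (F x) \<le> mb" if "- (pi / 2) \<le> x" "x \<le> 3 * pi / 2" "h \<le> \<bar>x\<bar>" "h \<le> \<bar>x - pi\<bar>" for x
    proof -
      have "t * Re (log_gf (of_real (exp (- t)) * cis x)) \<le> main_const - \<delta>"
        using that E by (intro minor t) (auto simp: h_def)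
      then have "Re (log_gf_polar 1 t x) \<le> (main_const - \<delta>) / t"
        using t(1) by (simp add: log_gf_polar_def pos_le_divide_eq mult.commute)
      then show ?thesis by (simp add: F_def mb_def norm_mult)
    qed
    have piece: "norm (integral {x..y} F) \<le> mb * (2 * pi)"
      if "- (pi / 2) \<le> x" "x \<le> y" "y \<le> 3 * pi / 2" "\<And>z. x \<le> z \<Longrightarrow> z \<le> y \<Longrightarrow> h \<le> \<bar>z\<bar> \<and> h \<le> \<bar>z - pi\<bar>" for x y
    proof -
      have "norm (integral {x..y} F) \<le> mb * (y - x)"
        by (rule integral_bound[OF that(2) cont]) (use that in \<open>auto intro!: Fm\<close>)
      also have "\<dots> \<le> mb * (2 * pi)" using that by (intro mult_left_mono) (auto simp: mb_def)
      finally show ?thesis .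
    qed
    define I1 I2 I3 I4 I5 where "I1 = integral {- (pi / 2)..- h} F" and "I2 = integral {- h..h} F"
      and "I3 = integral {h..pi - h} F" and "I4 = integral {pi - h..pi + h} F" and "I5 = integral {pi + h..3 * pi / 2} F"
    have split: "integral {- (pi / 2)..3 * pi / 2} F = I1 + I2 + I3 + I4 + I5"
    proof -
      have "I1 + I2 = integral {- (pi / 2)..h} F" unfolding I1_def I2_def
        by (rule Henstock_Kurzweil_Integration.integral_combine[OF _ _ int]) (use h in auto)
      moreover have "integral {- (pi / 2)..h} F + I3 = integral {- (pi / 2)..pi - h} F" unfolding I3_def
        by (rule Henstock_Kurzweil_Integration.integral_combine[OF _ _ int]) (use h in auto)
      moreover have "integral {- (pi / 2)..pi - h} F + I4 = integral {- (pi / 2)..pi + h} F" unfolding I4_def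
        by (rule Henstock_Kurzweil_Integration.integral_combine[OF _ _ int]) (use h in auto)
      moreover have "integral {- (pi / 2)..pi + h} F + I5 = integral {- (pi / 2)..3 * pi / 2} F" unfolding I5_def
        by (rule Henstock_Kurzweil_Integration.integral_combine[OF _ _ int]) (use h in auto)
      ultimately show ?thesis by simp
    qed
    have m1: "norm I1 \<le> mb * (2 * pi)" unfolding I1_def by (rule piece) (use h in auto)
    have m3: "norm I3 \<le> mb * (2 * pi)" unfolding I3_def by (rule piece) (use h in auto)
    have m5: "norm I5 \<le> mb * (2 * pi)" unfolding I5_def by (rule piece) (use h in auto)
    have mW: "3 * (mb * (2 * pi)) \<le> \<epsilon> * W"
    proof -
      have "(main_const - \<delta>) / t \<le> B 0 1 t - \<delta> / (2 * t)"
      proof -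
        have "main_const - \<delta> \<le> t * B 0 1 t - \<delta> / 2" using E by linarith
        then have "(main_const - \<delta>) / t \<le> (t * B 0 1 t - \<delta> / 2) / t" using t(1) by (intro divide_right_mono) auto
        then show ?thesis using t(1) by (simp add: diff_divide_distrib)
      qed
      then have "mb \<le> exp (B 0 1 t - \<delta> / (2 * t))" by (simp add: mb_def)
      also have "\<dots> = exp (B 0 1 t) * exp (- (\<delta> / (2 * t)))" by (simp flip: exp_add)
      finally have "3 * (mb * (2 * pi)) \<le> 3 * (exp (B 0 1 t) * exp (- (\<delta> / (2 * t))) * (2 * pi))" by simp
      also have "\<dots> = (6 * pi * exp (- (\<delta> / (2 * t))) / (t * sqrt t)) * W"
        using t(1) by (simp add: W_def)
      also have "\<dots> \<le> \<epsilon> * W" using E W by (intro mult_right_mono) auto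
      finally show ?thesis .
    qed
    define k1 where "k1 = integral UNIV (arc_kernel \<eta> 1 t)"
    have I2: "I2 = of_real W * k1" unfolding I2_def F_def h_def W_def k1_def by (rule arc_at_one[OF t(1) n])
    have I4: "norm I4 \<le> \<rho> * (G + \<epsilon>) * W"
    proof -
      define k2 where "k2 = integral UNIV (\<lambda>x. norm (arc_kernel \<eta> (-1) t x))"
      have "norm I4 \<le> exp (B 0 (-1) t) * (t * sqrt t) * k2"
        unfolding I4_def F_def h_def k2_def by (rule arc_at_minus_one[OF t(1)])
      also have "\<dots> \<le> exp (B 0 (-1) t) * (t * sqrt t) * (G + \<epsilon>)"
        using E t(1) by (intro mult_left_mono) (auto simp: k2_def)
      also have "\<dots> \<le> (exp (B 0 1 t) * \<rho>) * (t * sqrt t) * (G + \<epsilon>)"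
      proof (intro mult_right_mono)
        have "exp (B 0 (-1) t) \<le> exp (B 0 1 t - \<delta>')" using E by simp
        then show "exp (B 0 (-1) t) \<le> exp (B 0 1 t) * \<rho>" by (simp add: \<rho>_def flip: exp_add)
      qed (use G \<epsilon> t(1) in auto)
      finally show ?thesis by (simp add: W_def mult_ac)
    qed
    define X where "X = 2 * pi * exp (- (real n * t)) * a"
    have tot: "complex_of_real X = of_real W * k1 + (I1 + I3 + I4 + I5)"
      using I split I2 by (simp add: X_def algebra_simps)
    have rest: "norm (I1 + I3 + I4 + I5) \<le> (\<epsilon> + \<rho> * (G + \<epsilon>)) * W"
    proof -
      have "norm (I1 + I3 + I4 + I5) \<le> norm I1 + norm I3 + norm I4 + norm I5"
        by (intro order_trans[OF norm_triangle_ineq] add_mono order_refl)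
      then show ?thesis using m1 m3 m5 I4 mW by (simp add: algebra_simps)
    qed
    have k1: "norm (k1 - of_real G) < \<epsilon>" using E by (simp add: k1_def dist_norm)
    have dev: "\<bar>X - W * G\<bar> \<le> W * \<epsilon> + (\<epsilon> + \<rho> * (G + \<epsilon>)) * W"
    proof -
      have "complex_of_real (X - W * G) = of_real W * (k1 - of_real G) + (I1 + I3 + I4 + I5)"
        using tot by (simp add: algebra_simps)
      then have "norm (complex_of_real (X - W * G)) \<le> norm (of_real W * (k1 - of_real G)) + norm (I1 + I3 + I4 + I5)"
        by (metis norm_triangle_ineq)
      moreover have "norm (of_real W * (k1 - of_real G)) \<le> W * \<epsilon>"
        using k1 W by (simp add: norm_mult mult_left_mono less_imp_le)
      ultimately show ?thesis using rest by (simp del: of_real_diff)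
    qed
    have \<rho>\<epsilon>: "\<rho> * (G + \<epsilon>) \<le> G - 3 * \<epsilon>"
    proof -
      have "\<rho> * \<epsilon> \<le> 1 * \<epsilon>" using \<rho> \<epsilon> by (intro mult_right_mono) auto
      moreover have "\<rho> * G = G - 4 * \<epsilon>" by (simp add: \<epsilon>_def field_simps)
      ultimately show ?thesis by (simp add: distrib_left)
    qed
    have "(\<epsilon> + \<rho> * (G + \<epsilon>)) * W \<le> (G - 2 * \<epsilon>) * W" using \<rho>\<epsilon> W by (intro mult_right_mono) auto
    then have dev2: "\<bar>X - W * G\<bar> \<le> W * (G - \<epsilon>)" using dev by (simp add: algebra_simps)
    have lo: "W * \<epsilon> \<le> X" using dev2 by (simp add: algebra_simps abs_le_iff)
    have hi: "X \<le> W * (5 * G)"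
    proof -
      have "X \<le> W * (2 * G - \<epsilon>)" using dev2 by (simp add: algebra_simps abs_le_iff)
      also have "\<dots> \<le> W * (5 * G)" using W G \<epsilon> by (intro mult_left_mono) auto
      finally show ?thesis .
    qed
    have aX: "a = X * exp (real n * t) / (2 * pi)"
      by (simp add: X_def exp_minus field_simps)
    have WE: "exp (B 0 1 t + real n * t) * (t * sqrt t) = W * exp (real n * t)" by (simp add: W_def exp_add)
    have "\<epsilon> / (2 * pi) * (W * exp (real n * t)) \<le> a"
      unfolding aX using mult_right_mono[OF lo, of "exp (real n * t)"] by (simp add: divide_right_mono mult_ac)
    moreover have "a \<le> (5 * G) / (2 * pi) * (W * exp (real n * t))"
      unfolding aX using mult_right_mono[OF hi, of "exp (real n * t)"] by (simp add: divide_right_mono mult_ac)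
    ultimately show ?thesis unfolding WE a_def by blast
  qed
  show ?thesis
    by (rule that[of "\<epsilon> / (2 * pi)" "5 * G / (2 * pi)" t0]) (use \<epsilon> G t0 main in auto)
qed

lemma isCont_B1:
  assumes t: "t > 0" shows "isCont (B 1 1) t"
proof -
  define c where "c n = lc n * real n" for n
  have "isCont (\<lambda>t. \<Sum>n. c n * exp (- t) ^ n) t"
  proof (rule isCont_powser')
    show "isCont (\<lambda>a. exp (- a)) t" by (intro continuous_intros)
    show "summable (\<lambda>n. c n * exp (- (t / 2)) ^ n)"
    proof (rule summable_comparison_test')
      show "summable (\<lambda>n. real (Suc n) ^ 2 * exp (- (t / 2)) ^ n)"
        using t by (intro summable_Suc_power_mult) auto
      fix n
      have "\<bar>lc n\<bar> * real n \<le> real n * real n" by (intro mult_right_mono abs_log_coeff_le legendre_char_le) auto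
      also have "\<dots> \<le> real (Suc n) ^ 2" by (simp add: power2_eq_square mult_mono)
      finally show "norm (c n * exp (- (t / 2)) ^ n) \<le> real (Suc n) ^ 2 * exp (- (t / 2)) ^ n"
        by (simp add: c_def abs_mult mult_right_mono del: of_nat_Suc)
    qed
    show "norm (exp (- t)) < norm (exp (- (t / 2)))" using t by simp
  qed
  moreover have "\<forall>\<^sub>F x in nhds t. (\<Sum>n. c n * exp (- x) ^ n) = B 1 1 x"
  proof -
    have "\<forall>\<^sub>F x in nhds t. x > 0" using eventually_nhds_in_open[of "{0<..}" t] t by simp
    then show ?thesis
    proof eventually_elim
      case (elim x)
      have "(\<lambda>n. lc (Suc n) * (real (Suc n) ^ 1 * (1 ^ Suc n * exp (- (real (Suc n) * x))))) sums B 1 1 x"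
        by (rule B_sums(1)[OF elim]) simp
      then have "(\<lambda>n. c (Suc n) * exp (- x) ^ Suc n) sums B 1 1 x"
        unfolding c_def exp_mult_power by (simp only: power_one power_one_right mult_1 mult.assoc)
      then have "(\<lambda>n. c n * exp (- x) ^ n) sums (B 1 1 x + c 0 * exp (- x) ^ 0)"
        by (subst (asm) sums_Suc_iff)
      then show ?case by (simp add: c_def sums_iff)
    qed
  qed
  ultimately show ?thesis by (rule isCont_cong[THEN iffD1, rotated])
qed

text \<open>As \<open>t\<^sup>2 * B 1 1 t\<close> tends to \<open>A = main_const\<close>, the value
  of \<open>B 1 1\<close> exceeds \<open>n\<close> at \<open>sqrt (A / (2 * n))\<close> and lies
  below \<open>n\<close> at \<open>sqrt (2 * A / n)\<close>; the intermediate value theorem applies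
  between them.\<close>

lemma saddle_point_exists:
  "\<forall>\<^sub>F n in sequentially. \<exists>t. 0 < t \<and> t \<le> sqrt (2 * main_const / real n) \<and> B 1 1 t = real n"
proof -
  define A where "A = main_const"
  have A: "A > 0" using main_const_pos by (simp add: A_def)
  have "\<forall>\<^sub>F t in at_right 0. t\<^sup>2 * B 1 1 t > A / 2" "\<forall>\<^sub>F t in at_right 0. t\<^sup>2 * B 1 1 t < 2 * A"
    using order_tendstoD[OF tendsto_B(2)[of 1], of "A / 2"] order_tendstoD[OF tendsto_B(2)[of 1], of "2 * A"] A
    by (auto simp: A_def)
  then have "\<forall>\<^sub>F t in at_right 0. t\<^sup>2 * B 1 1 t > A / 2 \<and> t\<^sup>2 * B 1 1 t < 2 * A"
    by (rule eventually_conj)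
  then obtain b where b: "b > 0" "\<And>t. 0 < t \<Longrightarrow> t < b \<Longrightarrow> t\<^sup>2 * B 1 1 t > A / 2 \<and> t\<^sup>2 * B 1 1 t < 2 * A"
    unfolding eventually_at_right_field by auto
  have "(\<lambda>n. sqrt (2 * A / real n)) \<longlonglongrightarrow> 0" using A by real_asymp
  then have "\<forall>\<^sub>F n in sequentially. sqrt (2 * A / real n) < b" by (rule order_tendstoD(2)) (rule b)
  then show ?thesis using eventually_gt_at_top[of "0::nat"]
  proof eventually_elim
    case (elim n)
    define x y where "x = sqrt (A / (2 * real n))" and "y = sqrt (2 * A / real n)"
    have n: "real n > 0" using elim by simp
    have x: "x > 0" "x\<^sup>2 = A / (2 * real n)" using A n by (simp_all add: x_def)
    have y: "y > 0" "y\<^sup>2 = 2 * A / real n" "y < b" using A n elim by (simp_all add: y_def)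
    have xy: "x \<le> y" unfolding x_def y_def using A n by (intro real_sqrt_le_mono) (simp add: field_simps)
    have "A / (2 * real n) * B 1 1 x > A / 2" using b(2)[of x] x xy y by simp
    then have 1: "real n \<le> B 1 1 x" using A n by (simp add: field_simps)
    have "2 * A / real n * B 1 1 y < 2 * A" using b(2)[of y] y by simp
    then have 2: "B 1 1 y \<le> real n" using A n by (simp add: field_simps)
    have "continuous_on {x..y} (B 1 1)"
      using x by (intro continuous_at_imp_continuous_on ballI isCont_B1) auto
    then obtain t where "x \<le> t" "t \<le> y" "B 1 1 t = real n"
      using IVT2'[of "B 1 1" y "real n" x] 1 2 xy by blast
    then show ?case using x by (intro exI[of _ t]) (auto simp: y_def A_def)
  qed
qed

text \<open>At the saddle point, \<open>\<tau> * ln a\<close> tends to \<open>2 * A\<close> and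
  \<open>\<tau> * sqrt n\<close> to \<open>sqrt A\<close>; the quotient is
  \<open>ln a / sqrt n\<close>, with limit \<open>2 * sqrt A\<close>.\<close>

theorem log_plus_signed_partition_number:
  assumes p: "p \<noteq> 5" "p mod 8 \<noteq> 1"
  shows "(\<lambda>n. log_plus (real_of_int (signed_partition_number n (legendre_char p))))
    \<sim>[at_top] (\<lambda>n. 1 / 2 * kappa * sqrt ((1 - 1 / real p) * real n))"
proof -
  define A where "A = main_const"
  have A: "A > 0" using main_const_pos by (simp add: A_def)
  define a :: "nat \<Rightarrow> real" where "a n = of_int (signed_partition_number n (legendre_char p))" for n
  obtain c1 c2 t0 where c: "c1 > 0" "c2 > 0" "t0 > 0"
    and bnd: "\<And>t n. 0 < t \<Longrightarrow> t < t0 \<Longrightarrow> B 1 1 t = real n \<Longrightarrow>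
      c1 * (exp (B 0 1 t + real n * t) * (t * sqrt t)) \<le> a n \<and> a n \<le> c2 * (exp (B 0 1 t + real n * t) * (t * sqrt t))"
    using saddle_point_bounds[OF p] unfolding a_def by blast
  \<comment> \<open>A saddle point is known to exist only for large \<open>n\<close>, so all facts
    about \<open>\<tau>\<close> are eventual.\<close>
  define \<tau> where "\<tau> n = (SOME t. 0 < t \<and> t \<le> sqrt (2 * main_const / real n) \<and> B 1 1 t = real n)" for n
  have \<tau>: "\<forall>\<^sub>F n in sequentially. 0 < \<tau> n \<and> \<tau> n \<le> sqrt (2 * A / real n) \<and> B 1 1 (\<tau> n) = real n"
    using saddle_point_exists unfolding A_def \<tau>_def by eventually_elim (rule someI_ex)
  have "(\<lambda>n. sqrt (2 * A / real n)) \<longlonglongrightarrow> 0" using A by real_asymp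
  then have \<tau>0: "\<tau> \<longlonglongrightarrow> 0"
    by (rule tendsto_sandwich[OF _ _ tendsto_const, rotated 2]) (use \<tau> in \<open>auto elim!: eventually_mono\<close>)
  have \<tau>r: "filterlim \<tau> (at_right 0) sequentially"
    unfolding filterlim_at using \<tau>0 \<tau> by (auto elim!: eventually_mono)
  have l0: "(\<lambda>n. \<tau> n * B 0 1 (\<tau> n)) \<longlonglongrightarrow> A"
    using filterlim_compose[OF tendsto_B(1)[of 1] \<tau>r] by (simp add: A_def)
  have "(\<lambda>n. (\<tau> n)\<^sup>2 * B 1 1 (\<tau> n)) \<longlonglongrightarrow> A"
    using filterlim_compose[OF tendsto_B(2)[of 1] \<tau>r] by (simp add: A_def)
  moreover have "\<forall>\<^sub>F n in sequentially. (\<tau> n)\<^sup>2 * B 1 1 (\<tau> n) = (\<tau> n)\<^sup>2 * real n"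
    using \<tau> by eventually_elim simp
  ultimately have l1: "(\<lambda>n. (\<tau> n)\<^sup>2 * real n) \<longlonglongrightarrow> A" by (rule Lim_transform_eventually)
  have small: "\<forall>\<^sub>F n in sequentially. \<tau> n < t0" by (rule order_tendstoD(2)[OF \<tau>0 c(3)])
  have lt: "(\<lambda>n. \<tau> n * ln (\<tau> n * sqrt (\<tau> n))) \<longlonglongrightarrow> 0"
  proof -
    have "((\<lambda>t :: real. t * ln (t * sqrt t)) \<longlongrightarrow> 0) (at_right 0)" by real_asymp
    from filterlim_compose[OF this \<tau>r] show ?thesis .
  qed
  \<comment> \<open>This is \<open>\<tau> n\<close> times the logarithm of the bound with constant
    \<open>c\<close>. The factor \<open>\<tau>\<close> makes the contributions of \<open>c\<close>
    and of \<open>t * sqrt t\<close> vanish in the limit, so both bounds lead to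
    \<open>2 * A\<close>.\<close>
  define L where "L c n = \<tau> n * ln c + \<tau> n * B 0 1 (\<tau> n) + (\<tau> n)\<^sup>2 * real n + \<tau> n * ln (\<tau> n * sqrt (\<tau> n))" for c n
  have Ll: "L c \<longlonglongrightarrow> 2 * A" for c
  proof -
    have "(\<lambda>n. \<tau> n * ln c + \<tau> n * B 0 1 (\<tau> n) + (\<tau> n)\<^sup>2 * real n + \<tau> n * ln (\<tau> n * sqrt (\<tau> n))) \<longlonglongrightarrow> 0 * ln c + A + A + 0"
      by (intro tendsto_add tendsto_mult tendsto_const \<tau>0 l0 l1 lt)
    then show ?thesis by (simp add: L_def[abs_def])
  qed
  have LX: "\<tau> n * ln (c * (exp (B 0 1 (\<tau> n) + real n * \<tau> n) * (\<tau> n * sqrt (\<tau> n)))) = L c n"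
    if "\<tau> n > 0" "c > 0" for c n
  proof -
    have "ln (c * (exp (B 0 1 (\<tau> n) + real n * \<tau> n) * (\<tau> n * sqrt (\<tau> n))))
        = ln c + ((B 0 1 (\<tau> n) + real n * \<tau> n) + ln (\<tau> n * sqrt (\<tau> n)))"
      using that by (simp add: ln_mult_pos)
    then show ?thesis unfolding L_def by (simp only: power2_eq_square) (simp add: algebra_simps)
  qed
  have ev: "\<forall>\<^sub>F n in sequentially. 0 < a n \<and> L c1 n \<le> \<tau> n * ln (a n) \<and> \<tau> n * ln (a n) \<le> L c2 n"
    using \<tau> small
  proof eventually_elim
    case (elim n)
    define X where "X = exp (B 0 1 (\<tau> n) + real n * \<tau> n) * (\<tau> n * sqrt (\<tau> n))"
    have X: "X > 0" using elim by (simp add: X_def)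
    have ab: "c1 * X \<le> a n" "a n \<le> c2 * X" using bnd[of "\<tau> n" n] elim by (auto simp: X_def)
    have a0: "a n > 0" using ab(1) c(1) X by (meson less_le_trans mult_pos_pos)
    have "ln (c1 * X) \<le> ln (a n)" "ln (a n) \<le> ln (c2 * X)"
      using ab a0 c X by (auto intro!: ln_mono)
    then have "\<tau> n * ln (c1 * X) \<le> \<tau> n * ln (a n)" "\<tau> n * ln (a n) \<le> \<tau> n * ln (c2 * X)"
      using elim by (auto intro!: mult_left_mono)
    then show ?case using a0 LX[of n c1] LX[of n c2] elim c unfolding X_def by auto
  qed
  have l2: "(\<lambda>n. \<tau> n * ln (a n)) \<longlonglongrightarrow> 2 * A"
    by (rule tendsto_sandwich[OF _ _ Ll[of c1] Ll[of c2]]) (use ev in \<open>auto elim!: eventually_mono\<close>)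
  have l3: "(\<lambda>n. \<tau> n * sqrt (real n)) \<longlonglongrightarrow> sqrt A"
  proof -
    have "(\<lambda>n. sqrt ((\<tau> n)\<^sup>2 * real n)) \<longlonglongrightarrow> sqrt A" by (rule tendsto_real_sqrt[OF l1])
    moreover have "\<forall>\<^sub>F n in sequentially. sqrt ((\<tau> n)\<^sup>2 * real n) = \<tau> n * sqrt (real n)"
      using \<tau> by eventually_elim (simp add: real_sqrt_mult)
    ultimately show ?thesis by (rule Lim_transform_eventually)
  qed
  have sA: "sqrt A > 0" using A by simp
  have "(\<lambda>n. \<tau> n * ln (a n) / (\<tau> n * sqrt (real n)) / (2 * sqrt A)) \<longlonglongrightarrow> 2 * A / sqrt A / (2 * sqrt A)"
    by (intro tendsto_divide l2 l3 tendsto_const) (use sA in auto)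
  moreover have "2 * A / sqrt A / (2 * sqrt A) = 1" using A by simp
  ultimately have lim: "(\<lambda>n. \<tau> n * ln (a n) / (\<tau> n * sqrt (real n)) / (2 * sqrt A)) \<longlonglongrightarrow> 1" by simp
  \<comment> \<open>\<open>log_plus\<close> agrees with \<open>ln\<close> only where the logarithm
    is nonnegative, so \<open>a n > 0\<close> alone would not do.\<close>
  have pos: "\<forall>\<^sub>F n in sequentially. \<tau> n * ln (a n) > 0"
    by (rule order_tendstoD(1)[OF l2]) (use A in simp)
  have rhs: "1 / 2 * kappa * sqrt ((1 - 1 / real p) * real n) = 2 * sqrt A * sqrt (real n)" for n
  proof -
    have "2 * sqrt A = sqrt (4 * A)" by (simp add: real_sqrt_mult)
    \<comment> \<open>A square is split off from the radicand \<open>2 / 3\<close> of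
      \<open>kappa\<close> and the factor \<open>1 - 1 / p\<close>, so that the square root falls
      into the factors of the claim.\<close>
    also have "4 * A = (pi / 2)\<^sup>2 * ((2 / 3) * (1 - 1 / real p))"
      by (simp add: A_def main_const_def power_divide)
    also have "sqrt \<dots> = pi / 2 * (sqrt (2 / 3) * sqrt (1 - 1 / real p))"
      by (simp only: real_sqrt_mult real_sqrt_abs) simp
    finally have "2 * sqrt A = 1 / 2 * kappa * sqrt (1 - 1 / real p)"
      by (simp add: kappa_def)
    then show ?thesis by (simp add: real_sqrt_mult)
  qed
  show ?thesis
  proof (rule asymp_equivI')
    have "\<forall>\<^sub>F n in sequentially. \<tau> n * ln (a n) / (\<tau> n * sqrt (real n)) / (2 * sqrt A)
        = log_plus (a n) / (1 / 2 * kappa * sqrt ((1 - 1 / real p) * real n))"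
      using \<tau> ev pos
    proof eventually_elim
      case (elim n)
      have "ln (a n) > 0" using elim by (simp add: zero_less_mult_iff)
      then have "log_plus (a n) = ln (a n)" using elim by (simp add: log_plus_def)
      moreover have "\<tau> n * ln (a n) / (\<tau> n * sqrt (real n)) = ln (a n) / sqrt (real n)" using elim by simp
      ultimately show ?case unfolding rhs by (simp add: mult.commute)
    qed
    from Lim_transform_eventually[OF lim this]
    show "(\<lambda>n. log_plus (real_of_int (signed_partition_number n (legendre_char p))) / (1 / 2 * kappa * sqrt ((1 - 1 / real p) * real n))) \<longlonglongrightarrow> 1"
      by (simp only: a_def)
  qed
qed

end

theorem theorem1p1:
  fixes p :: nat
  assumes "prime p" and "odd p" and "p \<noteq> 5" and "\<not> [p = 1] (mod 8)"
  shows "(\<lambda>n. log_plus (real_of_int (signed_partition_number n (legendre_char p))))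
           \<sim>[at_top] (\<lambda>n. 1 / 2 * kappa * sqrt ((1 - 1 / real p) * real n))"
proof -
  interpret odd_prime p by unfold_locales (use assms in auto)
  have "p mod 8 \<noteq> 1" using assms(4) by (simp add: Cong.cong_def)
  then show ?thesis using log_plus_signed_partition_number[OF assms(3)] by blast
qed

end
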